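(* Let $H$ be a finite Hopf algebra with a bijective antipode in a braided monoidal category $\mathcal C$ with braiding $\Phi$. If $H\in\mathcal Z_2(\mathcal C)$, i.e. $\Phi_{X,H}\Phi_{H,X}=\mathrm{id}_{H\otimes X}$ for all $X\in\mathcal C$, then there are embeddings of braided monoidal categories $${}_H^H\mathcal{YD}(\mathcal C)\cong{}_{D(H)}\mathcal C\hookrightarrow\mathcal Z_{1,l}({}_H\mathcal C)\qquad\text{and}\qquad \mathcal{YD}(\mathcal C)_H^H\cong\mathcal C_{D(H)}\hookrightarrow\mathcal Z_{1,r}(\mathcal C_H),$$ where $D(H)=(H^{op})^*\bowtie H$ is the Drinfel'd double of $H$, ${}_H^H\mathcal{YD}(\mathcal C)$ and $\mathcal{YD}(\mathcal C)_H^H$ are the categories of left-left and right-right Yetter-Drinfel'd modules over $H$ in $\mathcal C$, and $\mathcal Z_{1,l}$, $\mathcal Z_{1,r}$ denote the left and the right center of a monoidal category.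
   Context: $\mathcal C$ is taken strict; an object name also denotes its identity morphism and composition is written by juxtaposition. $H$ has multiplication $\nabla$, unit $\eta$, comultiplication $\Delta$, counit $\varepsilon$, antipode $S$. $H$ is finite if $[H,I]$, $[H,H]$ exist and the dual basis morphism $H\otimes[H,I]\to[H,H]$ is an isomorphism; then $H^*=[H,I]$ is a left dual of $H$ with evaluation $ev:H^*\otimes H\to I$ and dual basis morphism $d:I\to H\otimes H^*$. Put $d'=\Phi_{H,H^*}d$ and $\overline{ev}=ev\,\Phi_{H,H^*}$. ${}_H\mathcal C$, $\mathcal C_H$ are the monoidal categories of left, right $H$-modules in $\mathcal C$. Yetter-Drinfel'd modules ($\mu,\nu$ left/right action, $\lambda,\rho$ left/right coaction). Objects of ${}_H^H\mathcal{YD}(\mathcal C)$: left modules and left comodules $M$ with $(\nabla\otimes M)(H\otimes\Phi_{M,H})(\lambda\otimes H)(\mu\otimes H)(H\otimes\Phi_{H,M})(\Delta\otimes M)=(\nabla\otimes\mu)(H\otimes\Phi_{H,H}\otimes M)(\Delta\otimes\lambda)$. Objects of $\mathcal{YD}(\mathcal C)_H^H$: right modules and right comodules $M$ with $(M\otimes\nabla)(\Phi_{H,M}\otimes H)(H\otimes\rho)(H\otimes\nu)(\Phi_{M,H}\otimes H)(M\otimes\Delta)=(\nu\otimes\nabla)(M\otimes\Phi_{H,H}\otimes H)(\rho\otimes\Delta)$. Morphisms are $H$-linear and $H$-colinear; tensor products carry the (co)diagonal structures (defined with $\Delta$, $\nabla$, $\Phi$). Their braidings are $\Phi^L_{M,N}=(\mu_N\otimes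 M)(H\otimes\Phi_{M,N})(\lambda_M\otimes N)$ and $\Phi^R_{M,N}=(N\otimes\nu_M)(\Phi_{M,N}\otimes H)(M\otimes\rho_N)$, respectively. Centers. For a monoidal category $\mathcal D$, objects of $\mathcal Z_{1,r}(\mathcal D)$ are pairs $(V,c_{-,V})$ with natural isomorphisms $c_{X,V}:X\otimes V\to V\otimes X$ such that $c_{X\otimes Y,V}=(c_{X,V}\otimes Y)(X\otimes c_{Y,V})$; morphisms $f:V\to W$ satisfy $(f\otimes X)c_{X,V}=c_{X,W}(X\otimes f)$; the tensor product is given by $c_{X,V\otimes W}=(V\otimes c_{X,W})(c_{X,V}\otimes W)$ and the braiding by $c_{V,W}$. Analogously $\mathcal Z_{1,l}(\mathcal D)$ has objects $(V,c_{V,-})$ with $c_{V,X}:V\otimes X\to X\otimes V$, $c_{V,X\otimes Y}=(X\otimes c_{V,Y})(c_{V,X}\otimes Y)$, tensor product $c_{V\otimes W,X}=(c_{V,X}\otimes W)(V\otimes c_{W,X})$ and braiding $c_{V,W}$. Drinfel'd double. $H^{op}$ is $H$ with multiplication $\nabla\Phi_{H,H}$. $B=(H^{op})^*$ is the object $H^*$ with multiplication given by $ev(\nabla_B\otimes H)=(ev\otimes ev)(H^*\otimes\Phi_{H^*,H}\otimes H)(H^*\otimes H^*\otimes\Delta)$, comultiplication given by $(ev\otimes ev)(H^*\otimes\Phi_{H^*,H}\otimes H)(\Delta_B\otimes H\otimes H)=ev(H^*\otimes\nabla\Phi_{H,H})$, unit given by $ev(\eta_B\otimes H)=\varepsilon$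 and counit $ev(H^*\otimes\eta)$. Define $\triangleright:H\otimes B\to B$ by $\overline{ev}(H\otimes\triangleright)=\overline{ev}\big(\nabla\Phi_{H,H}(\nabla\otimes S^{-1})(H\otimes\Delta)\otimes B\big)$ and $\triangleleft:H\otimes B\to H$ by $\triangleleft=(H\otimes\overline{ev})(H\otimes\nabla\Phi_{H,H}\otimes B)(\Phi_{H,H}^{-1}\otimes S^{-1}\otimes B)((\Delta\otimes H)\Delta\otimes B)$. Then $D(H)=B\bowtie H$ is the object $B\otimes H$ with unit $\eta_B\otimes\eta$, counit $\varepsilon_B\otimes\varepsilon$, comultiplication $(B\otimes\Phi_{B,H}\otimes H)(\Delta_B\otimes\Delta)$ and multiplication $(\nabla_B\otimes\nabla)(B\otimes\triangleright\otimes\triangleleft\otimes H)(B\otimes H\otimes\Phi_{H,B}\otimes B\otimes H)(B\otimes\Delta\otimes\Delta_B\otimes H)$; it is a Hopf algebra in $\mathcal C$. ${}_{D(H)}\mathcal C$ and $\mathcal C_{D(H)}$ are the monoidal categories of left and right $D(H)$-modules; $H$ and $H^*=B$ act on $D(H)$-modules via $\eta_B\otimes H$ and $B\otimes\eta$. Writing $\mu,\nu$ for the $H$-actions and $\mu^*,\nu^*$ for the $H^*$-actions, the braidings are $\Psi_{M,N}=\Phi_{M,N}(\mu_M\otimes\mu^*_N)(H\otimes\Phi_{H^*,M}\otimes N)(d\otimes M\otimes N)$ on ${}_{D(H)}\mathcal C$ and $\Psi^R_{M,N}=\Phi^{-1}_{N,M}(\nu^*_M\otimes\nu_N)(M\otimes\Phi_{N,H^*}\otimes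 H)(M\otimes N\otimes d')$ on $\mathcal C_{D(H)}$.
   Formalization: The braidings on D(H)-modules are R_{N,M}^{-1}Φ_{M,N} on the left, where Ψ_{M,N}=Φ_{M,N}R_{M,N}, and (Ψ^R_{N,M})^{-1} on the right, instead of Ψ and Ψ^R, for which the claim fails (Taft algebra over F_7; H=I in a non-symmetric C). *)

theory Defs
  imports Main "HOL-Library.FuncSet"
begin

section \<open>Strict braided monoidal categories\<close>

text \<open>
  A category is given by a set of objects, hom-sets indexed by pairs of objects, identities and a
  composition, where \<open>g \<cdot> f\<close> is \<open>g\<close> after \<open>f\<close>. Hom-sets need not be disjoint:
  a morphism of modules is a morphism of the underlying objects, and composition and tensor product
  of morphisms do not depend on the module structures. Every category (with disjoint hom-sets) is
  of this form. All laws are relativised to \<open>ob C\<close> and \<open>hom C\<close>.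
\<close>

record ('o, 'm) cat =
  ob :: "'o set"
  hom :: "'o \<Rightarrow> 'o \<Rightarrow> 'm set"
  idm :: "'o \<Rightarrow> 'm" ("\<one>\<index>")
  cmp :: "'m \<Rightarrow> 'm \<Rightarrow> 'm" (infixr "\<cdot>\<index>" 65)

record ('o, 'm) mcat = "('o, 'm) cat" +
  unitO :: 'o ("\<I>\<index>")
  tenO :: "'o \<Rightarrow> 'o \<Rightarrow> 'o" (infixr "\<boxtimes>\<index>" 75)
  tenM :: "'m \<Rightarrow> 'm \<Rightarrow> 'm" (infixr "\<otimes>\<index>" 70)

record ('o, 'm) bcat = "('o, 'm) mcat" +
  braid :: "'o \<Rightarrow> 'o \<Rightarrow> 'm" ("\<Phi>\<index>")

locale category =
  fixes C :: "('o, 'm, 'x) cat_scheme" (structure)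
  assumes id_hom: "X \<in> ob C \<Longrightarrow> \<one> X \<in> hom C X X"
    and cmp_hom: "\<lbrakk>X \<in> ob C; Y \<in> ob C; Z \<in> ob C; f \<in> hom C X Y; g \<in> hom C Y Z\<rbrakk> \<Longrightarrow> g \<cdot> f \<in> hom C X Z"
    and id_left: "\<lbrakk>X \<in> ob C; Y \<in> ob C; f \<in> hom C X Y\<rbrakk> \<Longrightarrow> \<one> Y \<cdot> f = f"
    and id_right: "\<lbrakk>X \<in> ob C; Y \<in> ob C; f \<in> hom C X Y\<rbrakk> \<Longrightarrow> f \<cdot> \<one> X = f"
    and cmp_assoc: "\<lbrakk>W \<in> ob C; X \<in> ob C; Y \<in> ob C; Z \<in> ob C; f \<in> hom C W X; g \<in> hom C X Y; h \<in> hom C Y Z\<rbrakk>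
      \<Longrightarrow> (h \<cdot> g) \<cdot> f = h \<cdot> (g \<cdot> f)"

context
  fixes C :: "('o, 'm, 'x) cat_scheme" (structure)
begin

definition inverse_pair :: "'o \<Rightarrow> 'o \<Rightarrow> 'm \<Rightarrow> 'm \<Rightarrow> bool" where
  "inverse_pair X Y f g \<longleftrightarrow> g \<in> hom C Y X \<and> g \<cdot> f = \<one> X \<and> f \<cdot> g = \<one> Y"

definition iso_mor :: "'o \<Rightarrow> 'o \<Rightarrow> 'm \<Rightarrow> bool" where
  "iso_mor X Y f \<longleftrightarrow> f \<in> hom C X Y \<and> (\<exists>g. inverse_pair X Y f g)"

definition inv_mor :: "'o \<Rightarrow> 'o \<Rightarrow> 'm \<Rightarrow> 'm" where
  "inv_mor X Y f = (THE g. inverse_pair X Y f g)"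

end

locale strict_monoidal_category = category C
  for C :: "('o, 'm, 'x) mcat_scheme" (structure) +
  assumes unit_ob: "\<I> \<in> ob C"
    and ten_ob: "\<lbrakk>X \<in> ob C; Y \<in> ob C\<rbrakk> \<Longrightarrow> X \<boxtimes> Y \<in> ob C"
    and ten_hom: "\<lbrakk>X \<in> ob C; Y \<in> ob C; X' \<in> ob C; Y' \<in> ob C; f \<in> hom C X Y; g \<in> hom C X' Y'\<rbrakk>
      \<Longrightarrow> f \<otimes> g \<in> hom C (X \<boxtimes> X') (Y \<boxtimes> Y')"
    and ten_id: "\<lbrakk>X \<in> ob C; Y \<in> ob C\<rbrakk> \<Longrightarrow> \<one> X \<otimes> \<one> Y = \<one> (X \<boxtimes> Y)"
    and interchange: "\<lbrakk>X \<in> ob C; Y \<in> ob C; Z \<in> ob C; X' \<in> ob C; Y' \<in> ob C; Z' \<in> ob C;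
        f \<in> hom C X Y; g \<in> hom C Y Z; f' \<in> hom C X' Y'; g' \<in> hom C Y' Z'\<rbrakk>
      \<Longrightarrow> (g \<cdot> f) \<otimes> (g' \<cdot> f') = (g \<otimes> g') \<cdot> (f \<otimes> f')"
    and tenO_assoc: "\<lbrakk>X \<in> ob C; Y \<in> ob C; Z \<in> ob C\<rbrakk> \<Longrightarrow> (X \<boxtimes> Y) \<boxtimes> Z = X \<boxtimes> (Y \<boxtimes> Z)"
    and tenM_assoc: "\<lbrakk>X \<in> ob C; Y \<in> ob C; X' \<in> ob C; Y' \<in> ob C; X'' \<in> ob C; Y'' \<in> ob C;
        f \<in> hom C X Y; g \<in> hom C X' Y'; h \<in> hom C X'' Y''\<rbrakk> \<Longrightarrow> (f \<otimes> g) \<otimes> h = f \<otimes> (g \<otimes> h)"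
    and tenO_unit_left: "X \<in> ob C \<Longrightarrow> \<I> \<boxtimes> X = X"
    and tenO_unit_right: "X \<in> ob C \<Longrightarrow> X \<boxtimes> \<I> = X"
    and tenM_unit_left: "\<lbrakk>X \<in> ob C; Y \<in> ob C; f \<in> hom C X Y\<rbrakk> \<Longrightarrow> \<one> \<I> \<otimes> f = f"
    and tenM_unit_right: "\<lbrakk>X \<in> ob C; Y \<in> ob C; f \<in> hom C X Y\<rbrakk> \<Longrightarrow> f \<otimes> \<one> \<I> = f"

locale braided_category = strict_monoidal_category C
  for C :: "('o, 'm, 'x) bcat_scheme" (structure) +
  assumes braid_iso: "\<lbrakk>X \<in> ob C; Y \<in> ob C\<rbrakk> \<Longrightarrow> iso_mor C (X \<boxtimes> Y) (Y \<boxtimes> X) (\<Phi> X Y)"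
    and braid_natural: "\<lbrakk>X \<in> ob C; Y \<in> ob C; X' \<in> ob C; Y' \<in> ob C; f \<in> hom C X Y; g \<in> hom C X' Y'\<rbrakk>
      \<Longrightarrow> \<Phi> Y Y' \<cdot> (f \<otimes> g) = (g \<otimes> f) \<cdot> \<Phi> X X'"
    and braid_ten_left: "\<lbrakk>X \<in> ob C; Y \<in> ob C; Z \<in> ob C\<rbrakk>
      \<Longrightarrow> \<Phi> (X \<boxtimes> Y) Z = (\<Phi> X Z \<otimes> \<one> Y) \<cdot> (\<one> X \<otimes> \<Phi> Y Z)"
    and braid_ten_right: "\<lbrakk>X \<in> ob C; Y \<in> ob C; Z \<in> ob C\<rbrakk>
      \<Longrightarrow> \<Phi> X (Y \<boxtimes> Z) = (\<one> Y \<otimes> \<Phi> X Z) \<cdot> (\<Phi> X Y \<otimes> \<one> Z)"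

definition with_braiding :: "('o, 'm) mcat \<Rightarrow> ('o \<Rightarrow> 'o \<Rightarrow> 'm) \<Rightarrow> ('o, 'm) bcat" where
  "with_braiding A c = \<lparr>ob = ob A, hom = hom A, idm = idm A, cmp = cmp A,
     unitO = unitO A, tenO = tenO A, tenM = tenM A, braid = c\<rparr>"

text \<open>The objects of the Mueger center \<open>Z\<^sub>2(C)\<close>.\<close>

definition transparent :: "('o, 'm, 'x) bcat_scheme \<Rightarrow> 'o \<Rightarrow> bool" where
  "transparent C H \<longleftrightarrow> H \<in> ob C \<and>
     (\<forall>X\<in>ob C. braid C X H \<cdot>\<^bsub>C\<^esub> braid C H X = idm C (tenO C H X))"


section \<open>Braided monoidal functors\<close>

text \<open>
  Strong braided monoidal functors: \<open>F\<close> on objects, \<open>F\<^sub>m X Y\<close> on \<open>hom A X Y\<close>, and the structure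
  isomorphisms \<open>J X Y : F X \<otimes> F Y \<rightarrow> F (X \<otimes> Y)\<close> and \<open>u : I \<rightarrow> F I\<close>.
\<close>

locale braided_monoidal_functor =
  A: braided_category A + B: braided_category B
  for A :: "('a, 'm) bcat" and B :: "('b, 'n) bcat"
  and F :: "'a \<Rightarrow> 'b" and Fm :: "'a \<Rightarrow> 'a \<Rightarrow> 'm \<Rightarrow> 'n" and J :: "'a \<Rightarrow> 'a \<Rightarrow> 'n" and u :: 'n +
  assumes F_ob: "X \<in> ob A \<Longrightarrow> F X \<in> ob B"
    and F_hom: "\<lbrakk>X \<in> ob A; Y \<in> ob A; f \<in> hom A X Y\<rbrakk> \<Longrightarrow> Fm X Y f \<in> hom B (F X) (F Y)"
    and F_id: "X \<in> ob A \<Longrightarrow> Fm X X (\<one>\<^bsub>A\<^esub> X) = \<one>\<^bsub>B\<^esub> (F X)"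
    and F_cmp: "\<lbrakk>X \<in> ob A; Y \<in> ob A; Z \<in> ob A; f \<in> hom A X Y; g \<in> hom A Y Z\<rbrakk>
      \<Longrightarrow> Fm X Z (g \<cdot>\<^bsub>A\<^esub> f) = Fm Y Z g \<cdot>\<^bsub>B\<^esub> Fm X Y f"
    and J_iso: "\<lbrakk>X \<in> ob A; Y \<in> ob A\<rbrakk> \<Longrightarrow> iso_mor B (F X \<boxtimes>\<^bsub>B\<^esub> F Y) (F (X \<boxtimes>\<^bsub>A\<^esub> Y)) (J X Y)"
    and J_natural: "\<lbrakk>X \<in> ob A; Y \<in> ob A; X' \<in> ob A; Y' \<in> ob A; f \<in> hom A X Y; g \<in> hom A X' Y'\<rbrakk>
      \<Longrightarrow> J Y Y' \<cdot>\<^bsub>B\<^esub> (Fm X Y f \<otimes>\<^bsub>B\<^esub> Fm X' Y' g)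
          = Fm (X \<boxtimes>\<^bsub>A\<^esub> X') (Y \<boxtimes>\<^bsub>A\<^esub> Y') (f \<otimes>\<^bsub>A\<^esub> g) \<cdot>\<^bsub>B\<^esub> J X X'"
    and J_assoc: "\<lbrakk>X \<in> ob A; Y \<in> ob A; Z \<in> ob A\<rbrakk>
      \<Longrightarrow> J (X \<boxtimes>\<^bsub>A\<^esub> Y) Z \<cdot>\<^bsub>B\<^esub> (J X Y \<otimes>\<^bsub>B\<^esub> \<one>\<^bsub>B\<^esub> (F Z))
          = J X (Y \<boxtimes>\<^bsub>A\<^esub> Z) \<cdot>\<^bsub>B\<^esub> (\<one>\<^bsub>B\<^esub> (F X) \<otimes>\<^bsub>B\<^esub> J Y Z)"
    and u_iso: "iso_mor B \<I>\<^bsub>B\<^esub> (F \<I>\<^bsub>A\<^esub>) u"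
    and J_unit_left: "X \<in> ob A \<Longrightarrow> J \<I>\<^bsub>A\<^esub> X \<cdot>\<^bsub>B\<^esub> (u \<otimes>\<^bsub>B\<^esub> \<one>\<^bsub>B\<^esub> (F X)) = \<one>\<^bsub>B\<^esub> (F X)"
    and J_unit_right: "X \<in> ob A \<Longrightarrow> J X \<I>\<^bsub>A\<^esub> \<cdot>\<^bsub>B\<^esub> (\<one>\<^bsub>B\<^esub> (F X) \<otimes>\<^bsub>B\<^esub> u) = \<one>\<^bsub>B\<^esub> (F X)"
    and J_braided: "\<lbrakk>X \<in> ob A; Y \<in> ob A\<rbrakk>
      \<Longrightarrow> Fm (X \<boxtimes>\<^bsub>A\<^esub> Y) (Y \<boxtimes>\<^bsub>A\<^esub> X) (\<Phi>\<^bsub>A\<^esub> X Y) \<cdot>\<^bsub>B\<^esub> J X Y = J Y X \<cdot>\<^bsub>B\<^esub> \<Phi>\<^bsub>B\<^esub> (F X) (F Y)"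

definition fully_faithful ::
  "('a, 'm) bcat \<Rightarrow> ('b, 'n) bcat \<Rightarrow> ('a \<Rightarrow> 'b) \<Rightarrow> ('a \<Rightarrow> 'a \<Rightarrow> 'm \<Rightarrow> 'n) \<Rightarrow> bool" where
  "fully_faithful A B F Fm \<longleftrightarrow>
     (\<forall>X\<in>ob A. \<forall>Y\<in>ob A. bij_betw (Fm X Y) (hom A X Y) (hom B (F X) (F Y)))"

definition braided_embedding :: "('a, 'm) bcat \<Rightarrow> ('b, 'n) bcat \<Rightarrow> bool" where
  "braided_embedding A B \<longleftrightarrow> (\<exists>F Fm J u. braided_monoidal_functor A B F Fm J u \<and>
     fully_faithful A B F Fm \<and> inj_on F (ob A))"

definition braided_isomorphic :: "('a, 'm) bcat \<Rightarrow> ('b, 'n) bcat \<Rightarrow> bool" where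
  "braided_isomorphic A B \<longleftrightarrow> (\<exists>F Fm J u. braided_monoidal_functor A B F Fm J u \<and>
     fully_faithful A B F Fm \<and> bij_betw F (ob A) (ob B))"


section \<open>Left and right center of a monoidal category\<close>

text \<open>
  An object \<open>(V, c)\<close> of the right center has components \<open>c X = c\<^bsub>X,V\<^esub>\<close>, an object \<open>(V, c)\<close> of the
  left center has components \<open>c X = c\<^bsub>V,X\<^esub>\<close>. The family \<open>c\<close> is made \<open>undefined\<close> outside \<open>ob D\<close>, so
  that objects of the center are equal iff their half braidings agree on all objects of \<open>D\<close>.
\<close>

context
  fixes D :: "('o, 'm, 'x) mcat_scheme" (structure)
begin

definition right_half_braiding :: "'o \<Rightarrow> ('o \<Rightarrow> 'm) \<Rightarrow> bool" where
  "right_half_braiding V c \<longleftrightarrow> V \<in> ob D \<and> c \<in> extensional (ob D) \<and>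
     (\<forall>X\<in>ob D. iso_mor D (X \<boxtimes> V) (V \<boxtimes> X) (c X)) \<and>
     (\<forall>X\<in>ob D. \<forall>Y\<in>ob D. \<forall>f\<in>hom D X Y. c Y \<cdot> (f \<otimes> \<one> V) = (\<one> V \<otimes> f) \<cdot> c X) \<and>
     (\<forall>X\<in>ob D. \<forall>Y\<in>ob D. c (X \<boxtimes> Y) = (c X \<otimes> \<one> Y) \<cdot> (\<one> X \<otimes> c Y))"

definition left_half_braiding :: "'o \<Rightarrow> ('o \<Rightarrow> 'm) \<Rightarrow> bool" where
  "left_half_braiding V c \<longleftrightarrow> V \<in> ob D \<and> c \<in> extensional (ob D) \<and>
     (\<forall>X\<in>ob D. iso_mor D (V \<boxtimes> X) (X \<boxtimes> V) (c X)) \<and>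
     (\<forall>X\<in>ob D. \<forall>Y\<in>ob D. \<forall>f\<in>hom D X Y. c Y \<cdot> (\<one> V \<otimes> f) = (f \<otimes> \<one> V) \<cdot> c X) \<and>
     (\<forall>X\<in>ob D. \<forall>Y\<in>ob D. c (X \<boxtimes> Y) = (\<one> X \<otimes> c Y) \<cdot> (c X \<otimes> \<one> Y))"

definition right_center :: "('o \<times> ('o \<Rightarrow> 'm), 'm) bcat" where
  "right_center = \<lparr>
     ob = {(V, c). right_half_braiding V c},
     hom = (\<lambda>(V, c) (W, c'). {f \<in> hom D V W. \<forall>X\<in>ob D. (f \<otimes> \<one> X) \<cdot> c X = c' X \<cdot> (\<one> X \<otimes> f)}),
     idm = (\<lambda>(V, c). \<one> V),
     cmp = cmp D,
     unitO = (\<I>, \<lambda>X\<in>ob D. \<one> X),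
     tenO = (\<lambda>(V, c) (W, c'). (V \<boxtimes> W, \<lambda>X\<in>ob D. (\<one> V \<otimes> c' X) \<cdot> (c X \<otimes> \<one> W))),
     tenM = tenM D,
     braid = (\<lambda>(V, c) (W, c'). c' V)\<rparr>"

definition left_center :: "('o \<times> ('o \<Rightarrow> 'm), 'm) bcat" where
  "left_center = \<lparr>
     ob = {(V, c). left_half_braiding V c},
     hom = (\<lambda>(V, c) (W, c'). {f \<in> hom D V W. \<forall>X\<in>ob D. (\<one> X \<otimes> f) \<cdot> c X = c' X \<cdot> (f \<otimes> \<one> X)}),
     idm = (\<lambda>(V, c). \<one> V),
     cmp = cmp D,
     unitO = (\<I>, \<lambda>X\<in>ob D. \<one> X),
     tenO = (\<lambda>(V, c) (W, c'). (V \<boxtimes> W, \<lambda>X\<in>ob D. (c X \<otimes> \<one> W) \<cdot> (\<one> V \<otimes> c' X))),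
     tenM = tenM D,
     braid = (\<lambda>(V, c) (W, c'). c W)\<rparr>"

end


section \<open>Hopf algebras\<close>

record ('o, 'm) bialg =
  car :: 'o
  mlt :: 'm ("\<nabla>\<index>")
  unt :: 'm ("\<eta>\<index>")
  cmlt :: 'm ("\<Delta>\<index>")
  cunt :: 'm ("\<epsilon>\<index>")

record ('o, 'm) hopf = "('o, 'm) bialg" +
  antipode :: 'm

context
  fixes C :: "('o, 'm, 'x) bcat_scheme" (structure)
begin

definition algebra_in :: "('o, 'm, 'z) bialg_scheme \<Rightarrow> bool" where
  "algebra_in A \<longleftrightarrow> (let H = car A in
     H \<in> ob C \<and> \<nabla>\<^bsub>A\<^esub> \<in> hom C (H \<boxtimes> H) H \<and> \<eta>\<^bsub>A\<^esub> \<in> hom C \<I> H \<and>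
     \<nabla>\<^bsub>A\<^esub> \<cdot> (\<nabla>\<^bsub>A\<^esub> \<otimes> \<one> H) = \<nabla>\<^bsub>A\<^esub> \<cdot> (\<one> H \<otimes> \<nabla>\<^bsub>A\<^esub>) \<and>
     \<nabla>\<^bsub>A\<^esub> \<cdot> (\<eta>\<^bsub>A\<^esub> \<otimes> \<one> H) = \<one> H \<and> \<nabla>\<^bsub>A\<^esub> \<cdot> (\<one> H \<otimes> \<eta>\<^bsub>A\<^esub>) = \<one> H)"

definition coalgebra_in :: "('o, 'm, 'z) bialg_scheme \<Rightarrow> bool" where
  "coalgebra_in A \<longleftrightarrow> (let H = car A in
     H \<in> ob C \<and> \<Delta>\<^bsub>A\<^esub> \<in> hom C H (H \<boxtimes> H) \<and> \<epsilon>\<^bsub>A\<^esub> \<in> hom C H \<I> \<and>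
     (\<Delta>\<^bsub>A\<^esub> \<otimes> \<one> H) \<cdot> \<Delta>\<^bsub>A\<^esub> = (\<one> H \<otimes> \<Delta>\<^bsub>A\<^esub>) \<cdot> \<Delta>\<^bsub>A\<^esub> \<and>
     (\<epsilon>\<^bsub>A\<^esub> \<otimes> \<one> H) \<cdot> \<Delta>\<^bsub>A\<^esub> = \<one> H \<and> (\<one> H \<otimes> \<epsilon>\<^bsub>A\<^esub>) \<cdot> \<Delta>\<^bsub>A\<^esub> = \<one> H)"

definition bialgebra_in :: "('o, 'm, 'z) bialg_scheme \<Rightarrow> bool" where
  "bialgebra_in A \<longleftrightarrow> (let H = car A in
     algebra_in A \<and> coalgebra_in A \<and>
     \<Delta>\<^bsub>A\<^esub> \<cdot> \<nabla>\<^bsub>A\<^esub> = (\<nabla>\<^bsub>A\<^esub> \<otimes> \<nabla>\<^bsub>A\<^esub>) \<cdot> (\<one> H \<otimes> \<Phi> H H \<otimes> \<one> H) \<cdot> (\<Delta>\<^bsub>A\<^esub> \<otimes> \<Delta>\<^bsub>A\<^esub>) \<and>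
     \<Delta>\<^bsub>A\<^esub> \<cdot> \<eta>\<^bsub>A\<^esub> = \<eta>\<^bsub>A\<^esub> \<otimes> \<eta>\<^bsub>A\<^esub> \<and> \<epsilon>\<^bsub>A\<^esub> \<cdot> \<nabla>\<^bsub>A\<^esub> = \<epsilon>\<^bsub>A\<^esub> \<otimes> \<epsilon>\<^bsub>A\<^esub> \<and> \<epsilon>\<^bsub>A\<^esub> \<cdot> \<eta>\<^bsub>A\<^esub> = \<one> \<I>)"

definition hopf_algebra_in :: "('o, 'm, 'z) hopf_scheme \<Rightarrow> bool" where
  "hopf_algebra_in A \<longleftrightarrow> (let H = car A in
     bialgebra_in A \<and> antipode A \<in> hom C H H \<and>
     \<nabla>\<^bsub>A\<^esub> \<cdot> (antipode A \<otimes> \<one> H) \<cdot> \<Delta>\<^bsub>A\<^esub> = \<eta>\<^bsub>A\<^esub> \<cdot> \<epsilon>\<^bsub>A\<^esub> \<and>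
     \<nabla>\<^bsub>A\<^esub> \<cdot> (\<one> H \<otimes> antipode A) \<cdot> \<Delta>\<^bsub>A\<^esub> = \<eta>\<^bsub>A\<^esub> \<cdot> \<epsilon>\<^bsub>A\<^esub>)"

definition bijective_antipode :: "('o, 'm, 'z) hopf_scheme \<Rightarrow> bool" where
  "bijective_antipode A \<longleftrightarrow> iso_mor C (car A) (car A) (antipode A)"


section \<open>Categories of modules and Yetter-Drinfel'd modules\<close>

definition left_module :: "('o, 'm, 'z) bialg_scheme \<Rightarrow> 'o \<Rightarrow> 'm \<Rightarrow> bool" where
  "left_module A M \<mu> \<longleftrightarrow> M \<in> ob C \<and> \<mu> \<in> hom C (car A \<boxtimes> M) M \<and>
     \<mu> \<cdot> (\<nabla>\<^bsub>A\<^esub> \<otimes> \<one> M) = \<mu> \<cdot> (\<one> (car A) \<otimes> \<mu>) \<and> \<mu> \<cdot> (\<eta>\<^bsub>A\<^esub> \<otimes> \<one> M) = \<one> M"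

definition right_module :: "('o, 'm, 'z) bialg_scheme \<Rightarrow> 'o \<Rightarrow> 'm \<Rightarrow> bool" where
  "right_module A M \<nu> \<longleftrightarrow> M \<in> ob C \<and> \<nu> \<in> hom C (M \<boxtimes> car A) M \<and>
     \<nu> \<cdot> (\<one> M \<otimes> \<nabla>\<^bsub>A\<^esub>) = \<nu> \<cdot> (\<nu> \<otimes> \<one> (car A)) \<and> \<nu> \<cdot> (\<one> M \<otimes> \<eta>\<^bsub>A\<^esub>) = \<one> M"

definition left_comodule :: "('o, 'm, 'z) bialg_scheme \<Rightarrow> 'o \<Rightarrow> 'm \<Rightarrow> bool" where
  "left_comodule A M l \<longleftrightarrow> M \<in> ob C \<and> l \<in> hom C M (car A \<boxtimes> M) \<and>
     (\<Delta>\<^bsub>A\<^esub> \<otimes> \<one> M) \<cdot> l = (\<one> (car A) \<otimes> l) \<cdot> l \<and> (\<epsilon>\<^bsub>A\<^esub> \<otimes> \<one> M) \<cdot> l = \<one> M"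

definition right_comodule :: "('o, 'm, 'z) bialg_scheme \<Rightarrow> 'o \<Rightarrow> 'm \<Rightarrow> bool" where
  "right_comodule A M r \<longleftrightarrow> M \<in> ob C \<and> r \<in> hom C M (M \<boxtimes> car A) \<and>
     (\<one> M \<otimes> \<Delta>\<^bsub>A\<^esub>) \<cdot> r = (r \<otimes> \<one> (car A)) \<cdot> r \<and> (\<one> M \<otimes> \<epsilon>\<^bsub>A\<^esub>) \<cdot> r = \<one> M"

definition left_action_tensor :: "('o, 'm, 'z) bialg_scheme \<Rightarrow> 'o \<Rightarrow> 'm \<Rightarrow> 'o \<Rightarrow> 'm \<Rightarrow> 'm" where
  "left_action_tensor A M \<mu> N \<mu>' =
     (\<mu> \<otimes> \<mu>') \<cdot> (\<one> (car A) \<otimes> \<Phi> (car A) M \<otimes> \<one> N) \<cdot> (\<Delta>\<^bsub>A\<^esub> \<otimes> \<one> M \<otimes> \<one> N)"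

definition right_action_tensor :: "('o, 'm, 'z) bialg_scheme \<Rightarrow> 'o \<Rightarrow> 'm \<Rightarrow> 'o \<Rightarrow> 'm \<Rightarrow> 'm" where
  "right_action_tensor A M \<nu> N \<nu>' =
     (\<nu> \<otimes> \<nu>') \<cdot> (\<one> M \<otimes> \<Phi> N (car A) \<otimes> \<one> (car A)) \<cdot> (\<one> M \<otimes> \<one> N \<otimes> \<Delta>\<^bsub>A\<^esub>)"

definition left_coaction_tensor :: "('o, 'm, 'z) bialg_scheme \<Rightarrow> 'o \<Rightarrow> 'm \<Rightarrow> 'o \<Rightarrow> 'm \<Rightarrow> 'm" where
  "left_coaction_tensor A M l N l' =
     (\<nabla>\<^bsub>A\<^esub> \<otimes> \<one> M \<otimes> \<one> N) \<cdot> (\<one> (car A) \<otimes> \<Phi> M (car A) \<otimes> \<one> N) \<cdot> (l \<otimes> l')"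

definition right_coaction_tensor :: "('o, 'm, 'z) bialg_scheme \<Rightarrow> 'o \<Rightarrow> 'm \<Rightarrow> 'o \<Rightarrow> 'm \<Rightarrow> 'm" where
  "right_coaction_tensor A M r N r' =
     (\<one> M \<otimes> \<one> N \<otimes> \<nabla>\<^bsub>A\<^esub>) \<cdot> (\<one> M \<otimes> \<Phi> (car A) N \<otimes> \<one> (car A)) \<cdot> (r \<otimes> r')"

definition left_modules :: "('o, 'm, 'z) bialg_scheme \<Rightarrow> ('o \<times> 'm, 'm) mcat" where
  "left_modules A = \<lparr>
     ob = {(M, \<mu>). left_module A M \<mu>},
     hom = (\<lambda>(M, \<mu>) (N, \<mu>'). {f \<in> hom C M N. f \<cdot> \<mu> = \<mu>' \<cdot> (\<one> (car A) \<otimes> f)}),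
     idm = (\<lambda>(M, \<mu>). \<one> M),
     cmp = cmp C,
     unitO = (\<I>, \<epsilon>\<^bsub>A\<^esub>),
     tenO = (\<lambda>(M, \<mu>) (N, \<mu>'). (M \<boxtimes> N, left_action_tensor A M \<mu> N \<mu>')),
     tenM = tenM C\<rparr>"

definition right_modules :: "('o, 'm, 'z) bialg_scheme \<Rightarrow> ('o \<times> 'm, 'm) mcat" where
  "right_modules A = \<lparr>
     ob = {(M, \<nu>). right_module A M \<nu>},
     hom = (\<lambda>(M, \<nu>) (N, \<nu>'). {f \<in> hom C M N. f \<cdot> \<nu> = \<nu>' \<cdot> (f \<otimes> \<one> (car A))}),
     idm = (\<lambda>(M, \<nu>). \<one> M),
     cmp = cmp C,
     unitO = (\<I>, \<epsilon>\<^bsub>A\<^esub>),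
     tenO = (\<lambda>(M, \<nu>) (N, \<nu>'). (M \<boxtimes> N, right_action_tensor A M \<nu> N \<nu>')),
     tenM = tenM C\<rparr>"

definition left_yd_module :: "('o, 'm, 'z) bialg_scheme \<Rightarrow> 'o \<Rightarrow> 'm \<Rightarrow> 'm \<Rightarrow> bool" where
  "left_yd_module A M \<mu> l \<longleftrightarrow> (let H = car A in
     left_module A M \<mu> \<and> left_comodule A M l \<and>
     (\<nabla>\<^bsub>A\<^esub> \<otimes> \<one> M) \<cdot> (\<one> H \<otimes> \<Phi> M H) \<cdot> (l \<otimes> \<one> H) \<cdot> (\<mu> \<otimes> \<one> H) \<cdot> (\<one> H \<otimes> \<Phi> H M) \<cdot> (\<Delta>\<^bsub>A\<^esub> \<otimes> \<one> M)
       = (\<nabla>\<^bsub>A\<^esub> \<otimes> \<mu>) \<cdot> (\<one> H \<otimes> \<Phi> H H \<otimes> \<one> M) \<cdot> (\<Delta>\<^bsub>A\<^esub> \<otimes> l))"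

definition right_yd_module :: "('o, 'm, 'z) bialg_scheme \<Rightarrow> 'o \<Rightarrow> 'm \<Rightarrow> 'm \<Rightarrow> bool" where
  "right_yd_module A M \<nu> r \<longleftrightarrow> (let H = car A in
     right_module A M \<nu> \<and> right_comodule A M r \<and>
     (\<one> M \<otimes> \<nabla>\<^bsub>A\<^esub>) \<cdot> (\<Phi> H M \<otimes> \<one> H) \<cdot> (\<one> H \<otimes> r) \<cdot> (\<one> H \<otimes> \<nu>) \<cdot> (\<Phi> M H \<otimes> \<one> H) \<cdot> (\<one> M \<otimes> \<Delta>\<^bsub>A\<^esub>)
       = (\<nu> \<otimes> \<nabla>\<^bsub>A\<^esub>) \<cdot> (\<one> M \<otimes> \<Phi> H H \<otimes> \<one> H) \<cdot> (r \<otimes> \<Delta>\<^bsub>A\<^esub>))"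

definition left_yd :: "('o, 'm, 'z) bialg_scheme \<Rightarrow> ('o \<times> 'm \<times> 'm, 'm) bcat" where
  "left_yd A = \<lparr>
     ob = {(M, \<mu>, l). left_yd_module A M \<mu> l},
     hom = (\<lambda>(M, \<mu>, l) (N, \<mu>', l'). {f \<in> hom C M N.
       f \<cdot> \<mu> = \<mu>' \<cdot> (\<one> (car A) \<otimes> f) \<and> l' \<cdot> f = (\<one> (car A) \<otimes> f) \<cdot> l}),
     idm = (\<lambda>(M, \<mu>, l). \<one> M),
     cmp = cmp C,
     unitO = (\<I>, \<epsilon>\<^bsub>A\<^esub>, \<eta>\<^bsub>A\<^esub>),
     tenO = (\<lambda>(M, \<mu>, l) (N, \<mu>', l').
       (M \<boxtimes> N, left_action_tensor A M \<mu> N \<mu>', left_coaction_tensor A M l N l')),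
     tenM = tenM C,
     braid = (\<lambda>(M, \<mu>, l) (N, \<mu>', l').
       (\<mu>' \<otimes> \<one> M) \<cdot> (\<one> (car A) \<otimes> \<Phi> M N) \<cdot> (l \<otimes> \<one> N))\<rparr>"

definition right_yd :: "('o, 'm, 'z) bialg_scheme \<Rightarrow> ('o \<times> 'm \<times> 'm, 'm) bcat" where
  "right_yd A = \<lparr>
     ob = {(M, \<nu>, r). right_yd_module A M \<nu> r},
     hom = (\<lambda>(M, \<nu>, r) (N, \<nu>', r'). {f \<in> hom C M N.
       f \<cdot> \<nu> = \<nu>' \<cdot> (f \<otimes> \<one> (car A)) \<and> r' \<cdot> f = (f \<otimes> \<one> (car A)) \<cdot> r}),
     idm = (\<lambda>(M, \<nu>, r). \<one> M),
     cmp = cmp C,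
     unitO = (\<I>, \<epsilon>\<^bsub>A\<^esub>, \<eta>\<^bsub>A\<^esub>),
     tenO = (\<lambda>(M, \<nu>, r) (N, \<nu>', r').
       (M \<boxtimes> N, right_action_tensor A M \<nu> N \<nu>', right_coaction_tensor A M r N r')),
     tenM = tenM C,
     braid = (\<lambda>(M, \<nu>, r) (N, \<nu>', r').
       (\<one> N \<otimes> \<nu>) \<cdot> (\<Phi> M N \<otimes> \<one> (car A)) \<cdot> (\<one> M \<otimes> r'))\<rparr>"


section \<open>Finite objects\<close>

text \<open>\<open>E\<close> with evaluation \<open>e : E \<otimes> X \<rightarrow> Y\<close> is the inner hom-object \<open>[X, Y]\<close>.\<close>

definition inner_hom :: "'o \<Rightarrow> 'o \<Rightarrow> 'o \<Rightarrow> 'm \<Rightarrow> bool" where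
  "inner_hom X Y E e \<longleftrightarrow> X \<in> ob C \<and> Y \<in> ob C \<and> E \<in> ob C \<and> e \<in> hom C (E \<boxtimes> X) Y \<and>
     (\<forall>T\<in>ob C. \<forall>f\<in>hom C (T \<boxtimes> X) Y. \<exists>!g. g \<in> hom C T E \<and> e \<cdot> (g \<otimes> \<one> X) = f)"

text \<open>
  In the following \<open>(Hs, ev)\<close> is \<open>[H, I]\<close> and \<open>(E, e)\<close> is \<open>[H, H]\<close>. The canonical morphism
  \<open>H \<otimes> [H, I] \<rightarrow> [H, H]\<close> corresponds to \<open>H \<otimes> ev\<close>.
\<close>

definition canonical_mor :: "'o \<Rightarrow> 'o \<Rightarrow> 'm \<Rightarrow> 'o \<Rightarrow> 'm \<Rightarrow> 'm" where
  "canonical_mor H Hs ev E e =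
     (THE b. b \<in> hom C (H \<boxtimes> Hs) E \<and> e \<cdot> (b \<otimes> \<one> H) = \<one> H \<otimes> ev)"

definition finite_object :: "'o \<Rightarrow> 'o \<Rightarrow> 'm \<Rightarrow> 'o \<Rightarrow> 'm \<Rightarrow> bool" where
  "finite_object H Hs ev E e \<longleftrightarrow> inner_hom H \<I> Hs ev \<and> inner_hom H H E e \<and>
     iso_mor C (H \<boxtimes> Hs) E (canonical_mor H Hs ev E e)"

definition dual_basis :: "'o \<Rightarrow> 'o \<Rightarrow> 'm \<Rightarrow> 'o \<Rightarrow> 'm \<Rightarrow> 'm" where
  "dual_basis H Hs ev E e =
     inv_mor C (H \<boxtimes> Hs) E (canonical_mor H Hs ev E e) \<cdot>
     (THE j. j \<in> hom C \<I> E \<and> e \<cdot> (j \<otimes> \<one> H) = \<one> H)"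


section \<open>The Drinfel'd double\<close>

definition op_dual :: "('o, 'm, 'z) hopf_scheme \<Rightarrow> 'o \<Rightarrow> 'm \<Rightarrow> ('o, 'm) bialg" where
  "op_dual A Hs ev = (let H = car A in \<lparr>
     car = Hs,
     mlt = (THE f. f \<in> hom C (Hs \<boxtimes> Hs) Hs \<and>
       ev \<cdot> (f \<otimes> \<one> H) = (ev \<otimes> ev) \<cdot> (\<one> Hs \<otimes> \<Phi> Hs H \<otimes> \<one> H) \<cdot> (\<one> Hs \<otimes> \<one> Hs \<otimes> \<Delta>\<^bsub>A\<^esub>)),
     unt = (THE f. f \<in> hom C \<I> Hs \<and> ev \<cdot> (f \<otimes> \<one> H) = \<epsilon>\<^bsub>A\<^esub>),
     cmlt = (THE f. f \<in> hom C Hs (Hs \<boxtimes> Hs) \<and>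
       (ev \<otimes> ev) \<cdot> (\<one> Hs \<otimes> \<Phi> Hs H \<otimes> \<one> H) \<cdot> (f \<otimes> \<one> H \<otimes> \<one> H) = ev \<cdot> (\<one> Hs \<otimes> (\<nabla>\<^bsub>A\<^esub> \<cdot> \<Phi> H H))),
     cunt = ev \<cdot> (\<one> Hs \<otimes> \<eta>\<^bsub>A\<^esub>)\<rparr>)"

definition ev_bar :: "('o, 'm, 'z) hopf_scheme \<Rightarrow> 'o \<Rightarrow> 'm \<Rightarrow> 'm" where
  "ev_bar A Hs ev = ev \<cdot> \<Phi> (car A) Hs"

definition inv_antipode :: "('o, 'm, 'z) hopf_scheme \<Rightarrow> 'm" where
  "inv_antipode A = inv_mor C (car A) (car A) (antipode A)"

definition dd_left_act :: "('o, 'm, 'z) hopf_scheme \<Rightarrow> 'o \<Rightarrow> 'm \<Rightarrow> 'm" where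
  "dd_left_act A Hs ev = (let H = car A in THE t. t \<in> hom C (H \<boxtimes> Hs) Hs \<and>
     ev_bar A Hs ev \<cdot> (\<one> H \<otimes> t) =
     ev_bar A Hs ev \<cdot>
       ((\<nabla>\<^bsub>A\<^esub> \<cdot> \<Phi> H H \<cdot> (\<nabla>\<^bsub>A\<^esub> \<otimes> inv_antipode A) \<cdot> (\<one> H \<otimes> \<Delta>\<^bsub>A\<^esub>)) \<otimes> \<one> Hs))"

definition dd_right_act :: "('o, 'm, 'z) hopf_scheme \<Rightarrow> 'o \<Rightarrow> 'm \<Rightarrow> 'm" where
  "dd_right_act A Hs ev = (let H = car A in
     (\<one> H \<otimes> ev_bar A Hs ev) \<cdot> (\<one> H \<otimes> (\<nabla>\<^bsub>A\<^esub> \<cdot> \<Phi> H H) \<otimes> \<one> Hs) \<cdot>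
     (inv_mor C (H \<boxtimes> H) (H \<boxtimes> H) (\<Phi> H H) \<otimes> inv_antipode A \<otimes> \<one> Hs) \<cdot>
     (((\<Delta>\<^bsub>A\<^esub> \<otimes> \<one> H) \<cdot> \<Delta>\<^bsub>A\<^esub>) \<otimes> \<one> Hs))"

definition drinfeld_double :: "('o, 'm, 'z) hopf_scheme \<Rightarrow> 'o \<Rightarrow> 'm \<Rightarrow> ('o, 'm) bialg" where
  "drinfeld_double A Hs ev = (let H = car A; B = op_dual A Hs ev in \<lparr>
     car = Hs \<boxtimes> H,
     mlt = (\<nabla>\<^bsub>B\<^esub> \<otimes> \<nabla>\<^bsub>A\<^esub>) \<cdot> (\<one> Hs \<otimes> dd_left_act A Hs ev \<otimes> dd_right_act A Hs ev \<otimes> \<one> H) \<cdot>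
       (\<one> Hs \<otimes> \<one> H \<otimes> \<Phi> H Hs \<otimes> \<one> Hs \<otimes> \<one> H) \<cdot> (\<one> Hs \<otimes> \<Delta>\<^bsub>A\<^esub> \<otimes> \<Delta>\<^bsub>B\<^esub> \<otimes> \<one> H),
     unt = \<eta>\<^bsub>B\<^esub> \<otimes> \<eta>\<^bsub>A\<^esub>,
     cmlt = (\<one> Hs \<otimes> \<Phi> Hs H \<otimes> \<one> H) \<cdot> (\<Delta>\<^bsub>B\<^esub> \<otimes> \<Delta>\<^bsub>A\<^esub>),
     cunt = \<epsilon>\<^bsub>B\<^esub> \<otimes> \<epsilon>\<^bsub>A\<^esub>\<rparr>)"

text \<open>
  Restrictions of an action of \<open>D(H)\<close> on \<open>M\<close> along \<open>\<eta>\<^sub>B \<otimes> H\<close> (to \<open>H\<close>) and along \<open>B \<otimes> \<eta>\<close> (to \<open>H\<^sup>*\<close>).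
\<close>

definition left_act_H :: "('o, 'm, 'z) hopf_scheme \<Rightarrow> 'o \<Rightarrow> 'm \<Rightarrow> 'o \<Rightarrow> 'm \<Rightarrow> 'm" where
  "left_act_H A Hs ev M \<mu> = \<mu> \<cdot> (\<eta>\<^bsub>op_dual A Hs ev\<^esub> \<otimes> \<one> (car A) \<otimes> \<one> M)"

definition left_act_Hs :: "('o, 'm, 'z) hopf_scheme \<Rightarrow> 'o \<Rightarrow> 'o \<Rightarrow> 'm \<Rightarrow> 'm" where
  "left_act_Hs A Hs M \<mu> = \<mu> \<cdot> (\<one> Hs \<otimes> \<eta>\<^bsub>A\<^esub> \<otimes> \<one> M)"

definition right_act_H :: "('o, 'm, 'z) hopf_scheme \<Rightarrow> 'o \<Rightarrow> 'm \<Rightarrow> 'o \<Rightarrow> 'm \<Rightarrow> 'm" where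
  "right_act_H A Hs ev M \<nu> = \<nu> \<cdot> (\<one> M \<otimes> \<eta>\<^bsub>op_dual A Hs ev\<^esub> \<otimes> \<one> (car A))"

definition right_act_Hs :: "('o, 'm, 'z) hopf_scheme \<Rightarrow> 'o \<Rightarrow> 'o \<Rightarrow> 'm \<Rightarrow> 'm" where
  "right_act_Hs A Hs M \<nu> = \<nu> \<cdot> (\<one> M \<otimes> \<one> Hs \<otimes> \<eta>\<^bsub>A\<^esub>)"

text \<open>
  The action of the universal R-matrix of \<open>D(H)\<close> on \<open>M \<otimes> N\<close>: on left modules \<open>H\<close> acts on the first
  factor and \<open>H\<^sup>*\<close> on the second one, on right modules it is the other way round.
\<close>

definition left_R :: "('o, 'm, 'z) hopf_scheme \<Rightarrow> 'o \<Rightarrow> 'm \<Rightarrow> 'm \<Rightarrow> 'o \<Rightarrow> 'm \<Rightarrow> 'o \<Rightarrow> 'm \<Rightarrow> 'm" where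
  "left_R A Hs ev d M \<mu> N \<mu>' =
     (left_act_H A Hs ev M \<mu> \<otimes> left_act_Hs A Hs N \<mu>') \<cdot>
     (\<one> (car A) \<otimes> \<Phi> Hs M \<otimes> \<one> N) \<cdot> (d \<otimes> \<one> M \<otimes> \<one> N)"

definition right_R :: "('o, 'm, 'z) hopf_scheme \<Rightarrow> 'o \<Rightarrow> 'm \<Rightarrow> 'm \<Rightarrow> 'o \<Rightarrow> 'm \<Rightarrow> 'o \<Rightarrow> 'm \<Rightarrow> 'm" where
  "right_R A Hs ev d M \<nu> N \<nu>' =
     (right_act_Hs A Hs M \<nu> \<otimes> right_act_H A Hs ev N \<nu>') \<cdot>
     (\<one> M \<otimes> \<Phi> N Hs \<otimes> \<one> (car A)) \<cdot> (\<one> M \<otimes> \<one> N \<otimes> (\<Phi> (car A) Hs \<cdot> d))"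

text \<open>
  The braidings \<open>M \<otimes> N \<rightarrow> N \<otimes> M\<close> of \<open>D(H)\<close>-modules are \<open>R\<^bsub>N,M\<^esub>\<^sup>-\<^sup>1 \<cdot> \<Phi>\<^bsub>M,N\<^esub>\<close>, on both sides. For right
  modules this is the inverse of \<open>\<Phi>\<^bsub>M,N\<^esub>\<^sup>-\<^sup>1 \<cdot> R\<^bsub>N,M\<^esub> : N \<otimes> M \<rightarrow> M \<otimes> N\<close>. The orientation matters: it is the
  one which makes the braidings correspond to those of \<open>left_yd\<close> and \<open>right_yd\<close> and to those
  of the left and the right center, respectively. The opposite choices \<open>\<Phi>\<^bsub>M,N\<^esub> \<cdot> R\<^bsub>M,N\<^esub>\<close> and
  \<open>\<Phi>\<^bsub>N,M\<^esub>\<^sup>-\<^sup>1 \<cdot> R\<^bsub>M,N\<^esub>\<close> are braidings as well, but in general the categories so obtained are not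
  equivalent, as braided categories, to those of Yetter-Drinfel'd modules (for the left-hand choice
  consider a Taft algebra in vector spaces, for the right-hand one \<open>H = I\<close> in a non-symmetric \<open>C\<close>).
\<close>

definition left_double_modules ::
  "('o, 'm, 'z) hopf_scheme \<Rightarrow> 'o \<Rightarrow> 'm \<Rightarrow> 'm \<Rightarrow> ('o \<times> 'm, 'm) bcat" where
  "left_double_modules A Hs ev d = with_braiding (left_modules (drinfeld_double A Hs ev))
     (\<lambda>(M, \<mu>) (N, \<mu>'). inv_mor C (N \<boxtimes> M) (N \<boxtimes> M) (left_R A Hs ev d N \<mu>' M \<mu>) \<cdot> \<Phi> M N)"

definition right_double_modules ::
  "('o, 'm, 'z) hopf_scheme \<Rightarrow> 'o \<Rightarrow> 'm \<Rightarrow> 'm \<Rightarrow> ('o \<times> 'm, 'm) bcat" where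
  "right_double_modules A Hs ev d = with_braiding (right_modules (drinfeld_double A Hs ev))
     (\<lambda>(M, \<nu>) (N, \<nu>'). inv_mor C (N \<boxtimes> M) (N \<boxtimes> M) (right_R A Hs ev d N \<nu>' M \<nu>) \<cdot> \<Phi> M N)"

end

end

theory Submission imports Defs "HOL-Library.Multiset" begin

text \<open>
  A Yetter-Drinfel'd module \<open>(M, \<mu>, l)\<close> becomes a module over \<open>D(H) = H\<^sup>* \<bowtie> H\<close> by letting \<open>b \<in> H\<^sup>*\<close> act as
  \<open>m \<mapsto> \<langle>b, S\<^sup>-\<^sup>1(m\<^sub>-\<^sub>1)\<rangle> m\<^sub>0\<close>, and the coaction is recovered from this action by means of the dual basis. The
  Yetter-Drinfel'd condition is equivalent to
  \<open>S\<^sup>-\<^sup>1(m\<^sub>-\<^sub>1) \<otimes> h m\<^sub>0 = S\<^sup>-\<^sup>1(h\<^sub>3) S\<^sup>-\<^sup>1((h\<^sub>2 m)\<^sub>-\<^sub>1) h\<^sub>1 \<otimes> (h\<^sub>2 m)\<^sub>0\<close>, and this is exactly the commutation rule of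
  \<open>H\<close> and \<open>H\<^sup>*\<close> in the double. On the other hand \<open>m \<otimes> x \<mapsto> m\<^sub>-\<^sub>1 x \<otimes> m\<^sub>0\<close> is a half braiding on \<open>H\<close>-modules, from
  which \<open>l\<close> is regained by inserting the unit of the regular module. Both functors are the identity on
  morphisms and strictly monoidal, so braidings and their axioms can be transported along them.

  All identities between composites are computed graphically. As \<open>H\<close>, and hence \<open>H\<^sup>*\<close>, is transparent, its
  strands may cross any other strand on either side, so that the value of a diagram depends only on how
  its boxes are connected, as long as strands of other objects do not cross each other.
\<close>

section \<open>The left center\<close>

text \<open>The inverse antipode (\<open>Si\<close> below) in the action of \<open>H\<^sup>*\<close>
  has two causes. The product of \<open>H\<^sup>*\<close> is dual to \<open>\<Delta>\<close> without
  a flip, so pairing b directly with the left coaction would give an action in the wrong order; and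
  the coproduct of \<open>H\<^sup>*\<close> is dual to the opposite product of H, a second reversal
  which \<open>Si\<close> undoes on tensor products. As a consequence the R-matrix acts by
  \<open>x \<otimes> m \<mapsto> Si(m(-1)) x \<otimes> m(0)\<close>. This is the inverse of the map
  behind the half braiding, and explains why the braiding of the double contains an inverted
  R-matrix.

  Hand computation with associativity and interchange, as in the part on centers, is not feasible
  for the double. Terms are therefore compiled into lists of boxes with labelled wires, and the side
  conditions of a rewriting step are decided by simplification. Crossings of two arbitrary strands
  do occur and are treated as boxes of their own.

  Reversing the tensor product settles the right-hand center but not the right modules over the
  double: it would exchange the factors of \<open>Hs \<boxtimes> H\<close> and the sides of the
  duality. That comparison is computed anew, for the same double.\<close>

context category begin

text \<open>Inverses are unique, so \<open>inv_mor\<close>, a definite description, is known as soon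
  as some inverse is exhibited. The antipode, the braiding of \<open>H\<close> with itself and the
  R-matrices are inverted through this lemma.\<close>

lemma inv_mor_eq:
  assumes "X \<in> ob C" "Y \<in> ob C" "f \<in> hom C X Y" "inverse_pair C X Y f g"
  shows "inv_mor C X Y f = g"
  unfolding inv_mor_def
proof (rule the_equality)
  show "inverse_pair C X Y f g" by (rule assms(4))
next
  fix g' assume g': "inverse_pair C X Y f g'"
  have "g' = g' \<cdot> (f \<cdot> g)" using g' assms by (auto simp: inverse_pair_def id_right)
  also have "\<dots> = (g' \<cdot> f) \<cdot> g" using g' assms cmp_assoc[of Y X Y X g f g'] by (auto simp: inverse_pair_def)
  also have "\<dots> = g" using g' assms by (auto simp: inverse_pair_def id_left)
  finally show "g' = g" .
qed

lemma iso_inv: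
  assumes "X \<in> ob C" "Y \<in> ob C" "iso_mor C X Y f"
  shows "inverse_pair C X Y f (inv_mor C X Y f)"
  using assms inv_mor_eq by (metis iso_mor_def)

lemma iso_id: "X \<in> ob C \<Longrightarrow> iso_mor C X X (\<one> X)"
  unfolding iso_mor_def inverse_pair_def using id_hom id_left by blast

text \<open>The regrouping that brings an inner pair together, so that it can be cancelled or
  replaced.\<close>

lemma cmp4:
  assumes "V \<in> ob C" "W \<in> ob C" "X \<in> ob C" "Y \<in> ob C" "Z \<in> ob C"
    "d \<in> hom C V W" "c \<in> hom C W X" "b \<in> hom C X Y" "a \<in> hom C Y Z"
  shows "(a \<cdot> b) \<cdot> (c \<cdot> d) = a \<cdot> ((b \<cdot> c) \<cdot> d)"
  using assms cmp_assoc[of V X Y Z "c \<cdot> d" b a] cmp_assoc[of V W X Y d c b] cmp_hom[of V W X d c] by simp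

lemma iso_cmp:
  assumes o: "X \<in> ob C" "Y \<in> ob C" "Z \<in> ob C" and f: "iso_mor C X Y f" and g: "iso_mor C Y Z g"
  shows "iso_mor C X Z (g \<cdot> f)"
proof -
  obtain f' g' where f': "f \<in> hom C X Y" "f' \<in> hom C Y X" "f' \<cdot> f = \<one> X" "f \<cdot> f' = \<one> Y"
    and g': "g \<in> hom C Y Z" "g' \<in> hom C Z Y" "g' \<cdot> g = \<one> Y" "g \<cdot> g' = \<one> Z"
    using f g by (auto simp: iso_mor_def inverse_pair_def)
  have "(f' \<cdot> g') \<cdot> (g \<cdot> f) = f' \<cdot> ((g' \<cdot> g) \<cdot> f)" "(g \<cdot> f) \<cdot> (f' \<cdot> g') = g \<cdot> ((f \<cdot> f') \<cdot> g')"
    using cmp4[of X Y Z Y X f g g' f'] cmp4[of Z Y X Y Z g' f' f g] o f' g' by simp_all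
  hence "inverse_pair C X Z (g \<cdot> f) (f' \<cdot> g')"
    using o f' g' by (auto simp: inverse_pair_def id_left intro: cmp_hom)
  thus ?thesis using cmp_hom[OF o f'(1) g'(1)] by (auto simp: iso_mor_def)
qed

end

context strict_monoidal_category begin

lemmas obs = ten_ob unit_ob
lemmas homs = id_hom ten_hom obs

lemma rwhisk: "\<lbrakk>X \<in> ob C; Y \<in> ob C; Z \<in> ob C; W \<in> ob C; f \<in> hom C X Y; g \<in> hom C Y Z\<rbrakk> \<Longrightarrow>
    (g \<cdot> f) \<otimes> \<one> W = (g \<otimes> \<one> W) \<cdot> (f \<otimes> \<one> W)"
  using interchange[of X Y Z W W W f g "\<one> W" "\<one> W"] by (simp add: id_hom id_left[of W W])

lemma lwhisk: "\<lbrakk>X \<in> ob C; Y \<in> ob C; Z \<in> ob C; W \<in> ob C; f \<in> hom C X Y; g \<in> hom C Y Z\<rbrakk> \<Longrightarrow>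
    \<one> W \<otimes> (g \<cdot> f) = (\<one> W \<otimes> g) \<cdot> (\<one> W \<otimes> f)"
  using interchange[of W W W X Y Z "\<one> W" "\<one> W" f g] by (simp add: id_hom id_left[of W W])

text \<open>Together with \<open>slide2\<close> it says that morphisms on disjoint tensor factors
  may be performed in either order.\<close>

lemma slide1: "\<lbrakk>X \<in> ob C; Y \<in> ob C; Z \<in> ob C; W \<in> ob C; f \<in> hom C X Y; g \<in> hom C Z W\<rbrakk> \<Longrightarrow>
    (f \<otimes> \<one> W) \<cdot> (\<one> X \<otimes> g) = f \<otimes> g"
  using interchange[of X X Y Z W W "\<one> X" f g "\<one> W"] by (simp add: id_hom id_left id_right)

lemma slide2: "\<lbrakk>X \<in> ob C; Y \<in> ob C; Z \<in> ob C; W \<in> ob C; f \<in> hom C X Y; g \<in> hom C Z W\<rbrakk> \<Longrightarrow>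
    (\<one> Y \<otimes> g) \<cdot> (f \<otimes> \<one> Z) = f \<otimes> g"
  using interchange[of X Y Y Z Z W f "\<one> Y" "\<one> Z" g] by (simp add: id_hom id_left id_right)

lemma iso_ten:
  assumes o: "X \<in> ob C" "Y \<in> ob C" "X' \<in> ob C" "Y' \<in> ob C" and f: "iso_mor C X Y f" and g: "iso_mor C X' Y' g"
  shows "iso_mor C (X \<boxtimes> X') (Y \<boxtimes> Y') (f \<otimes> g)"
proof -
  obtain f' g' where f': "f \<in> hom C X Y" "f' \<in> hom C Y X" "f' \<cdot> f = \<one> X" "f \<cdot> f' = \<one> Y"
    and g': "g \<in> hom C X' Y'" "g' \<in> hom C Y' X'" "g' \<cdot> g = \<one> X'" "g \<cdot> g' = \<one> Y'"
    using f g by (auto simp: iso_mor_def inverse_pair_def)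
  have "inverse_pair C (X \<boxtimes> X') (Y \<boxtimes> Y') (f \<otimes> g) (f' \<otimes> g')"
    using o f' g' by (auto simp: inverse_pair_def ten_id ten_hom
        interchange[of X Y X X' Y' X' f f' g g', symmetric] interchange[of Y X Y Y' X' Y' f' f g' g, symmetric])
  thus ?thesis using o f' g' by (auto simp: iso_mor_def ten_hom)
qed

lemma left_half_braidingD:
  assumes "left_half_braiding C V c"
  shows "V \<in> ob C" "c \<in> extensional (ob C)" "X \<in> ob C \<Longrightarrow> iso_mor C (V \<boxtimes> X) (X \<boxtimes> V) (c X)"
    "X \<in> ob C \<Longrightarrow> c X \<in> hom C (V \<boxtimes> X) (X \<boxtimes> V)"
    "X \<in> ob C \<Longrightarrow> Y \<in> ob C \<Longrightarrow> f \<in> hom C X Y \<Longrightarrow> c Y \<cdot> (\<one> V \<otimes> f) = (f \<otimes> \<one> V) \<cdot> c X"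
    "X \<in> ob C \<Longrightarrow> Y \<in> ob C \<Longrightarrow> c (X \<boxtimes> Y) = (\<one> X \<otimes> c Y) \<cdot> (c X \<otimes> \<one> Y)"
  using assms unfolding left_half_braiding_def iso_mor_def by blast+

text \<open>This becomes the multiplicativity condition for the half braiding of a tensor product.
  The two sides differ only in the order of \<open>cX\<close> and \<open>dY\<close>, which act on
  disjoint pairs of factors.\<close>

lemma half_braiding_tensor_comp:
  assumes o: "V \<in> ob C" "W \<in> ob C" "X \<in> ob C" "Y \<in> ob C"
    and h: "cX \<in> hom C (V \<boxtimes> X) (X \<boxtimes> V)" "cY \<in> hom C (V \<boxtimes> Y) (Y \<boxtimes> V)"
      "dX \<in> hom C (W \<boxtimes> X) (X \<boxtimes> W)" "dY \<in> hom C (W \<boxtimes> Y) (Y \<boxtimes> W)"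
  shows "(((\<one> X \<otimes> cY) \<cdot> (cX \<otimes> \<one> Y)) \<otimes> \<one> W) \<cdot> (\<one> V \<otimes> ((\<one> X \<otimes> dY) \<cdot> (dX \<otimes> \<one> Y))) =
    (\<one> X \<otimes> ((cY \<otimes> \<one> W) \<cdot> (\<one> V \<otimes> dY))) \<cdot> (((cX \<otimes> \<one> W) \<cdot> (\<one> V \<otimes> dX)) \<otimes> \<one> Y)"
proof -
  note t = o h
  have a: "((\<one> X \<otimes> cY) \<cdot> (cX \<otimes> \<one> Y)) \<otimes> \<one> W = (\<one> X \<otimes> cY \<otimes> \<one> W) \<cdot> (cX \<otimes> \<one> (Y \<boxtimes> W))"
    using rwhisk[of "V \<boxtimes> X \<boxtimes> Y" "X \<boxtimes> V \<boxtimes> Y" "X \<boxtimes> Y \<boxtimes> V" W "cX \<otimes> \<one> Y" "\<one> X \<otimes> cY"] t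
      ten_hom[OF _ _ _ _ h(1) id_hom[OF o(4)]] ten_hom[OF _ _ _ _ id_hom[OF o(3)] h(2)]
      tenM_assoc[of X X "V \<boxtimes> Y" "Y \<boxtimes> V" W W "\<one> X" cY "\<one> W"]
      tenM_assoc[of "V \<boxtimes> X" "X \<boxtimes> V" Y Y W W cX "\<one> Y" "\<one> W"]
    by (simp add: homs ten_id tenO_assoc)
  have b: "\<one> V \<otimes> ((\<one> X \<otimes> dY) \<cdot> (dX \<otimes> \<one> Y)) = (\<one> (V \<boxtimes> X) \<otimes> dY) \<cdot> (\<one> V \<otimes> dX \<otimes> \<one> Y)"
    using lwhisk[of "W \<boxtimes> X \<boxtimes> Y" "X \<boxtimes> W \<boxtimes> Y" "X \<boxtimes> Y \<boxtimes> W" V "dX \<otimes> \<one> Y" "\<one> X \<otimes> dY"] t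
      ten_hom[OF _ _ _ _ h(3) id_hom[OF o(4)]] ten_hom[OF _ _ _ _ id_hom[OF o(3)] h(4)]
      tenM_assoc[of V V X X "W \<boxtimes> Y" "Y \<boxtimes> W" "\<one> V" "\<one> X" dY, symmetric]
    by (simp add: homs ten_id tenO_assoc)
  \<comment> \<open>The actual commutation; the other equations only move identities in and out of
    brackets.\<close>
  have c: "(cX \<otimes> \<one> (Y \<boxtimes> W)) \<cdot> (\<one> (V \<boxtimes> X) \<otimes> dY) = (\<one> (X \<boxtimes> V) \<otimes> dY) \<cdot> (cX \<otimes> \<one> (W \<boxtimes> Y))"
    using slide1[of "V \<boxtimes> X" "X \<boxtimes> V" "W \<boxtimes> Y" "Y \<boxtimes> W" cX dY] slide2[of "V \<boxtimes> X" "X \<boxtimes> V" "W \<boxtimes> Y" "Y \<boxtimes> W" cX dY] t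
    by (simp add: homs)
  have d: "\<one> X \<otimes> ((cY \<otimes> \<one> W) \<cdot> (\<one> V \<otimes> dY)) = (\<one> X \<otimes> cY \<otimes> \<one> W) \<cdot> (\<one> (X \<boxtimes> V) \<otimes> dY)"
    using lwhisk[of "V \<boxtimes> W \<boxtimes> Y" "V \<boxtimes> Y \<boxtimes> W" "Y \<boxtimes> V \<boxtimes> W" X "\<one> V \<otimes> dY" "cY \<otimes> \<one> W"] t
      ten_hom[OF _ _ _ _ h(2) id_hom[OF o(2)]] ten_hom[OF _ _ _ _ id_hom[OF o(1)] h(4)]
      tenM_assoc[of X X V V "W \<boxtimes> Y" "Y \<boxtimes> W" "\<one> X" "\<one> V" dY, symmetric]
    by (simp add: homs ten_id tenO_assoc)
  have e: "((cX \<otimes> \<one> W) \<cdot> (\<one> V \<otimes> dX)) \<otimes> \<one> Y = (cX \<otimes> \<one> (W \<boxtimes> Y)) \<cdot> (\<one> V \<otimes> dX \<otimes> \<one> Y)"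
    using rwhisk[of "V \<boxtimes> W \<boxtimes> X" "V \<boxtimes> X \<boxtimes> W" "X \<boxtimes> V \<boxtimes> W" Y "\<one> V \<otimes> dX" "cX \<otimes> \<one> W"] t
      ten_hom[OF _ _ _ _ h(1) id_hom[OF o(2)]] ten_hom[OF _ _ _ _ id_hom[OF o(1)] h(3)]
      tenM_assoc[of V V "W \<boxtimes> X" "X \<boxtimes> W" Y Y "\<one> V" dX "\<one> Y"]
      tenM_assoc[of "V \<boxtimes> X" "X \<boxtimes> V" W W Y Y cX "\<one> W" "\<one> Y"]
    by (simp add: homs ten_id tenO_assoc)
  have h1: "\<one> X \<otimes> cY \<otimes> \<one> W \<in> hom C (X \<boxtimes> V \<boxtimes> Y \<boxtimes> W) (X \<boxtimes> Y \<boxtimes> V \<boxtimes> W)"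
    using ten_hom[of X X "V \<boxtimes> Y \<boxtimes> W" "Y \<boxtimes> V \<boxtimes> W" "\<one> X" "cY \<otimes> \<one> W"]
      ten_hom[of "V \<boxtimes> Y" "Y \<boxtimes> V" W W cY "\<one> W"] t by (simp add: id_hom obs tenO_assoc)
  have h2: "cX \<otimes> \<one> (Y \<boxtimes> W) \<in> hom C (V \<boxtimes> X \<boxtimes> Y \<boxtimes> W) (X \<boxtimes> V \<boxtimes> Y \<boxtimes> W)"
    "cX \<otimes> \<one> (W \<boxtimes> Y) \<in> hom C (V \<boxtimes> X \<boxtimes> W \<boxtimes> Y) (X \<boxtimes> V \<boxtimes> W \<boxtimes> Y)"
    using ten_hom[of "V \<boxtimes> X" "X \<boxtimes> V" "Y \<boxtimes> W" "Y \<boxtimes> W" cX] ten_hom[of "V \<boxtimes> X" "X \<boxtimes> V" "W \<boxtimes> Y" "W \<boxtimes> Y" cX] t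
    by (simp_all add: id_hom obs tenO_assoc)
  have h3: "\<one> (V \<boxtimes> X) \<otimes> dY \<in> hom C (V \<boxtimes> X \<boxtimes> W \<boxtimes> Y) (V \<boxtimes> X \<boxtimes> Y \<boxtimes> W)"
    "\<one> (X \<boxtimes> V) \<otimes> dY \<in> hom C (X \<boxtimes> V \<boxtimes> W \<boxtimes> Y) (X \<boxtimes> V \<boxtimes> Y \<boxtimes> W)"
    using ten_hom[of "V \<boxtimes> X" "V \<boxtimes> X" "W \<boxtimes> Y" "Y \<boxtimes> W" _ dY] ten_hom[of "X \<boxtimes> V" "X \<boxtimes> V" "W \<boxtimes> Y" "Y \<boxtimes> W" _ dY] t
    by (simp_all add: id_hom obs tenO_assoc)
  have h4: "\<one> V \<otimes> dX \<otimes> \<one> Y \<in> hom C (V \<boxtimes> W \<boxtimes> X \<boxtimes> Y) (V \<boxtimes> X \<boxtimes> W \<boxtimes> Y)"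
    using ten_hom[of V V "W \<boxtimes> X \<boxtimes> Y" "X \<boxtimes> W \<boxtimes> Y" "\<one> V" "dX \<otimes> \<one> Y"]
      ten_hom[of "W \<boxtimes> X" "X \<boxtimes> W" Y Y dX "\<one> Y"] t by (simp add: id_hom obs tenO_assoc)
  note oo = ten_ob[OF o(1)] ten_ob[OF o(2)] ten_ob[OF o(3)] ten_ob[OF o(4)]
  have "((\<one> X \<otimes> cY \<otimes> \<one> W) \<cdot> (cX \<otimes> \<one> (Y \<boxtimes> W))) \<cdot> ((\<one> (V \<boxtimes> X) \<otimes> dY) \<cdot> (\<one> V \<otimes> dX \<otimes> \<one> Y)) =
    (\<one> X \<otimes> cY \<otimes> \<one> W) \<cdot> (((cX \<otimes> \<one> (Y \<boxtimes> W)) \<cdot> (\<one> (V \<boxtimes> X) \<otimes> dY)) \<cdot> (\<one> V \<otimes> dX \<otimes> \<one> Y))"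
    by (rule cmp4[OF _ _ _ _ _ h4 h3(1) h2(1) h1]) (use o in \<open>simp_all add: obs\<close>)
  also have "\<dots> = ((\<one> X \<otimes> cY \<otimes> \<one> W) \<cdot> (\<one> (X \<boxtimes> V) \<otimes> dY)) \<cdot> ((cX \<otimes> \<one> (W \<boxtimes> Y)) \<cdot> (\<one> V \<otimes> dX \<otimes> \<one> Y))"
    unfolding c by (rule cmp4[OF _ _ _ _ _ h4 h2(2) h3(2) h1, symmetric]) (use o in \<open>simp_all add: obs\<close>)
  finally show ?thesis unfolding a b d e .
qed

lemma left_half_braidingI:
  assumes "V \<in> ob C" "c \<in> extensional (ob C)" "\<And>X. X \<in> ob C \<Longrightarrow> iso_mor C (V \<boxtimes> X) (X \<boxtimes> V) (c X)"
    "\<And>X Y f. X \<in> ob C \<Longrightarrow> Y \<in> ob C \<Longrightarrow> f \<in> hom C X Y \<Longrightarrow> c Y \<cdot> (\<one> V \<otimes> f) = (f \<otimes> \<one> V) \<cdot> c X"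
    "\<And>X Y. X \<in> ob C \<Longrightarrow> Y \<in> ob C \<Longrightarrow> c (X \<boxtimes> Y) = (\<one> X \<otimes> c Y) \<cdot> (c X \<otimes> \<one> Y)"
  shows "left_half_braiding C V c"
  using assms unfolding left_half_braiding_def by blast

lemma half_braiding_tensor:
  assumes "left_half_braiding C V c" "left_half_braiding C W d"
  shows "left_half_braiding C (V \<boxtimes> W) (\<lambda>X\<in>ob C. (c X \<otimes> \<one> W) \<cdot> (\<one> V \<otimes> d X))" (is "left_half_braiding C _ ?e")
proof (rule left_half_braidingI)
  note c = left_half_braidingD[OF assms(1)] and d = left_half_braidingD[OF assms(2)]
  note o = c(1) d(1)
  show "V \<boxtimes> W \<in> ob C" using o by (simp add: obs)
  show "?e \<in> extensional (ob C)" by simp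
  have i1: "iso_mor C (V \<boxtimes> X \<boxtimes> W) (X \<boxtimes> V \<boxtimes> W) (c X \<otimes> \<one> W)"
    and i2: "iso_mor C (V \<boxtimes> W \<boxtimes> X) (V \<boxtimes> X \<boxtimes> W) (\<one> V \<otimes> d X)" if X: "X \<in> ob C" for X
    using iso_ten[OF _ _ _ _ c(3)[OF X] iso_id[OF o(2)]] iso_ten[OF _ _ _ _ iso_id[OF o(1)] d(3)[OF X]] X o
    by (simp_all add: obs tenO_assoc)
  show "iso_mor C ((V \<boxtimes> W) \<boxtimes> X) (X \<boxtimes> V \<boxtimes> W) (?e X)" if X: "X \<in> ob C" for X
    using iso_cmp[OF _ _ _ i2[OF X] i1[OF X]] X o by (simp add: obs tenO_assoc)
  have h1: "c X \<otimes> \<one> W \<in> hom C (V \<boxtimes> X \<boxtimes> W) (X \<boxtimes> V \<boxtimes> W)"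
    and h2: "\<one> V \<otimes> d X \<in> hom C (V \<boxtimes> W \<boxtimes> X) (V \<boxtimes> X \<boxtimes> W)" if X: "X \<in> ob C" for X
    using i1[OF X] i2[OF X] by (auto simp: iso_mor_def)
  show "?e Y \<cdot> (\<one> (V \<boxtimes> W) \<otimes> f) = (f \<otimes> \<one> (V \<boxtimes> W)) \<cdot> ?e X" if X: "X \<in> ob C" and Y: "Y \<in> ob C" and f: "f \<in> hom C X Y" for X Y f
  proof -
    have f1: "\<one> W \<otimes> f \<in> hom C (W \<boxtimes> X) (W \<boxtimes> Y)" "f \<otimes> \<one> W \<in> hom C (X \<boxtimes> W) (Y \<boxtimes> W)"
      "\<one> V \<otimes> f \<in> hom C (V \<boxtimes> X) (V \<boxtimes> Y)" "f \<otimes> \<one> V \<in> hom C (X \<boxtimes> V) (Y \<boxtimes> V)"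
      using X Y f o by (simp_all add: homs)
    have f2: "\<one> V \<otimes> \<one> W \<otimes> f \<in> hom C (V \<boxtimes> W \<boxtimes> X) (V \<boxtimes> W \<boxtimes> Y)"
      "\<one> V \<otimes> f \<otimes> \<one> W \<in> hom C (V \<boxtimes> X \<boxtimes> W) (V \<boxtimes> Y \<boxtimes> W)"
      "f \<otimes> \<one> V \<otimes> \<one> W \<in> hom C (X \<boxtimes> V \<boxtimes> W) (Y \<boxtimes> V \<boxtimes> W)"
      using X Y o f1 f by (simp_all add: homs)
    have a1: "\<one> (V \<boxtimes> W) \<otimes> f = \<one> V \<otimes> \<one> W \<otimes> f" "f \<otimes> \<one> (V \<boxtimes> W) = f \<otimes> \<one> V \<otimes> \<one> W"
      using tenM_assoc[of V V W W X Y "\<one> V" "\<one> W" f] X Y f o by (simp_all add: homs ten_id)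
    have "(\<one> V \<otimes> d Y) \<cdot> (\<one> V \<otimes> \<one> W \<otimes> f) = \<one> V \<otimes> (d Y \<cdot> (\<one> W \<otimes> f))"
      using lwhisk[OF _ _ _ o(1) f1(1) d(4)[OF Y]] X Y o by (simp add: obs)
    also have "\<dots> = (\<one> V \<otimes> f \<otimes> \<one> W) \<cdot> (\<one> V \<otimes> d X)"
      using lwhisk[OF _ _ _ o(1) d(4)[OF X] f1(2)] X Y o d(5)[OF X Y f] by (simp add: obs)
    finally have e1: "(\<one> V \<otimes> d Y) \<cdot> (\<one> V \<otimes> \<one> W \<otimes> f) = (\<one> V \<otimes> f \<otimes> \<one> W) \<cdot> (\<one> V \<otimes> d X)" .
    have "(c Y \<otimes> \<one> W) \<cdot> (\<one> V \<otimes> f \<otimes> \<one> W) = (c Y \<cdot> (\<one> V \<otimes> f)) \<otimes> \<one> W"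
      using rwhisk[OF _ _ _ o(2) f1(3) c(4)[OF Y]] X Y o f tenM_assoc[of V V X Y W W "\<one> V" f "\<one> W"] by (simp add: homs)
    also have "\<dots> = (f \<otimes> \<one> V \<otimes> \<one> W) \<cdot> (c X \<otimes> \<one> W)"
      using rwhisk[OF _ _ _ o(2) c(4)[OF X] f1(4)] X Y o f c(5)[OF X Y f] tenM_assoc[of X Y V V W W f "\<one> V" "\<one> W"]
      by (simp add: homs)
    finally have e2: "(c Y \<otimes> \<one> W) \<cdot> (\<one> V \<otimes> f \<otimes> \<one> W) = (f \<otimes> \<one> V \<otimes> \<one> W) \<cdot> (c X \<otimes> \<one> W)" .
    have "((c Y \<otimes> \<one> W) \<cdot> (\<one> V \<otimes> d Y)) \<cdot> (\<one> V \<otimes> \<one> W \<otimes> f) = (c Y \<otimes> \<one> W) \<cdot> ((\<one> V \<otimes> d Y) \<cdot> (\<one> V \<otimes> \<one> W \<otimes> f))"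
      by (rule cmp_assoc[OF _ _ _ _ f2(1) h2[OF Y] h1[OF Y]]) (use X Y o in \<open>simp_all add: obs\<close>)
    also have "\<dots> = ((c Y \<otimes> \<one> W) \<cdot> (\<one> V \<otimes> f \<otimes> \<one> W)) \<cdot> (\<one> V \<otimes> d X)"
      unfolding e1 by (rule cmp_assoc[OF _ _ _ _ h2[OF X] f2(2) h1[OF Y], symmetric]) (use X Y o in \<open>simp_all add: obs\<close>)
    also have "\<dots> = (f \<otimes> \<one> V \<otimes> \<one> W) \<cdot> ((c X \<otimes> \<one> W) \<cdot> (\<one> V \<otimes> d X))"
      unfolding e2 by (rule cmp_assoc[OF _ _ _ _ h2[OF X] h1[OF X] f2(3)]) (use X Y o in \<open>simp_all add: obs\<close>)
    finally show ?thesis using X Y by (simp add: a1)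
  qed
  show "?e (X \<boxtimes> Y) = (\<one> X \<otimes> ?e Y) \<cdot> (?e X \<otimes> \<one> Y)" if X: "X \<in> ob C" and Y: "Y \<in> ob C" for X Y
    using half_braiding_tensor_comp[OF o X Y c(4)[OF X] c(4)[OF Y] d(4)[OF X] d(4)[OF Y]] X Y c(6)[OF X Y] d(6)[OF X Y]
    by (simp add: obs)
qed

lemma half_braiding_unit: "left_half_braiding C \<I> (\<lambda>X\<in>ob C. \<one> X)"
proof (rule left_half_braidingI)
  show "iso_mor C (\<I> \<boxtimes> X) (X \<boxtimes> \<I>) ((\<lambda>X\<in>ob C. \<one> X) X)" if "X \<in> ob C" for X
    using iso_id[OF that] that by (simp add: tenO_unit_left tenO_unit_right)
  show "(\<lambda>X\<in>ob C. \<one> X) (X \<boxtimes> Y) = (\<one> X \<otimes> (\<lambda>X\<in>ob C. \<one> X) Y) \<cdot> ((\<lambda>X\<in>ob C. \<one> X) X \<otimes> \<one> Y)"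
    if "X \<in> ob C" "Y \<in> ob C" for X Y
    using that id_left[OF ten_ob ten_ob id_hom[OF ten_ob]] by (simp add: ten_id obs)
qed (auto simp: unit_ob obs id_left id_right id_hom tenM_unit_left tenM_unit_right)

lemma left_center_sel [simp]:
  "ob (left_center C) = {(V, c). left_half_braiding C V c}"
  "hom (left_center C) (V, c) (W, c') = {f \<in> hom C V W. \<forall>X\<in>ob C. (\<one> X \<otimes> f) \<cdot> c X = c' X \<cdot> (f \<otimes> \<one> X)}"
  "idm (left_center C) (V, c) = \<one> V" "cmp (left_center C) = cmp C"
  "unitO (left_center C) = (\<I>, \<lambda>X\<in>ob C. \<one> X)"
  "tenO (left_center C) (V, c) (W, c') = (V \<boxtimes> W, \<lambda>X\<in>ob C. (c X \<otimes> \<one> W) \<cdot> (\<one> V \<otimes> c' X))"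
  "tenM (left_center C) = tenM C" "braid (left_center C) (V, c) (W, c') = c W"
  by (simp_all add: left_center_def)

text \<open>Isomorphisms of the center refer to its own hom-sets, so invertibility of the braiding
  there requires that an inverse in \<open>C\<close> again respects the half braidings. The equation
  defining morphisms is multiplied by \<open>g\<close> on both sides.\<close>

lemma left_center_inv:
  assumes P: "left_half_braiding C V c" and Q: "left_half_braiding C W d"
    and f: "f \<in> hom (left_center C) (V, c) (W, d)" and g: "inverse_pair C V W f g"
  shows "g \<in> hom (left_center C) (W, d) (V, c)"
proof -
  note c = left_half_braidingD[OF P] and d = left_half_braidingD[OF Q]
  have f': "f \<in> hom C V W" and g': "g \<in> hom C W V" "g \<cdot> f = \<one> V" "f \<cdot> g = \<one> W"
    using f g by (auto simp: inverse_pair_def)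
  have "(\<one> X \<otimes> g) \<cdot> d X = c X \<cdot> (g \<otimes> \<one> X)" if X: "X \<in> ob C" for X
  proof -
    have o: "X \<boxtimes> V \<in> ob C" "V \<boxtimes> X \<in> ob C" "X \<boxtimes> W \<in> ob C" "W \<boxtimes> X \<in> ob C" using X c(1) d(1) by (simp_all add: obs)
    have h: "\<one> X \<otimes> g \<in> hom C (X \<boxtimes> W) (X \<boxtimes> V)" "\<one> X \<otimes> f \<in> hom C (X \<boxtimes> V) (X \<boxtimes> W)"
      "f \<otimes> \<one> X \<in> hom C (V \<boxtimes> X) (W \<boxtimes> X)" "g \<otimes> \<one> X \<in> hom C (W \<boxtimes> X) (V \<boxtimes> X)"
      using X c(1) d(1) f' g' by (simp_all add: homs)
    have gf: "(\<one> X \<otimes> g) \<cdot> (\<one> X \<otimes> f) = \<one> (X \<boxtimes> V)" "(f \<otimes> \<one> X) \<cdot> (g \<otimes> \<one> X) = \<one> (W \<boxtimes> X)"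
      using lwhisk[OF c(1) d(1) c(1) X f' g'(1)] rwhisk[OF d(1) c(1) d(1) X g'(1) f'] g' c(1) d(1) X by (simp_all add: ten_id)
    have "(\<one> X \<otimes> g) \<cdot> d X = ((\<one> X \<otimes> g) \<cdot> d X) \<cdot> ((f \<otimes> \<one> X) \<cdot> (g \<otimes> \<one> X))"
      using id_right[OF o(4,1) cmp_hom[OF o(4,3,1) d(4)[OF X] h(1)]] gf by simp
    also have "\<dots> = (\<one> X \<otimes> g) \<cdot> ((d X \<cdot> (f \<otimes> \<one> X)) \<cdot> (g \<otimes> \<one> X))"
      by (rule cmp4[OF o(4,2,4,3,1) h(4,3) d(4)[OF X] h(1)])
    also have "d X \<cdot> (f \<otimes> \<one> X) = (\<one> X \<otimes> f) \<cdot> c X" using f X by simp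
    also have "(\<one> X \<otimes> g) \<cdot> (((\<one> X \<otimes> f) \<cdot> c X) \<cdot> (g \<otimes> \<one> X)) = ((\<one> X \<otimes> g) \<cdot> (\<one> X \<otimes> f)) \<cdot> (c X \<cdot> (g \<otimes> \<one> X))"
      by (rule cmp4[OF o(4,2,1,3,1) h(4) c(4)[OF X] h(2,1), symmetric])
    also have "\<dots> = c X \<cdot> (g \<otimes> \<one> X)"
      using gf id_left[OF o(4,1) cmp_hom[OF o(4,2,1) h(4) c(4)[OF X]]] by simp
    finally show ?thesis .
  qed
  thus ?thesis using g' by simp
qed

text \<open>Most axioms restate defining conditions: one hexagon is the definition of the tensor
  product, the other is the multiplicativity of \<open>c\<close>, and naturality combines the
  naturality of \<open>c\<close> with the condition on morphisms. The point with content is that the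
  braiding is itself a morphism of the center.\<close>

theorem braided_left_center: "braided_category (left_center C)"
proof -
  let ?Z = "left_center C"
  note D = left_half_braidingD
  have ten: "tenO ?Z P Q \<in> ob ?Z" if "P \<in> ob ?Z" "Q \<in> ob ?Z" for P Q
    using that half_braiding_tensor by (cases P; cases Q) auto
  show ?thesis
  proof
    fix P assume "P \<in> ob ?Z"
    then obtain V c where P: "P = (V, c)" and c: "left_half_braiding C V c" by (cases P) auto
    note c = D[OF c]
    show "idm ?Z P \<in> hom ?Z P P"
      using c by (auto simp: P id_hom ten_id id_left[OF _ _ c(4)] id_right[OF _ _ c(4)] obs)
    \<comment> \<open>Objects contain a family of morphisms, so the unit law also compares families.
      Both are \<open>undefined\<close> off the objects, hence extensionality applies.\<close>
    show "tenO ?Z (unitO ?Z) P = P"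
      using c by (auto simp: P tenO_unit_left unit_ob ten_id id_left[OF _ _ c(4)] id_right[OF _ _ c(4)] obs tenM_unit_left[OF _ _ c(4)]
        intro!: extensionalityI[OF restrict_extensional c(2)])
    show "tenO ?Z P (unitO ?Z) = P"
      using c by (auto simp: P tenO_unit_right unit_ob ten_id id_left[OF _ _ c(4)] id_right[OF _ _ c(4)] obs tenM_unit_right[OF _ _ c(4)]
        intro!: extensionalityI[OF restrict_extensional c(2)])
  next
    fix P Q R f g assume "P \<in> ob ?Z" "Q \<in> ob ?Z" "R \<in> ob ?Z" and f: "f \<in> hom ?Z P Q" and g: "g \<in> hom ?Z Q R"
    then obtain V c W d U e where P: "P = (V, c)" and "left_half_braiding C V c" and Q: "Q = (W, d)"
      and "left_half_braiding C W d" and R: "R = (U, e)" and "left_half_braiding C U e"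
      by (cases P; cases Q; cases R) auto
    note c = D[OF this(2)] and d = D[OF this(4)] and e = D[OF this(6)]
    have f': "f \<in> hom C V W" and g': "g \<in> hom C W U" using f g P Q R by auto
    have "(\<one> X \<otimes> (g \<cdot> f)) \<cdot> c X = e X \<cdot> ((g \<cdot> f) \<otimes> \<one> X)" if X: "X \<in> ob C" for X
    proof -
      have h: "\<one> X \<otimes> g \<in> hom C (X \<boxtimes> W) (X \<boxtimes> U)" "\<one> X \<otimes> f \<in> hom C (X \<boxtimes> V) (X \<boxtimes> W)"
        "f \<otimes> \<one> X \<in> hom C (V \<boxtimes> X) (W \<boxtimes> X)" "g \<otimes> \<one> X \<in> hom C (W \<boxtimes> X) (U \<boxtimes> X)"
        using X c(1) d(1) e(1) f' g' by (simp_all add: homs)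
      have o: "X \<boxtimes> V \<in> ob C" "V \<boxtimes> X \<in> ob C" "X \<boxtimes> W \<in> ob C" "W \<boxtimes> X \<in> ob C" "X \<boxtimes> U \<in> ob C" "U \<boxtimes> X \<in> ob C"
        using X c(1) d(1) e(1) by (simp_all add: obs)
      have "((\<one> X \<otimes> g) \<cdot> (\<one> X \<otimes> f)) \<cdot> c X = (\<one> X \<otimes> g) \<cdot> (d X \<cdot> (f \<otimes> \<one> X))"
        using cmp_assoc[OF o(2,1,3,5) c(4)[OF X] h(2,1)] f X P Q by simp
      also have "\<dots> = (e X \<cdot> (g \<otimes> \<one> X)) \<cdot> (f \<otimes> \<one> X)"
        using cmp_assoc[OF o(2,4,3,5) h(3) d(4)[OF X] h(1)] g X Q R by simp
      also have "\<dots> = e X \<cdot> ((g \<otimes> \<one> X) \<cdot> (f \<otimes> \<one> X))"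
        using cmp_assoc[OF o(2,4,6,5) h(3,4) e(4)[OF X]] .
      finally show ?thesis
        using lwhisk[OF c(1) d(1) e(1) X f' g'] rwhisk[OF c(1) d(1) e(1) X f' g'] by simp
    qed
    thus "cmp ?Z g f \<in> hom ?Z P R" using cmp_hom[OF c(1) d(1) e(1) f' g'] by (simp add: P R)
  next
    fix P Q f assume "P \<in> ob ?Z" "Q \<in> ob ?Z" and f: "f \<in> hom ?Z P Q"
    then obtain V c W d where P: "P = (V, c)" "V \<in> ob C" and Q: "Q = (W, d)" "W \<in> ob C"
      by (cases P; cases Q) (auto dest: D(1))
    have f': "f \<in> hom C V W" using f P Q by auto
    show "cmp ?Z (idm ?Z Q) f = f" "cmp ?Z f (idm ?Z P) = f"
      using f' P Q id_left[OF P(2) Q(2) f'] id_right[OF P(2) Q(2) f'] by auto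
    show "tenM ?Z (idm ?Z (unitO ?Z)) f = f" "tenM ?Z f (idm ?Z (unitO ?Z)) = f"
      using tenM_unit_left[OF P(2) Q(2) f'] tenM_unit_right[OF P(2) Q(2) f'] by auto
  next
    fix P Q R T f g k assume "P \<in> ob ?Z" "Q \<in> ob ?Z" "R \<in> ob ?Z" "T \<in> ob ?Z"
      "f \<in> hom ?Z P Q" "g \<in> hom ?Z Q R" "k \<in> hom ?Z R T"
    thus "cmp ?Z (cmp ?Z k g) f = cmp ?Z k (cmp ?Z g f)"
      by (cases P; cases Q; cases R; cases T) (auto dest!: D(1) intro: cmp_assoc)
  next
    show "unitO ?Z \<in> ob ?Z" using half_braiding_unit by simp
  next
    fix P Q assume "P \<in> ob ?Z" "Q \<in> ob ?Z"
    thus "tenO ?Z P Q \<in> ob ?Z" by (rule ten)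
    show "tenM ?Z (idm ?Z P) (idm ?Z Q) = idm ?Z (tenO ?Z P Q)"
      using \<open>P \<in> ob ?Z\<close> \<open>Q \<in> ob ?Z\<close> by (cases P; cases Q) (auto dest!: D(1) simp: ten_id)
  next
    fix P Q P' Q' f g assume "P \<in> ob ?Z" "Q \<in> ob ?Z" "P' \<in> ob ?Z" "Q' \<in> ob ?Z"
      and f: "f \<in> hom ?Z P Q" and g: "g \<in> hom ?Z P' Q'"
    then obtain V c V' c' W d W' d' where P: "P = (V, c)" and "left_half_braiding C V c"
      and Q: "Q = (V', c')" and "left_half_braiding C V' c'"
      and P': "P' = (W, d)" and "left_half_braiding C W d" and Q': "Q' = (W', d')" and "left_half_braiding C W' d'"
      by (cases P; cases Q; cases P'; cases Q') auto
    note c = D[OF this(2)] and c' = D[OF this(4)] and d = D[OF this(6)] and d' = D[OF this(8)]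
    note o = c(1) c'(1) d(1) d'(1)
    have f': "f \<in> hom C V V'" and g': "g \<in> hom C W W'" using f g P Q P' Q' by auto
    have "(\<one> X \<otimes> f \<otimes> g) \<cdot> ((c X \<otimes> \<one> W) \<cdot> (\<one> V \<otimes> d X)) = ((c' X \<otimes> \<one> W') \<cdot> (\<one> V' \<otimes> d' X)) \<cdot> ((f \<otimes> g) \<otimes> \<one> X)"
      if X: "X \<in> ob C" for X
    proof -
      have h: "\<one> X \<otimes> f \<in> hom C (X \<boxtimes> V) (X \<boxtimes> V')" "f \<otimes> \<one> X \<in> hom C (V \<boxtimes> X) (V' \<boxtimes> X)"
        "\<one> X \<otimes> g \<in> hom C (X \<boxtimes> W) (X \<boxtimes> W')" "g \<otimes> \<one> X \<in> hom C (W \<boxtimes> X) (W' \<boxtimes> X)"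
        using X o f' g' by (simp_all add: homs)
      have xo: "X \<boxtimes> V \<in> ob C" "V \<boxtimes> X \<in> ob C" "X \<boxtimes> V' \<in> ob C" "V' \<boxtimes> X \<in> ob C"
        "X \<boxtimes> W \<in> ob C" "W \<boxtimes> X \<in> ob C" "X \<boxtimes> W' \<in> ob C" "W' \<boxtimes> X \<in> ob C"
        using X o by (simp_all add: obs)
      have as: "(\<one> X \<otimes> f) \<otimes> g = \<one> X \<otimes> f \<otimes> g" "(f \<otimes> \<one> X) \<otimes> g = f \<otimes> \<one> X \<otimes> g" "(f \<otimes> g) \<otimes> \<one> X = f \<otimes> g \<otimes> \<one> X"
        using tenM_assoc[of X X V V' W W' "\<one> X" f g] tenM_assoc[of V V' X X W W' f "\<one> X" g]
          tenM_assoc[of V V' W W' X X f g "\<one> X"] X o f' g' by (simp_all add: id_hom)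
      have 1: "(\<one> X \<otimes> f \<otimes> g) \<cdot> (c X \<otimes> \<one> W) = (c' X \<otimes> \<one> W') \<cdot> (f \<otimes> \<one> X \<otimes> g)"
        using interchange[OF xo(2,1,3) o(3) o(3) o(4) c(4)[OF X] h(1) id_hom[OF o(3)] g']
          interchange[OF xo(2,4,3) o(3) o(4) o(4) h(2) c'(4)[OF X] g' id_hom[OF o(4)]] f X P Q
          id_left[OF o(3,4) g'] id_right[OF o(3,4) g'] by (simp add: as)
      have 2: "(f \<otimes> \<one> X \<otimes> g) \<cdot> (\<one> V \<otimes> d X) = (\<one> V' \<otimes> d' X) \<cdot> (f \<otimes> g \<otimes> \<one> X)"
        using interchange[OF o(1) o(1) o(2) xo(6,5,7) id_hom[OF o(1)] f' d(4)[OF X] h(3)]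
          interchange[OF o(1) o(2) o(2) xo(6,8,7) f' id_hom[OF o(2)] h(4) d'(4)[OF X]] g X P' Q'
          id_left[OF o(1,2) f'] id_right[OF o(1,2) f'] by simp
      have t: "\<one> V \<otimes> d X \<in> hom C (V \<boxtimes> W \<boxtimes> X) (V \<boxtimes> X \<boxtimes> W)" "c X \<otimes> \<one> W \<in> hom C (V \<boxtimes> X \<boxtimes> W) (X \<boxtimes> V \<boxtimes> W)"
        "\<one> V' \<otimes> d' X \<in> hom C (V' \<boxtimes> W' \<boxtimes> X) (V' \<boxtimes> X \<boxtimes> W')" "c' X \<otimes> \<one> W' \<in> hom C (V' \<boxtimes> X \<boxtimes> W') (X \<boxtimes> V' \<boxtimes> W')"
        "\<one> X \<otimes> f \<otimes> g \<in> hom C (X \<boxtimes> V \<boxtimes> W) (X \<boxtimes> V' \<boxtimes> W')" "f \<otimes> \<one> X \<otimes> g \<in> hom C (V \<boxtimes> X \<boxtimes> W) (V' \<boxtimes> X \<boxtimes> W')"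
        "f \<otimes> g \<otimes> \<one> X \<in> hom C (V \<boxtimes> W \<boxtimes> X) (V' \<boxtimes> W' \<boxtimes> X)"
        using ten_hom[OF o(1,1) xo(6,5) id_hom[OF o(1)] d(4)[OF X]] ten_hom[OF xo(2,1) o(3,3) c(4)[OF X] id_hom[OF o(3)]]
          ten_hom[OF o(2,2) xo(8,7) id_hom[OF o(2)] d'(4)[OF X]] ten_hom[OF xo(4,3) o(4,4) c'(4)[OF X] id_hom[OF o(4)]]
          ten_hom[OF xo(1,3) o(3,4) h(1) g'] ten_hom[OF xo(2,4) o(3,4) h(2) g'] ten_hom[OF o(1,2) xo(6,8) f' h(4)] X o
        by (simp_all add: tenO_assoc as)
      have oo: "V \<boxtimes> W \<boxtimes> X \<in> ob C" "V \<boxtimes> X \<boxtimes> W \<in> ob C" "X \<boxtimes> V \<boxtimes> W \<in> ob C"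
        "V' \<boxtimes> W' \<boxtimes> X \<in> ob C" "V' \<boxtimes> X \<boxtimes> W' \<in> ob C" "X \<boxtimes> V' \<boxtimes> W' \<in> ob C"
        using X o by (simp_all add: obs)
      have "(\<one> X \<otimes> f \<otimes> g) \<cdot> ((c X \<otimes> \<one> W) \<cdot> (\<one> V \<otimes> d X)) = (c' X \<otimes> \<one> W') \<cdot> ((f \<otimes> \<one> X \<otimes> g) \<cdot> (\<one> V \<otimes> d X))"
        using cmp_assoc[OF oo(1,2,3,6) t(1,2,5)] cmp_assoc[OF oo(1,2,5,6) t(1,6,4)] 1 by simp
      also have "\<dots> = ((c' X \<otimes> \<one> W') \<cdot> (\<one> V' \<otimes> d' X)) \<cdot> (f \<otimes> g \<otimes> \<one> X)"
        using cmp_assoc[OF oo(1,4,5,6) t(7,3,4)] 2 by simp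
      finally show ?thesis by (simp add: as)
    qed
    thus "tenM ?Z f g \<in> hom ?Z (tenO ?Z P P') (tenO ?Z Q Q')"
      using ten_hom[OF o f' g'] by (simp add: P Q P' Q')
  next
    fix P Q R P' Q' R' f g f' g'
    assume "P \<in> ob ?Z" "Q \<in> ob ?Z" "R \<in> ob ?Z" "P' \<in> ob ?Z" "Q' \<in> ob ?Z" "R' \<in> ob ?Z"
      "f \<in> hom ?Z P Q" "g \<in> hom ?Z Q R" "f' \<in> hom ?Z P' Q'" "g' \<in> hom ?Z Q' R'"
    thus "tenM ?Z (cmp ?Z g f) (cmp ?Z g' f') = cmp ?Z (tenM ?Z g g') (tenM ?Z f f')"
      by (cases P; cases Q; cases R; cases P'; cases Q'; cases R') (auto dest!: D(1) intro: interchange)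
  next
    fix P Q R assume "P \<in> ob ?Z" "Q \<in> ob ?Z" "R \<in> ob ?Z"
    then obtain V c W d U e where P: "P = (V, c)" and "left_half_braiding C V c" and Q: "Q = (W, d)"
      and "left_half_braiding C W d" and R: "R = (U, e)" and "left_half_braiding C U e"
      by (cases P; cases Q; cases R) auto
    note c = D[OF this(2)] and d = D[OF this(4)] and e = D[OF this(6)]
    note o = c(1) d(1) e(1)
    have "(((c X \<otimes> \<one> W) \<cdot> (\<one> V \<otimes> d X)) \<otimes> \<one> U) \<cdot> (\<one> (V \<boxtimes> W) \<otimes> e X) =
        (c X \<otimes> \<one> (W \<boxtimes> U)) \<cdot> (\<one> V \<otimes> ((d X \<otimes> \<one> U) \<cdot> (\<one> W \<otimes> e X)))" if X: "X \<in> ob C" for X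
    proof -
      have xo: "X \<boxtimes> V \<in> ob C" "V \<boxtimes> X \<in> ob C" "X \<boxtimes> W \<in> ob C" "W \<boxtimes> X \<in> ob C" "X \<boxtimes> U \<in> ob C" "U \<boxtimes> X \<in> ob C"
        "W \<boxtimes> U \<in> ob C" "V \<boxtimes> W \<in> ob C" "V \<boxtimes> W \<boxtimes> X \<in> ob C" "V \<boxtimes> X \<boxtimes> W \<in> ob C" "X \<boxtimes> V \<boxtimes> W \<in> ob C"
        "W \<boxtimes> U \<boxtimes> X \<in> ob C" "W \<boxtimes> X \<boxtimes> U \<in> ob C" "X \<boxtimes> W \<boxtimes> U \<in> ob C"
        "V \<boxtimes> W \<boxtimes> U \<boxtimes> X \<in> ob C" "V \<boxtimes> W \<boxtimes> X \<boxtimes> U \<in> ob C" "V \<boxtimes> X \<boxtimes> W \<boxtimes> U \<in> ob C" "X \<boxtimes> V \<boxtimes> W \<boxtimes> U \<in> ob C"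
        using X o by (simp_all add: obs)
      have t: "\<one> V \<otimes> d X \<in> hom C (V \<boxtimes> W \<boxtimes> X) (V \<boxtimes> X \<boxtimes> W)" "c X \<otimes> \<one> W \<in> hom C (V \<boxtimes> X \<boxtimes> W) (X \<boxtimes> V \<boxtimes> W)"
        "\<one> W \<otimes> e X \<in> hom C (W \<boxtimes> U \<boxtimes> X) (W \<boxtimes> X \<boxtimes> U)" "d X \<otimes> \<one> U \<in> hom C (W \<boxtimes> X \<boxtimes> U) (X \<boxtimes> W \<boxtimes> U)"
        using ten_hom[OF o(1,1) xo(4,3) id_hom[OF o(1)] d(4)[OF X]] ten_hom[OF xo(2,1) o(2,2) c(4)[OF X] id_hom[OF o(2)]]
          ten_hom[OF o(2,2) xo(6,5) id_hom[OF o(2)] e(4)[OF X]] ten_hom[OF xo(4,3) o(3,3) d(4)[OF X] id_hom[OF o(3)]] X o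
        by (simp_all add: tenO_assoc)
      have 1: "((c X \<otimes> \<one> W) \<cdot> (\<one> V \<otimes> d X)) \<otimes> \<one> U = (c X \<otimes> \<one> (W \<boxtimes> U)) \<cdot> (\<one> V \<otimes> d X \<otimes> \<one> U)"
        using rwhisk[OF xo(9,10,11) o(3) t(1,2)] tenM_assoc[OF xo(2,1) o(2,2,3,3) c(4)[OF X] id_hom[OF o(2)] id_hom[OF o(3)]]
          tenM_assoc[OF o(1,1) xo(4,3) o(3,3) id_hom[OF o(1)] d(4)[OF X] id_hom[OF o(3)]] o by (simp add: ten_id)
      have 2: "\<one> V \<otimes> ((d X \<otimes> \<one> U) \<cdot> (\<one> W \<otimes> e X)) = (\<one> V \<otimes> d X \<otimes> \<one> U) \<cdot> (\<one> (V \<boxtimes> W) \<otimes> e X)"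
        using lwhisk[OF xo(12,13,14) o(1) t(3,4)]
          tenM_assoc[OF o(1,1,2,2) xo(6,5) id_hom[OF o(1)] id_hom[OF o(2)] e(4)[OF X]] o by (simp add: ten_id)
      have t': "\<one> (V \<boxtimes> W) \<otimes> e X \<in> hom C (V \<boxtimes> W \<boxtimes> U \<boxtimes> X) (V \<boxtimes> W \<boxtimes> X \<boxtimes> U)"
        "\<one> V \<otimes> d X \<otimes> \<one> U \<in> hom C (V \<boxtimes> W \<boxtimes> X \<boxtimes> U) (V \<boxtimes> X \<boxtimes> W \<boxtimes> U)"
        "c X \<otimes> \<one> (W \<boxtimes> U) \<in> hom C (V \<boxtimes> X \<boxtimes> W \<boxtimes> U) (X \<boxtimes> V \<boxtimes> W \<boxtimes> U)"
        using ten_hom[OF xo(8,8) xo(6,5) id_hom[OF xo(8)] e(4)[OF X]] ten_hom[OF o(1,1) xo(13,14) id_hom[OF o(1)] t(4)]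
          ten_hom[OF xo(2,1) xo(7,7) c(4)[OF X] id_hom[OF xo(7)]] X o
        by (simp_all add: tenO_assoc obs)
      show ?thesis unfolding 1 2 by (rule cmp_assoc[OF xo(15,16,17,18) t'])
    qed
    hence "(\<lambda>X\<in>ob C. (((c X \<otimes> \<one> W) \<cdot> (\<one> V \<otimes> d X)) \<otimes> \<one> U) \<cdot> (\<one> (V \<boxtimes> W) \<otimes> e X)) =
      (\<lambda>X\<in>ob C. (c X \<otimes> \<one> (W \<boxtimes> U)) \<cdot> (\<one> V \<otimes> ((d X \<otimes> \<one> U) \<cdot> (\<one> W \<otimes> e X))))"
      by (intro restrict_ext) simp
    thus "tenO ?Z (tenO ?Z P Q) R = tenO ?Z P (tenO ?Z Q R)"
      using o by (simp add: P Q R tenO_assoc cong: restrict_cong)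
    show "braid ?Z (tenO ?Z P Q) R = cmp ?Z (tenM ?Z (braid ?Z P R) (idm ?Z Q)) (tenM ?Z (idm ?Z P) (braid ?Z Q R))"
      using o by (simp add: P Q R)
    show "braid ?Z P (tenO ?Z Q R) = cmp ?Z (tenM ?Z (idm ?Z Q) (braid ?Z P R)) (tenM ?Z (braid ?Z P Q) (idm ?Z R))"
      using c(6)[OF o(2,3)] by (simp add: P Q R)
  next
    fix P Q P' Q' P'' Q'' f g k assume "P \<in> ob ?Z" "Q \<in> ob ?Z" "P' \<in> ob ?Z" "Q' \<in> ob ?Z" "P'' \<in> ob ?Z" "Q'' \<in> ob ?Z"
      "f \<in> hom ?Z P Q" "g \<in> hom ?Z P' Q'" "k \<in> hom ?Z P'' Q''"
    thus "tenM ?Z (tenM ?Z f g) k = tenM ?Z f (tenM ?Z g k)"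
      by (cases P; cases Q; cases P'; cases Q'; cases P''; cases Q'') (auto dest!: D(1) intro: tenM_assoc)
  next
    fix P Q assume pq: "P \<in> ob ?Z" "Q \<in> ob ?Z"
    then obtain V c W d where P: "P = (V, c)" and c: "left_half_braiding C V c" and Q: "Q = (W, d)"
      and d: "left_half_braiding C W d" by (cases P; cases Q) auto
    note c' = D[OF c] and d' = D[OF d]
    note o = c'(1) d'(1)
    have hom: "c W \<in> hom ?Z (tenO ?Z P Q) (tenO ?Z Q P)"
    proof -
      have "(\<one> X \<otimes> c W) \<cdot> ((c X \<otimes> \<one> W) \<cdot> (\<one> V \<otimes> d X)) = ((d X \<otimes> \<one> V) \<cdot> (\<one> W \<otimes> c X)) \<cdot> (c W \<otimes> \<one> X)" if X: "X \<in> ob C" for X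
      proof -
        have xo: "X \<boxtimes> V \<in> ob C" "V \<boxtimes> X \<in> ob C" "X \<boxtimes> W \<in> ob C" "W \<boxtimes> X \<in> ob C" "V \<boxtimes> W \<in> ob C" "W \<boxtimes> V \<in> ob C"
          "V \<boxtimes> W \<boxtimes> X \<in> ob C" "V \<boxtimes> X \<boxtimes> W \<in> ob C" "X \<boxtimes> V \<boxtimes> W \<in> ob C" "X \<boxtimes> W \<boxtimes> V \<in> ob C"
          "W \<boxtimes> V \<boxtimes> X \<in> ob C" "W \<boxtimes> X \<boxtimes> V \<in> ob C"
          using X o by (simp_all add: obs)
        have t: "\<one> V \<otimes> d X \<in> hom C (V \<boxtimes> W \<boxtimes> X) (V \<boxtimes> X \<boxtimes> W)" "c X \<otimes> \<one> W \<in> hom C (V \<boxtimes> X \<boxtimes> W) (X \<boxtimes> V \<boxtimes> W)"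
          "\<one> X \<otimes> c W \<in> hom C (X \<boxtimes> V \<boxtimes> W) (X \<boxtimes> W \<boxtimes> V)" "c W \<otimes> \<one> X \<in> hom C (V \<boxtimes> W \<boxtimes> X) (W \<boxtimes> V \<boxtimes> X)"
          "\<one> W \<otimes> c X \<in> hom C (W \<boxtimes> V \<boxtimes> X) (W \<boxtimes> X \<boxtimes> V)" "d X \<otimes> \<one> V \<in> hom C (W \<boxtimes> X \<boxtimes> V) (X \<boxtimes> W \<boxtimes> V)"
          using ten_hom[OF o(1,1) xo(4,3) id_hom[OF o(1)] d'(4)[OF X]] ten_hom[OF xo(2,1) o(2,2) c'(4)[OF X] id_hom[OF o(2)]]
            ten_hom[OF X X xo(5,6) id_hom[OF X] c'(4)[OF o(2)]] ten_hom[OF xo(5,6) X X c'(4)[OF o(2)] id_hom[OF X]]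
            ten_hom[OF o(2,2) xo(2,1) id_hom[OF o(2)] c'(4)[OF X]] ten_hom[OF xo(4,3) o(1,1) d'(4)[OF X] id_hom[OF o(1)]] X o
          by (simp_all add: tenO_assoc)
        have "(\<one> X \<otimes> c W) \<cdot> ((c X \<otimes> \<one> W) \<cdot> (\<one> V \<otimes> d X)) = c (X \<boxtimes> W) \<cdot> (\<one> V \<otimes> d X)"
          using cmp_assoc[OF xo(7,8,9,10) t(1,2,3)] c'(6)[OF X o(2)] by simp
        \<comment> \<open>Naturality of \<open>c\<close> at the morphism \<open>d X\<close> from
          \<open>W \<boxtimes> X\<close> to \<open>X \<boxtimes> W\<close>.\<close>
        also have "\<dots> = (d X \<otimes> \<one> V) \<cdot> ((\<one> W \<otimes> c X) \<cdot> (c W \<otimes> \<one> X))"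
          using c'(5)[OF xo(4,3) d'(4)[OF X]] c'(6)[OF o(2) X] by simp
        also have "\<dots> = ((d X \<otimes> \<one> V) \<cdot> (\<one> W \<otimes> c X)) \<cdot> (c W \<otimes> \<one> X)"
          using cmp_assoc[OF xo(7,11,12,10) t(4,5,6)] by simp
        finally show ?thesis .
      qed
      thus ?thesis using c'(4)[OF o(2)] by (simp add: P Q)
    qed
    obtain g where g: "inverse_pair C (V \<boxtimes> W) (W \<boxtimes> V) (c W) g" using c'(3)[OF o(2)] by (auto simp: iso_mor_def)
    have gh: "g \<in> hom ?Z (tenO ?Z Q P) (tenO ?Z P Q)"
      using left_center_inv[OF half_braiding_tensor[OF c d] half_braiding_tensor[OF d c] _ g] hom by (simp add: P Q)
    show "iso_mor ?Z (tenO ?Z P Q) (tenO ?Z Q P) (braid ?Z P Q)"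
      unfolding iso_mor_def inverse_pair_def using hom gh g by (auto simp: P Q inverse_pair_def)
  next
    fix P Q P' Q' f g assume "P \<in> ob ?Z" "Q \<in> ob ?Z" "P' \<in> ob ?Z" "Q' \<in> ob ?Z"
      and f: "f \<in> hom ?Z P Q" and g: "g \<in> hom ?Z P' Q'"
    then obtain V c V' c' W d W' d' where P: "P = (V, c)" and "left_half_braiding C V c"
      and Q: "Q = (V', c')" and "left_half_braiding C V' c'"
      and P': "P' = (W, d)" and "left_half_braiding C W d" and Q': "Q' = (W', d')" and "left_half_braiding C W' d'"
      by (cases P; cases Q; cases P'; cases Q') auto
    note c = D[OF this(2)] and c' = D[OF this(4)] and d = D[OF this(6)] and d' = D[OF this(8)]
    note o = c(1) c'(1) d(1) d'(1)
    have f': "f \<in> hom C V V'" and g': "g \<in> hom C W W'" using f g P Q P' Q' by auto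
    have xo: "V \<boxtimes> W \<in> ob C" "V \<boxtimes> W' \<in> ob C" "V' \<boxtimes> W' \<in> ob C" "W' \<boxtimes> V' \<in> ob C" "W' \<boxtimes> V \<in> ob C" "W \<boxtimes> V \<in> ob C"
      using o by (simp_all add: obs)
    have h: "\<one> V \<otimes> g \<in> hom C (V \<boxtimes> W) (V \<boxtimes> W')" "f \<otimes> \<one> W' \<in> hom C (V \<boxtimes> W') (V' \<boxtimes> W')"
      "\<one> W' \<otimes> f \<in> hom C (W' \<boxtimes> V) (W' \<boxtimes> V')" "g \<otimes> \<one> V \<in> hom C (W \<boxtimes> V) (W' \<boxtimes> V)"
      using o f' g' by (simp_all add: homs)
    have "c' W' \<cdot> (f \<otimes> g) = (c' W' \<cdot> (f \<otimes> \<one> W')) \<cdot> (\<one> V \<otimes> g)"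
      using slide1[OF o(1,2,3,4) f' g'] cmp_assoc[OF xo(1-4) h(1,2) c'(4)[OF o(4)]] by simp
    also have "\<dots> = (\<one> W' \<otimes> f) \<cdot> (c W' \<cdot> (\<one> V \<otimes> g))"
      using f o P Q cmp_assoc[OF xo(1,2,5,4) h(1) c(4)[OF o(4)] h(3)] by simp
    also have "\<dots> = (g \<otimes> f) \<cdot> c W"
      using c(5)[OF o(3,4) g'] cmp_assoc[OF xo(1,6,5,4) c(4)[OF o(3)] h(4,3)] slide2[OF o(3,4,1,2) g' f'] by simp
    finally show "cmp ?Z (braid ?Z Q Q') (tenM ?Z f g) = cmp ?Z (tenM ?Z g f) (braid ?Z P P')"
      by (simp add: P Q P' Q')
  qed
qed

end

section \<open>Strict embeddings of braided categories\<close>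

text \<open>Equality of hom-sets makes sense because hom-sets need not be disjoint: a morphism of
  modules is a morphism of \<open>C\<close>. Closure of \<open>A\<close> under unit and tensor
  product is included, so that axioms can be pulled back to an \<open>A\<close> which is not yet
  known to be a category.\<close>

definition strict_embedding :: "('a, 'm) bcat \<Rightarrow> ('b, 'm) bcat \<Rightarrow> ('a \<Rightarrow> 'b) \<Rightarrow> bool" where
  "strict_embedding A B F \<longleftrightarrow> inj_on F (ob A) \<and>
     (\<forall>X\<in>ob A. F X \<in> ob B \<and> idm A X = idm B (F X)) \<and>
     (\<forall>X\<in>ob A. \<forall>Y\<in>ob A. hom A X Y = hom B (F X) (F Y) \<and> tenO A X Y \<in> ob A \<and>
        F (tenO A X Y) = tenO B (F X) (F Y) \<and> braid A X Y = braid B (F X) (F Y)) \<and>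
     cmp A = cmp B \<and> tenM A = tenM B \<and> unitO A \<in> ob A \<and> F (unitO A) = unitO B"

lemma strict_embeddingD:
  assumes "strict_embedding A B F"
  shows "inj_on F (ob A)" "X \<in> ob A \<Longrightarrow> F X \<in> ob B" "X \<in> ob A \<Longrightarrow> idm A X = idm B (F X)"
    "X \<in> ob A \<Longrightarrow> Y \<in> ob A \<Longrightarrow> hom A X Y = hom B (F X) (F Y)"
    "X \<in> ob A \<Longrightarrow> Y \<in> ob A \<Longrightarrow> tenO A X Y \<in> ob A"
    "X \<in> ob A \<Longrightarrow> Y \<in> ob A \<Longrightarrow> F (tenO A X Y) = tenO B (F X) (F Y)"
    "X \<in> ob A \<Longrightarrow> Y \<in> ob A \<Longrightarrow> braid A X Y = braid B (F X) (F Y)"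
    "cmp A = cmp B" "tenM A = tenM B" "unitO A \<in> ob A" "F (unitO A) = unitO B"
  using assms unfolding strict_embedding_def by blast+

text \<open>Equations between morphisms of \<open>A\<close> are literally equations in
  \<open>B\<close>, and equations between objects follow from injectivity of \<open>F\<close>. In
  this way Yetter-Drinfel'd modules inherit all braided axioms from a center, and modules over the
  double inherit them from Yetter-Drinfel'd modules.\<close>

lemma strict_embedding_braided:
  assumes "braided_category B" "strict_embedding A B F"
  shows "braided_category A"
proof -
  interpret B: braided_category B by fact
  note D = strict_embeddingD[OF assms(2)]
  have eq: "X = Y" if "X \<in> ob A" "Y \<in> ob A" "F X = F Y" for X Y using D(1) that by (auto simp: inj_on_def)
  show ?thesis
  proof
    fix W X Y Z f g k assume "W \<in> ob A" "X \<in> ob A" "Y \<in> ob A" "Z \<in> ob A" "f \<in> hom A W X" "g \<in> hom A X Y" "k \<in> hom A Y Z"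
    thus "cmp A (cmp A k g) f = cmp A k (cmp A g f)"
      using B.cmp_assoc[of "F W" "F X" "F Y" "F Z" f g k] by (simp add: D)
  next
    fix X Y X' Y' X'' Y'' f g k assume "X \<in> ob A" "Y \<in> ob A" "X' \<in> ob A" "Y' \<in> ob A" "X'' \<in> ob A" "Y'' \<in> ob A"
      "f \<in> hom A X Y" "g \<in> hom A X' Y'" "k \<in> hom A X'' Y''"
    thus "tenM A (tenM A f g) k = tenM A f (tenM A g k)"
      using B.tenM_assoc[of "F X" "F Y" "F X'" "F Y'" "F X''" "F Y''" f g k] by (simp add: D)
  next
    fix X Y Z X' Y' Z' f g f' g' assume "X \<in> ob A" "Y \<in> ob A" "Z \<in> ob A" "X' \<in> ob A" "Y' \<in> ob A" "Z' \<in> ob A"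
      "f \<in> hom A X Y" "g \<in> hom A Y Z" "f' \<in> hom A X' Y'" "g' \<in> hom A Y' Z'"
    thus "tenM A (cmp A g f) (cmp A g' f') = cmp A (tenM A g g') (tenM A f f')"
      using B.interchange[of "F X" "F Y" "F Z" "F X'" "F Y'" "F Z'" f g f' g'] by (simp add: D)
  next
    fix X Y X' Y' f g assume "X \<in> ob A" "Y \<in> ob A" "X' \<in> ob A" "Y' \<in> ob A" "f \<in> hom A X Y" "g \<in> hom A X' Y'"
    thus "tenM A f g \<in> hom A (tenO A X X') (tenO A Y Y')"
      and "cmp A (braid A Y Y') (tenM A f g) = cmp A (tenM A g f) (braid A X X')"
      using B.ten_hom[of "F X" "F Y" "F X'" "F Y'" f g] B.braid_natural[of "F X" "F Y" "F X'" "F Y'" f g]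
      by (simp_all add: D)
  next
    fix X Y Z assume o: "X \<in> ob A" "Y \<in> ob A" "Z \<in> ob A"
    thus "tenO A (tenO A X Y) Z = tenO A X (tenO A Y Z)"
      by (intro eq) (simp_all add: D B.tenO_assoc)
    from o show "braid A (tenO A X Y) Z = cmp A (tenM A (braid A X Z) (idm A Y)) (tenM A (idm A X) (braid A Y Z))"
      "braid A X (tenO A Y Z) = cmp A (tenM A (idm A Y) (braid A X Z)) (tenM A (braid A X Y) (idm A Z))"
      by (simp_all add: D B.braid_ten_left B.braid_ten_right)
    fix f g assume "f \<in> hom A X Y" "g \<in> hom A Y Z"
    with o show "cmp A g f \<in> hom A X Z" using B.cmp_hom[of "F X" "F Y" "F Z" f g] by (simp add: D)
  next
    fix X Y f assume o: "X \<in> ob A" "Y \<in> ob A" and "f \<in> hom A X Y"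
    thus "cmp A (idm A Y) f = f" "cmp A f (idm A X) = f"
      "tenM A (idm A (unitO A)) f = f" "tenM A f (idm A (unitO A)) = f"
      using B.id_left[of "F X" "F Y" f] B.id_right[of "F X" "F Y" f]
        B.tenM_unit_left[of "F X" "F Y" f] B.tenM_unit_right[of "F X" "F Y" f] by (simp_all add: D)
  next
    fix X Y assume o: "X \<in> ob A" "Y \<in> ob A"
    thus "iso_mor A (tenO A X Y) (tenO A Y X) (braid A X Y)"
      using B.braid_iso[of "F X" "F Y"] by (auto simp: iso_mor_def inverse_pair_def D)
    from o show "tenO A X Y \<in> ob A" "tenM A (idm A X) (idm A Y) = idm A (tenO A X Y)"
      by (simp_all add: D B.ten_id)
  next
    show "unitO A \<in> ob A" by (rule D)
  next
    fix X assume o: "X \<in> ob A"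
    thus "idm A X \<in> hom A X X" by (simp add: D B.id_hom)
    from o show "tenO A (unitO A) X = X" "tenO A X (unitO A) = X"
      by (auto intro!: eq simp: D B.tenO_unit_left B.tenO_unit_right)
  qed
qed

lemma strict_embedding_functor:
  assumes "braided_category B" "strict_embedding A B F"
  shows "braided_monoidal_functor A B F (\<lambda>X Y f. f) (\<lambda>X Y. idm B (tenO B (F X) (F Y))) (idm B (unitO B))"
    and "fully_faithful A B F (\<lambda>X Y f. f)"
proof -
  interpret B: braided_category B by fact
  interpret A: braided_category A using strict_embedding_braided[OF assms] .
  note D = strict_embeddingD[OF assms(2)]
  have io: "iso_mor B X X (idm B X)" if "X \<in> ob B" for X
    using that B.iso_id by simp
  show "fully_faithful A B F (\<lambda>X Y f. f)" by (simp add: fully_faithful_def bij_betw_def D)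
  show "braided_monoidal_functor A B F (\<lambda>X Y f. f) (\<lambda>X Y. idm B (tenO B (F X) (F Y))) (idm B (unitO B))"
  proof
    fix X Y X' Y' f g assume o: "X \<in> ob A" "Y \<in> ob A" "X' \<in> ob A" "Y' \<in> ob A" "f \<in> hom A X Y" "g \<in> hom A X' Y'"
    hence "tenM B f g \<in> hom B (tenO B (F X) (F X')) (tenO B (F Y) (F Y'))" by (simp add: B.ten_hom D)
    from B.id_left[OF _ _ this] B.id_right[OF _ _ this] o
    show "cmp B (idm B (tenO B (F Y) (F Y'))) (tenM B f g) = cmp B (tenM A f g) (idm B (tenO B (F X) (F X')))"
      by (simp add: D B.ten_ob)
  next
    fix X Y assume o: "X \<in> ob A" "Y \<in> ob A"
    hence "braid B (F X) (F Y) \<in> hom B (tenO B (F X) (F Y)) (tenO B (F Y) (F X))"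
      using B.braid_iso[of "F X" "F Y"] by (simp add: iso_mor_def D)
    from B.id_left[OF _ _ this] B.id_right[OF _ _ this] o
    show "cmp B (braid A X Y) (idm B (tenO B (F X) (F Y))) = cmp B (idm B (tenO B (F Y) (F X))) (braid B (F X) (F Y))"
      by (simp add: D B.ten_ob)
  qed (simp_all add: D io B.ten_ob B.unit_ob B.ten_id B.tenO_assoc B.id_left[OF _ _ B.id_hom] B.id_hom B.tenO_unit_left B.tenO_unit_right)
qed

lemma strict_embedding_embeds:
  assumes "braided_category B" "strict_embedding A B F"
  shows "braided_embedding A B"
  unfolding braided_embedding_def
  using strict_embedding_functor[OF assms] strict_embeddingD(1)[OF assms(2)] by fast

lemma strict_embedding_iso:
  assumes "braided_category B" "strict_embedding A B F" "F ` ob A = ob B"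
  shows "braided_isomorphic A B"
proof -
  have "bij_betw F (ob A) (ob B)" using strict_embeddingD(1)[OF assms(2)] assms(3) by (simp add: bij_betw_def)
  thus ?thesis unfolding braided_isomorphic_def using strict_embedding_functor[OF assms(1,2)] by fast
qed

text \<open>Allows axioms and embeddings to be carried from Yetter-Drinfel'd modules to modules over
  the double, against the direction in which the comparison functor is defined.\<close>

lemma strict_embedding_inverse:
  assumes "strict_embedding A B F" "F ` ob A = ob B"
  shows "strict_embedding B A (inv_into (ob A) F)"
proof -
  note D = strict_embeddingD[OF assms(1)]
  let ?G = "inv_into (ob A) F"
  have G: "?G X \<in> ob A" "F (?G X) = X" if "X \<in> ob B" for X
    using that assms(2) by (auto simp: inv_into_into f_inv_into_f)
  have FG: "?G (F X) = X" if "X \<in> ob A" for X using that D(1) by simp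
  have t: "tenO B X Y = F (tenO A (?G X) (?G Y))" if "X \<in> ob B" "Y \<in> ob B" for X Y
    using that by (simp add: D G)
  show ?thesis
    unfolding strict_embedding_def
  proof (intro conjI ballI)
    show "inj_on ?G (ob B)" using assms(2) by (simp add: inj_on_inv_into)
    show "cmp B = cmp A" "tenM B = tenM A" using D(8,9) by simp_all
    show "unitO B \<in> ob B" "?G (unitO B) = unitO A" using D(2)[OF D(10)] FG[OF D(10)] D(11) by simp_all
    fix X assume X: "X \<in> ob B"
    show "?G X \<in> ob A" "idm B X = idm A (?G X)" using X by (simp_all add: G D(3))
    fix Y assume Y: "Y \<in> ob B"
    show "hom B X Y = hom A (?G X) (?G Y)" "braid B X Y = braid A (?G X) (?G Y)"
      using X Y by (simp_all add: G D(4,7))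
    have o: "tenO A (?G X) (?G Y) \<in> ob A" using X Y by (simp add: G D(5))
    show "tenO B X Y \<in> ob B" "?G (tenO B X Y) = tenO A (?G X) (?G Y)"
      unfolding t[OF X Y] using o by (simp_all add: D(2) FG)
  qed
qed

lemma strict_embedding_comp:
  "strict_embedding A B F \<Longrightarrow> strict_embedding B D G \<Longrightarrow> strict_embedding A D (G \<circ> F)"
  unfolding strict_embedding_def by (auto simp: inj_on_def)

text \<open>
  Reversing the tensor product exchanges left and right modules, comodules and centers.
\<close>

definition rev_cat :: "('o, 'm) bcat \<Rightarrow> ('o, 'm) bcat" where
  "rev_cat A = \<lparr>ob = ob A, hom = hom A, idm = idm A, cmp = cmp A, unitO = unitO A,
     tenO = (\<lambda>X Y. tenO A Y X), tenM = (\<lambda>f g. tenM A g f), braid = (\<lambda>X Y. braid A Y X)\<rparr>"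

lemma rev_cat_sel [simp]:
  "ob (rev_cat A) = ob A" "hom (rev_cat A) = hom A" "idm (rev_cat A) = idm A" "cmp (rev_cat A) = cmp A"
  "unitO (rev_cat A) = unitO A" "tenO (rev_cat A) X Y = tenO A Y X" "tenM (rev_cat A) f g = tenM A g f"
  "braid (rev_cat A) X Y = braid A Y X"
  by (simp_all add: rev_cat_def)

lemma rev_rev_cat [simp]: "rev_cat (rev_cat A) = A"
  by (simp add: rev_cat_def)

lemma strict_embedding_rev: "strict_embedding A B F \<Longrightarrow> strict_embedding (rev_cat A) (rev_cat B) F"
  unfolding strict_embedding_def by (auto simp: rev_cat_def)

text \<open>With exchanged indices the old braiding already has the right domain and codomain, and
  the two hexagons change places; no inverse is taken.\<close>

lemma rev_braided:
  assumes "braided_category C"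
  shows "braided_category (rev_cat C)"
proof -
  interpret braided_category C by fact
  show ?thesis
  proof
  fix X Y X' Y' X'' Y'' f g k
  assume "X \<in> ob (rev_cat C)" "Y \<in> ob (rev_cat C)" "X' \<in> ob (rev_cat C)" "Y' \<in> ob (rev_cat C)"
    "X'' \<in> ob (rev_cat C)" "Y'' \<in> ob (rev_cat C)" "f \<in> hom (rev_cat C) X Y" "g \<in> hom (rev_cat C) X' Y'" "k \<in> hom (rev_cat C) X'' Y''"
  thus "tenM (rev_cat C) (tenM (rev_cat C) f g) k = tenM (rev_cat C) f (tenM (rev_cat C) g k)"
    using tenM_assoc[of X'' Y'' X' Y' X Y k g f] by simp
next
  fix X Y X' Y' f g
  assume "X \<in> ob (rev_cat C)" "Y \<in> ob (rev_cat C)" "X' \<in> ob (rev_cat C)" "Y' \<in> ob (rev_cat C)"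
    "f \<in> hom (rev_cat C) X Y" "g \<in> hom (rev_cat C) X' Y'"
  thus "cmp (rev_cat C) (braid (rev_cat C) Y Y') (tenM (rev_cat C) f g) =
      cmp (rev_cat C) (tenM (rev_cat C) g f) (braid (rev_cat C) X X')"
    using braid_natural[of X' Y' X Y g f] by simp
next
  fix X Y assume "X \<in> ob (rev_cat C)" "Y \<in> ob (rev_cat C)"
  thus "iso_mor (rev_cat C) (tenO (rev_cat C) X Y) (tenO (rev_cat C) Y X) (braid (rev_cat C) X Y)"
    using braid_iso[of Y X] by (simp add: iso_mor_def inverse_pair_def)
qed (auto simp: id_hom unit_ob ten_ob ten_hom ten_id tenO_assoc id_left id_right cmp_assoc tenO_unit_left tenO_unit_right
      tenM_unit_left tenM_unit_right braid_ten_left braid_ten_right interchange intro: cmp_hom)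
qed

section \<open>Diagrams with transparent strands\<close>

text \<open>
  Wires carry an object and a label. \<open>Tw\<close> and \<open>Uw\<close> stand for transparent objects, \<open>Nw\<close> for arbitrary ones. The
  second transparent constructor keeps the strands of \<open>H\<^sup>*\<close> apart from those of \<open>H\<close> even if \<open>H\<^sup>* = H\<close> as objects.
\<close>

datatype 'o wire = Tw 'o nat | Uw 'o nat | Nw 'o nat

primrec wo :: "'o wire \<Rightarrow> 'o" where
  "wo (Tw X i) = X" | "wo (Uw X i) = X" | "wo (Nw X i) = X"

primrec nt :: "'o wire \<Rightarrow> bool" where
  "nt (Tw X i) = False" | "nt (Uw X i) = False" | "nt (Nw X i) = True"

type_synonym ('o, 'm) arrow = "'o wire list \<times> 'm \<times> 'o wire list"

context braided_category begin

definition dm :: "('o, 'm) arrow \<Rightarrow> 'o wire list" where "dm t = fst t"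
definition mo :: "('o, 'm) arrow \<Rightarrow> 'm" where "mo t = fst (snd t)"
definition cd :: "('o, 'm) arrow \<Rightarrow> 'o wire list" where "cd t = snd (snd t)"

lemma arrow_sel [simp]: "dm (us, f, vs) = us" "mo (us, f, vs) = f" "cd (us, f, vs) = vs"
  by (simp_all add: dm_def mo_def cd_def)

lemma arrow_eqI: "dm t = dm s \<Longrightarrow> mo t = mo s \<Longrightarrow> cd t = cd s \<Longrightarrow> t = s"
  by (cases t; cases s) simp

text \<open>The singleton case is separate so that lists of wires unfold to iterated tensor products
  without a trailing unit, which is how the objects are written in the definitions.\<close>

fun obj :: "'o wire list \<Rightarrow> 'o" where
  "obj [] = \<I>"
| "obj [a] = wo a"
| "obj (a # b # ws) = wo a \<boxtimes> obj (b # ws)"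

primrec wire :: "'o wire \<Rightarrow> bool" where
  "wire (Tw X i) \<longleftrightarrow> transparent C X"
| "wire (Uw X i) \<longleftrightarrow> transparent C X"
| "wire (Nw X i) \<longleftrightarrow> X \<in> ob C"

definition wires :: "'o wire list \<Rightarrow> bool" where
  "wires ws \<longleftrightarrow> (\<forall>a\<in>set ws. wire a)"

lemma wires_simps [simp]:
  "wires []" "wires (a # ws) \<longleftrightarrow> wire a \<and> wires ws" "wires (us @ vs) \<longleftrightarrow> wires us \<and> wires vs"
  by (auto simp: wires_def)

lemma wires_subset: "wires ws \<Longrightarrow> set vs \<subseteq> set ws \<Longrightarrow> wires vs"
  by (auto simp: wires_def)

lemma transparent_ob: "transparent C X \<Longrightarrow> X \<in> ob C"
  by (simp add: transparent_def)

lemma wo_ob [simp]: "wire a \<Longrightarrow> wo a \<in> ob C"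
  by (cases a) (auto simp: transparent_ob)

lemma obj_ob [simp]: "wires ws \<Longrightarrow> obj ws \<in> ob C"
  by (induction ws rule: obj.induct) (auto simp: unit_ob ten_ob)

lemma obj_Cons: "wires (a # ws) \<Longrightarrow> obj (a # ws) = wo a \<boxtimes> obj ws"
  by (cases ws) (auto simp: tenO_unit_right)

lemma obj_append: "wires us \<Longrightarrow> wires vs \<Longrightarrow> obj (us @ vs) = obj us \<boxtimes> obj vs"
  by (induction us) (auto simp: tenO_unit_left obj_Cons tenO_assoc)

definition ok :: "('o, 'm) arrow \<Rightarrow> bool" where
  "ok t \<longleftrightarrow> wires (dm t) \<and> wires (cd t) \<and> mo t \<in> hom C (obj (dm t)) (obj (cd t))"

definition cc :: "('o, 'm) arrow \<Rightarrow> ('o, 'm) arrow \<Rightarrow> ('o, 'm) arrow"  (infixr "\<circ>\<^sub>w" 65) where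
  "t \<circ>\<^sub>w s = (dm s, mo t \<cdot> mo s, cd t)"

definition tt :: "('o, 'm) arrow \<Rightarrow> ('o, 'm) arrow \<Rightarrow> ('o, 'm) arrow"  (infixr "\<otimes>\<^sub>w" 70) where
  "t \<otimes>\<^sub>w s = (dm t @ dm s, mo t \<otimes> mo s, cd t @ cd s)"

definition idw :: "'o wire list \<Rightarrow> ('o, 'm) arrow" where
  "idw us = (us, \<one> (obj us), us)"

definition br :: "'o wire list \<Rightarrow> 'o wire list \<Rightarrow> ('o, 'm) arrow" where
  "br us vs = (us @ vs, \<Phi> (obj us) (obj vs), vs @ us)"

lemma arrow_simps [simp]:
  "dm (t \<circ>\<^sub>w s) = dm s" "cd (t \<circ>\<^sub>w s) = cd t" "mo (t \<circ>\<^sub>w s) = mo t \<cdot> mo s"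
  "dm (t \<otimes>\<^sub>w s) = dm t @ dm s" "cd (t \<otimes>\<^sub>w s) = cd t @ cd s" "mo (t \<otimes>\<^sub>w s) = mo t \<otimes> mo s"
  "dm (idw us) = us" "cd (idw us) = us" "mo (idw us) = \<one> (obj us)"
  "dm (br us vs) = us @ vs" "cd (br us vs) = vs @ us" "mo (br us vs) = \<Phi> (obj us) (obj vs)"
  by (simp_all add: cc_def tt_def idw_def br_def)

lemma braid_hom: "X \<in> ob C \<Longrightarrow> Y \<in> ob C \<Longrightarrow> \<Phi> X Y \<in> hom C (X \<boxtimes> Y) (Y \<boxtimes> X)"
  using braid_iso by (auto simp: iso_mor_def)

lemma ok_hom: "ok t \<Longrightarrow> mo t \<in> hom C (obj (dm t)) (obj (cd t))"
  by (simp add: ok_def)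

lemma ok_idw [simp]: "ok (idw us) \<longleftrightarrow> wires us"
  by (auto simp: ok_def id_hom)

lemma ok_br [simp]: "wires us \<Longrightarrow> wires vs \<Longrightarrow> ok (br us vs)"
  by (auto simp: ok_def obj_append braid_hom)

lemma ok_cc [simp]: "ok t \<Longrightarrow> ok s \<Longrightarrow> dm t = cd s \<Longrightarrow> ok (t \<circ>\<^sub>w s)"
  unfolding ok_def by (auto intro: cmp_hom[of _ "obj (cd s)"])

lemma ok_tt [simp]: "ok t \<Longrightarrow> ok s \<Longrightarrow> ok (t \<otimes>\<^sub>w s)"
  unfolding ok_def by (auto simp: obj_append intro: ten_hom)

lemma ok_wires [simp]: "ok t \<Longrightarrow> wires (dm t)" "ok t \<Longrightarrow> wires (cd t)"
  by (simp_all add: ok_def)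

lemma cc_assoc: "ok t \<Longrightarrow> ok s \<Longrightarrow> ok r \<Longrightarrow> dm t = cd s \<Longrightarrow> dm s = cd r \<Longrightarrow>
    (t \<circ>\<^sub>w s) \<circ>\<^sub>w r = t \<circ>\<^sub>w s \<circ>\<^sub>w r"
  by (rule arrow_eqI; simp; rule cmp_assoc[of "obj (dm r)" "obj (cd r)" "obj (cd s)" "obj (cd t)"])
     (auto dest: ok_hom)

lemma cc_id_left [simp]: "ok t \<Longrightarrow> cd t = us \<Longrightarrow> idw us \<circ>\<^sub>w t = t"
  by (rule arrow_eqI; simp; rule id_left[of "obj (dm t)"]) (auto dest: ok_hom)

lemma cc_id_right [simp]: "ok t \<Longrightarrow> dm t = us \<Longrightarrow> t \<circ>\<^sub>w idw us = t"
  by (rule arrow_eqI; simp; rule id_right[of _ "obj (cd t)"]) (auto dest: ok_hom)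

lemma tt_assoc: "ok t \<Longrightarrow> ok s \<Longrightarrow> ok r \<Longrightarrow> (t \<otimes>\<^sub>w s) \<otimes>\<^sub>w r = t \<otimes>\<^sub>w s \<otimes>\<^sub>w r"
  by (rule arrow_eqI; simp; rule tenM_assoc) (auto dest: ok_hom intro: obj_ob)

lemma tt_id: "wires us \<Longrightarrow> wires vs \<Longrightarrow> idw us \<otimes>\<^sub>w idw vs = idw (us @ vs)"
  by (rule arrow_eqI) (simp_all add: obj_append ten_id)

lemma tt_id2: "wires us \<Longrightarrow> wires vs \<Longrightarrow> ok t \<Longrightarrow> idw us \<otimes>\<^sub>w idw vs \<otimes>\<^sub>w t = idw (us @ vs) \<otimes>\<^sub>w t"
  by (simp add: tt_id flip: tt_assoc)

lemma tt_nil [simp]: "ok t \<Longrightarrow> idw [] \<otimes>\<^sub>w t = t" "ok t \<Longrightarrow> t \<otimes>\<^sub>w idw [] = t"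
  by (rule arrow_eqI; simp; rule tenM_unit_left tenM_unit_right; auto dest: ok_hom)+

lemma inter: "ok t \<Longrightarrow> ok s \<Longrightarrow> ok t' \<Longrightarrow> ok s' \<Longrightarrow> dm t = cd s \<Longrightarrow> dm t' = cd s' \<Longrightarrow>
    (t \<otimes>\<^sub>w t') \<circ>\<^sub>w (s \<otimes>\<^sub>w s') = (t \<circ>\<^sub>w s) \<otimes>\<^sub>w (t' \<circ>\<^sub>w s')"
  by (rule arrow_eqI; simp; rule sym,
      rule interchange[of "obj (dm s)" "obj (cd s)" "obj (cd t)" "obj (dm s')" "obj (cd s')" "obj (cd t')"])
     (auto dest: ok_hom)

lemma br_nat: "ok s \<Longrightarrow> ok t \<Longrightarrow> us = cd s \<Longrightarrow> vs = cd t \<Longrightarrow>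
    br us vs \<circ>\<^sub>w (s \<otimes>\<^sub>w t) = (t \<otimes>\<^sub>w s) \<circ>\<^sub>w br (dm s) (dm t)"
  by (rule arrow_eqI; simp; rule braid_natural) (auto dest: ok_hom)

lemma br_left: "wires us \<Longrightarrow> wires vs \<Longrightarrow> wires ws \<Longrightarrow>
    br (us @ vs) ws = (br us ws \<otimes>\<^sub>w idw vs) \<circ>\<^sub>w (idw us \<otimes>\<^sub>w br vs ws)"
  by (rule arrow_eqI) (simp_all add: obj_append braid_ten_left)

lemma br_right: "wires us \<Longrightarrow> wires vs \<Longrightarrow> wires ws \<Longrightarrow>
    br us (vs @ ws) = (idw vs \<otimes>\<^sub>w br us ws) \<circ>\<^sub>w (br us vs \<otimes>\<^sub>w idw ws)"
  by (rule arrow_eqI) (simp_all add: obj_append braid_ten_right)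

lemma iso_idem:
  assumes X: "X \<in> ob C" and f: "iso_mor C X X f" and ff: "f \<cdot> f = f"
  shows "f = \<one> X"
proof -
  obtain g where g: "g \<in> hom C X X" "g \<cdot> f = \<one> X" and f: "f \<in> hom C X X"
    using f by (auto simp: iso_mor_def inverse_pair_def)
  have "f = (g \<cdot> f) \<cdot> f" using g f X by (simp add: id_left)
  also have "\<dots> = g \<cdot> f" using cmp_assoc[OF X X X X f f g(1)] ff by simp
  finally show ?thesis using g by simp
qed

text \<open>The hexagon at \<open>\<I> \<boxtimes> \<I>\<close> makes each of these braidings
  idempotent, and an idempotent isomorphism is an identity.\<close>

lemma braid_unit:
  assumes X: "X \<in> ob C"
  shows "\<Phi> \<I> X = \<one> X" "\<Phi> X \<I> = \<one> X"
proof -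
  have i: "iso_mor C X X (\<Phi> \<I> X)" "iso_mor C X X (\<Phi> X \<I>)"
    using braid_iso[OF unit_ob X] braid_iso[OF X unit_ob] X by (simp_all add: tenO_unit_left tenO_unit_right)
  hence h: "\<Phi> \<I> X \<in> hom C X X" "\<Phi> X \<I> \<in> hom C X X" by (auto simp: iso_mor_def)
  have "\<Phi> \<I> X \<cdot> \<Phi> \<I> X = \<Phi> \<I> X"
    using braid_ten_left[OF unit_ob unit_ob X] h X tenM_unit_left[OF X X] tenM_unit_right[OF X X]
    by (simp add: tenO_unit_left unit_ob)
  thus "\<Phi> \<I> X = \<one> X" using iso_idem[OF X i(1)] by simp
  have "\<Phi> X \<I> \<cdot> \<Phi> X \<I> = \<Phi> X \<I>"
    using braid_ten_right[OF X unit_ob unit_ob] h X tenM_unit_left[OF X X] tenM_unit_right[OF X X]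
    by (simp add: tenO_unit_left unit_ob)
  thus "\<Phi> X \<I> = \<one> X" using iso_idem[OF X i(2)] by simp
qed

lemma br_nil [simp]: "wires us \<Longrightarrow> br [] us = idw us" "wires us \<Longrightarrow> br us [] = idw us"
  by (rule arrow_eqI; simp add: braid_unit)+

text \<open>Transparency is defined through one order of the double crossing. Since braidings are
  invertible, the one-sided inverse is two-sided, which gives the other order.\<close>

lemma transparent_braid:
  assumes "transparent C X" "Y \<in> ob C"
  shows "\<Phi> Y X \<cdot> \<Phi> X Y = \<one> (X \<boxtimes> Y)" "\<Phi> X Y \<cdot> \<Phi> Y X = \<one> (Y \<boxtimes> X)"
proof -
  have X: "X \<in> ob C" using assms transparent_ob by simp
  show 1: "\<Phi> Y X \<cdot> \<Phi> X Y = \<one> (X \<boxtimes> Y)" using assms by (auto simp: transparent_def)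
  obtain g where g: "g \<in> hom C (Y \<boxtimes> X) (X \<boxtimes> Y)" "\<Phi> X Y \<cdot> g = \<one> (Y \<boxtimes> X)"
    using braid_iso[OF X assms(2)] by (auto simp: iso_mor_def inverse_pair_def)
  have o: "X \<boxtimes> Y \<in> ob C" "Y \<boxtimes> X \<in> ob C" using X assms by (auto simp: ten_ob)
  have h: "\<Phi> X Y \<in> hom C (X \<boxtimes> Y) (Y \<boxtimes> X)" "\<Phi> Y X \<in> hom C (Y \<boxtimes> X) (X \<boxtimes> Y)"
    using X assms by (auto simp: braid_hom)
  have "\<Phi> Y X = \<Phi> Y X \<cdot> (\<Phi> X Y \<cdot> g)" using g h o by (simp add: id_right)
  also have "\<dots> = g" using cmp_assoc[OF o(2,1,2,1) g(1) h] 1 g o by (simp add: id_left)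
  finally show "\<Phi> X Y \<cdot> \<Phi> Y X = \<one> (Y \<boxtimes> X)" using g by simp
qed

lemma br_sym: "wire a \<Longrightarrow> wire b \<Longrightarrow> \<not> (nt a \<and> nt b) \<Longrightarrow> br [b] [a] \<circ>\<^sub>w br [a] [b] = idw [a, b]"
  by (rule arrow_eqI) (cases a; cases b; auto simp: transparent_braid transparent_ob)+

text \<open>Two ways to pull \<open>a\<close> and \<open>b\<close> to the front when
  \<open>b\<close> stands before \<open>a\<close>. The wires cross exactly once on the left-hand
  side and once on the right-hand side, so naturality of the braiding suffices.\<close>

lemma swap_last:
  assumes "wires us" "wires vs" "wires zs" "wire a" "wire b"
  shows "(br [b] [a] \<otimes>\<^sub>w idw (us @ vs @ zs)) \<circ>\<^sub>w (idw [b] \<otimes>\<^sub>w br (us @ vs) [a] \<otimes>\<^sub>w idw zs) \<circ>\<^sub>w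
      (br us [b] \<otimes>\<^sub>w idw (vs @ a # zs)) =
    (idw [a] \<otimes>\<^sub>w br us [b] \<otimes>\<^sub>w idw (vs @ zs)) \<circ>\<^sub>w (br (us @ b # vs) [a] \<otimes>\<^sub>w idw zs)"
proof -
  have "br (b # us @ vs) [a] = (br [b] [a] \<otimes>\<^sub>w idw (us @ vs)) \<circ>\<^sub>w (idw [b] \<otimes>\<^sub>w br (us @ vs) [a])"
    using br_left[of "[b]" "us @ vs" "[a]"] assms by simp
  hence "(br [b] [a] \<otimes>\<^sub>w idw (us @ vs @ zs)) \<circ>\<^sub>w (idw [b] \<otimes>\<^sub>w br (us @ vs) [a] \<otimes>\<^sub>w idw zs) =
      br (b # us @ vs) [a] \<otimes>\<^sub>w idw zs"
    using assms inter[of "br [b] [a] \<otimes>\<^sub>w idw (us @ vs)" "idw [b] \<otimes>\<^sub>w br (us @ vs) [a]" "idw zs" "idw zs"]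
    by (simp add: tt_assoc tt_id)
  moreover have "br us [b] \<otimes>\<^sub>w idw (vs @ a # zs) = (br us [b] \<otimes>\<^sub>w idw vs \<otimes>\<^sub>w idw [a]) \<otimes>\<^sub>w idw zs"
    using assms by (simp add: tt_assoc tt_id)
  moreover have "br (b # us @ vs) [a] \<circ>\<^sub>w ((br us [b] \<otimes>\<^sub>w idw vs) \<otimes>\<^sub>w idw [a]) =
      (idw [a] \<otimes>\<^sub>w br us [b] \<otimes>\<^sub>w idw vs) \<circ>\<^sub>w br (us @ b # vs) [a]"
    using br_nat[of "br us [b] \<otimes>\<^sub>w idw vs" "idw [a]"] assms by simp
  moreover have "(idw [a] \<otimes>\<^sub>w br us [b] \<otimes>\<^sub>w idw vs) \<otimes>\<^sub>w idw zs = idw [a] \<otimes>\<^sub>w br us [b] \<otimes>\<^sub>w idw (vs @ zs)"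
    using assms by (simp add: tt_assoc tt_id)
  ultimately show ?thesis
    using assms inter[of "br (b # us @ vs) [a]" "br us [b] \<otimes>\<^sub>w idw vs \<otimes>\<^sub>w idw [a]" "idw zs" "idw zs"]
      inter[of "idw [a] \<otimes>\<^sub>w br us [b] \<otimes>\<^sub>w idw vs" "br (us @ b # vs) [a]" "idw zs" "idw zs"]
    by (simp add: tt_assoc cc_assoc[symmetric])
qed

text \<open>Here \<open>a\<close> stands before \<open>b\<close>. On the left-hand side the two
  cross twice, on the right-hand side not at all, so one of them has to be transparent.\<close>

lemma swap_over:
  assumes w: "wires us" "wires vs" "wires zs" "wire a" "wire b" and ab: "\<not> (nt a \<and> nt b)"
  shows "(br [b] [a] \<otimes>\<^sub>w idw (us @ vs @ zs)) \<circ>\<^sub>w (idw [b] \<otimes>\<^sub>w br us [a] \<otimes>\<^sub>w idw (vs @ zs)) \<circ>\<^sub>w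
      (br (us @ a # vs) [b] \<otimes>\<^sub>w idw zs) =
    (idw [a] \<otimes>\<^sub>w br (us @ vs) [b] \<otimes>\<^sub>w idw zs) \<circ>\<^sub>w (br us [a] \<otimes>\<^sub>w idw (vs @ b # zs))"
proof -
  have 1: "(br [b] [a] \<otimes>\<^sub>w idw us) \<circ>\<^sub>w (idw [b] \<otimes>\<^sub>w br us [a]) = br (b # us) [a]"
    using br_left[of "[b]" us "[a]"] w by simp
  have 2: "br (us @ a # vs) [b] = (br us [b] \<otimes>\<^sub>w idw (a # vs)) \<circ>\<^sub>w
      ((idw us \<otimes>\<^sub>w br [a] [b]) \<otimes>\<^sub>w idw vs) \<circ>\<^sub>w (idw (us @ [a]) \<otimes>\<^sub>w br vs [b])"
  proof -
    have "idw us \<otimes>\<^sub>w br (a # vs) [b] = ((idw us \<otimes>\<^sub>w br [a] [b]) \<otimes>\<^sub>w idw vs) \<circ>\<^sub>w (idw (us @ [a]) \<otimes>\<^sub>w br vs [b])"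
      using br_left[of "[a]" vs "[b]"] w inter[of "idw us" "idw us" "br [a] [b] \<otimes>\<^sub>w idw vs" "idw [a] \<otimes>\<^sub>w br vs [b]"]
      by (simp add: tt_assoc tt_id2)
    thus ?thesis using br_left[of us "a # vs" "[b]"] w by simp
  qed
  have 3: "br (b # us) [a] \<circ>\<^sub>w (br us [b] \<otimes>\<^sub>w idw [a]) =
      (idw [a] \<otimes>\<^sub>w br us [b]) \<circ>\<^sub>w (br us [a] \<otimes>\<^sub>w idw [b]) \<circ>\<^sub>w (idw us \<otimes>\<^sub>w br [b] [a])"
    using br_nat[of "br us [b]" "idw [a]"] br_left[of us "[b]" "[a]"] w by simp
  \<comment> \<open>The double crossing of \<open>a\<close> and \<open>b\<close> cancels by
    transparency of one of them.\<close>
  have 4: "(idw us \<otimes>\<^sub>w br [b] [a]) \<circ>\<^sub>w (idw us \<otimes>\<^sub>w br [a] [b]) = idw (us @ [a, b])"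
    using w ab by (simp add: inter br_sym tt_id)
  have 5: "br (b # us) [a] \<circ>\<^sub>w (br us [b] \<otimes>\<^sub>w idw [a]) \<circ>\<^sub>w (idw us \<otimes>\<^sub>w br [a] [b]) =
      (idw [a] \<otimes>\<^sub>w br us [b]) \<circ>\<^sub>w (br us [a] \<otimes>\<^sub>w idw [b])"
    using w 3 4 by (simp add: cc_assoc flip: cc_assoc[of "br (b # us) [a]"])
  have 6: "(br (b # us) [a] \<otimes>\<^sub>w idw vs) \<circ>\<^sub>w (br us [b] \<otimes>\<^sub>w idw (a # vs)) \<circ>\<^sub>w ((idw us \<otimes>\<^sub>w br [a] [b]) \<otimes>\<^sub>w idw vs)
     = ((idw [a] \<otimes>\<^sub>w br us [b]) \<otimes>\<^sub>w idw vs) \<circ>\<^sub>w (br us [a] \<otimes>\<^sub>w idw (b # vs))"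
  proof -
    have e: "br us [b] \<otimes>\<^sub>w idw (a # vs) = (br us [b] \<otimes>\<^sub>w idw [a]) \<otimes>\<^sub>w idw vs"
      "br us [a] \<otimes>\<^sub>w idw (b # vs) = (br us [a] \<otimes>\<^sub>w idw [b]) \<otimes>\<^sub>w idw vs"
      using w by (simp_all add: tt_assoc tt_id)
    show ?thesis unfolding e using w 5 by (simp add: inter)
  qed
  have 7: "(br us [a] \<otimes>\<^sub>w idw (b # vs)) \<circ>\<^sub>w (idw (us @ [a]) \<otimes>\<^sub>w br vs [b]) =
      (idw (a # us) \<otimes>\<^sub>w br vs [b]) \<circ>\<^sub>w (br us [a] \<otimes>\<^sub>w idw (vs @ [b]))"
    using w by (simp add: inter)
  have 8: "((idw [a] \<otimes>\<^sub>w br us [b]) \<otimes>\<^sub>w idw vs) \<circ>\<^sub>w (idw (a # us) \<otimes>\<^sub>w br vs [b]) = idw [a] \<otimes>\<^sub>w br (us @ vs) [b]"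
  proof -
    have e: "idw (a # us) \<otimes>\<^sub>w br vs [b] = idw [a] \<otimes>\<^sub>w idw us \<otimes>\<^sub>w br vs [b]"
      using w by (simp add: tt_id2)
    show ?thesis unfolding e br_left[OF w(1,2), of "[b]", simplified, OF w(5)] using w by (simp add: inter tt_assoc)
  qed
  have "(br (b # us) [a] \<otimes>\<^sub>w idw vs) \<circ>\<^sub>w br (us @ a # vs) [b] =
      ((br (b # us) [a] \<otimes>\<^sub>w idw vs) \<circ>\<^sub>w (br us [b] \<otimes>\<^sub>w idw (a # vs)) \<circ>\<^sub>w ((idw us \<otimes>\<^sub>w br [a] [b]) \<otimes>\<^sub>w idw vs)) \<circ>\<^sub>w
        (idw (us @ [a]) \<otimes>\<^sub>w br vs [b])"
    unfolding 2 using w by (simp add: cc_assoc)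
  also have "\<dots> = ((idw [a] \<otimes>\<^sub>w br us [b]) \<otimes>\<^sub>w idw vs) \<circ>\<^sub>w (idw (a # us) \<otimes>\<^sub>w br vs [b]) \<circ>\<^sub>w (br us [a] \<otimes>\<^sub>w idw (vs @ [b]))"
    unfolding 6 using w 7 by (simp add: cc_assoc)
  also have "\<dots> = (idw [a] \<otimes>\<^sub>w br (us @ vs) [b]) \<circ>\<^sub>w (br us [a] \<otimes>\<^sub>w idw (vs @ [b]))"
    using w by (simp add: 8 flip: cc_assoc)
  finally have 9: "(br (b # us) [a] \<otimes>\<^sub>w idw vs) \<circ>\<^sub>w br (us @ a # vs) [b] =
      (idw [a] \<otimes>\<^sub>w br (us @ vs) [b]) \<circ>\<^sub>w (br us [a] \<otimes>\<^sub>w idw (vs @ [b]))" .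
  have "(br [b] [a] \<otimes>\<^sub>w idw (us @ vs @ zs)) \<circ>\<^sub>w (idw [b] \<otimes>\<^sub>w br us [a] \<otimes>\<^sub>w idw (vs @ zs)) =
      (br (b # us) [a] \<otimes>\<^sub>w idw vs) \<otimes>\<^sub>w idw zs"
    using w inter[of "br [b] [a] \<otimes>\<^sub>w idw us" "idw [b] \<otimes>\<^sub>w br us [a]" "idw (vs @ zs)" "idw (vs @ zs)"]
    by (simp add: tt_assoc tt_id 1)
  moreover have "idw [a] \<otimes>\<^sub>w br (us @ vs) [b] \<otimes>\<^sub>w idw zs = (idw [a] \<otimes>\<^sub>w br (us @ vs) [b]) \<otimes>\<^sub>w idw zs"
    "br us [a] \<otimes>\<^sub>w idw (vs @ b # zs) = (br us [a] \<otimes>\<^sub>w idw (vs @ [b])) \<otimes>\<^sub>w idw zs"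
    using w by (simp_all add: tt_assoc tt_id)
  ultimately show ?thesis using w 9 by (simp add: inter cc_assoc[symmetric])
qed

section \<open>Reordering of wires and its coherence\<close>

definition mv :: "'o wire \<Rightarrow> 'o wire list \<Rightarrow> ('o, 'm) arrow" where
  "mv a ws = br (takeWhile (\<lambda>b. b \<noteq> a) ws) [a] \<otimes>\<^sub>w idw (tl (dropWhile (\<lambda>b. b \<noteq> a) ws))"

text \<open>
  The composite of braidings that reorders the wires \<open>ws\<close> into \<open>ts\<close>. It is well behaved only under \<open>adm ws ts\<close>,
  when the wires of the form \<open>Nw\<close> keep their order.
\<close>

primrec perm :: "'o wire list \<Rightarrow> 'o wire list \<Rightarrow> ('o, 'm) arrow" where
  "perm ws [] = idw []"
| "perm ws (a # ts) = (idw [a] \<otimes>\<^sub>w perm (remove1 a ws) ts) \<circ>\<^sub>w mv a ws"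

definition wf :: "'o wire list \<Rightarrow> bool" where
  "wf ws \<longleftrightarrow> wires ws \<and> distinct ws"

definition adm :: "'o wire list \<Rightarrow> 'o wire list \<Rightarrow> bool" where
  "adm ws ts \<longleftrightarrow> wf ws \<and> wf ts \<and> set ws = set ts \<and> filter nt ws = filter nt ts"

lemma mv_split: "a \<notin> set us \<Longrightarrow> mv a (us @ a # vs) = br us [a] \<otimes>\<^sub>w idw vs"
  by (simp add: mv_def takeWhile_append dropWhile_append)

lemma remove1_split: "a \<notin> set us \<Longrightarrow> remove1 a (us @ a # vs) = us @ vs"
  by (simp add: remove1_append)

lemma wf_simps [simp]: "wf []" "wf (a # ws) \<longleftrightarrow> wire a \<and> a \<notin> set ws \<and> wf ws"
  by (auto simp: wf_def)

lemma wf_append: "wf (us @ vs) \<longleftrightarrow> wf us \<and> wf vs \<and> set us \<inter> set vs = {}"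
  by (auto simp: wf_def)

lemma wf_wires [simp]: "wf ws \<Longrightarrow> wires ws"
  by (simp add: wf_def)

lemma perm_typ:
  "wf ws \<Longrightarrow> wf ts \<Longrightarrow> set ws = set ts \<Longrightarrow> ok (perm ws ts) \<and> dm (perm ws ts) = ws \<and> cd (perm ws ts) = ts"
proof (induction ts arbitrary: ws)
  case (Cons a ts)
  then obtain us vs where ws: "ws = us @ a # vs" by (metis list.set_intros(1) split_list)
  have a: "a \<notin> set us" "wf (us @ vs)" "set (us @ vs) = set ts"
    using Cons.prems by (auto simp: ws wf_append)
  show ?case using Cons.IH[OF a(2)] a Cons.prems
    by (simp add: ws mv_split remove1_split wf_append)
qed simp

lemma perm_ok [simp]:
  assumes "adm ws ts"
  shows "ok (perm ws ts)" "dm (perm ws ts) = ws" "cd (perm ws ts) = ts"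
  using perm_typ assms by (auto simp: adm_def)

lemma adm_sym: "adm ws ts \<Longrightarrow> adm ts ws"
  by (simp add: adm_def)

lemma adm_trans: "adm ws ts \<Longrightarrow> adm ts us \<Longrightarrow> adm ws us"
  by (simp add: adm_def)

lemma adm_refl [simp]: "adm ws ws \<longleftrightarrow> wf ws"
  by (simp add: adm_def)

lemma perm_id: "wf ws \<Longrightarrow> perm ws ws = idw ws"
proof (induction ws)
  case (Cons a ws)
  have "mv a (a # ws) = idw (a # ws)" using mv_split[of a "[]" ws] Cons.prems by (simp add: tt_id)
  thus ?case using Cons by (simp add: tt_id)
qed simp

text \<open>Pulling out \<open>a\<close> after a reordering agrees with pulling it out beforehand.
  In the induction on \<open>ts\<close> this reduces to comparing the two orders in which
  \<open>a\<close> and the head \<open>b\<close> of the target can be extracted from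
  \<open>ws\<close>.\<close>

lemma mv_perm:
  assumes "adm ws ts" "a \<in> set ws"
  shows "mv a ts \<circ>\<^sub>w perm ws ts = (idw [a] \<otimes>\<^sub>w perm (remove1 a ws) (remove1 a ts)) \<circ>\<^sub>w mv a ws"
  using assms
proof (induction ts arbitrary: ws)
  case Nil thus ?case by (simp add: adm_def)
next
  case (Cons b ts)
  have wf: "wf ws" "wf (b # ts)" and s: "set ws = insert b (set ts)" using Cons.prems by (auto simp: adm_def)
  have r: "adm (remove1 b ws) ts"
    using Cons.prems by (auto simp: adm_def wf_def filter_remove1 set_remove1_eq distinct_remove1
        intro: wires_subset[of ws])
  have ra: "a \<noteq> b \<Longrightarrow> adm (remove1 a (remove1 b ws)) (remove1 a ts)"
    using r by (auto simp: adm_def wf_def filter_remove1 set_remove1_eq distinct_remove1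
        intro: wires_subset[of ts] wires_subset[of "remove1 b ws"])
  have mvok: "ok (mv c zs) \<and> dm (mv c zs) = zs \<and> cd (mv c zs) = c # remove1 c zs" if "wf zs" "c \<in> set zs" for c zs
  proof -
    obtain us vs where "zs = us @ c # vs" "c \<notin> set us" using \<open>c \<in> set zs\<close> split_list_first by metis
    thus ?thesis using that by (simp add: mv_split remove1_split wf_append)
  qed
  show ?case
  proof (cases "a = b")
    case True
    have "mv b (b # ts) = idw (b # ts)" using mv_split[of b "[]" ts] wf by (simp add: tt_id)
    thus ?thesis using True r wf mvok[of ws b] s by simp
  next
    case False
    hence a: "a \<in> set ts" "a \<in> set (remove1 b ws)" using Cons.prems s wf by (auto simp: adm_def wf_def)
    let ?P = "perm (remove1 a (remove1 b ws)) (remove1 a ts)"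
    have wft: "wf ts" "wf (remove1 b ws)" using r by (auto simp: adm_def)
    obtain t1 t2 where t: "ts = t1 @ a # t2" "a \<notin> set t1" using a split_list_first by metis
    have m1: "mv a (b # ts) = (br [b] [a] \<otimes>\<^sub>w idw (t1 @ t2)) \<circ>\<^sub>w (idw [b] \<otimes>\<^sub>w mv a ts)"
    proof -
      have "mv a (b # ts) = br (b # t1) [a] \<otimes>\<^sub>w idw t2" using mv_split[of a "b # t1" t2] t False by simp
      thus ?thesis using br_left[of "[b]" t1 "[a]"] wf t
          inter[of "br [b] [a] \<otimes>\<^sub>w idw t1" "idw [b] \<otimes>\<^sub>w br t1 [a]" "idw t2" "idw t2"]
        by (simp add: mv_split wf_append tt_assoc tt_id)
    qed
    have IH: "mv a ts \<circ>\<^sub>w perm (remove1 b ws) ts = (idw [a] \<otimes>\<^sub>w ?P) \<circ>\<^sub>w mv a (remove1 b ws)"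
      using Cons.IH[OF r a(2)] .
    \<comment> \<open>The comparison for two wires: \<open>swap_over\<close> if \<open>a\<close>
      precedes \<open>b\<close> in \<open>ws\<close>, and \<open>swap_last\<close>
      otherwise.\<close>
    have Q: "(br [b] [a] \<otimes>\<^sub>w idw (remove1 a (remove1 b ws))) \<circ>\<^sub>w (idw [b] \<otimes>\<^sub>w mv a (remove1 b ws)) \<circ>\<^sub>w mv b ws =
      (idw [a] \<otimes>\<^sub>w mv b (remove1 a ws)) \<circ>\<^sub>w mv a ws"
    proof -
      have "b \<in> set ws" using s by simp
      then obtain u v where uv: "ws = u @ b # v" "b \<notin> set u" using split_list_first by metis
      show ?thesis
      proof (cases "a \<in> set u")
        case True
        then obtain u1 u2 where u: "u = u1 @ a # u2" "a \<notin> set u1" using split_list_first by metis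
        \<comment> \<open>In the target \<open>b\<close> comes first, in \<open>ws\<close> it comes
          after \<open>a\<close>. Admissibility keeps the order of the \<open>Nw\<close> wires, so
          they cannot both be of this kind.\<close>
        have "\<not> (nt a \<and> nt b)"
        proof
          assume n: "nt a \<and> nt b"
          have "filter nt ws = filter nt (b # ts)" using Cons.prems by (simp add: adm_def)
          hence "b # filter nt ts = filter nt u1 @ a # filter nt (u2 @ b # v)" using n by (simp add: uv u)
          thus False using False uv u by (cases "filter nt u1") (auto dest: arg_cong[where f=set] simp: filter_eq_Cons_iff)
        qed
        from swap_over[OF _ _ _ _ _ this, of u1 u2 v] show ?thesis
          using wf u uv False mv_split[of a u1 "u2 @ b # v"] mv_split[of b "u1 @ u2" v] mv_split[of b "u1 @ a # u2" v]
            mv_split[of a u1 "u2 @ v"]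
          by (simp add: wf_append remove1_append)
      next
        case F: False
        hence "a \<in> set v" using Cons.prems uv False by auto
        then obtain v1 v2 where v: "v = v1 @ a # v2" "a \<notin> set v1" using split_list_first by metis
        from swap_last[of u v1 v2 a b] show ?thesis
          using wf F v uv False mv_split[of a "u @ b # v1" v2] mv_split[of b u "v1 @ v2"] mv_split[of b u "v1 @ a # v2"]
            mv_split[of a "u @ v1" v2]
          by (simp add: wf_append remove1_append)
      qed
    qed
    have Pok: "ok ?P" "dm ?P = remove1 a (remove1 b ws)" "cd ?P = t1 @ t2"
      using ra[OF False] t by (auto simp: remove1_append)
    have cr: "remove1 b (remove1 a ws) = remove1 a (remove1 b ws)" by (simp add: remove1_commute)
    have oks: "ok (mv a ts)" "dm (mv a ts) = ts" "cd (mv a ts) = a # t1 @ t2"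
      "ok (mv a (remove1 b ws))" "dm (mv a (remove1 b ws)) = remove1 b ws"
      "cd (mv a (remove1 b ws)) = a # remove1 a (remove1 b ws)"
      "ok (mv b ws)" "dm (mv b ws) = ws" "cd (mv b ws) = b # remove1 b ws"
      "ok (mv a ws)" "dm (mv a ws) = ws" "cd (mv a ws) = a # remove1 a ws"
      using mvok[OF wft(1) a(1)] mvok[OF wft(2) a(2)] mvok[OF wf(1), of b] mvok[OF wf(1), of a] s Cons.prems t
      by (auto simp: remove1_append)
    have wra: "wf (remove1 a ws)" using wf by (auto simp: wf_def intro: wires_subset[of ws] set_remove1_subset)
    have oks2: "ok (mv b (remove1 a ws))" "dm (mv b (remove1 a ws)) = remove1 a ws"
      "cd (mv b (remove1 a ws)) = b # remove1 a (remove1 b ws)"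
      using mvok[OF wra, of b] s wf False by (auto simp: wf_def cr)
    have wab: "wire a" "wire b" using wf a t by (auto simp: wf_append)
    have wt: "wires t1" "wires t2" using wf t by (auto simp: wf_append)
    have wr: "wires (remove1 a (remove1 b ws))" using Pok(1,2) ok_wires(1) by metis
    have "mv a (b # ts) \<circ>\<^sub>w perm ws (b # ts) =
      (br [b] [a] \<otimes>\<^sub>w idw (t1 @ t2)) \<circ>\<^sub>w (idw [b] \<otimes>\<^sub>w (mv a ts \<circ>\<^sub>w perm (remove1 b ws) ts)) \<circ>\<^sub>w mv b ws"
    proof -
      have "idw [b] \<otimes>\<^sub>w (mv a ts \<circ>\<^sub>w perm (remove1 b ws) ts) =
          (idw [b] \<otimes>\<^sub>w mv a ts) \<circ>\<^sub>w (idw [b] \<otimes>\<^sub>w perm (remove1 b ws) ts)"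
        using oks r wab by (simp add: inter)
      thus ?thesis unfolding m1 using oks r wab wt t by (simp add: cc_assoc)
    qed
    also have "\<dots> = (br [b] [a] \<otimes>\<^sub>w idw (t1 @ t2)) \<circ>\<^sub>w ((idw [b, a] \<otimes>\<^sub>w ?P) \<circ>\<^sub>w (idw [b] \<otimes>\<^sub>w mv a (remove1 b ws))) \<circ>\<^sub>w mv b ws"
      unfolding IH using oks Pok wab inter[of "idw [b]" "idw [b]" "idw [a] \<otimes>\<^sub>w ?P" "mv a (remove1 b ws)"]
      by (simp add: tt_id2)
    also have "\<dots> = ((br [b] [a] \<otimes>\<^sub>w idw (t1 @ t2)) \<circ>\<^sub>w (idw [b, a] \<otimes>\<^sub>w ?P)) \<circ>\<^sub>w (idw [b] \<otimes>\<^sub>w mv a (remove1 b ws)) \<circ>\<^sub>w mv b ws"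
      using oks Pok wab wt by (simp add: cc_assoc)
    also have "(br [b] [a] \<otimes>\<^sub>w idw (t1 @ t2)) \<circ>\<^sub>w (idw [b, a] \<otimes>\<^sub>w ?P) =
        (idw [a, b] \<otimes>\<^sub>w ?P) \<circ>\<^sub>w (br [b] [a] \<otimes>\<^sub>w idw (remove1 a (remove1 b ws)))"
      using oks Pok wab wt wr by (simp add: inter)
    also have "\<dots> \<circ>\<^sub>w (idw [b] \<otimes>\<^sub>w mv a (remove1 b ws)) \<circ>\<^sub>w mv b ws = (idw [a, b] \<otimes>\<^sub>w ?P) \<circ>\<^sub>w (idw [a] \<otimes>\<^sub>w mv b (remove1 a ws)) \<circ>\<^sub>w mv a ws"
      using oks oks2 Pok wab wt wr Q by (simp add: cc_assoc)
    also have "\<dots> = (idw [a] \<otimes>\<^sub>w ((idw [b] \<otimes>\<^sub>w ?P) \<circ>\<^sub>w mv b (remove1 a ws))) \<circ>\<^sub>w mv a ws"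
      using oks oks2 Pok wab inter[of "idw [a]" "idw [a]" "idw [b] \<otimes>\<^sub>w ?P" "mv b (remove1 a ws)"]
      by (simp add: tt_id2 flip: cc_assoc)
    finally show ?thesis using False cr by simp
  qed
qed

text \<open>Coherence: a composite of reorderings depends only on the initial and the final order.
  Because of this, transparent crossings need not be recorded in a diagram.\<close>

lemma perm_comp:
  "adm ws ts \<Longrightarrow> wf us \<Longrightarrow> set us = set ts \<Longrightarrow> perm ts us \<circ>\<^sub>w perm ws ts = perm ws us"
proof (induction us arbitrary: ws ts)
  case Nil thus ?case by (simp add: adm_def)
next
  case (Cons a us)
  have a: "a \<in> set ws" "a \<in> set ts" using Cons.prems by (auto simp: adm_def)
  have r: "adm (remove1 a ws) (remove1 a ts)"
    using Cons.prems by (auto simp: adm_def wf_def filter_remove1 set_remove1_eq distinct_remove1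
        intro: wires_subset[of ws] wires_subset[of ts])
  have w: "wf ws" "wf ts" using Cons.prems by (auto simp: adm_def)
  have us: "wf us" "set us = set (remove1 a ts)" using Cons.prems w by (auto simp: wf_def)
  have mvok: "ok (mv a zs) \<and> dm (mv a zs) = zs \<and> cd (mv a zs) = a # remove1 a zs" if "wf zs" "a \<in> set zs" for zs
  proof -
    obtain us vs where "zs = us @ a # vs" "a \<notin> set us" using \<open>a \<in> set zs\<close> split_list_first by metis
    thus ?thesis using that by (simp add: mv_split remove1_split wf_append)
  qed
  have p: "ok (perm (remove1 a ts) us)" "dm (perm (remove1 a ts) us) = remove1 a ts"
    using perm_typ[OF _ us(1)] us(2) r by (auto simp: adm_def)
  note o = mvok[OF w(1) a(1)] mvok[OF w(2) a(2)]
  have wa: "wire a" using Cons.prems by simp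
  have "perm ts (a # us) \<circ>\<^sub>w perm ws ts = (idw [a] \<otimes>\<^sub>w perm (remove1 a ts) us) \<circ>\<^sub>w (mv a ts \<circ>\<^sub>w perm ws ts)"
    using o p wa Cons.prems by (simp add: cc_assoc)
  also have "\<dots> = ((idw [a] \<otimes>\<^sub>w perm (remove1 a ts) us) \<circ>\<^sub>w (idw [a] \<otimes>\<^sub>w perm (remove1 a ws) (remove1 a ts))) \<circ>\<^sub>w mv a ws"
    unfolding mv_perm[OF Cons.prems(1) a(1)] using o p wa r by (simp add: cc_assoc)
  also have "\<dots> = perm ws (a # us)"
    using Cons.IH[OF r us(1) us(2)] p r wa by (simp add: inter)
  finally show ?case .
qed

lemma mv_ok:
  assumes "wf zs" "c \<in> set zs"
  shows "ok (mv c zs)" "dm (mv c zs) = zs" "cd (mv c zs) = c # remove1 c zs"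
proof -
  obtain us vs where "zs = us @ c # vs" "c \<notin> set us" using \<open>c \<in> set zs\<close> split_list_first by metis
  thus "ok (mv c zs)" "dm (mv c zs) = zs" "cd (mv c zs) = c # remove1 c zs"
    using assms by (simp_all add: mv_split remove1_split wf_append)
qed

lemma perm_whisk_right:
  "wf ws \<Longrightarrow> wf ts \<Longrightarrow> set ws = set ts \<Longrightarrow> wf vs \<Longrightarrow> set ts \<inter> set vs = {} \<Longrightarrow>
    perm (ws @ vs) (ts @ vs) = perm ws ts \<otimes>\<^sub>w idw vs"
proof (induction ts arbitrary: ws)
  case Nil thus ?case by (simp add: perm_id)
next
  case (Cons a ts)
  have "a \<in> set ws" using Cons.prems by simp
  then obtain u v where ws: "ws = u @ a # v" "a \<notin> set u" using split_list_first by metis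
  have uv: "wf (u @ v)" "set (u @ v) = set ts" using Cons.prems ws by (auto simp: wf_append)
  note p = perm_typ[OF uv(1) _ uv(2)]
  have IH: "perm (u @ v @ vs) (ts @ vs) = perm (u @ v) ts \<otimes>\<^sub>w idw vs"
    using Cons.IH[OF uv(1) _ uv(2)] Cons.prems by simp
  have "perm (ws @ vs) ((a # ts) @ vs) =
      (idw [a] \<otimes>\<^sub>w perm (u @ v) ts \<otimes>\<^sub>w idw vs) \<circ>\<^sub>w (br u [a] \<otimes>\<^sub>w idw (v @ vs))"
    using ws mv_split[of a u "v @ vs"] by (simp add: remove1_append IH)
  also have "\<dots> = ((idw [a] \<otimes>\<^sub>w perm (u @ v) ts) \<otimes>\<^sub>w idw vs) \<circ>\<^sub>w ((br u [a] \<otimes>\<^sub>w idw v) \<otimes>\<^sub>w idw vs)"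
    using Cons.prems ws p by (simp add: tt_assoc tt_id wf_append)
  also have "\<dots> = perm ws (a # ts) \<otimes>\<^sub>w idw vs"
    using Cons.prems ws p by (simp add: inter mv_split remove1_split wf_append)
  finally show ?case .
qed

lemma perm_whisk_left:
  "wf (us @ ws) \<Longrightarrow> wf ts \<Longrightarrow> set ws = set ts \<Longrightarrow> perm (us @ ws) (us @ ts) = idw us \<otimes>\<^sub>w perm ws ts"
proof (induction us)
  case Nil thus ?case using perm_typ[of ws ts] by simp
next
  case (Cons a us)
  note p = perm_typ[of ws ts]
  have "mv a (a # us @ ws) = idw (a # us @ ws)"
    using mv_split[of a "[]" "us @ ws"] Cons.prems by (simp add: tt_id wf_append)
  moreover have "wires us" "wires ws" "wf (us @ ws)" "wf ws" using Cons.prems by (auto simp: wf_def)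
  ultimately show ?case using Cons p by (simp add: tt_id tt_id2)
qed

lemma perm_whisk:
  assumes "wf (us @ ws @ vs)" "wf ts" "set ws = set ts"
  shows "perm (us @ ws @ vs) (us @ ts @ vs) = idw us \<otimes>\<^sub>w perm ws ts \<otimes>\<^sub>w idw vs"
  using assms by (simp add: perm_whisk_left perm_whisk_right wf_append)

lemma perm_swap: "wf (us @ vs) \<Longrightarrow> perm (us @ vs) (vs @ us) = br us vs"
proof (induction vs)
  case Nil thus ?case by (simp add: perm_id)
next
  case (Cons a vs)
  have w: "wf us" "wf vs" "wire a" "a \<notin> set us" using Cons.prems by (auto simp: wf_append)
  have "wf (us @ vs)" using Cons.prems by (auto simp: wf_append)
  from Cons.IH[OF this] have "perm (us @ a # vs) ((a # vs) @ us) =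
      (idw [a] \<otimes>\<^sub>w br us vs) \<circ>\<^sub>w (br us [a] \<otimes>\<^sub>w idw vs)"
    using w by (simp add: mv_split remove1_split)
  also have "\<dots> = br us (a # vs)" using br_right[of us "[a]" vs] w by simp
  finally show ?case .
qed

section \<open>Boxes among other wires\<close>

definition box :: "'o wire list \<Rightarrow> ('o, 'm) arrow \<Rightarrow> 'o wire list \<Rightarrow> ('o, 'm) arrow" where
  "box us x vs = idw us \<otimes>\<^sub>w x \<otimes>\<^sub>w idw vs"

lemma box_simps [simp]:
  "dm (box us x vs) = us @ dm x @ vs" "cd (box us x vs) = us @ cd x @ vs"
  "ok x \<Longrightarrow> wires us \<Longrightarrow> wires vs \<Longrightarrow> ok (box us x vs)"
  by (simp_all add: box_def)

lemma box_box: "ok x \<Longrightarrow> wires us \<Longrightarrow> wires vs \<Longrightarrow> wires us' \<Longrightarrow> wires vs' \<Longrightarrow>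
    box us (box us' x vs') vs = box (us @ us') x (vs' @ vs)"
  by (simp add: box_def tt_assoc tt_id tt_id2)

lemma box_cc: "ok x \<Longrightarrow> ok y \<Longrightarrow> dm x = cd y \<Longrightarrow> wires us \<Longrightarrow> wires vs \<Longrightarrow>
    box us (x \<circ>\<^sub>w y) vs = box us x vs \<circ>\<^sub>w box us y vs"
  by (simp add: box_def inter)

lemma box_nil [simp]: "ok x \<Longrightarrow> box [] x [] = x"
  by (simp add: box_def)

lemma box_idw: "wires us \<Longrightarrow> wires ws \<Longrightarrow> wires vs \<Longrightarrow> box us (idw ws) vs = idw (us @ ws @ vs)"
  by (simp add: box_def tt_id)

lemma perm_box: "wf (us @ ws @ vs) \<Longrightarrow> wf ts \<Longrightarrow> set ws = set ts \<Longrightarrow>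
    perm (us @ ws @ vs) (us @ ts @ vs) = box us (perm ws ts) vs"
  by (simp add: box_def perm_whisk)

lemma split_unique: "a \<notin> set us \<Longrightarrow> a \<notin> set us' \<Longrightarrow> us @ a # vs = us' @ a # vs' \<Longrightarrow> us = us' \<and> vs = vs'"
proof (induction us arbitrary: us')
  case Nil thus ?case by (cases us') auto
next
  case (Cons b us) thus ?case by (cases us') auto
qed

lemma wf_remove1: "wf ws \<Longrightarrow> wf (remove1 a ws)"
  using set_remove1_subset[of a ws] by (auto simp: wf_def intro: wires_subset)

lemma adm_remove1: "adm ws ts \<Longrightarrow> adm (remove1 a ws) (remove1 a ts)"
  by (simp add: adm_def wf_remove1 filter_remove1) (simp add: wf_def)

text \<open>
  A box may neither create nor swallow all non-transparent strands: otherwise its position relative to the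
  other such strands would matter.
\<close>

definition okop :: "('o, 'm) arrow \<Rightarrow> bool" where
  "okop x \<longleftrightarrow> ok x \<and> (filter nt (dm x) = [] \<longleftrightarrow> filter nt (cd x) = [])"

lemma okop_ok [simp]: "okop x \<Longrightarrow> ok x"
  by (simp add: okop_def)

text \<open>If the box has an \<open>Nw\<close> input, then the first such input separates the
  remaining \<open>Nw\<close> wires into those before and those after the box, equally in both
  arrangements. If it has none, it has no \<open>Nw\<close> output either and cannot affect the
  order.\<close>

lemma adm_out:
  assumes "adm (us @ dm x @ vs) (us' @ dm x @ vs')" "wf (us @ cd x @ vs)" "okop x"
  shows "adm (us @ cd x @ vs) (us' @ cd x @ vs')"
proof -
  have w: "wf (us @ dm x @ vs)" "wf (us' @ dm x @ vs')"
    and s: "set (us @ dm x @ vs) = set (us' @ dm x @ vs')"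
    and f: "filter nt us @ filter nt (dm x) @ filter nt vs = filter nt us' @ filter nt (dm x) @ filter nt vs'"
    using assms(1) by (auto simp: adm_def)
  have d: "set (us @ dm x @ vs) - set (dm x) = set us \<union> set vs"
    "set (us' @ dm x @ vs') - set (dm x) = set us' \<union> set vs'"
    using w by (auto simp: wf_append)
  hence s': "set us \<union> set vs = set us' \<union> set vs'" using s by metis
  have w': "wf (us' @ cd x @ vs')" using assms(2) w s' by (auto simp: wf_append)
  have "filter nt us @ filter nt (cd x) @ filter nt vs = filter nt us' @ filter nt (cd x) @ filter nt vs'"
  proof (cases "filter nt (dm x) = []")
    case True thus ?thesis using f assms(3) by (simp add: okop_def)
  next
    case False
    then obtain c r where c: "filter nt (dm x) = c # r" by (cases "filter nt (dm x)") auto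
    hence "c \<in> set (filter nt (dm x))" by simp
    hence "c \<in> set (dm x)" by simp
    hence "c \<notin> set (filter nt us)" "c \<notin> set (filter nt us')" using w by (auto simp: wf_append)
    hence "filter nt us = filter nt us' \<and> r @ filter nt vs = r @ filter nt vs'"
      using f c by (intro split_unique[of c]) simp_all
    thus ?thesis by simp
  qed
  thus ?thesis using assms(2) w' s' by (auto simp: adm_def)
qed

text \<open>A box commutes with reorderings of the wires around it. The induction is on the wires to
  be placed in front of the box; in the base case the box itself travels to the front by naturality
  of the braiding.\<close>

lemma perm_nat:
  assumes "adm (us @ dm x @ vs) (us' @ dm x @ vs')" "wf (us @ cd x @ vs)" "okop x"
  shows "perm (us @ cd x @ vs) (us' @ cd x @ vs') \<circ>\<^sub>w box us x vs =
    box us' x vs' \<circ>\<^sub>w perm (us @ dm x @ vs) (us' @ dm x @ vs')"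
  using assms
proof (induction us' arbitrary: us vs)
  case Nil
  have w: "wf (us @ dm x @ vs)" "wf (us @ cd x @ vs)" "wf (dm x @ vs')" "wf (cd x @ vs')"
    using Nil.prems adm_out[OF Nil.prems] by (auto simp: adm_def)
  have s: "set us \<union> set vs = set vs'"
  proof -
    have "set (us @ dm x @ vs) - set (dm x) = set us \<union> set vs" "set (dm x @ vs') - set (dm x) = set vs'"
      using w by (auto simp: wf_append)
    moreover have "set (us @ dm x @ vs) = set (dm x @ vs')" using Nil.prems(1) by (auto simp: adm_def)
    ultimately show ?thesis by metis
  qed
  have x: "ok x" "ok (perm (us @ vs) vs')" "dm (perm (us @ vs) vs') = us @ vs" "cd (perm (us @ vs) vs') = vs'"
    using Nil.prems w s perm_typ[of "us @ vs" vs'] by (auto simp: wf_append Int_Un_distrib)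
  \<comment> \<open>The wires \<open>us\<close> have to pass the box. As the order of the
    \<open>Nw\<close> wires is kept, at most one of the two sides contains such wires.\<close>
  have "filter nt us = [] \<or> filter nt (dm x) = []"
  proof (rule ccontr)
    assume n: "\<not> ?thesis"
    then obtain c r where c: "filter nt us = c # r" by (cases "filter nt us") auto
    obtain e q where e: "filter nt (dm x) = e # q" using n by (cases "filter nt (dm x)") auto
    have "c \<in> set (filter nt us)" "e \<in> set (filter nt (dm x))" using c e by simp_all
    hence "c \<in> set us" "e \<in> set (dm x)" by simp_all
    moreover have "c = e" using Nil.prems(1) c e by (simp add: adm_def)
    ultimately show False using w by (auto simp: wf_append)
  qed
  hence ad: "filter nt us @ filter nt ys = filter nt ys @ filter nt us" if "ys = dm x \<or> ys = cd x" for ys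
    using that Nil.prems(3) by (auto simp: okop_def)
  have P: "perm (us @ ys @ vs) (ys @ vs') = (idw ys \<otimes>\<^sub>w perm (us @ vs) vs') \<circ>\<^sub>w (br us ys \<otimes>\<^sub>w idw vs)"
    if ys: "ys = dm x \<or> ys = cd x" for ys
  proof -
    have wy: "wf (us @ ys @ vs)" "wf (ys @ vs')" using ys w by auto
    have a: "adm (us @ ys @ vs) (ys @ us @ vs)" using wy ad[OF ys] by (auto simp: adm_def wf_append)
    have "perm (us @ ys @ vs) (ys @ vs') = perm (ys @ us @ vs) (ys @ vs') \<circ>\<^sub>w perm (us @ ys @ vs) (ys @ us @ vs)"
      using perm_comp[OF a wy(2)] s by auto
    also have "perm (us @ ys @ vs) (ys @ us @ vs) = br us ys \<otimes>\<^sub>w idw vs"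
      using perm_whisk_right[of "us @ ys" "ys @ us" vs] perm_swap[of us ys] wy by (auto simp: wf_append)
    also have "perm (ys @ us @ vs) (ys @ vs') = idw ys \<otimes>\<^sub>w perm (us @ vs) vs'"
      using perm_whisk_left[of ys "us @ vs" vs'] wy s by (auto simp: wf_append)
    finally show ?thesis .
  qed
  have wi: "wires us" "wires vs" "wires vs'" using w by (auto simp: wf_append)
  have "perm (us @ cd x @ vs) (cd x @ vs') \<circ>\<^sub>w box us x vs =
    (idw (cd x) \<otimes>\<^sub>w perm (us @ vs) vs') \<circ>\<^sub>w ((br us (cd x) \<circ>\<^sub>w (idw us \<otimes>\<^sub>w x)) \<otimes>\<^sub>w idw vs)"
  proof -
    have "box us x vs = (idw us \<otimes>\<^sub>w x) \<otimes>\<^sub>w idw vs" using x wi by (simp add: box_def tt_assoc)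
    thus ?thesis using x wi by (simp add: P cc_assoc inter)
  qed
  also have "br us (cd x) \<circ>\<^sub>w (idw us \<otimes>\<^sub>w x) = (x \<otimes>\<^sub>w idw us) \<circ>\<^sub>w br us (dm x)"
    using br_nat[of "idw us" x] x wi by simp
  also have "(idw (cd x) \<otimes>\<^sub>w perm (us @ vs) vs') \<circ>\<^sub>w (((x \<otimes>\<^sub>w idw us) \<circ>\<^sub>w br us (dm x)) \<otimes>\<^sub>w idw vs) =
      ((idw (cd x) \<otimes>\<^sub>w perm (us @ vs) vs') \<circ>\<^sub>w (x \<otimes>\<^sub>w idw (us @ vs))) \<circ>\<^sub>w (br us (dm x) \<otimes>\<^sub>w idw vs)"
  proof -
    have "((x \<otimes>\<^sub>w idw us) \<circ>\<^sub>w br us (dm x)) \<otimes>\<^sub>w idw vs = (x \<otimes>\<^sub>w idw (us @ vs)) \<circ>\<^sub>w (br us (dm x) \<otimes>\<^sub>w idw vs)"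
      using x wi inter[of "x \<otimes>\<^sub>w idw us" "br us (dm x)" "idw vs" "idw vs"] by (simp add: tt_assoc tt_id)
    thus ?thesis using x wi by (simp add: cc_assoc)
  qed
  also have "(idw (cd x) \<otimes>\<^sub>w perm (us @ vs) vs') \<circ>\<^sub>w (x \<otimes>\<^sub>w idw (us @ vs)) =
      (x \<otimes>\<^sub>w idw vs') \<circ>\<^sub>w (idw (dm x) \<otimes>\<^sub>w perm (us @ vs) vs')"
    using x wi by (simp add: inter)
  finally show ?case using x wi by (simp add: P box_def cc_assoc)
next
  case (Cons a us')
  have w: "wf (us @ dm x @ vs)" "wf (us @ cd x @ vs)" "wf (a # us' @ dm x @ vs')" "wf (a # us' @ cd x @ vs')"
    using Cons.prems adm_out[OF Cons.prems] by (auto simp: adm_def)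
  have "a \<in> set us \<union> set vs" using Cons.prems(1) w by (auto simp: adm_def)
  have x: "ok x" using Cons.prems by simp
  \<comment> \<open>The induction step for a wire \<open>a\<close> taken from either side;
    \<open>u\<close> and \<open>v\<close> are the neighbours of the box once \<open>a\<close> has
    been removed.\<close>
  have step: ?case
    if us: "remove1 a (us @ dm x @ vs) = u @ dm x @ v" "remove1 a (us @ cd x @ vs) = u @ cd x @ v"
      and m: "mv a (us @ cd x @ vs) \<circ>\<^sub>w box us x vs = (idw [a] \<otimes>\<^sub>w box u x v) \<circ>\<^sub>w mv a (us @ dm x @ vs)"
      and ain: "a \<in> set (us @ vs)" for u v
  proof -
    have wa: "wire a" using w by simp
    have c: "adm (u @ dm x @ v) (us' @ dm x @ vs')" "wf (u @ cd x @ v)"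
      using adm_remove1[OF Cons.prems(1), of a] wf_remove1[OF w(2), of a] by (simp_all add: us)
    note IH = Cons.IH[OF c Cons.prems(3)]
    note o = mv_ok[OF w(1), of a] mv_ok[OF w(2), of a]
    have ain': "a \<in> set (us @ dm x @ vs)" "a \<in> set (us @ cd x @ vs)" using ain by auto
    have wv: "wires u" "wires v" "wires us" "wires vs" "wires us'" "wires vs'" using c w by (auto simp: wf_append adm_def)
    have pc: "adm (u @ cd x @ v) (us' @ cd x @ vs')" using adm_out[OF c Cons.prems(3)] .
    have "perm (us @ cd x @ vs) ((a # us') @ cd x @ vs') \<circ>\<^sub>w box us x vs =
        (idw [a] \<otimes>\<^sub>w perm (u @ cd x @ v) (us' @ cd x @ vs')) \<circ>\<^sub>w mv a (us @ cd x @ vs) \<circ>\<^sub>w box us x vs"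
      using o ain' pc wa x wv by (simp add: us cc_assoc)
    also have "\<dots> = (idw [a] \<otimes>\<^sub>w (perm (u @ cd x @ v) (us' @ cd x @ vs') \<circ>\<^sub>w box u x v)) \<circ>\<^sub>w mv a (us @ dm x @ vs)"
      unfolding m using o ain' pc wa x us wv inter[of "idw [a]" "idw [a]"] by (simp flip: cc_assoc)
    also have "\<dots> = ((idw [a] \<otimes>\<^sub>w box us' x vs') \<circ>\<^sub>w (idw [a] \<otimes>\<^sub>w perm (u @ dm x @ v) (us' @ dm x @ vs'))) \<circ>\<^sub>w
        mv a (us @ dm x @ vs)"
      unfolding IH using c wa x wv by (simp add: inter)
    also have "idw [a] \<otimes>\<^sub>w box us' x vs' = box (a # us') x vs'"
      using wa x wv by (simp add: box_def tt_id2)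
    finally show ?thesis using o ain' c wa x us wv by (simp add: cc_assoc)
  qed
  show ?case
  proof (cases "a \<in> set us")
    case True
    then obtain u1 u2 where u: "us = u1 @ a # u2" "a \<notin> set u1" using split_list_first by metis
    have wi: "wires u1" "wires u2" "wires vs" "wire a" using w u by (auto simp: wf_append)
    have e: "box (u1 @ a # u2) x vs = idw (u1 @ [a]) \<otimes>\<^sub>w box u2 x vs"
      "box (u1 @ u2) x vs = idw u1 \<otimes>\<^sub>w box u2 x vs"
      using x wi by (simp_all add: box_def tt_id2)
    have "(br u1 [a] \<otimes>\<^sub>w idw (u2 @ cd x @ vs)) \<circ>\<^sub>w (idw (u1 @ [a]) \<otimes>\<^sub>w box u2 x vs) =
        (idw (a # u1) \<otimes>\<^sub>w box u2 x vs) \<circ>\<^sub>w (br u1 [a] \<otimes>\<^sub>w idw (u2 @ dm x @ vs))"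
      using x wi by (simp add: inter)
    also have "idw (a # u1) \<otimes>\<^sub>w box u2 x vs = idw [a] \<otimes>\<^sub>w box (u1 @ u2) x vs"
      unfolding e using x wi by (simp add: tt_id2)
    finally have "mv a (us @ cd x @ vs) \<circ>\<^sub>w box us x vs = (idw [a] \<otimes>\<^sub>w box (u1 @ u2) x vs) \<circ>\<^sub>w mv a (us @ dm x @ vs)"
      using u mv_split[of a u1 "u2 @ cd x @ vs"] mv_split[of a u1 "u2 @ dm x @ vs"] e by simp
    thus ?thesis using step[of "u1 @ u2" vs] u by (simp add: remove1_append)
  next
    case False
    hence "a \<in> set vs" using \<open>a \<in> set us \<union> set vs\<close> by simp
    then obtain v1 v2 where v: "vs = v1 @ a # v2" "a \<notin> set v1" using split_list_first by metis
    have na: "a \<notin> set (dm x)" "a \<notin> set (cd x)" using w v by (auto simp: wf_append)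
    have wi: "wires us" "wires v1" "wires v2" "wire a" using w v by (auto simp: wf_append)
    have e: "box us x (v1 @ a # v2) = (box us x v1 \<otimes>\<^sub>w idw [a]) \<otimes>\<^sub>w idw v2"
      "box us x (v1 @ v2) = box us x v1 \<otimes>\<^sub>w idw v2"
      using x wi by (simp_all add: box_def tt_id tt_assoc)
    have "br (us @ cd x @ v1) [a] \<circ>\<^sub>w (box us x v1 \<otimes>\<^sub>w idw [a]) = (idw [a] \<otimes>\<^sub>w box us x v1) \<circ>\<^sub>w br (us @ dm x @ v1) [a]"
      using br_nat[of "box us x v1" "idw [a]"] x wi by simp
    moreover have "idw [a] \<otimes>\<^sub>w box us x v1 \<otimes>\<^sub>w idw v2 = (idw [a] \<otimes>\<^sub>w box us x v1) \<otimes>\<^sub>w idw v2"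
      using x wi by (simp add: tt_assoc)
    ultimately have "(br (us @ cd x @ v1) [a] \<otimes>\<^sub>w idw v2) \<circ>\<^sub>w ((box us x v1 \<otimes>\<^sub>w idw [a]) \<otimes>\<^sub>w idw v2) =
        (idw [a] \<otimes>\<^sub>w box us x v1 \<otimes>\<^sub>w idw v2) \<circ>\<^sub>w (br (us @ dm x @ v1) [a] \<otimes>\<^sub>w idw v2)"
      using x wi by (simp add: inter)
    hence "mv a (us @ cd x @ vs) \<circ>\<^sub>w box us x vs = (idw [a] \<otimes>\<^sub>w box us x (v1 @ v2)) \<circ>\<^sub>w mv a (us @ dm x @ vs)"
      using v na False mv_split[of a "us @ cd x @ v1" v2] mv_split[of a "us @ dm x @ v1" v2] e by simp
    thus ?thesis using step[of us "v1 @ v2"] v na False by (simp add: remove1_append)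
  qed
qed

end

text \<open>With an empty pattern the list is returned unchanged. This is the right value for boxes
  without \<open>Nw\<close> inputs, since by \<open>okop\<close> they have no \<open>Nw\<close>
  outputs.\<close>

primrec repl :: "'a list \<Rightarrow> 'a list \<Rightarrow> 'a list \<Rightarrow> 'a list" where
  "repl i r [] = []"
| "repl i r (n # ns) = (if i = [] then n # ns
     else if take (length i) (n # ns) = i then r @ drop (length i) (n # ns) else n # repl i r ns)"

lemma repl_nil [simp]: "repl [] r ns = ns"
  by (cases ns) auto

lemma repl_split: "distinct (us @ i @ vs) \<Longrightarrow> i \<noteq> [] \<Longrightarrow> repl i r (us @ i @ vs) = us @ r @ vs"
proof (induction us)
  case Nil thus ?case by (cases i) auto
next
  case (Cons a us)
  have "take (length i) (a # us @ i @ vs) \<noteq> i"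
  proof
    assume "take (length i) (a # us @ i @ vs) = i"
    hence "a \<in> set i" using Cons.prems by (cases i) auto
    thus False using Cons.prems by auto
  qed
  thus ?case using Cons by auto
qed

text \<open>Disjoint nonempty blocks of one list cannot interlock. For two independent boxes this
  decides which of them lies further to the left.\<close>

lemma common_split:
  assumes e: "u @ x @ v = u' @ y @ v'" and d: "set x \<inter> set y = {}" and n: "x \<noteq> []" "y \<noteq> []"
  shows "(\<exists>w. u = u' @ y @ w \<and> v' = w @ x @ v) \<or> (\<exists>w. u' = u @ x @ w \<and> v = w @ y @ v')"
proof -
  from append_eq_append_conv2[THEN iffD1, OF e] obtain z where
    "u = u' @ z \<and> z @ x @ v = y @ v' \<or> u @ z = u' \<and> x @ v = z @ y @ v'" by blast
  thus ?thesis
  proof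
    assume z: "u = u' @ z \<and> z @ x @ v = y @ v'"
    hence "z @ (x @ v) = y @ v'" by simp
    from append_eq_append_conv2[THEN iffD1, OF this] obtain w where
      "z = y @ w \<and> w @ x @ v = v' \<or> z @ w = y \<and> x @ v = w @ v'" by blast
    thus ?thesis
    proof
      assume "z = y @ w \<and> w @ x @ v = v'" thus ?thesis using z by auto
    next
      assume w: "z @ w = y \<and> x @ v = w @ v'"
      hence "w = []" using d n(1) by (cases w; cases x) auto
      thus ?thesis using w z by auto
    qed
  next
    assume z: "u @ z = u' \<and> x @ v = z @ y @ v'"
    hence "x @ v = z @ (y @ v')" by simp
    from append_eq_append_conv2[THEN iffD1, OF this] obtain w where
      "x = z @ w \<and> w @ v = y @ v' \<or> x @ w = z \<and> v = w @ y @ v'" by blast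
    thus ?thesis
    proof
      assume w: "x = z @ w \<and> w @ v = y @ v'"
      hence "w = []" using d n(2) by (cases w; cases y) auto
      thus ?thesis using w z by auto
    next
      assume "x @ w = z \<and> v = w @ y @ v'" thus ?thesis using z by auto
    qed
  qed
qed

section \<open>Programs of boxes and the morphisms they denote\<close>

context braided_category begin

text \<open>
  \<open>den p t\<close>: connecting the boxes of \<open>p\<close>, in order of execution, along equal wires yields the morphism \<open>t\<close>.
\<close>

inductive den :: "('o, 'm) arrow list \<Rightarrow> ('o, 'm) arrow \<Rightarrow> bool" where
  den_nil: "adm ws ts \<Longrightarrow> den [] (perm ws ts)"
| den_cons: "okop x \<Longrightarrow> adm ws (us @ dm x @ vs) \<Longrightarrow> wf (us @ cd x @ vs) \<Longrightarrow> den p t \<Longrightarrow> dm t = us @ cd x @ vs \<Longrightarrow>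
    den (x # p) (t \<circ>\<^sub>w box us x vs \<circ>\<^sub>w perm ws (us @ dm x @ vs))"

inductive_cases den_nilE: "den [] t"
inductive_cases den_consE: "den (x # p) t"

lemma den_ok: "den p t \<Longrightarrow> ok t \<and> wf (dm t) \<and> wf (cd t)"
proof (induction rule: den.induct)
  case (den_cons x ws us vs p t)
  thus ?case by (auto simp: adm_def wf_append)
qed (auto simp: adm_def)

lemma den_okD [simp]: "den p t \<Longrightarrow> ok t" "den p t \<Longrightarrow> wf (dm t)" "den p t \<Longrightarrow> wf (cd t)"
  using den_ok by blast+

lemma wf_wires3: "wf (us @ vs @ ws) \<Longrightarrow> wires us \<and> wires vs \<and> wires ws"
  by (simp add: wf_append)

lemma den_pre: "den p t \<Longrightarrow> adm ws (dm t) \<Longrightarrow> den p (t \<circ>\<^sub>w perm ws (dm t))"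
proof (induction rule: den.cases)
  case (den_nil vs ts)
  hence a: "adm ws vs" "adm vs ts" by simp_all
  hence "perm vs ts \<circ>\<^sub>w perm ws vs = perm ws ts" by (intro perm_comp) (simp_all add: adm_def)
  thus ?case using den_nil a den.den_nil[OF adm_trans[OF a]] by simp
next
  case (den_cons x vs u v p s)
  let ?L = "u @ dm x @ v"
  have a: "adm ws ?L" using den_cons adm_trans[of ws vs] by simp
  have "wires u" "wires v" using wf_wires3[OF \<open>wf (u @ cd x @ v)\<close>] by blast+
  hence "(s \<circ>\<^sub>w box u x v \<circ>\<^sub>w perm vs ?L) \<circ>\<^sub>w perm ws vs = s \<circ>\<^sub>w box u x v \<circ>\<^sub>w (perm vs ?L \<circ>\<^sub>w perm ws vs)"
    using den_cons by (simp add: cc_assoc)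
  also have "perm vs ?L \<circ>\<^sub>w perm ws vs = perm ws ?L" using den_cons perm_comp[of ws vs ?L] by (auto simp: adm_def)
  finally show ?case using den_cons den.den_cons[OF \<open>okop x\<close> a] by simp
qed

text \<open>Soundness of the notation: a program and its ordered ends determine the morphism. Two
  placements of the first box differ by a reordering, which \<open>perm_nat\<close> moves past the
  box and \<open>den_pre\<close> absorbs into the rest.\<close>

lemma den_unique: "den p t \<Longrightarrow> den p s \<Longrightarrow> dm s = dm t \<Longrightarrow> cd s = cd t \<Longrightarrow> s = t"
proof (induction arbitrary: s rule: den.induct)
  case (den_nil ws ts)
  from den_nil(2) show ?case by (rule den_nilE) (use den_nil in simp)
next
  case (den_cons x ws us vs p t)
  from den_cons(7) obtain us' vs' r where r: "adm ws (us' @ dm x @ vs')" "wf (us' @ cd x @ vs')" "den p r"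
      "dm r = us' @ cd x @ vs'" and s: "s = r \<circ>\<^sub>w box us' x vs' \<circ>\<^sub>w perm ws (us' @ dm x @ vs')"
    by (rule den_consE) (use den_cons(1,2,8) in auto)
  let ?L = "us @ dm x @ vs" and ?L' = "us' @ dm x @ vs'"
  let ?\<pi> = "perm (us @ cd x @ vs) (us' @ cd x @ vs')"
  have a: "adm ?L ?L'" using den_cons(2) r(1) adm_sym adm_trans by blast
  have a': "adm (us @ cd x @ vs) (us' @ cd x @ vs')" using adm_out[OF a den_cons(3,1)] .
  have "den p (r \<circ>\<^sub>w ?\<pi>)" using den_pre[OF r(3)] a' r(4) by simp
  hence e: "r \<circ>\<^sub>w ?\<pi> = t" using den_cons.IH[of "r \<circ>\<^sub>w ?\<pi>"] den_cons r s a' by simp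
  have w: "wires us" "wires vs" "wires us'" "wires vs'" using wf_wires3[OF den_cons(3)] wf_wires3[OF r(2)] by auto
  have "t \<circ>\<^sub>w box us x vs \<circ>\<^sub>w perm ws ?L = r \<circ>\<^sub>w ((?\<pi> \<circ>\<^sub>w box us x vs) \<circ>\<^sub>w perm ws ?L)"
    unfolding e[symmetric] using den_cons r a' w by (simp add: cc_assoc)
  also have "?\<pi> \<circ>\<^sub>w box us x vs = box us' x vs' \<circ>\<^sub>w perm ?L ?L'"
    using perm_nat[OF a den_cons(3,1)] .
  also have "(box us' x vs' \<circ>\<^sub>w perm ?L ?L') \<circ>\<^sub>w perm ws ?L = box us' x vs' \<circ>\<^sub>w perm ws ?L'"
    using den_cons r a w perm_comp[OF den_cons(2), of ?L'] by (simp add: cc_assoc adm_def)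
  finally show ?case using s by simp
qed

lemma den_post: "den p t \<Longrightarrow> adm (cd t) ts \<Longrightarrow> den p (perm (cd t) ts \<circ>\<^sub>w t)"
proof (induction rule: den.induct)
  case (den_nil ws vs)
  hence a: "adm ws vs" "adm vs ts" by simp_all
  hence "perm vs ts \<circ>\<^sub>w perm ws vs = perm ws ts" by (intro perm_comp) (simp_all add: adm_def)
  thus ?case using a den.den_nil[OF adm_trans[OF a]] by simp
next
  case (den_cons x ws us vs p t)
  have "wires us" "wires vs" using den_cons(3) wf_wires3 by blast+
  thus ?case using den_cons den.den_cons[of x ws us vs p "perm (cd t) ts \<circ>\<^sub>w t"] by (simp add: cc_assoc)
qed

lemma den_cc: "den p t \<Longrightarrow> den q s \<Longrightarrow> dm s = cd t \<Longrightarrow> den (p @ q) (s \<circ>\<^sub>w t)"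
proof (induction rule: den.induct)
  case (den_nil ws vs)
  thus ?case using den_pre[of q s ws] by simp
next
  case (den_cons x ws us vs p t)
  have "wires us" "wires vs" using den_cons(3) wf_wires3 by blast+
  thus ?case using den_cons den.den_cons[of x ws us vs "p @ q" "s \<circ>\<^sub>w t"] by (simp add: cc_assoc)
qed

lemma den_idw: "wf ws \<Longrightarrow> den [] (idw ws)"
  using den_nil[of ws ws] by (simp add: perm_id)

lemma den_split:
  assumes "den (p @ q) t"
  obtains s r where "den p s" "den q r" "dm r = cd s" "t = r \<circ>\<^sub>w s"
  using assms
proof (induction p arbitrary: t thesis)
  case Nil
  show ?case by (rule Nil(1)[of "idw (dm t)" t]) (use Nil(2) den_idw in simp_all)
next
  case (Cons x p)
  from Cons(3) have "den (x # (p @ q)) t" by simp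
  then obtain ws us vs t' where t: "okop x" "adm ws (us @ dm x @ vs)" "wf (us @ cd x @ vs)" "den (p @ q) t'"
    "dm t' = us @ cd x @ vs" "t = t' \<circ>\<^sub>w box us x vs \<circ>\<^sub>w perm ws (us @ dm x @ vs)"
    by (rule den_consE) blast
  obtain s r where sr: "den p s" "den q r" "dm r = cd s" "t' = r \<circ>\<^sub>w s" using Cons(1)[OF _ t(4)] by blast
  have "wires us" "wires vs" using t(3) wf_wires3 by blast+
  thus ?case using t sr den_cons[OF t(1,2,3) sr(1)]
    by (intro Cons(2)[of "s \<circ>\<^sub>w box us x vs \<circ>\<^sub>w perm ws (us @ dm x @ vs)" r]) (simp_all add: cc_assoc)
qed

definition outs :: "('o, 'm) arrow list \<Rightarrow> 'o wire list" where
  "outs p = concat (map cd p)"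

lemma outs_simps [simp]: "outs [] = []" "outs (x # p) = cd x @ outs p" "outs (p @ q) = outs p @ outs q"
  by (simp_all add: outs_def)

text \<open>The outputs of \<open>p\<close> must avoid the labels of the surrounding wires, because
  equal labels would be read as a connection.\<close>

lemma den_box:
  "den p t \<Longrightarrow> wf (us @ dm t @ vs) \<Longrightarrow> set (outs p) \<inter> (set us \<union> set vs) = {} \<Longrightarrow> den p (box us t vs)"
proof (induction rule: den.induct)
  case (den_nil ws ts)
  have "adm (us @ ws @ vs) (us @ ts @ vs)" using den_nil by (auto simp: adm_def wf_append)
  thus ?case using den_nil perm_box[of us ws vs ts] den.den_nil[of "us @ ws @ vs" "us @ ts @ vs"]
    by (simp add: adm_def)
next
  case (den_cons x ws u v p t)
  let ?L = "u @ dm x @ v"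
  have w: "wf (us @ ws @ vs)" using den_cons by simp
  have uv: "wires u" "wires v" "wires us" "wires vs" using den_cons(3) w wf_wires3 by blast+
  have "set ?L = set ws" using den_cons(2) by (auto simp: adm_def)
  hence s: "set u \<union> set v \<subseteq> set ws" by auto
  have wf1: "wf ((us @ u) @ cd x @ (v @ vs))" using w den_cons(3,8) s by (auto simp: wf_append)
  have a: "adm (us @ ws @ vs) ((us @ u) @ dm x @ (v @ vs))"
    using w den_cons(2) \<open>set ?L = set ws\<close> by (auto simp: adm_def wf_append)
  have "perm (us @ ws @ vs) (us @ ?L @ vs) = box us (perm ws ?L) vs"
    using perm_box[of us ws vs ?L] w den_cons(2) \<open>set ?L = set ws\<close> by (auto simp: adm_def)
  moreover have "den p (box us t vs)" using den_cons wf1 by (auto simp: wf_append)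
  ultimately show ?case
    using den.den_cons[OF den_cons(1) a wf1, of p "box us t vs"] den_cons uv
    by (simp add: box_cc box_box)
qed

text \<open>With \<open>track\<close> it predicts the live wires, and the order of the
  \<open>Nw\<close> wires among them, from the initial ones alone. Side conditions of rewriting
  thereby become independent of how the boxes are laid out.\<close>

primrec cur :: "('o, 'm) arrow list \<Rightarrow> 'o wire set \<Rightarrow> 'o wire set" where
  "cur [] S = S"
| "cur (x # p) S = cur p (S - set (dm x) \<union> set (cd x))"

primrec track :: "('o, 'm) arrow list \<Rightarrow> 'o wire list \<Rightarrow> 'o wire list" where
  "track [] ns = ns"
| "track (x # p) ns = track p (repl (filter nt (dm x)) (filter nt (cd x)) ns)"

lemma den_state: "den p t \<Longrightarrow> set (cd t) = cur p (set (dm t)) \<and> filter nt (cd t) = track p (filter nt (dm t))"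
proof (induction rule: den.induct)
  case (den_nil ws ts) thus ?case by (simp add: adm_def)
next
  case (den_cons x ws us vs p t)
  let ?L = "us @ dm x @ vs"
  have L: "set ws = set ?L" "filter nt ws = filter nt ?L" "wf ?L" using den_cons(2) by (auto simp: adm_def)
  have 1: "set ?L - set (dm x) \<union> set (cd x) = set (us @ cd x @ vs)" using L(3) by (auto simp: wf_append)
  have 2: "repl (filter nt (dm x)) (filter nt (cd x)) (filter nt ws) = filter nt (us @ cd x @ vs)"
  proof (cases "filter nt (dm x) = []")
    case True thus ?thesis using L den_cons(1) by (simp add: okop_def)
  next
    case False
    have "distinct ?L" using L(3) by (simp only: wf_def)
    hence "distinct (filter nt ?L)" by (rule distinct_filter)
    hence "distinct (filter nt us @ filter nt (dm x) @ filter nt vs)" by (simp only: filter_append)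
    from repl_split[OF this False] show ?thesis unfolding L(2) by simp
  qed
  show ?case using den_cons 1 2 L by simp
qed

lemma den_adm: "den p t \<Longrightarrow> den p s \<Longrightarrow> adm (dm t) (dm s) \<Longrightarrow> adm (cd t) (cd s)"
  using den_state[of p t] den_state[of p s] by (simp add: adm_def)

text \<open>By uniqueness, a morphism that executes \<open>l\<close> is \<open>k\<close> next to
  identities, up to reorderings before and after. Then \<open>r\<close>, which also denotes
  \<open>k\<close>, can be executed instead.\<close>

lemma den_block:
  assumes "den l t" "den l k" "den r k" "adm (dm t) (a @ dm k @ b)"
    "set (outs l) \<inter> (set a \<union> set b) = {}" "set (outs r) \<inter> (set a \<union> set b) = {}"
  shows "den r t"
proof -
  have w: "wf (a @ dm k @ b)" using assms(4) by (simp add: adm_def)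
  note bl = den_box[OF assms(2) w assms(5)] and br = den_box[OF assms(3) w assms(6)]
  let ?p = "perm (dm t) (a @ dm k @ b)"
  have l: "den l (box a k b \<circ>\<^sub>w ?p)" and r: "den r (box a k b \<circ>\<^sub>w ?p)"
    using den_pre[OF bl] den_pre[OF br] assms(4) by simp_all
  have ad: "adm (cd (box a k b \<circ>\<^sub>w ?p)) (cd t)"
    by (rule den_adm[OF l assms(1)]) (use assms in simp)
  have "den l (perm (cd (box a k b \<circ>\<^sub>w ?p)) (cd t) \<circ>\<^sub>w box a k b \<circ>\<^sub>w ?p)"
    using den_post[OF l ad] .
  from den_unique[OF this assms(1)] have "t = perm (cd (box a k b \<circ>\<^sub>w ?p)) (cd t) \<circ>\<^sub>w box a k b \<circ>\<^sub>w ?p"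
    using ad assms(4) by simp
  thus ?thesis using den_post[OF r ad] by simp
qed

text \<open>The transparent wires outside \<open>zs\<close> are parked on the far left. Then
  \<open>zs\<close> can be made contiguous, as its \<open>Nw\<close> wires are already adjacent
  among all \<open>Nw\<close> wires.\<close>

lemma layout:
  assumes "wf ws" "distinct zs" "set zs \<subseteq> set ws" "filter nt ws = u @ filter nt zs @ v"
  shows "adm ws (filter (\<lambda>a. \<not> nt a \<and> a \<notin> set zs) ws @ u @ zs @ v)"
proof -
  have d: "distinct (u @ filter nt zs @ v)" using assms(1,4) by (metis distinct_filter wf_def)
  have s: "set u \<union> set (filter nt zs) \<union> set v = {a \<in> set ws. nt a}" using arg_cong[OF assms(4), of set] by auto
  have n: "filter nt u = u" "filter nt v = v" using s by (auto simp: filter_id_conv)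
  have "\<forall>a\<in>set u \<union> set v. a \<notin> set zs" using d s by fastforce
  hence "distinct (filter (\<lambda>a. \<not> nt a \<and> a \<notin> set zs) ws @ u @ zs @ v)"
    using assms(1,2) d s unfolding wf_def by fastforce
  moreover have "wires (filter (\<lambda>a. \<not> nt a \<and> a \<notin> set zs) ws @ u @ zs @ v)"
    by (rule wires_subset[OF wf_wires[OF assms(1)]]) (use s assms(3) in auto)
  ultimately have "wf (filter (\<lambda>a. \<not> nt a \<and> a \<notin> set zs) ws @ u @ zs @ v)"
    unfolding wf_def by blast
  moreover have "set ws = set (filter (\<lambda>a. \<not> nt a \<and> a \<notin> set zs) ws @ u @ zs @ v)"
    using s assms(3) by auto
  moreover have "filter nt ws = filter nt (filter (\<lambda>a. \<not> nt a \<and> a \<notin> set zs) ws @ u @ zs @ v)"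
    unfolding assms(4) by (auto simp: n filter_empty_conv)
  ultimately show ?thesis using assms(1) unfolding adm_def by blast
qed

definition rl :: "('o, 'm) arrow list \<Rightarrow> ('o, 'm) arrow list \<Rightarrow> 'o wire list \<Rightarrow> 'o wire list \<Rightarrow> bool" where
  "rl l r ins os \<longleftrightarrow> (\<exists>k. den l (ins, k, os) \<and> den r (ins, k, os))"

lemma rl_sym: "rl l r ins os \<Longrightarrow> rl r l ins os"
  by (auto simp: rl_def)

text \<open>The morphism is cut before and after \<open>l\<close>, and \<open>den_block\<close> is
  applied to the middle piece. The \<open>Nw\<close> inputs have to be adjacent, since otherwise the
  inputs could not be gathered without crossing foreign \<open>Nw\<close> strands.\<close>

lemma den_rewrite:
  assumes "den (p1 @ l @ p2) t" "rl l r ins os"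
    "track p1 (filter nt (dm t)) = u @ filter nt ins @ v" "set ins \<subseteq> cur p1 (set (dm t))"
    "(set (outs l) \<union> set (outs r)) \<inter> (cur p1 (set (dm t)) - set ins) = {}"
  shows "den (p1 @ r @ p2) t"
proof -
  obtain s q where s: "den p1 s" "den (l @ p2) q" "dm q = cd s" "t = q \<circ>\<^sub>w s" using den_split[OF assms(1)] by metis
  obtain x y where x: "den l x" "den p2 y" "dm y = cd x" "q = y \<circ>\<^sub>w x" using den_split[OF s(2)] by metis
  obtain k where k: "den l (ins, k, os)" "den r (ins, k, os)" using assms(2) by (auto simp: rl_def)
  have st: "set (dm x) = cur p1 (set (dm t))" "filter nt (dm x) = u @ filter nt ins @ v"
    using den_state[OF s(1)] s x assms by auto
  have ins: "distinct ins" using den_ok[OF k(1)] by (simp add: wf_def)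
  let ?a = "filter (\<lambda>a. \<not> nt a \<and> a \<notin> set ins) (dm x) @ u"
  have ad: "adm (dm x) (?a @ ins @ v)" using layout[of "dm x" "ins" u v] x st assms ins by simp
  have "set ?a \<union> set v \<subseteq> cur p1 (set (dm t)) - set ins"
  proof -
    have "set (?a @ ins @ v) = set (dm x)" "distinct (?a @ ins @ v)" using ad by (auto simp: adm_def wf_def)
    thus ?thesis using st by auto
  qed
  hence "den r x" using den_block[OF x(1) k, of ?a v] ad assms(5) by auto
  thus ?thesis using s x den_cc[OF den_cc[OF s(1), of r x] x(2)] by (simp add: cc_assoc)
qed

lemma layout2:
  assumes "wf ws" "distinct xs" "distinct ys" "set xs \<inter> set ys = {}" "set xs \<union> set ys \<subseteq> set ws"
    "filter nt ws = a @ filter nt xs @ b @ filter nt ys @ c"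
  obtains a' where "adm ws (a' @ xs @ b @ ys @ c)"
proof -
  have d: "distinct (a @ filter nt xs @ b @ filter nt ys @ c)" using assms(1,6) by (metis distinct_filter wf_def)
  have s: "set a \<union> set (filter nt xs) \<union> set b \<union> set (filter nt ys) \<union> set c = {a \<in> set ws. nt a}"
    using arg_cong[OF assms(6), of set] by auto
  have n: "filter nt b = b" "\<forall>a\<in>set b. nt a" using s by (auto simp: filter_id_conv)
  have "distinct (xs @ b @ ys)" "set (xs @ b @ ys) \<subseteq> set ws" using assms d s n(2) by auto
  from layout[OF assms(1) this, of a c] show ?thesis
    using n assms(6) that[of "filter (\<lambda>a. \<not> nt a \<and> a \<notin> set (xs @ b @ ys)) ws @ a"] by simp
qed

lemma den_swap_aux:
  assumes x: "okop x" and y: "okop y" and a: "adm ws (a @ dm x @ b @ dm y @ c)"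
    and w: "wf (a @ cd x @ b @ cd y @ c)" "set (dm x) \<inter> set (cd y) = {}" "set (cd x) \<inter> set (dm y) = {}"
  obtains s where "dm s = ws" "den [x, y] s" "den [y, x] s"
proof -
  let ?p = "perm ws (a @ dm x @ b @ dm y @ c)"
  have wl: "wf (a @ dm x @ b @ dm y @ c)" using a by (simp add: adm_def)
  have wi: "wires a" "wires b" "wires c" using wl by (simp_all add: wf_append)
  have w1: "wf (a @ cd x @ b @ dm y @ c)" "wf (a @ dm x @ b @ cd y @ c)" using w wl by (auto simp: wf_append)
  have e: "box (a @ cd x @ b) y c \<circ>\<^sub>w box a x (b @ dm y @ c) = box a x (b @ cd y @ c) \<circ>\<^sub>w box (a @ dm x @ b) y c"
  proof -
    have 1: "box (a @ z @ b) y c = box a (idw z \<otimes>\<^sub>w idw b \<otimes>\<^sub>w y) c" if "wires z" for z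
      using that y wi by (simp add: box_def tt_id tt_assoc tt_id2)
    have 2: "box a x (b @ z @ c) = box a (x \<otimes>\<^sub>w idw b \<otimes>\<^sub>w idw z) c" if "wires z" for z
      using that x wi by (simp add: box_def tt_id tt_assoc tt_id2)
    show ?thesis using x y wi by (simp add: 1 2 inter flip: box_cc)
  qed
  have 0: "den [] (idw (a @ cd x @ b @ cd y @ c))" using den_idw w by simp
  have p1: "perm zs zs = idw zs" if "wf zs" for zs using that by (rule perm_id)
  have "den [y] (box (a @ cd x @ b) y c)"
    using den_cons[OF y, of "a @ cd x @ b @ dm y @ c" "a @ cd x @ b" c "[]", OF _ _ 0] 0 w w1 wi x y by (simp add: p1)
  from den_cons[OF x a _ this] have A: "den [x, y] (box (a @ cd x @ b) y c \<circ>\<^sub>w box a x (b @ dm y @ c) \<circ>\<^sub>w ?p)"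
    using w w1 by simp
  have "den [x] (box a x (b @ cd y @ c))"
    using den_cons[OF x, of "a @ dm x @ b @ cd y @ c" a "b @ cd y @ c" "[]", OF _ _ 0] 0 w w1 wi x y by (simp add: p1)
  from den_cons[OF y, of ws "a @ dm x @ b" c, OF _ _ this]
  have "den [y, x] (box a x (b @ cd y @ c) \<circ>\<^sub>w box (a @ dm x @ b) y c \<circ>\<^sub>w ?p)"
    using a w w1 by simp
  moreover have "box a x (b @ cd y @ c) \<circ>\<^sub>w box (a @ dm x @ b) y c \<circ>\<^sub>w ?p =
      box (a @ cd x @ b) y c \<circ>\<^sub>w box a x (b @ dm y @ c) \<circ>\<^sub>w ?p"
    using e a x y wi by (simp flip: cc_assoc)
  ultimately show ?thesis using A that[of "box (a @ cd x @ b) y c \<circ>\<^sub>w box a x (b @ dm y @ c) \<circ>\<^sub>w ?p"] a by simp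
qed

text \<open>Boxes that do not feed each other commute by interchange, once the inputs of both have
  been gathered side by side in the initial list. The work lies in showing that such an arrangement
  is admissible.\<close>

lemma den_swap:
  assumes "den (x # y # p) t" "set (dm y) \<inter> set (cd x) = {}" "set (cd y) \<inter> set (dm x) = {}"
  shows "den (y # x # p) t"
proof -
  obtain s r where s: "den [x, y] s" "den p r" "dm r = cd s" "t = r \<circ>\<^sub>w s"
    using den_split[of "[x, y]" p t] assms(1) by (metis append_Cons append_Nil)
  obtain ws u v s' where 1: "okop x" "adm ws (u @ dm x @ v)" "wf (u @ cd x @ v)" "den [y] s'" "dm s' = u @ cd x @ v"
    "s = s' \<circ>\<^sub>w box u x v \<circ>\<^sub>w perm ws (u @ dm x @ v)"
    using s(1) by (rule den_consE) blast
  obtain u' v' s'' where 2: "okop y" "adm (u @ cd x @ v) (u' @ dm y @ v')" "wf (u' @ cd y @ v')"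
    "s' = s'' \<circ>\<^sub>w box u' y v' \<circ>\<^sub>w perm (u @ cd x @ v) (u' @ dm y @ v')"
    using 1(4) by (rule den_consE) (use 1 in auto)
  have ws: "wf ws" "dm s = ws" using 1 by (auto simp: adm_def)
  have wx: "wf (u @ dm x @ v)" "set ws = set u \<union> set (dm x) \<union> set v" using 1(2) by (auto simp: adm_def)
  have wy: "wf (u' @ dm y @ v')" "set u \<union> set (cd x) \<union> set v = set u' \<union> set (dm y) \<union> set v'"
    using 2(2) by (auto simp: adm_def)
  have dx: "set (dm x) \<subseteq> set ws" "set (dm y) \<subseteq> set ws" "set (dm x) \<inter> set (dm y) = {}"
    using wx wy assms by (auto simp: wf_append)
  have cx: "set (cd x) \<inter> (set ws - set (dm x)) = {}" using 1(3) wx by (auto simp: wf_append)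
  have cy: "set (cd y) \<inter> (set ws - set (dm x) - set (dm y) \<union> set (cd x)) = {}"
  proof -
    have "set ws - set (dm x) - set (dm y) \<union> set (cd x) \<subseteq> set u' \<union> set v'"
      using wx(2) wy(2) assms(2) by blast
    moreover have "set (cd y) \<inter> (set u' \<union> set v') = {}" using 2(3) by (auto simp: wf_append)
    ultimately show ?thesis by blast
  qed
  have dis: "distinct (dm x)" "distinct (dm y)" "wf (cd x)" "wf (cd y)" using wx wy 1(3) 2(3) by (auto simp: wf_append wf_def)
  let ?X = "filter nt (dm x)" and ?Y = "filter nt (dm y)"
  have nx: "filter nt ws = filter nt u @ ?X @ filter nt v" using 1(2) by (simp add: adm_def)
  have ny: "filter nt u @ filter nt (cd x) @ filter nt v = filter nt u' @ ?Y @ filter nt v'" using 2(2) by (simp add: adm_def)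
  \<comment> \<open>The \<open>Nw\<close> inputs of \<open>y\<close> were known to be adjacent only
    after \<open>x\<close> had been executed. Replacing the outputs of \<open>x\<close> by its
    inputs keeps them adjacent, because the two blocks cannot interlock.\<close>
  have "(\<exists>a b c. filter nt ws = a @ ?X @ b @ ?Y @ c) \<or> (\<exists>a b c. filter nt ws = a @ ?Y @ b @ ?X @ c)"
  proof (cases "?X = [] \<or> ?Y = []")
    case True
    thus ?thesis
    proof
      assume X: "?X = []"
      hence "filter nt (cd x) = []" using 1(1) by (simp add: okop_def)
      hence "filter nt ws = [] @ ?X @ filter nt u' @ ?Y @ filter nt v'" using nx ny X by simp
      thus ?thesis by blast
    next
      assume Y: "?Y = []"
      hence "filter nt ws = filter nt u @ ?X @ filter nt v @ ?Y @ []" using nx by simp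
      thus ?thesis by blast
    qed
  next
    case False
    have "set (filter nt (cd x)) \<inter> set ?Y = {}" using assms(2) by auto
    moreover have "filter nt (cd x) \<noteq> []" using False 1(1) by (simp add: okop_def)
    ultimately consider w where "filter nt u = filter nt u' @ ?Y @ w"
      | w where "filter nt v = w @ ?Y @ filter nt v'"
      using common_split[OF ny] False by blast
    thus ?thesis
    proof cases
      case 1
      hence "filter nt ws = filter nt u' @ ?Y @ w @ ?X @ filter nt v" using nx by simp
      thus ?thesis by blast
    next
      case 2
      hence "filter nt ws = filter nt u @ ?X @ w @ ?Y @ filter nt v'" using nx by simp
      thus ?thesis by blast
    qed
  qed
  then obtain s0 where s0: "dm s0 = ws" "den [x, y] s0" "den [y, x] s0"
  proof (elim disjE exE)
    fix a b c assume n: "filter nt ws = a @ ?X @ b @ ?Y @ c"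
    obtain a' where L: "adm ws (a' @ dm x @ b @ dm y @ c)" using layout2[OF ws(1) dis(1,2) dx(3) _ n] dx by blast
    hence "wf (a' @ cd x @ b @ cd y @ c)"
      using cx cy dis unfolding adm_def wf_append by auto
    from den_swap_aux[OF 1(1) 2(1) L this] assms(2,3) that show thesis by blast
  next
    fix a b c assume n: "filter nt ws = a @ ?Y @ b @ ?X @ c"
    obtain a' where L: "adm ws (a' @ dm y @ b @ dm x @ c)" using layout2[OF ws(1) dis(2,1) _ _ n] dx by blast
    hence "wf (a' @ cd y @ b @ cd x @ c)"
      using cx cy dis unfolding adm_def wf_append by auto
    from den_swap_aux[OF 2(1) 1(1) L this] assms(2,3) that show thesis by blast
  qed
  have ad: "adm (cd s0) (cd s)" using den_adm[OF s0(2) s(1)] s0 ws by simp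
  have "s = perm (cd s0) (cd s) \<circ>\<^sub>w s0"
    using den_unique[OF den_post[OF s0(2) ad] s(1)] s0 ws ad by simp
  hence "den [y, x] s" using den_post[OF s0(3) ad] by simp
  from den_cc[OF this s(2,3)] show ?thesis using s(4) by simp
qed

end

text \<open>A transposition instead of a substitution, so that the relabelling is injective and an
  involution.\<close>

definition ren :: "'o wire \<Rightarrow> 'o wire \<Rightarrow> 'o wire \<Rightarrow> 'o wire" where
  "ren a b c = (if c = a then b else if c = b then a else c)"

definition rena :: "('o wire \<Rightarrow> 'o wire) \<Rightarrow> ('o, 'm) arrow \<Rightarrow> ('o, 'm) arrow" where
  "rena r t = (case t of (us, f, vs) \<Rightarrow> (map r us, f, map r vs))"

text \<open>A test for adjacency which the simplifier can run on concrete lists.\<close>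

primrec contig :: "'a list \<Rightarrow> 'a list \<Rightarrow> bool" where
  "contig i [] \<longleftrightarrow> i = []"
| "contig i (n # ns) \<longleftrightarrow> take (length i) (n # ns) = i \<or> contig i ns"

lemma contigD: "contig i ns \<Longrightarrow> \<exists>u v. ns = u @ i @ v"
proof (induction ns)
  case Nil thus ?case by simp
next
  case (Cons n ns)
  show ?case
  proof (cases "take (length i) (n # ns) = i")
    case True
    hence "n # ns = [] @ i @ drop (length i) (n # ns)" by (metis append_Nil append_take_drop_id)
    thus ?thesis by blast
  next
    case False
    then obtain u v where "ns = u @ i @ v" using Cons by auto
    hence "n # ns = (n # u) @ i @ v" by simp
    thus ?thesis by blast
  qed
qed

text \<open>\<open>Idn\<close> and \<open>Idl\<close> both stand for identities, but
  \<open>Idl\<close> produces the identity of a whole tensor product as a single term. The choice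
  serves to match the terms occurring in the definitions.\<close>

datatype ('o, 'm) item = Idn "'o wire" | Idl "'o wire list" | Gen "('o, 'm) arrow" | Brd "'o wire list" "'o wire list"

section \<open>Reordering, relabelling and rewriting of programs\<close>

context braided_category begin

lemma den_ins: "den p t \<Longrightarrow> y \<in> set p \<Longrightarrow> set (dm y) \<subseteq> set (dm t) \<union> set (outs p)"
proof (induction rule: den.induct)
  case (den_cons x ws us vs p t)
  hence "set (us @ dm x @ vs) = set ws" by (auto simp: adm_def)
  thus ?case using den_cons by auto
qed simp

lemma den_move:
  "den (p @ x # q) t \<Longrightarrow> set (dm x) \<inter> set (outs p) = {} \<Longrightarrow> \<forall>y\<in>set p. set (cd x) \<inter> set (dm y) = {} \<Longrightarrow>
    den (x # p @ q) t"
proof (induction p arbitrary: t)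
  case (Cons y p)
  obtain s r where s: "den [y] s" "den (p @ x # q) r" "dm r = cd s" "t = r \<circ>\<^sub>w s"
    using den_split[of "[y]" "p @ x # q" t] Cons.prems(1) by (metis append_Cons append_Nil)
  have "den (x # p @ q) r" using Cons.IH[OF s(2)] Cons.prems by auto
  from den_cc[OF s(1) this s(3)] have "den (y # x # p @ q) t" using s by simp
  thus ?case using den_swap[of y x "p @ q" t] Cons.prems by auto
qed simp

text \<open>A list version of \<open>cur\<close>, suited to evaluation by the simplifier.\<close>

primrec curl :: "('o, 'm) arrow list \<Rightarrow> 'o wire list \<Rightarrow> 'o wire list" where
  "curl [] ws = ws"
| "curl (x # p) ws = curl p (filter (\<lambda>a. a \<notin> set (dm x)) ws @ cd x)"

primrec ready :: "'o wire list \<Rightarrow> ('o, 'm) arrow list \<Rightarrow> bool" where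
  "ready ws [] \<longleftrightarrow> True"
| "ready ws (x # p) \<longleftrightarrow> set (dm x) \<subseteq> set ws \<and> ready (filter (\<lambda>a. a \<notin> set (dm x)) ws @ cd x) p"

lemma set_curl: "set (curl p ws) = cur p (set ws)"
proof (induction p arbitrary: ws)
  case (Cons x p)
  have "set (filter (\<lambda>a. a \<notin> set (dm x)) ws @ cd x) = set ws - set (dm x) \<union> set (cd x)" by auto
  thus ?case using Cons by simp
qed simp

lemma ready_cong: "set ws = set vs \<Longrightarrow> ready ws p = ready vs p"
proof (induction p arbitrary: ws vs)
  case (Cons x p)
  have "ready (filter (\<lambda>a. a \<notin> set (dm x)) ws @ cd x) p = ready (filter (\<lambda>a. a \<notin> set (dm x)) vs @ cd x) p"
    by (rule Cons.IH) (use Cons.prems in auto)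
  thus ?case using Cons.prems by simp
qed simp

text \<open>When no label is produced twice, the labels determine which box feeds which. The boxes
  may then be executed in any order in which inputs are available in time: the first box of
  \<open>q\<close> is moved to the front of \<open>p\<close>, and the rest follows by
  induction.\<close>

lemma den_reorder:
  "den p t \<Longrightarrow> distinct (dm t @ outs p) \<Longrightarrow> mset p = mset q \<Longrightarrow> ready (dm t) q \<Longrightarrow> den q t"
proof (induction q arbitrary: p t)
  case (Cons x q)
  have "x \<in> set p" using Cons.prems(3) by (metis list.set_intros(1) mset_eq_setD)
  then obtain p1 p2 where p: "p = p1 @ x # p2" by (metis split_list)
  have m: "mset (p1 @ p2) = mset q" using Cons.prems(3) p by simp
  have x: "set (dm x) \<subseteq> set (dm t)" using Cons.prems(4) by simp
  have "\<forall>y\<in>set p1. set (cd x) \<inter> set (dm y) = {}"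
  proof
    fix y assume y: "y \<in> set p1"
    obtain s r where s: "den p1 s" "dm s = dm t"
      using den_split[of p1 "x # p2" t] Cons.prems(1) p by (metis arrow_simps(1))
    from den_ins[OF s(1) y] have "set (dm y) \<subseteq> set (dm t) \<union> set (outs p1)" using s by simp
    thus "set (cd x) \<inter> set (dm y) = {}" using Cons.prems(2) p by auto
  qed
  moreover have "set (dm x) \<inter> set (outs p1) = {}" using Cons.prems(2) p x by auto
  ultimately have "den (x # p1 @ p2) t" using den_move[of p1 x p2 t] Cons.prems(1) p by simp
  then obtain s r where s: "den [x] s" "den (p1 @ p2) r" "dm r = cd s" "t = r \<circ>\<^sub>w s"
    using den_split[of "[x]" "p1 @ p2" t] by (metis append_Cons append_Nil)
  have c: "set (dm r) = set (dm t) - set (dm x) \<union> set (cd x)" using den_state[OF s(1)] s by simp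
  have "wf (dm r)" using s by simp
  hence "distinct (dm r @ outs (p1 @ p2))" using Cons.prems(2) c p by (auto simp: wf_def)
  moreover have "ready (dm r) q"
  proof -
    have "set (filter (\<lambda>a. a \<notin> set (dm x)) (dm t) @ cd x) = set (dm r)" using c by auto
    from ready_cong[OF this] show ?thesis using Cons.prems(4) by simp
  qed
  ultimately have "den q r" using Cons.IH[OF s(2) _ m] by simp
  from den_cc[OF s(1) this s(3)] show ?case using s by simp
qed simp

text \<open>One rewriting step with all bookkeeping: \<open>p\<close> is brought into the order in
  which \<open>l\<close> stands together, and then \<open>l\<close> is replaced. The result
  \<open>q\<close> is given in advance, with \<open>r\<close> at position \<open>n\<close>.\<close>

lemma den_step:
  assumes d: "den p (ws, g, ts)" and rl: "rl l r ins os"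
    and q: "take n q @ r @ drop (n + length r) q = q"
    and m: "mset p = mset (take n q @ l @ drop (n + length r) q)"
    and s: "distinct (ws @ outs p)" "distinct (ws @ outs q)"
    and rd: "ready ws (take n q @ l @ drop (n + length r) q)"
    and ct: "contig (filter nt ins) (track (take n q) (filter nt ws))"
    and i: "set ins \<subseteq> set (curl (take n q) ws)"
  shows "den q (ws, g, ts)"
proof -
  let ?p1 = "take n q" and ?p2 = "drop (n + length r) q"
  obtain u v where "track ?p1 (filter nt ws) = u @ filter nt ins @ v" using contigD[OF ct] by blast
  moreover have d1: "den (?p1 @ l @ ?p2) (ws, g, ts)" using den_reorder[OF d _ m] s rd by simp
  moreover have "(set (outs l) \<union> set (outs r)) \<inter> (cur ?p1 (set ws) - set ins) = {}"
  proof -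
    have c: "cur p S \<subseteq> S \<union> set (outs p)" for p and S :: "'o wire set" by (induction p arbitrary: S) fastforce+
    have "set (outs (take n q @ r @ drop (n + length r) q)) = set (outs q)" using q by simp
    have "distinct (ws @ outs (take n q @ r @ drop (n + length r) q))" using q s(2) by simp
    hence r: "set (outs r) \<inter> (set ws \<union> set (outs ?p1)) = {}" by auto
    have "set (outs p) = set (outs (?p1 @ l @ ?p2))" using mset_eq_setD[OF m] by (simp add: outs_def)
    \<comment> \<open>Distinctness passes to the permuted program because both output lists have the
      same elements and the same length.\<close>
    moreover have "length (outs p) = length (outs (?p1 @ l @ ?p2))"
    proof -
      have "length (outs p) = sum_mset (image_mset (length \<circ> cd) (mset p))" for p
        by (induction p) auto
      thus ?thesis using m by metis
    qed
    ultimately have "distinct (outs (?p1 @ l @ ?p2))" using s(1) by (metis card_distinct distinct_append distinct_card)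
    hence "set (outs l) \<inter> (set ws \<union> set (outs ?p1)) = {}"
      using s(1) \<open>set (outs p) = set (outs (?p1 @ l @ ?p2))\<close> by auto
    thus ?thesis using r c[of ?p1 "set ws"] by blast
  qed
  ultimately have "den (?p1 @ r @ ?p2) (ws, g, ts)"
    using den_rewrite[of ?p1 l ?p2 "(ws, g, ts)" r "ins" os] rl i by (simp add: set_curl)
  thus ?thesis using q by simp
qed

lemma obj_map: "(\<And>a. wo (f a) = wo a) \<Longrightarrow> obj (map f ws) = obj ws"
  by (induction ws rule: obj.induct) auto

lemma wire_iff: "wire a \<longleftrightarrow> (if nt a then wo a \<in> ob C else transparent C (wo a))"
  by (cases a) auto

context
  fixes r :: "'o wire \<Rightarrow> 'o wire"
  assumes r: "inj r" "\<And>a. wo (r a) = wo a" "\<And>a. nt (r a) = nt a"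
begin

lemma rena_simps [simp]:
  "dm (rena r t) = map r (dm t)" "cd (rena r t) = map r (cd t)" "mo (rena r t) = mo t"
  by (cases t; simp add: rena_def)+

lemma wires_map [simp]: "wires (map r ws) = wires ws"
  by (auto simp: wires_def wire_iff r)

lemma obj_map_r [simp]: "obj (map r ws) = obj ws"
  by (simp add: obj_map r)

lemma wf_map [simp]: "wf (map r ws) = wf ws"
  using r(1) by (auto simp: wf_def distinct_map intro: inj_on_subset)

lemma filter_map_r: "filter nt (map r ws) = map r (filter nt ws)"
  by (induction ws) (auto simp: r)

lemma adm_map: "adm ws ts \<Longrightarrow> adm (map r ws) (map r ts)"
  by (auto simp: adm_def filter_map_r)

lemma rena_cc: "rena r (t \<circ>\<^sub>w s) = rena r t \<circ>\<^sub>w rena r s"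
  by (rule arrow_eqI) simp_all

lemma rena_box: "rena r (box us x vs) = box (map r us) (rena r x) (map r vs)"
  by (rule arrow_eqI) (simp_all add: box_def)

lemma rena_okop: "okop x \<Longrightarrow> okop (rena r x)"
  unfolding okop_def ok_def by (simp add: filter_map_r)

lemma rena_tt: "rena r (t \<otimes>\<^sub>w s) = rena r t \<otimes>\<^sub>w rena r s"
  by (rule arrow_eqI) simp_all

lemma rena_idw: "rena r (idw ws) = idw (map r ws)"
  by (rule arrow_eqI) simp_all

lemma rena_perm: "wf ws \<Longrightarrow> wf ts \<Longrightarrow> set ws = set ts \<Longrightarrow> rena r (perm ws ts) = perm (map r ws) (map r ts)"
proof (induction ts arbitrary: ws)
  case Nil thus ?case by (intro arrow_eqI) simp_all
next
  case (Cons a ts)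
  have "a \<in> set ws" using Cons.prems by simp
  then obtain u v where ws: "ws = u @ a # v" "a \<notin> set u" using split_list_first by metis
  have uv: "wf (u @ v)" "set (u @ v) = set ts" using Cons.prems ws by (auto simp: wf_append)
  have n: "r a \<notin> set (map r u)" using ws r(1) by (auto dest: injD)
  have "rena r (mv a ws) = mv (r a) (map r ws)"
    using ws mv_split[OF n, of "map r v"] by (intro arrow_eqI) (simp_all add: mv_split r)
  moreover have "rena r (perm (u @ v) ts) = perm (map r u @ map r v) (map r ts)"
    using Cons.IH[OF uv(1) _ uv(2)] Cons.prems by simp
  ultimately show ?case using ws n remove1_split[OF n, of "map r v"] by (simp add: remove1_split rena_cc rena_tt rena_idw)
qed

text \<open>Labels only express connections, so an injective relabelling that respects objects and
  kinds of wires leaves the morphism alone.\<close>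

lemma den_map: "den p t \<Longrightarrow> den (map (rena r) p) (rena r t)"
proof (induction rule: den.induct)
  case (den_nil ws ts)
  thus ?case using den.den_nil[OF adm_map[OF den_nil]] by (simp add: rena_perm adm_def)
next
  case (den_cons x ws us vs p t)
  have "rena r (perm ws (us @ dm x @ vs)) = perm (map r ws) (map r us @ map r (dm x) @ map r vs)"
    using den_cons(2) by (simp add: rena_perm adm_def)
  moreover have "wf (map r us @ map r (cd x) @ map r vs)" using wf_map[of "us @ cd x @ vs"] den_cons by simp
  ultimately show ?case
    using den.den_cons[OF rena_okop[OF den_cons(1)], of "map r ws" "map r us" "map r vs" "map (rena r) p" "rena r t"]
      den_cons adm_map[OF den_cons(2)]
    by (simp add: rena_cc rena_box)
qed

end

lemma ren_props: "inj (ren a b)" "wo a = wo b \<Longrightarrow> wo (ren a b c) = wo c" "nt a = nt b \<Longrightarrow> nt (ren a b c) = nt c"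
  by (auto simp: ren_def inj_def)

lemma ren_ren [simp]: "ren a b (ren a b c) = c"
  by (simp add: ren_def)

lemma rena_rena [simp]: "rena (ren a b) (rena (ren a b) t) = t"
  by (cases t) (simp add: rena_def comp_def)

text \<open>When \<open>l\<close> collapses to an identity, no box is left that could turn the label
  \<open>a\<close> into \<open>b\<close>. The remaining boxes, and the ends \<open>ts\<close> as
  well, are therefore relabelled by exchanging the two.\<close>

lemma den_step_id:
  assumes d: "den p (ws, g, ts)" and l: "den l ([a], \<one> (wo a), [b])"
    and ab: "wo a = wo b" "nt a = nt b"
    and m: "mset p = mset (take n q @ l @ map (rena (ren a b)) (drop n q))"
    and s: "distinct (ws @ outs p)"
    and rd: "ready ws (take n q @ l @ map (rena (ren a b)) (drop n q))"
    and i: "a \<in> set (curl (take n q) ws)"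
  shows "den q (ws, g, map (ren a b) ts)"
proof -
  let ?r = "rena (ren a b)"
  let ?p1 = "take n q" and ?p2 = "map ?r (drop n q)"
  note rp = ren_props(1) ren_props(2)[OF ab(1)] ren_props(3)[OF ab(2)]
  have "den (?p1 @ l @ ?p2) (ws, g, ts)" using den_reorder[OF d _ m] s rd by simp
  then obtain s' z where s': "den ?p1 s'" "den (l @ ?p2) z" "dm z = cd s'" "(ws, g, ts) = z \<circ>\<^sub>w s'"
    by (rule den_split)
  from s'(2) obtain x y where x: "den l x" "den ?p2 y" "dm y = cd x" "z = y \<circ>\<^sub>w x"
    by (rule den_split)
  have dms: "dm s' = ws" using arg_cong[OF s'(4), of dm] by simp
  have a: "a \<in> set (dm x)" using den_state[OF s'(1)] s' x i dms by (simp add: set_curl)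
  obtain c e where ce: "dm x = c @ a # e" "a \<notin> set c" using a split_list_first by metis
  let ?k = "([a], \<one> (wo a), [b])"
  have wx: "wf (c @ [a] @ e)" using den_okD(2)[OF x(1)] ce by simp
  have lout: "set (outs l) \<inter> (set c \<union> set e) = {}"
  proof -
    have c: "cur p S \<subseteq> S \<union> set (outs p)" for p and S :: "'o wire set" by (induction p arbitrary: S) fastforce+
    have "set (outs p) = set (outs (?p1 @ l @ ?p2))" using mset_eq_setD[OF m] by (simp add: outs_def)
    moreover have "length (outs p) = length (outs (?p1 @ l @ ?p2))"
    proof -
      have "length (outs p) = sum_mset (image_mset (length \<circ> cd) (mset p))" for p
        by (induction p) auto
      thus ?thesis using m by metis
    qed
    ultimately have "distinct (outs (?p1 @ l @ ?p2))" using s(1) by (metis card_distinct distinct_append distinct_card)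
    hence "set (outs l) \<inter> (set ws \<union> set (outs ?p1)) = {}"
      using s(1) \<open>set (outs p) = set (outs (?p1 @ l @ ?p2))\<close> by auto
    moreover have "set (dm x) \<subseteq> set ws \<union> set (outs ?p1)"
      using den_state[OF s'(1)] s' x dms c[of ?p1 "set ws"] by simp
    ultimately show ?thesis using ce by auto
  qed
  have bl: "den l (box c ?k e)" using den_box[OF l, of c e] wx lout by simp
  have ad: "adm (c @ b # e) (cd x)" using den_adm[OF bl x(1)] ce wx by simp
  \<comment> \<open>By uniqueness of denotations, the part of the morphism that executes
    \<open>l\<close> is a relabelled identity wire followed by a reordering; the latter is then
    absorbed into \<open>y'\<close>.\<close>
  have "perm (c @ [b] @ e) (cd x) \<circ>\<^sub>w box c ?k e = x"
    using den_unique[OF x(1) den_post[OF bl, of "cd x"]] ad ce by simp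
  moreover define y' where "y' = y \<circ>\<^sub>w perm (c @ [b] @ e) (cd x)"
  ultimately have z: "z = y' \<circ>\<^sub>w box c ?k e" using x ad den_okD(1)[OF l] wx by (simp add: cc_assoc wf_append)
  have "den ?p2 y'" using den_pre[OF x(2), of "c @ [b] @ e"] ad x by (simp add: y'_def)
  hence "den (map ?r ?p2) (?r y')" using den_map[OF rp] by blast
  moreover have "map ?r ?p2 = drop n q"
    by (simp add: comp_def)
  moreover have dy: "dm (?r y') = c @ a # e"
  proof -
    have "b \<notin> set c" "b \<notin> set e" "a \<notin> set e" using ad wx by (auto simp: adm_def wf_append)
    hence "map (ren a b) c = c" "map (ren a b) e = e" using ce(2) by (auto simp: ren_def intro!: map_idI)
    moreover have "ren a b b = a" by (simp add: ren_def)
    ultimately show ?thesis using ad rena_simps[OF rp] by (simp add: y'_def)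
  qed
  ultimately have "den (drop n q) (?r y')" by simp
  from den_cc[OF s'(1) this] have "den q (?r y' \<circ>\<^sub>w s')" using dy s' x ce by simp
  moreover have "?r y' \<circ>\<^sub>w s' = (ws, g, map (ren a b) ts)"
  proof (rule arrow_eqI)
    have "box c ?k e = (dm x, \<one> (obj (c @ a # e)), c @ b # e)"
    proof (rule arrow_eqI)
      have "mo (box c ?k e) = mo (box c (idw [a]) e)" by (simp add: box_def)
      thus "mo (box c ?k e) = mo (dm x, \<one> (obj (c @ a # e)), c @ b # e)"
        using wx box_idw[of c "[a]" e] by (simp add: wf_append)
    qed (simp_all add: ce)
    moreover have "obj (c @ a # e) = obj (c @ b # e)"
      using wx ad ab(1) by (simp add: obj_append adm_def wf_append obj_Cons)
    moreover have "mo y' \<cdot> \<one> (obj (dm y')) = mo y'"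
      by (rule id_right[of _ "obj (cd y')"]) (use \<open>den ?p2 y'\<close> ok_hom[of y'] in simp_all)
    moreover have "dm y' = c @ b # e" using ad by (simp add: y'_def)
    ultimately have "mo z = mo y'" using z by simp
    thus "mo (?r y' \<circ>\<^sub>w s') = mo (ws, g, map (ren a b) ts)"
      using arg_cong[OF s'(4), of mo] rena_simps[OF rp] by simp
    show "cd (?r y' \<circ>\<^sub>w s') = cd (ws, g, map (ren a b) ts)"
      using arg_cong[OF s'(4), of cd] rena_simps[OF rp] x by (simp add: y'_def)
  qed (simp add: dms)
  ultimately show ?thesis by simp
qed

primrec meets :: "'o wire list \<Rightarrow> 'o wire list \<Rightarrow> bool" where
  "meets [] ws \<longleftrightarrow> False"
| "meets (a # as) ws \<longleftrightarrow> a \<in> set ws \<or> meets as ws"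

text \<open>Dependence is transitive: outputs of a box that uses one of the given wires are added to
  these wires.\<close>

primrec before :: "'o wire list \<Rightarrow> ('o, 'm) arrow list \<Rightarrow> ('o, 'm) arrow list" where
  "before ws [] = []"
| "before ws (x # p) = (if meets (dm x) ws then before (ws @ cd x) p else x # before ws p)"

primrec after :: "'o wire list \<Rightarrow> ('o, 'm) arrow list \<Rightarrow> ('o, 'm) arrow list" where
  "after ws [] = []"
| "after ws (x # p) = (if meets (dm x) ws then x # after (ws @ cd x) p else after ws p)"

primrec without :: "('o, 'm) arrow list \<Rightarrow> ('o, 'm) arrow list \<Rightarrow> ('o, 'm) arrow list" where
  "without [] p = p"
| "without (x # l) p = without l (remove1 x p)"

lemma mset_before_after: "mset (before ws p) + mset (after ws p) = mset p"
  by (induction p arbitrary: ws) auto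

lemma mset_without: "set l \<subseteq> set p \<Longrightarrow> distinct l \<Longrightarrow> mset (without l p) + mset l = mset p"
proof (induction l arbitrary: p)
  case (Cons x l)
  have "set l \<subseteq> set (remove1 x p)"
  proof
    fix y assume "y \<in> set l"
    hence "y \<noteq> x" "y \<in> set p" using Cons.prems by auto
    thus "y \<in> set (remove1 x p)" by (simp add: in_set_remove1)
  qed
  hence "mset (without l (remove1 x p)) + mset l = mset (remove1 x p)" using Cons by simp
  thus ?case using Cons.prems by simp
qed simp

lemma mset_rw:
  assumes "set l \<subseteq> set p" "distinct l"
  shows "mset p = mset (before ws (without l p) @ l @ after ws (without l p))"
proof -
  have "mset p = mset (without l p) + mset l" using mset_without[OF assms] by simp
  thus ?thesis using mset_before_after[of ws "without l p"] by (simp add: ac_simps)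
qed

text \<open>
  The boxes \<open>l\<close> of \<open>p\<close> are replaced by \<open>r\<close>; those depending on an output of \<open>l\<close> have to be moved behind \<open>r\<close>.
\<close>

lemma den_rw:
  assumes "den p (ws, g, ts)" "rl l r ins os"
    and "set l \<subseteq> set p \<and> distinct l \<and> distinct (ws @ outs p) \<and>
      distinct (ws @ outs (before (outs l) (without l p) @ r @ after (outs l) (without l p))) \<and>
      ready ws (before (outs l) (without l p) @ l @ after (outs l) (without l p)) \<and>
      contig (filter nt ins) (track (before (outs l) (without l p)) (filter nt ws)) \<and>
      set ins \<subseteq> set (curl (before (outs l) (without l p)) ws)"
  shows "den (before (outs l) (without l p) @ r @ after (outs l) (without l p)) (ws, g, ts)"
  by (rule den_step[OF assms(1,2), where n = "length (before (outs l) (without l p))"])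
    (use assms(3) mset_rw[of l p] in simp_all)

lemma den_rw_id:
  assumes "den p (ws, g, ts)" "den l ([a], \<one> (wo a), [b])"
    and "set l \<subseteq> set p \<and> distinct l \<and> wo a = wo b \<and> nt a = nt b \<and> distinct (ws @ outs p) \<and>
      ready ws (before (outs l) (without l p) @ l @ after (outs l) (without l p)) \<and>
      a \<in> set (curl (before (outs l) (without l p)) ws)"
  shows "den (before (outs l) (without l p) @ map (rena (ren a b)) (after (outs l) (without l p))) (ws, g, map (ren a b) ts)"
  by (rule den_step_id[OF assms(1,2), where n = "length (before (outs l) (without l p))"])
    (use assms(3) mset_rw[of l p] in \<open>simp_all add: comp_def\<close>)

lemma den_hom: "den p (ws, f, ts) \<Longrightarrow> f \<in> hom C (obj ws) (obj ts)"
  using ok_hom[of "(ws, f, ts)"] by simp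

lemma den_tt:
  assumes "den p t" "den q s" "wf (dm t @ dm s)" "wf (cd t @ dm s)"
    "set (outs p) \<inter> set (dm s) = {}" "set (outs q) \<inter> set (cd t) = {}"
  shows "den (p @ q) (t \<otimes>\<^sub>w s)"
proof -
  have "den p (box [] t (dm s))" using den_box[OF assms(1), of "[]" "dm s"] assms by simp
  moreover have "den q (box (cd t) s [])" using den_box[OF assms(2), of "cd t" "[]"] assms by simp
  ultimately have "den (p @ q) (box (cd t) s [] \<circ>\<^sub>w box [] t (dm s))" by (rule den_cc) simp
  thus ?thesis using assms(1,2) by (simp add: box_def inter)
qed

lemma den_op: "okop x \<Longrightarrow> wf (dm x) \<Longrightarrow> wf (cd x) \<Longrightarrow> den [x] x"
  using den_cons[of x "dm x" "[]" "[]" "[]" "idw (cd x)"] den_idw[of "cd x"] by (simp add: perm_id)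

text \<open>A crossing with one entirely transparent side contributes no box; it is visible only in
  the order of the wires.\<close>

lemma den_br: "wf (us @ vs) \<Longrightarrow> filter nt us = [] \<or> filter nt vs = [] \<Longrightarrow> den [] (br us vs)"
  using den_nil[of "us @ vs" "vs @ us"] by (auto simp: perm_swap adm_def wf_append Int_commute Un_commute)

section \<open>Layered diagrams as notation for composites in the category\<close>

primrec item :: "('o, 'm) item \<Rightarrow> ('o, 'm) arrow" where
  "item (Idn a) = ([a], \<one> (wo a), [a])"
| "item (Idl us) = (us, \<one> (obj us), us)"
| "item (Gen t) = t"
| "item (Brd us vs) = (us @ vs, \<Phi> (obj us) (obj vs), vs @ us)"

primrec iprog :: "('o, 'm) item \<Rightarrow> ('o, 'm) arrow list" where
  "iprog (Idn a) = []"
| "iprog (Idl us) = []"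
| "iprog (Gen t) = [t]"
| "iprog (Brd us vs) = []"

primrec iok :: "('o, 'm) item \<Rightarrow> bool" where
  "iok (Idn a) \<longleftrightarrow> wire a"
| "iok (Idl us) \<longleftrightarrow> wf us"
| "iok (Gen t) \<longleftrightarrow> okop t \<and> wf (dm t) \<and> wf (cd t)"
| "iok (Brd us vs) \<longleftrightarrow> wf (us @ vs) \<and> (filter nt us = [] \<or> filter nt vs = [])"

fun layer :: "('o, 'm) item list \<Rightarrow> ('o, 'm) arrow" where
  "layer [] = idw []"
| "layer [i] = item i"
| "layer (i # j # is) = item i \<otimes>\<^sub>w layer (j # is)"

fun lok :: "('o, 'm) item list \<Rightarrow> bool" where
  "lok [] \<longleftrightarrow> True"
| "lok [i] \<longleftrightarrow> iok i"
| "lok (i # j # is) \<longleftrightarrow> iok i \<and> lok (j # is) \<and> wf (dm (item i) @ dm (layer (j # is))) \<and>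
     wf (cd (item i) @ dm (layer (j # is))) \<and>
     set (outs (iprog i)) \<inter> set (dm (layer (j # is))) = {} \<and>
     set (outs (concat (map iprog (j # is)))) \<inter> set (cd (item i)) = {}"

text \<open>Layers are listed in the order of composition, the head being executed last, so that a
  diagram can be read off from the term it stands for. Programs run in the opposite direction, hence
  the reversal in \<open>dprog\<close>.\<close>

fun diag :: "('o, 'm) item list list \<Rightarrow> ('o, 'm) arrow" where
  "diag [] = idw []"
| "diag [l] = layer l"
| "diag (l # m # ls) = layer l \<circ>\<^sub>w diag (m # ls)"

fun dok :: "('o, 'm) item list list \<Rightarrow> bool" where
  "dok [] \<longleftrightarrow> True"
| "dok [l] \<longleftrightarrow> lok l"
| "dok (l # m # ls) \<longleftrightarrow> lok l \<and> dm (layer l) = cd (diag (m # ls)) \<and> dok (m # ls)"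

primrec dprog :: "('o, 'm) item list list \<Rightarrow> ('o, 'm) arrow list" where
  "dprog [] = []"
| "dprog (l # ls) = dprog ls @ concat (map iprog l)"

lemma den_item: "iok i \<Longrightarrow> den (iprog i) (item i)"
proof (cases i)
  case (Idn a)
  assume "iok i" thus ?thesis using Idn den_idw[of "[a]"] by (simp add: idw_def)
next
  case (Idl us)
  assume "iok i" thus ?thesis using Idl den_idw[of us] by (simp add: idw_def)
next
  case (Gen t)
  assume "iok i" thus ?thesis using Gen den_op[of t] by simp
next
  case (Brd us vs)
  assume "iok i" thus ?thesis using Brd den_br[of us vs] by (simp add: br_def)
qed

lemma den_layer: "lok l \<Longrightarrow> den (concat (map iprog l)) (layer l)"
proof (induction l rule: layer.induct)
  case 1 show ?case using den_idw[of "[]"] by simp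
next
  case (2 i) thus ?case using den_item by simp
next
  case (3 i j "is")
  have a: "den (concat (map iprog (j # is))) (layer (j # is))" using 3 by simp
  have b: "den (iprog i) (item i)" using 3 den_item by simp
  have "den (iprog i @ concat (map iprog (j # is))) (item i \<otimes>\<^sub>w layer (j # is))"
    by (rule den_tt[OF b a]) (use 3(2) in simp_all)
  thus ?case by simp
qed

lemma den_diag: "dok ls \<Longrightarrow> den (dprog ls) (diag ls)"
proof (induction ls rule: diag.induct)
  case 1 show ?case using den_idw[of "[]"] by simp
next
  case (2 l) thus ?case using den_layer by simp
next
  case (3 l m ls)
  thus ?case using den_cc[of "dprog (m # ls)" "diag (m # ls)" "concat (map iprog l)" "layer l"] den_layer[of l] by simp
qed

text \<open>Turns an equation in \<open>C\<close> into a rewriting rule: once both sides are laid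
  out as diagrams, the essential obligation is the original equation.\<close>

lemma diag_rlI:
  assumes "dok ls" "dok ms" "dm (diag ls) = dm (diag ms)" "cd (diag ls) = cd (diag ms)" "mo (diag ls) = mo (diag ms)"
  shows "rl (dprog ls) (dprog ms) (dm (diag ls)) (cd (diag ls))"
proof -
  have "diag ls = diag ms" using assms(3,5,4) by (rule arrow_eqI)
  thus ?thesis
    unfolding rl_def using den_diag[OF assms(1)] den_diag[OF assms(2)] by (intro exI[of _ "mo (diag ls)"]) (cases "diag ms"; simp)
qed

abbreviation "diag_rl ls ms \<equiv> rl (dprog ls) (dprog ms) (dm (diag ls)) (cd (diag ls))"

text \<open>The way back from programs to equations in \<open>C\<close>: two composites agree if
  their programs consist of the same boxes with the same labels.\<close>

lemma den_eq:
  assumes "den p (ws, f, ts)" "den q (ws, g, ts)" "mset p = mset q" "distinct (ws @ outs p)" "ready ws q"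
  shows "f = g"
  using den_unique[OF assms(2) den_reorder[OF assms(1) _ assms(3)]] assms(4,5) by simp

lemma den_diagI:
  assumes "dok ls" "diag ls = (ws, g, ts)" "mset p = mset (dprog ls)" "distinct (ws @ outs (dprog ls))" "ready ws p"
  shows "den p (ws, g, ts)"
  using den_reorder[OF den_diag[OF assms(1)] _ assms(3)[symmetric]] assms by simp

end

lemma rena_pair [simp]: "rena r (us, f, vs) = (map r us, f, map r vs)"
  by (simp add: rena_def)

declare ren_def [simp]

section \<open>Transparent Hopf algebras\<close>

text \<open>Finiteness is kept out of this locale, so that it can be instantiated at the reversed
  category as well.\<close>

locale transparent_hopf = braided_category C for C :: "('o, 'm) bcat" (structure) +
  fixes A :: "('o, 'm) hopf"
  assumes hopf: "hopf_algebra_in C A"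
    and bij: "bijective_antipode C A"
    and trH [simp]: "transparent C (car A)"
begin

abbreviation "H \<equiv> car A"
abbreviation h :: "nat \<Rightarrow> 'o wire" where "h \<equiv> Tw (car A)"
abbreviation "Mu \<equiv> mlt A"
abbreviation "Et \<equiv> unt A"
abbreviation "De \<equiv> cmlt A"
abbreviation "Ep \<equiv> cunt A"
abbreviation "S \<equiv> antipode A"
abbreviation "Si \<equiv> inv_antipode C A"
abbreviation "mul i j k \<equiv> ([h i, h j], Mu, [h k])"
abbreviation "uni i \<equiv> ([], Et, [h i])"
abbreviation "com i j k \<equiv> ([h i], De, [h j, h k])"
abbreviation "cou i \<equiv> ([h i], Ep, [])"
abbreviation "ant i j \<equiv> ([h i], S, [h j])"
abbreviation "ani i j \<equiv> ([h i], Si, [h j])"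

lemma H_ob [simp]: "H \<in> ob C" using trH by (rule transparent_ob)

lemmas hopf_unf = hopf[unfolded hopf_algebra_in_def bialgebra_in_def algebra_in_def coalgebra_in_def Let_def]

lemma inv_antipode: "Si \<in> hom C H H" "Si \<cdot> S = \<one> H" "S \<cdot> Si = \<one> H"
proof -
  obtain g where g: "inverse_pair C H H S g" and S: "S \<in> hom C H H"
    using bij by (auto simp: bijective_antipode_def iso_mor_def)
  have "Si = g" unfolding inv_antipode_def by (rule inv_mor_eq[OF H_ob H_ob S g])
  thus "Si \<in> hom C H H" "Si \<cdot> S = \<one> H" "S \<cdot> Si = \<one> H" using g by (simp_all add: inverse_pair_def)
qed

lemma okops [simp]:
  "okop (mul i j k)" "okop (uni k)" "okop (com k i j)" "okop (cou k)"
  "okop (ant i j)" "okop (ani i j)"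
  using hopf_unf inv_antipode by (auto simp: okop_def ok_def)

lemmas arr [simp] = cc_def tt_def idw_def

lemma rlI: "den l (ins, f, os) \<Longrightarrow> den r (ins, f, os) \<Longrightarrow> rl l r ins os"
  by (auto simp: rl_def)

text \<open>As in all rules of this form, the labels are parameters, to be instantiated with the
  wires at hand and with fresh ones. The distinctness assumptions become decidable for
  numerals.\<close>

lemma assoc_rl:
  assumes "distinct [i, j, k, l, m]" "distinct [i, j, l, n, m]"
  shows "diag_rl [[Gen (mul k l m)], [Gen (mul i j k), Idn (h l)]]
    [[Gen (mul i n m)], [Idn (h i), Gen (mul j l n)]]"
  by (rule diag_rlI) (use assms hopf_unf in auto)

lemma coassoc_rl:
  assumes "distinct [i, j, k, l, m]" "distinct [i, l, n, m, k]"
  shows "diag_rl [[Gen (com j l m), Idn (h k)], [Gen (com i j k)]]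
    [[Idn (h l), Gen (com n m k)], [Gen (com i l n)]]"
  by (rule diag_rlI) (use assms hopf_unf in auto)

lemma bialg_rl:
  assumes "distinct [i, j, k, l, m]" "distinct [i, j, a, b, c, d, l, m]"
  shows "diag_rl [[Gen (com k l m)], [Gen (mul i j k)]]
    [[Gen (mul a c l), Gen (mul b d m)], [Idn (h a), Brd [h b] [h c], Idn (h d)],
      [Gen (com i a b), Gen (com j c d)]]"
  by (rule diag_rlI) (use assms hopf_unf in auto)

text \<open>Formulated with \<open>den\<close> and an identity, as the result is a bare wire whose
  label has changed; such rules are applied by \<open>den_rw_id\<close>.\<close>

lemma unit_left: "distinct [i, j, k] \<Longrightarrow> den [uni j, mul j i k] ([h i], \<one> (wo (h i)), [h k])"
  using den_diag[of "[[Gen (mul j i k)], [Gen (uni j), Idn (h i)]]"] hopf_unf by auto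

lemma unit_right: "distinct [i, j, k] \<Longrightarrow> den [uni j, mul i j k] ([h i], \<one> (wo (h i)), [h k])"
  using den_diag[of "[[Gen (mul i j k)], [Idn (h i), Gen (uni j)]]"] hopf_unf by auto

lemma counit_left: "distinct [i, j, k] \<Longrightarrow> den [com i j k, cou j] ([h i], \<one> (wo (h i)), [h k])"
  using den_diag[of "[[Gen (cou j), Idn (h k)], [Gen (com i j k)]]"] hopf_unf by auto

lemma counit_right: "distinct [i, j, k] \<Longrightarrow> den [com i j k, cou k] ([h i], \<one> (wo (h i)), [h j])"
  using den_diag[of "[[Idn (h j), Gen (cou k)], [Gen (com i j k)]]"] hopf_unf by auto

lemma unit_De_rl: "distinct [i, j, k] \<Longrightarrow> diag_rl [[Gen (com i j k)], [Gen (uni i)]]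
    [[Gen (uni j), Gen (uni k)]]"
  by (rule diag_rlI) (use hopf_unf in auto)

lemma Mu_Ep_rl: "distinct [i, j, k] \<Longrightarrow> diag_rl [[Gen (cou k)], [Gen (mul i j k)]]
    [[Gen (cou i), Gen (cou j)]]"
  by (rule diag_rlI) (use hopf_unf in auto)

lemma Et_Ep_rl: "rl [uni i, cou i] [] [] []"
  by (rule rlI[where f = "Ep \<cdot> Et"])
     (use den_diag[of "[[Gen (cou i)], [Gen (uni i)]]"] den_idw[of "[]"]
       hopf_unf in auto)

lemma antipode_left_rl: "distinct [i, j, k, l, m] \<Longrightarrow>
  diag_rl [[Gen (mul l k m)], [Gen (ant j l), Idn (h k)], [Gen (com i j k)]]
    [[Gen (uni m)], [Gen (cou i)]]"
  by (rule diag_rlI) (use hopf_unf in auto)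

lemma antipode_right_rl: "distinct [i, j, k, l, m] \<Longrightarrow>
  diag_rl [[Gen (mul j l m)], [Idn (h j), Gen (ant k l)], [Gen (com i j k)]]
    [[Gen (uni m)], [Gen (cou i)]]"
  by (rule diag_rlI) (use hopf_unf in auto)

section \<open>The antipode and its inverse as anti-homomorphisms of algebras\<close>

lemma S_Si: "distinct [i, j, k] \<Longrightarrow> den [ani i j, ant j k] ([h i], \<one> (wo (h i)), [h k])"
  using den_diag[of "[[Gen (ant j k)], [Gen (ani i j)]]"] inv_antipode by auto

lemma Si_S: "distinct [i, j, k] \<Longrightarrow> den [ant i j, ani j k] ([h i], \<one> (wo (h i)), [h k])"
  using den_diag[of "[[Gen (ani j k)], [Gen (ant i j)]]"] inv_antipode by auto

text \<open>In Sweedler notation, \<open>S(y1) S(x1) x2 y2 S(x3 y3)\<close> is evaluated twice.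
  Cancelling the last two groups leaves \<open>S(y) S(x)\<close>, cancelling the first two leaves
  \<open>S(x y)\<close>.\<close>

lemma S_Mu: "S \<cdot> Mu = Mu \<cdot> (S \<otimes> S) \<cdot> \<Phi> H H"
proof -
  \<comment> \<open>A pattern that recurs below: \<open>0\<close> is a common diagram, and
    \<open>1\<close> and \<open>2\<close> are two evaluations of it. Numerals are wire
    labels.\<close>
  note 0 = den_diag[of "[[Gen (mul 17 16 18)],
      [Gen (mul 13 14 17), Gen (ant 15 16)],
      [Gen (mul 11 12 13), Gen (mul 5 9 14), Gen (mul 6 10 15)],
      [Gen (ant 7 11), Gen (ant 3 12), Idn (h 5), Brd [h 6] [h 9], Idn (h 10)],
      [Brd [h 3, h 5, h 6] [h 7], Idl [h 9, h 10]],
      [Idn (h 3), Gen (com 4 5 6), Idn (h 7), Gen (com 8 9 10)],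
      [Gen (com 1 3 4), Gen (com 2 7 8)]]", simplified]
  note 1 = den_rw[OF 0 rl_sym[OF bialg_rl[of 4 8 19 14 15 5 6 9 10]], simplified]
  note 1 = den_rw[OF 1 assoc_rl[of 13 14 17 16 18 5], simplified]
  note 1 = den_rw[OF 1 antipode_right_rl[of 19 14 15 16 5], simplified]
  note 1 = den_rw[OF 1 Mu_Ep_rl[of 4 8 19], simplified]
  note 1 = den_rw_id[OF 1 counit_right[of 1 3 4], simplified]
  note 1 = den_rw_id[OF 1 counit_right[of 2 7 8], simplified]
  note 1 = den_rw_id[OF 1 unit_right[of 13 5 18], simplified]
  note 1 = den_eq[OF 1 den_diag[of "[[Gen (mul 11 12 13)],
      [Gen (ant 2 11), Gen (ant 1 12)],
      [Brd [h 1] [h 2]]]", simplified], simplified]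
  note 2 = den_rw[OF 0 rl_sym[OF assoc_rl[of 13 5 19 9 17 14]], simplified]
  note 2 = den_rw[OF 2 assoc_rl[of 11 12 13 5 19 14], simplified]
  note 2 = den_rw[OF 2 rl_sym[OF coassoc_rl[of 1 13 6 3 5 4]], simplified]
  note 2 = den_rw[OF 2 antipode_left_rl[of 13 3 5 12 14], simplified]
  note 2 = den_rw_id[OF 2 unit_right[of 11 14 19], simplified]
  note 2 = den_rw_id[OF 2 counit_left[of 1 13 6], simplified]
  note 2 = den_rw[OF 2 rl_sym[OF coassoc_rl[of 2 3 10 7 9 8]], simplified]
  note 2 = den_rw[OF 2 antipode_left_rl[of 3 7 9 11 17], simplified]
  note 2 = den_rw_id[OF 2 unit_left[of 16 17 18], simplified]
  note 2 = den_rw_id[OF 2 counit_left[of 2 3 10], simplified]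
  note 2 = den_eq[OF 2 den_diag[of "[[Gen (ant 15 16)],
      [Gen (mul 1 2 15)]]", simplified], simplified]
  show ?thesis using trans[OF 1[symmetric] 2] by simp
qed

lemma S_Mu_rl:
  assumes "distinct [i, j, k, l]" "distinct [i, j, a, b, l]"
  shows "rl [mul i j k, ant k l] [ant i a, ant j b, mul b a l] [h i, h j] [h l]"
  by (rule rlI[where f = "S \<cdot> Mu"])
     (use assms den_diag[of "[[Gen (ant k l)], [Gen (mul i j k)]]"] S_Mu
       den_diag[of "[[Gen (mul b a l)], [Gen (ant j b), Gen (ant i a)], [Brd [h i] [h j]]]"]
       den_reorder[of "[ant j b, ant i a, mul b a l]" "([h i, h j], S \<cdot> Mu, [h l])" "[ant i a, ant j b, mul b a l]"]
     in auto)

text \<open>Two evaluations of \<open>S(1(1)) 1(2)\<close>, where the arguments in brackets number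
  the factors of the coproduct of the unit.\<close>

lemma S_Et: "S \<cdot> Et = Et"
proof -
  note 0 = den_diag[of "[[Gen (mul 4 3 5)],
      [Gen (ant 2 4), Idn (h 3)],
      [Gen (com 1 2 3)],
      [Gen (uni 1)]]", simplified]
  note 1 = den_rw[OF 0 unit_De_rl[of 1 2 3], simplified]
  note 1 = den_rw_id[OF 1 unit_right[of 4 3 5], simplified]
  note 1 = den_eq[OF 1 den_diag[of "[[Gen (ant 2 4)],
      [Gen (uni 2)]]", simplified], simplified]
  note 2 = den_rw[OF 0 antipode_left_rl[of 1 2 3 4 5], simplified]
  note 2 = den_rw[OF 2 Et_Ep_rl[of 1], simplified]
  note 2 = den_eq[OF 2 den_diag[of "[[Gen (uni 5)]]", simplified], simplified]
  show ?thesis using trans[OF 1[symmetric] 2] by simp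
qed

lemma S_Ep: "Ep \<cdot> S = Ep"
proof -
  note 0 = den_diag[of "[[Gen (cou 5)],
      [Gen (mul 4 3 5)],
      [Gen (ant 2 4), Idn (h 3)],
      [Gen (com 1 2 3)]]", simplified]
  note 1 = den_rw[OF 0 Mu_Ep_rl[of 4 3 5], simplified]
  note 1 = den_rw_id[OF 1 counit_right[of 1 2 3], simplified]
  note 1 = den_eq[OF 1 den_diag[of "[[Gen (cou 4)],
      [Gen (ant 1 4)]]", simplified], simplified]
  note 2 = den_rw[OF 0 antipode_left_rl[of 1 2 3 4 5], simplified]
  note 2 = den_rw[OF 2 Et_Ep_rl[of 5], simplified]
  note 2 = den_eq[OF 2 den_diag[of "[[Gen (cou 1)]]", simplified], simplified]
  show ?thesis using trans[OF 1[symmetric] 2] by simp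
qed

lemma Si_Et: "Si \<cdot> Et = Et"
  using cmp_assoc[OF unit_ob H_ob H_ob H_ob, of Et S Si] hopf_unf inv_antipode S_Et id_left[OF unit_ob H_ob, of Et] by simp

lemma Si_Ep: "Ep \<cdot> Si = Ep"
  using cmp_assoc[OF H_ob H_ob H_ob unit_ob, of Si S Ep] hopf_unf inv_antipode S_Ep id_right[OF H_ob unit_ob, of Ep] by simp

lemma Si_Et_rl: "i \<noteq> j \<Longrightarrow> diag_rl [[Gen (ani i j)], [Gen (uni i)]]
    [[Gen (uni j)]]"
  by (rule diag_rlI) (use Si_Et in auto)

lemma S_Ep_rl: "i \<noteq> j \<Longrightarrow> diag_rl [[Gen (cou j)], [Gen (ant i j)]]
    [[Gen (cou i)]]"
  by (rule diag_rlI) (use S_Ep in auto)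

lemma Si_Ep_rl: "i \<noteq> j \<Longrightarrow> diag_rl [[Gen (cou j)], [Gen (ani i j)]]
    [[Gen (cou i)]]"
  by (rule diag_rlI) (use Si_Ep in auto)

text \<open>The inverse antipode is applied to a product written as
  \<open>S(Si(x)) S(Si(y))\<close>. For a general Hopf algebra in a braided category the inverse
  braiding would appear here; for transparent \<open>H\<close> it equals the braiding.\<close>

lemma Si_Mu: "Si \<cdot> Mu = Mu \<cdot> (Si \<otimes> Si) \<cdot> \<Phi> H H"
proof -
  note 0 = den_diag[of "[[Gen (ani 7 8)],
      [Gen (mul 5 6 7)],
      [Gen (ant 3 5), Gen (ant 4 6)],
      [Gen (ani 1 3), Gen (ani 2 4)]]", simplified]
  note 1 = den_rw_id[OF 0 S_Si[of 1 3 5], simplified]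
  note 1 = den_rw_id[OF 1 S_Si[of 2 4 6], simplified]
  note 1 = den_eq[OF 1 den_diag[of "[[Gen (ani 7 8)],
      [Gen (mul 1 2 7)]]", simplified], simplified]
  note 2 = den_rw[OF 0 rl_sym[OF S_Mu_rl[of 4 3 9 7 6 5]], simplified]
  note 2 = den_rw_id[OF 2 Si_S[of 9 7 8], simplified]
  note 2 = den_eq[OF 2 den_diag[of "[[Gen (mul 4 3 9)],
      [Gen (ani 2 4), Gen (ani 1 3)],
      [Brd [h 1] [h 2]]]", simplified], simplified]
  show ?thesis using trans[OF 1[symmetric] 2] by simp
qed

lemma Si_Mu_rl:
  assumes "distinct [i, j, k, l]" "distinct [i, j, a, b, l]"
  shows "rl [mul i j k, ani k l] [ani i a, ani j b, mul b a l] [h i, h j] [h l]"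
  by (rule rlI[where f = "Si \<cdot> Mu"])
     (use assms den_diag[of "[[Gen (ani k l)], [Gen (mul i j k)]]"] Si_Mu
       den_diag[of "[[Gen (mul b a l)], [Gen (ani j b), Gen (ani i a)], [Brd [h i] [h j]]]"]
       den_reorder[of "[ani j b, ani i a, mul b a l]" "([h i, h j], Si \<cdot> Mu, [h l])" "[ani i a, ani j b, mul b a l]"]
     in auto)

text \<open>\<open>h2 Si(h1) = Si(h1 S(h2))\<close>, so the antipode axiom for \<open>S\<close>
  applies. In the same way \<open>Si_right\<close> rests on \<open>Si(h2) h1 = Si(S(h1) h2)\<close>.
  Thus \<open>Si\<close> is an antipode for the opposite multiplication.\<close>

lemma Si_left: "Mu \<cdot> \<Phi> H H \<cdot> (Si \<otimes> \<one> H) \<cdot> De = Et \<cdot> Ep"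
proof -
  note 0 = den_diag[of "[[Gen (ani 6 7)],
      [Gen (ant 5 6)],
      [Gen (mul 3 4 5)],
      [Brd [h 4] [h 3]],
      [Gen (ani 2 4), Idn (h 3)],
      [Gen (com 1 2 3)]]", simplified]
  note 1 = den_rw_id[OF 0 Si_S[of 5 6 7], simplified]
  note 1 = den_eq[OF 1 den_diag[of "[[Gen (mul 3 4 5)],
      [Brd [h 4] [h 3]],
      [Gen (ani 2 4), Idn (h 3)],
      [Gen (com 1 2 3)]]", simplified], simplified]
  note 2 = den_rw[OF 0 S_Mu_rl[of 3 4 5 6 8 9], simplified]
  note 2 = den_rw_id[OF 2 S_Si[of 2 4 9], simplified]
  note 2 = den_rw[OF 2 antipode_right_rl[of 1 2 3 8 6], simplified]
  note 2 = den_rw[OF 2 Si_Et_rl[of 6 7], simplified]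
  note 2 = den_eq[OF 2 den_diag[of "[[Gen (uni 7)],
      [Gen (cou 1)]]", simplified], simplified]
  show ?thesis using trans[OF 1[symmetric] 2] by simp
qed

lemma Si_right: "Mu \<cdot> \<Phi> H H \<cdot> (\<one> H \<otimes> Si) \<cdot> De = Et \<cdot> Ep"
proof -
  note 0 = den_diag[of "[[Gen (ani 6 7)],
      [Gen (ant 5 6)],
      [Gen (mul 4 2 5)],
      [Brd [h 2] [h 4]],
      [Idn (h 2), Gen (ani 3 4)],
      [Gen (com 1 2 3)]]", simplified]
  note 1 = den_rw_id[OF 0 Si_S[of 5 6 7], simplified]
  note 1 = den_eq[OF 1 den_diag[of "[[Gen (mul 4 2 5)],
      [Brd [h 2] [h 4]],
      [Idn (h 2), Gen (ani 3 4)],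
      [Gen (com 1 2 3)]]", simplified], simplified]
  note 2 = den_rw[OF 0 S_Mu_rl[of 4 2 5 6 8 9], simplified]
  note 2 = den_rw_id[OF 2 S_Si[of 3 4 8], simplified]
  note 2 = den_rw[OF 2 antipode_left_rl[of 1 2 3 9 6], simplified]
  note 2 = den_rw[OF 2 Si_Et_rl[of 6 7], simplified]
  note 2 = den_eq[OF 2 den_diag[of "[[Gen (uni 7)],
      [Gen (cou 1)]]", simplified], simplified]
  show ?thesis using trans[OF 1[symmetric] 2] by simp
qed

lemma Si_left_rl: "distinct [i, j, k, l, m] \<Longrightarrow> diag_rl [[Gen (mul k l m)], [Brd [h l] [h k]], [Gen (ani j l), Idn (h k)], [Gen (com i j k)]]
    [[Gen (uni m)], [Gen (cou i)]]"
  by (rule diag_rlI) (use Si_left in auto)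

lemma Si_right_rl: "distinct [i, j, k, l, m] \<Longrightarrow> diag_rl [[Gen (mul l j m)], [Brd [h j] [h l]], [Idn (h j), Gen (ani k l)], [Gen (com i j k)]]
    [[Gen (uni m)], [Gen (cou i)]]"
  by (rule diag_rlI) (use Si_right in auto)

end

section \<open>Left Yetter-Drinfel'd modules and the left center\<close>

context transparent_hopf begin

abbreviation "act M \<mu> i m n \<equiv> ([h i, Nw M m], \<mu>, [Nw M n])"
abbreviation "coa M l m i n \<equiv> ([Nw M m], l, [h i, Nw M n])"
abbreviation "mor M N f m n \<equiv> ([Nw M m], f, [Nw N n])"
text \<open>A crossing of two arbitrary strands is not determined by the connections alone and has
  to be kept as a box. The lemmas named \<open>phi_...\<close> let other boxes slide through
  it.\<close>

abbreviation "phi M X m x y n \<equiv> ([Nw M m, Nw X x], \<Phi> M X, [Nw X y, Nw M n])"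

lemma okop_phi [simp]: "M \<in> ob C \<Longrightarrow> X \<in> ob C \<Longrightarrow> okop (phi M X m x y n)"
  by (auto simp: okop_def ok_def braid_hom)

lemma okop_mor [simp]: "M \<in> ob C \<Longrightarrow> N \<in> ob C \<Longrightarrow> f \<in> hom C M N \<Longrightarrow> okop (mor M N f m n)"
  by (auto simp: okop_def ok_def)

lemma okop_act: "M \<in> ob C \<Longrightarrow> \<mu> \<in> hom C (H \<boxtimes> M) M \<Longrightarrow> okop (act M \<mu> i m n)"
  by (auto simp: okop_def ok_def)

lemma okop_coa: "M \<in> ob C \<Longrightarrow> l \<in> hom C M (H \<boxtimes> M) \<Longrightarrow> okop (coa M l m i n)"
  by (auto simp: okop_def ok_def)

lemma left_moduleD:
  assumes "left_module C A M \<mu>"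
  shows "M \<in> ob C" "\<mu> \<in> hom C (H \<boxtimes> M) M" "\<mu> \<cdot> (Mu \<otimes> \<one> M) = \<mu> \<cdot> (\<one> H \<otimes> \<mu>)" "\<mu> \<cdot> (Et \<otimes> \<one> M) = \<one> M"
    "okop (act M \<mu> i m n)"
  using assms by (auto simp: left_module_def okop_act)

lemma left_comoduleD:
  assumes "left_comodule C A M l"
  shows "M \<in> ob C" "l \<in> hom C M (H \<boxtimes> M)" "(De \<otimes> \<one> M) \<cdot> l = (\<one> H \<otimes> l) \<cdot> l" "(Ep \<otimes> \<one> M) \<cdot> l = \<one> M"
    "okop (coa M l m i n)"
  using assms by (auto simp: left_comodule_def okop_coa)

lemma act_rl:
  assumes M: "left_module C A M \<mu>" and "distinct [i, j, k]" "distinct [m, n, p]"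
  shows "diag_rl [[Gen ([h k, Nw M m], \<mu>, [Nw M n])], [Gen (mul i j k), Idn (Nw M m)]]
    [[Gen ([h i, Nw M p], \<mu>, [Nw M n])], [Idn (h i), Gen ([h j, Nw M m], \<mu>, [Nw M p])]]"
  by (rule diag_rlI) (use assms left_moduleD[OF M] in auto)

lemma act_unit:
  assumes M: "left_module C A M \<mu>" and "m \<noteq> n"
  shows "den [uni i, act M \<mu> i m n] ([Nw M m], \<one> (wo (Nw M m)), [Nw M n])"
  using assms left_moduleD[OF M] den_diag[of "[[Gen ([h i, Nw M m], \<mu>, [Nw M n])], [Gen (uni i), Idn (Nw M m)]]"]
  by auto

lemma coa_rl:
  assumes M: "left_comodule C A M l" and "distinct [i, j, k]" "distinct [m, n, p]"
  shows "diag_rl [[Gen (com i j k), Idn (Nw M n)], [Gen ([Nw M m], l, [h i, Nw M n])]]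
    [[Idn (h j), Gen ([Nw M p], l, [h k, Nw M n])], [Gen ([Nw M m], l, [h j, Nw M p])]]"
  by (rule diag_rlI) (use assms left_comoduleD[OF M] in auto)

lemma coa_unit:
  assumes M: "left_comodule C A M l" and "m \<noteq> n"
  shows "den [coa M l m i n, cou i] ([Nw M m], \<one> (wo (Nw M m)), [Nw M n])"
  using assms left_comoduleD[OF M] den_diag[of "[[Gen (cou i), Idn (Nw M n)], [Gen ([Nw M m], l, [h i, Nw M n])]]"]
  by auto

lemma left_ydD:
  assumes "left_yd_module C A M \<mu> l"
  shows "left_module C A M \<mu>" "left_comodule C A M l"
  using assms by (auto simp: left_yd_module_def Let_def)

text \<open>One side of the Yetter-Drinfel'd condition, named in order to serve as the common value
  of both programs in \<open>yd_rl\<close>.\<close>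

definition yd_left :: "'o \<Rightarrow> 'm \<Rightarrow> 'm \<Rightarrow> 'm" where
  "yd_left M \<mu> l = (Mu \<otimes> \<one> M) \<cdot> (\<one> H \<otimes> \<Phi> M H) \<cdot> (l \<otimes> \<one> H) \<cdot> (\<mu> \<otimes> \<one> H) \<cdot> (\<one> H \<otimes> \<Phi> H M) \<cdot> (De \<otimes> \<one> M)"

lemma yd_left_den:
  assumes M: "M \<in> ob C" "\<mu> \<in> hom C (H \<boxtimes> M) M" "l \<in> hom C M (H \<boxtimes> M)" and d: "distinct [i, j, k, p, r]" "distinct [m, n, q]"
  shows "den [com i j k, act M \<mu> j m n, coa M l n p q, mul p k r] ([h i, Nw M m], yd_left M \<mu> l, [h r, Nw M q])"
  using den_diag[of "[[Gen (mul p k r), Idn (Nw M q)], [Idn (h p), Brd [Nw M q] [h k]], [Gen ([Nw M n], l, [h p, Nw M q]), Idn (h k)],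
      [Gen ([h j, Nw M m], \<mu>, [Nw M n]), Idn (h k)], [Idn (h j), Brd [h k] [Nw M m]], [Gen (com i j k), Idn (Nw M m)]]"]
    M d okop_act[OF M(1,2)] okop_coa[OF M(1,3)] by (auto simp: yd_left_def)

lemma yd_right_den:
  assumes M: "M \<in> ob C" "\<mu> \<in> hom C (H \<boxtimes> M) M" "l \<in> hom C M (H \<boxtimes> M)" and d: "distinct [i, j, k, p, r]" "distinct [m, n, q]"
  shows "den [com i j k, coa M l m p n, mul j p r, act M \<mu> k n q]
    ([h i, Nw M m], (Mu \<otimes> \<mu>) \<cdot> (\<one> H \<otimes> \<Phi> H H \<otimes> \<one> M) \<cdot> (De \<otimes> l), [h r, Nw M q])"
  using den_diag[of "[[Gen (mul j p r), Gen ([h k, Nw M n], \<mu>, [Nw M q])], [Idn (h j), Brd [h k] [h p], Idn (Nw M n)],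
      [Gen (com i j k), Gen ([Nw M m], l, [h p, Nw M n])]]"]
    M d okop_act[OF M(1,2)] okop_coa[OF M(1,3)] by auto

lemma yd_rl:
  assumes M: "left_yd_module C A M \<mu> l" and "distinct [i, j, k, p, r]" "distinct [m, n, q]" "distinct [i, a, b, c, r]" "distinct [m, d, q]"
  shows "rl [com i j k, act M \<mu> j m n, coa M l n p q, mul p k r] [com i a b, coa M l m c d, mul a c r, act M \<mu> b d q]
    [h i, Nw M m] [h r, Nw M q]"
proof (rule rlI)
  note D = left_moduleD(1,2)[OF left_ydD(1)[OF M]] left_comoduleD(2)[OF left_ydD(2)[OF M]]
  show "den [com i j k, act M \<mu> j m n, coa M l n p q, mul p k r] ([h i, Nw M m], yd_left M \<mu> l, [h r, Nw M q])"
    using yd_left_den[OF D assms(2,3)] .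
  show "den [com i a b, coa M l m c d, mul a c r, act M \<mu> b d q] ([h i, Nw M m], yd_left M \<mu> l, [h r, Nw M q])"
    using yd_right_den[OF D assms(4,5)] M by (simp add: left_yd_module_def Let_def yd_left_def)
qed

lemma hom_rl:
  assumes M: "left_module C A M \<mu>" "left_module C A N \<nu>" and f: "f \<in> hom C M N" "f \<cdot> \<mu> = \<nu> \<cdot> (\<one> H \<otimes> f)"
    and d: "distinct [m, n, p]" "distinct [m, q, p]"
  shows "diag_rl [[Gen ([Nw M n], f, [Nw N p])], [Gen ([h i, Nw M m], \<mu>, [Nw M n])]]
    [[Gen ([h i, Nw N q], \<nu>, [Nw N p])], [Idn (h i), Gen ([Nw M m], f, [Nw N q])]]"
  by (rule diag_rlI) (use M f d left_moduleD[OF M(1)] left_moduleD[OF M(2)] in auto)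

lemma cohom_rl:
  assumes M: "left_comodule C A M l" "left_comodule C A N l'" and f: "f \<in> hom C M N" "l' \<cdot> f = (\<one> H \<otimes> f) \<cdot> l"
    and d: "distinct [m, n, p]" "distinct [m, q, p]"
  shows "diag_rl [[Gen ([Nw N n], l', [h i, Nw N p])], [Gen ([Nw M m], f, [Nw N n])]]
    [[Idn (h i), Gen ([Nw M q], f, [Nw N p])], [Gen ([Nw M m], l, [h i, Nw M q])]]"
  by (rule diag_rlI) (use M f d left_comoduleD[OF M(1)] left_comoduleD[OF M(2)] in auto)

lemma actT_den:
  assumes M: "left_module C A M \<mu>" "left_module C A N \<nu>" and d: "distinct [i, j, k]" "distinct [m, n, p, q]"
  shows "den [com i j k, act M \<mu> j m p, act N \<nu> k n q] ([h i, Nw M m, Nw N n], left_action_tensor C A M \<mu> N \<nu>, [Nw M p, Nw N q])"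
  using den_diag[of "[[Gen ([h j, Nw M m], \<mu>, [Nw M p]), Gen ([h k, Nw N n], \<nu>, [Nw N q])], [Idn (h j), Brd [h k] [Nw M m], Idn (Nw N n)],
      [Gen (com i j k), Idn (Nw M m), Idn (Nw N n)]]"] d left_moduleD[OF M(1)] left_moduleD[OF M(2)]
  by (auto simp: left_action_tensor_def)

lemma coaT_den:
  assumes M: "left_comodule C A M l" "left_comodule C A N l'" and d: "distinct [i, j, k]" "distinct [m, n, p, q]"
  shows "den [coa M l m i p, coa N l' n j q, mul i j k] ([Nw M m, Nw N n], left_coaction_tensor C A M l N l', [h k, Nw M p, Nw N q])"
  using den_diag[of "[[Gen (mul i j k), Idn (Nw M p), Idn (Nw N q)], [Idn (h i), Brd [Nw M p] [h j], Idn (Nw N q)],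
      [Gen ([Nw M m], l, [h i, Nw M p]), Gen ([Nw N n], l', [h j, Nw N q])]]"] d left_comoduleD[OF M(1)] left_comoduleD[OF M(2)]
  by (auto simp: left_coaction_tensor_def)

text \<open>A tensor product of modules runs on two wires, so that its action can be resolved into
  the actions of the factors.\<close>

abbreviation "actT M \<mu> N \<nu> i m n p q \<equiv> ([h i, Nw M m, Nw N n], left_action_tensor C A M \<mu> N \<nu>, [Nw M p, Nw N q])"
abbreviation "coaT M l N l' m n i p q \<equiv> ([Nw M m, Nw N n], left_coaction_tensor C A M l N l', [h i, Nw M p, Nw N q])"

lemma okop_den: "den p t \<Longrightarrow> filter nt (dm t) = [] \<longleftrightarrow> filter nt (cd t) = [] \<Longrightarrow> okop t"
  by (simp add: okop_def)

text \<open>A morphism defined as a composite can be handled as a single box and unfolded on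
  demand.\<close>

lemma rl_op:
  assumes "den p t" "filter nt (dm t) = [] \<longleftrightarrow> filter nt (cd t) = []"
  shows "rl [t] p (dm t) (cd t)"
proof -
  have "den [t] t" using assms by (intro den_op okop_den[OF assms]) simp_all
  thus ?thesis using assms by (cases t) (auto simp: rl_def)
qed

lemma actT_rl:
  assumes M: "left_module C A M \<mu>" "left_module C A N \<nu>" and d: "distinct [i, j, k]" "distinct [m, n, p, q]"
  shows "rl [actT M \<mu> N \<nu> i m n p q] [com i j k, act M \<mu> j m p, act N \<nu> k n q] [h i, Nw M m, Nw N n] [Nw M p, Nw N q]"
  using rl_op[OF actT_den[OF assms]] by simp

lemma coaT_rl:
  assumes M: "left_comodule C A M l" "left_comodule C A N l'" and d: "distinct [i, j, k]" "distinct [m, n, p, q]"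
  shows "rl [coaT M l N l' m n k p q] [coa M l m i p, coa N l' n j q, mul i j k] [Nw M m, Nw N n] [h k, Nw M p, Nw N q]"
  using rl_op[OF coaT_den[OF assms]] by simp

lemma okop_actT:
  assumes M: "left_module C A M \<mu>" "left_module C A N \<nu>"
  shows "okop (actT M \<mu> N \<nu> i m n p q)"
proof -
  have "okop (actT M \<mu> N \<nu> 1 1 2 3 4)" by (rule okop_den[OF actT_den[OF M, of 1 2 3]]) simp_all
  thus ?thesis by (auto simp: okop_def ok_def)
qed

lemma okop_coaT:
  assumes M: "left_comodule C A M l" "left_comodule C A N l'"
  shows "okop (coaT M l N l' m n i p q)"
proof -
  have "okop (coaT M l N l' 1 2 1 3 4)" by (rule okop_den[OF coaT_den[OF M, of 2 3 1]]) simp_all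
  thus ?thesis by (auto simp: okop_def ok_def)
qed

lemma left_module_tensor:
  assumes M: "left_module C A M \<mu>" and N: "left_module C A N \<nu>"
  shows "left_module C A (M \<boxtimes> N) (left_action_tensor C A M \<mu> N \<nu>)"
proof -
  note [simp] = left_moduleD(1,2,5)[OF M] left_moduleD(1,2,5)[OF N] okop_actT[OF M N]
  note 1 = den_diag[of "[[Gen (actT M \<mu> N \<nu> 3 4 5 6 7)], [Gen (mul 1 2 3), Idl [Nw M 4, Nw N 5]]]", simplified]
  note 1 = den_rw[OF 1 actT_rl[OF M N, of 3 8 9 4 5 6 7], simplified]
  note 1 = den_rw[OF 1 bialg_rl[of 1 2 3 8 9 10 11 12 13], simplified]
  note 1 = den_rw[OF 1 act_rl[OF M, of 10 12 8 4 6 3], simplified]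
  note 1 = den_rw[OF 1 act_rl[OF N, of 11 13 9 5 7 8], simplified]
  note 2 = den_diag[of "[[Gen (actT M \<mu> N \<nu> 1 3 8 6 7)], [Idn (h 1), Gen (actT M \<mu> N \<nu> 2 4 5 3 8)]]", simplified]
  note 2 = den_rw[OF 2 actT_rl[OF M N, of 2 12 13 4 5 3 8], simplified]
  note 2 = den_rw[OF 2 actT_rl[OF M N, of 1 10 11 3 8 6 7], simplified]
  have "left_action_tensor C A M \<mu> N \<nu> \<cdot> (Mu \<otimes> \<one> (M \<boxtimes> N)) = left_action_tensor C A M \<mu> N \<nu> \<cdot> (\<one> H \<otimes> left_action_tensor C A M \<mu> N \<nu>)"
    using den_eq[OF 1 2] by simp
  moreover
  note 1 = den_diag[of "[[Gen (actT M \<mu> N \<nu> 3 4 5 6 7)], [Gen (uni 3), Idl [Nw M 4, Nw N 5]]]", simplified]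
  note 1 = den_rw[OF 1 actT_rl[OF M N, of 3 1 2 4 5 6 7], simplified]
  note 1 = den_rw[OF 1 unit_De_rl[of 3 1 2], simplified]
  note 1 = den_rw_id[OF 1 act_unit[OF M, of 4 6 1], simplified]
  note 1 = den_rw_id[OF 1 act_unit[OF N, of 5 7 2], simplified]
  note 2 = den_diag[of "[[Idl [Nw M 4, Nw N 5]]]", simplified]
  have "left_action_tensor C A M \<mu> N \<nu> \<cdot> (Et \<otimes> \<one> (M \<boxtimes> N)) = \<one> (M \<boxtimes> N)"
    using den_eq[OF 1 2] by simp
  moreover have "left_action_tensor C A M \<mu> N \<nu> \<in> hom C (H \<boxtimes> M \<boxtimes> N) (M \<boxtimes> N)"
    using okop_actT[OF M N, of 1 1 2 3 4] by (simp add: okop_def ok_def)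
  ultimately show ?thesis by (simp add: left_module_def ten_ob)
qed

lemma left_action_tensor_assoc:
  assumes M: "left_module C A M \<mu>" and N: "left_module C A N \<nu>" and P: "left_module C A P \<pi>"
  shows "left_action_tensor C A (M \<boxtimes> N) (left_action_tensor C A M \<mu> N \<nu>) P \<pi> =
    left_action_tensor C A M \<mu> (N \<boxtimes> P) (left_action_tensor C A N \<nu> P \<pi>)"
proof -
  note [simp] = left_moduleD(1,2,5)[OF M] left_moduleD(1,2,5)[OF N] left_moduleD(1,2,5)[OF P] okop_actT[OF M N] okop_actT[OF N P]
  note 1 = den_diag[of "[[Gen (actT M \<mu> N \<nu> 2 4 5 7 8), Gen (act P \<pi> 3 6 9)], [Idn (h 2), Brd [h 3] [Nw M 4, Nw N 5], Idn (Nw P 6)], [Gen (com 1 2 3), Idl [Nw M 4,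
    Nw N 5], Idn (Nw P 6)]]", simplified]
  note 1 = den_rw[OF 1 actT_rl[OF M N, of 2 10 11 4 5 7 8], simplified]
  note 1 = den_rw[OF 1 coassoc_rl[of 1 2 3 10 11 12], simplified]
  note 2 = den_diag[of "[[Gen (act M \<mu> 10 4 7), Gen (actT N \<nu> P \<pi> 12 5 6 8 9)], [Idn (h 10), Brd [h 12] [Nw M 4], Idl [Nw N 5, Nw P 6]], [Gen (com 1 10 12),
    Idn (Nw M 4), Idl [Nw N 5, Nw P 6]]]", simplified]
  note 2 = den_rw[OF 2 actT_rl[OF N P, of 12 11 3 5 6 8 9], simplified]
  show ?thesis using den_eq[OF 1 2] by (simp add: left_action_tensor_def[of _ _ "_ \<boxtimes> _"] left_action_tensor_def[of _ _ _ _ "_ \<boxtimes> _"])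
qed

lemma left_action_tensor_unit:
  assumes M: "left_module C A M \<mu>"
  shows "left_action_tensor C A \<I> Ep M \<mu> = \<mu>" "left_action_tensor C A M \<mu> \<I> Ep = \<mu>"
proof -
  note [simp] = left_moduleD(1,2,5)[OF M]
  note 1 = den_diag[of "[[Gen (cou 2), Gen (act M \<mu> 3 4 5)], [Idn (h 2), Brd [h 3] [], Idn (Nw M 4)], [Gen (com 1 2 3), Idl [], Idn (Nw M 4)]]", simplified]
  note 1 = den_rw_id[OF 1 counit_left[of 1 2 3], simplified]
  note 2 = den_diag[of "[[Gen (act M \<mu> 1 4 5)]]", simplified]
  have "left_action_tensor C A \<I> Ep M \<mu> = \<mu>"
    using den_eq[OF 1 2] by (simp add: left_action_tensor_def left_action_tensor_def)
  thus "left_action_tensor C A \<I> Ep M \<mu> = \<mu>" .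
  note 1 = den_diag[of "[[Gen (act M \<mu> 2 4 5), Gen (cou 3)], [Idn (h 2), Brd [h 3] [Nw M 4], Idl []], [Gen (com 1 2 3), Idn (Nw M 4), Idl []]]", simplified]
  note 1 = den_rw_id[OF 1 counit_right[of 1 2 3], simplified]
  note 2 = den_diag[of "[[Gen (act M \<mu> 1 4 5)]]", simplified]
  have "left_action_tensor C A M \<mu> \<I> Ep = \<mu>"
    using den_eq[OF 1 2] by (simp add: left_action_tensor_def left_action_tensor_def)
  thus "left_action_tensor C A M \<mu> \<I> Ep = \<mu>" .
qed

lemma left_module_hom_tensor:
  assumes M: "left_module C A M \<mu>" and N: "left_module C A N \<nu>" and P: "left_module C A P \<pi>" and Q: "left_module C A Q \<kappa>"
    and f: "f \<in> hom C M P" "f \<cdot> \<mu> = \<pi> \<cdot> (\<one> H \<otimes> f)" and g: "g \<in> hom C N Q" "g \<cdot> \<nu> = \<kappa> \<cdot> (\<one> H \<otimes> g)"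
  shows "(f \<otimes> g) \<cdot> left_action_tensor C A M \<mu> N \<nu> = left_action_tensor C A P \<pi> Q \<kappa> \<cdot> (\<one> H \<otimes> f \<otimes> g)"
proof -
  note [simp] = left_moduleD(1,2,5)[OF M] left_moduleD(1,2,5)[OF N] left_moduleD(1,2,5)[OF P] left_moduleD(1,2,5)[OF Q]
    okop_actT[OF M N] okop_actT[OF P Q] f(1) g(1)
  note 1 = den_diag[of "[[Gen (mor M P f 4 6), Gen (mor N Q g 5 7)], [Gen (actT M \<mu> N \<nu> 1 2 3 4 5)]]", simplified]
  note 1 = den_rw[OF 1 actT_rl[OF M N, of 1 8 9 2 3 4 5], simplified]
  note 1 = den_rw[OF 1 hom_rl[OF M P f, of 2 4 6 10 8], simplified]
  note 1 = den_rw[OF 1 hom_rl[OF N Q g, of 3 5 7 4 9], simplified]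
  note 2 = den_diag[of "[[Gen (actT P \<pi> Q \<kappa> 1 10 4 6 7)], [Idn (h 1), Gen (mor M P f 2 10), Gen (mor N Q g 3 4)]]", simplified]
  note 2 = den_rw[OF 2 actT_rl[OF P Q, of 1 8 9 10 4 6 7], simplified]
  show ?thesis using den_eq[OF 1 2] by simp
qed

section \<open>The half braiding of a comodule\<close>

definition half_br :: "'o \<Rightarrow> 'm \<Rightarrow> 'o \<Rightarrow> 'm \<Rightarrow> 'm" where
  "half_br M l X \<chi> = (\<chi> \<otimes> \<one> M) \<cdot> (\<one> H \<otimes> \<Phi> M X) \<cdot> (l \<otimes> \<one> X)"

abbreviation "hbr M l X \<chi> m x y n \<equiv> ([Nw M m, Nw X x], half_br M l X \<chi>, [Nw X y, Nw M n])"

text \<open>\<open>x \<otimes> m \<mapsto> m(-1) x \<otimes> m(0)\<close>, the part of the half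
  braiding that remains when the crossing of \<open>M\<close> and \<open>X\<close> is split off.
  Invertibility of the half braiding reduces to that of this map, with inverse
  \<open>untwist\<close>.\<close>

definition twist :: "'o \<Rightarrow> 'm \<Rightarrow> 'o \<Rightarrow> 'm \<Rightarrow> 'm" where
  "twist M l X \<chi> = (\<chi> \<otimes> \<one> M) \<cdot> (\<Phi> X H \<otimes> \<one> M) \<cdot> (\<one> X \<otimes> l)"

definition untwist :: "'o \<Rightarrow> 'm \<Rightarrow> 'o \<Rightarrow> 'm \<Rightarrow> 'm" where
  "untwist M l X \<chi> = (\<chi> \<otimes> \<one> M) \<cdot> (\<Phi> X H \<otimes> \<one> M) \<cdot> (\<one> X \<otimes> Si \<otimes> \<one> M) \<cdot> (\<one> X \<otimes> l)"

text \<open>Naturality of \<open>\<Phi> M X\<close> at the action, split by a hexagon. The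
  additional crossing involves a strand of \<open>H\<close> and leaves no box. The rules for
  \<open>phi_act_left\<close> and \<open>phi_coa_left\<close> arise likewise.\<close>

lemma phi_act_right:
  assumes M: "M \<in> ob C" and X: "left_module C A X \<chi>" and d: "distinct [x, y, z, m, n]" "distinct [x, w, z, m, n]"
  shows "rl [act X \<chi> i x y, phi M X m y z n] [phi M X m x w n, act X \<chi> i w z] [Nw M m, h i, Nw X x] [Nw X z, Nw M n]"
proof (rule rlI[where f = "\<Phi> M X \<cdot> (\<one> M \<otimes> \<chi>)"])
  note [simp] = M left_moduleD(1,2,5)[OF X]
  show "den [act X \<chi> i x y, phi M X m y z n] ([Nw M m, h i, Nw X x], \<Phi> M X \<cdot> (\<one> M \<otimes> \<chi>), [Nw X z, Nw M n])"
    using d den_diag[of "[[Gen ([Nw M m, Nw X y], \<Phi> M X, [Nw X z, Nw M n])], [Idn (Nw M m), Gen ([h i, Nw X x], \<chi>, [Nw X y])]]"]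
    by auto
  show "den [phi M X m x w n, act X \<chi> i w z] ([Nw M m, h i, Nw X x], \<Phi> M X \<cdot> (\<one> M \<otimes> \<chi>), [Nw X z, Nw M n])"
    using d den_diag[of "[[Gen ([h i, Nw X w], \<chi>, [Nw X z]), Idn (Nw M n)], [Idn (h i), Gen ([Nw M m, Nw X x], \<Phi> M X, [Nw X w, Nw M n])],
      [Brd [Nw M m] [h i], Idn (Nw X x)]]"] braid_natural[of M M "H \<boxtimes> X" X "\<one> M" \<chi>] braid_ten_right[of M H X]
    by (auto simp: ten_ob id_hom)
qed

lemma phi_act_left:
  assumes M: "left_module C A M \<mu>" and X: "X \<in> ob C" and d: "distinct [m, p, x, y, n]" "distinct [m, x, y, q, n]"
  shows "rl [act M \<mu> i m p, phi M X p x y n] [phi M X m x y q, act M \<mu> i q n] [h i, Nw M m, Nw X x] [Nw X y, Nw M n]"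
proof (rule rlI[where f = "\<Phi> M X \<cdot> (\<mu> \<otimes> \<one> X)"])
  note [simp] = X left_moduleD(1,2,5)[OF M]
  show "den [act M \<mu> i m p, phi M X p x y n] ([h i, Nw M m, Nw X x], \<Phi> M X \<cdot> (\<mu> \<otimes> \<one> X), [Nw X y, Nw M n])"
    using d den_diag[of "[[Gen ([Nw M p, Nw X x], \<Phi> M X, [Nw X y, Nw M n])], [Gen ([h i, Nw M m], \<mu>, [Nw M p]), Idn (Nw X x)]]"]
    by auto
  show "den [phi M X m x y q, act M \<mu> i q n] ([h i, Nw M m, Nw X x], \<Phi> M X \<cdot> (\<mu> \<otimes> \<one> X), [Nw X y, Nw M n])"
    using d den_diag[of "[[Idn (Nw X y), Gen ([h i, Nw M q], \<mu>, [Nw M n])], [Brd [h i] [Nw X y], Idn (Nw M q)],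
      [Idn (h i), Gen ([Nw M m, Nw X x], \<Phi> M X, [Nw X y, Nw M q])]]"]
      braid_natural[of "H \<boxtimes> M" M X X \<mu> "\<one> X"] braid_ten_left[of H M X]
    by (auto simp: ten_ob id_hom)
qed

lemma phi_coa_left:
  assumes M: "left_comodule C A M l" and X: "X \<in> ob C" and d: "distinct [m, p, x, y, n]" "distinct [m, x, y, q, n]"
  shows "rl [coa M l m i p, phi M X p x y n] [phi M X m x y q, coa M l q i n] [Nw M m, Nw X x] [Nw X y, h i, Nw M n]"
proof (rule rlI[where f = "(\<one> X \<otimes> l) \<cdot> \<Phi> M X"])
  note [simp] = X left_comoduleD(1,2,5)[OF M]
  have "\<one> H \<otimes> \<Phi> M X \<in> hom C (H \<boxtimes> M \<boxtimes> X) (H \<boxtimes> X \<boxtimes> M)" "l \<otimes> \<one> X \<in> hom C (M \<boxtimes> X) (H \<boxtimes> M \<boxtimes> X)"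
    "\<Phi> H X \<otimes> \<one> M \<in> hom C (H \<boxtimes> X \<boxtimes> M) (X \<boxtimes> H \<boxtimes> M)"
    using ten_hom[of H H "M \<boxtimes> X" "X \<boxtimes> M" "\<one> H" "\<Phi> M X"] ten_hom[of M "H \<boxtimes> M" X X l "\<one> X"]
      ten_hom[of "H \<boxtimes> X" "X \<boxtimes> H" M M "\<Phi> H X" "\<one> M"] by (simp_all add: ten_ob id_hom braid_hom tenO_assoc)
  from cmp_assoc[OF _ _ _ _ this(2,1,3)]
  have "(\<Phi> H X \<otimes> \<one> M) \<cdot> (\<one> H \<otimes> \<Phi> M X) \<cdot> (l \<otimes> \<one> X) = (\<one> X \<otimes> l) \<cdot> \<Phi> M X"
    using braid_natural[of M "H \<boxtimes> M" X X l "\<one> X"] braid_ten_left[of H M X] by (simp add: ten_ob id_hom)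
  thus "den [coa M l m i p, phi M X p x y n] ([Nw M m, Nw X x], (\<one> X \<otimes> l) \<cdot> \<Phi> M X, [Nw X y, h i, Nw M n])"
    using d den_diag[of "[[Brd [h i] [Nw X y], Idn (Nw M n)], [Idn (h i), Gen ([Nw M p, Nw X x], \<Phi> M X, [Nw X y, Nw M n])],
      [Gen ([Nw M m], l, [h i, Nw M p]), Idn (Nw X x)]]"]
    by auto
  show "den [phi M X m x y q, coa M l q i n] ([Nw M m, Nw X x], (\<one> X \<otimes> l) \<cdot> \<Phi> M X, [Nw X y, h i, Nw M n])"
    using d den_diag[of "[[Idn (Nw X y), Gen ([Nw M q], l, [h i, Nw M n])], [Gen ([Nw M m, Nw X x], \<Phi> M X, [Nw X y, Nw M q])]]"]
    by auto
qed

lemma phi_mor_right: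
  assumes o: "M \<in> ob C" "X \<in> ob C" "Y \<in> ob C" and f: "f \<in> hom C X Y" and d: "distinct [m, x, y, z, n]" "distinct [m, x, w, n, z]"
  shows "rl [mor X Y f x y, phi M Y m y z n] [phi M X m x w n, mor X Y f w z] [Nw M m, Nw X x] [Nw Y z, Nw M n]"
  by (rule rlI[where f = "\<Phi> M Y \<cdot> (\<one> M \<otimes> f)"])
     (use o f d braid_natural[of M M X Y "\<one> M" f]
       den_diag[of "[[Gen ([Nw M m, Nw Y y], \<Phi> M Y, [Nw Y z, Nw M n])], [Idn (Nw M m), Gen ([Nw X x], f, [Nw Y y])]]"]
       den_diag[of "[[Gen ([Nw X w], f, [Nw Y z]), Idn (Nw M n)], [Gen ([Nw M m, Nw X x], \<Phi> M X, [Nw X w, Nw M n])]]"]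
      in \<open>auto simp: arr id_hom\<close>)

lemma phi_mor_left:
  assumes o: "M \<in> ob C" "N \<in> ob C" "X \<in> ob C" and f: "f \<in> hom C M N" and d: "distinct [m, p, x, y, n]" "distinct [m, x, y, q, n]"
  shows "rl [mor M N f m p, phi N X p x y n] [phi M X m x y q, mor M N f q n] [Nw M m, Nw X x] [Nw X y, Nw N n]"
  by (rule rlI[where f = "\<Phi> N X \<cdot> (f \<otimes> \<one> X)"])
     (use o f d braid_natural[of M N X X f "\<one> X"]
       den_diag[of "[[Gen ([Nw N p, Nw X x], \<Phi> N X, [Nw X y, Nw N n])], [Gen ([Nw M m], f, [Nw N p]), Idn (Nw X x)]]"]
       den_diag[of "[[Idn (Nw X y), Gen ([Nw M q], f, [Nw N n])], [Gen ([Nw M m, Nw X x], \<Phi> M X, [Nw X y, Nw M q])]]"]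
      in \<open>auto simp: arr id_hom\<close>)

lemma phi_ten_right:
  assumes o: "M \<in> ob C" "X \<in> ob C" "Y \<in> ob C" and d: "distinct [m, x, y, u, v, n]" "distinct [m, x, u, p, y, v, n]"
  shows "rl [([Nw M m, Nw X x, Nw Y y], \<Phi> M (X \<boxtimes> Y), [Nw X u, Nw Y v, Nw M n])] [phi M X m x u p, phi M Y p y v n]
    [Nw M m, Nw X x, Nw Y y] [Nw X u, Nw Y v, Nw M n]"
  using o d braid_ten_right[of M X Y] rl_op[of "[phi M X m x u p, phi M Y p y v n]" "([Nw M m, Nw X x, Nw Y y], \<Phi> M (X \<boxtimes> Y), [Nw X u, Nw Y v, Nw M n])"]
    den_diag[of "[[Idn (Nw X u), Gen ([Nw M p, Nw Y y], \<Phi> M Y, [Nw Y v, Nw M n])], [Gen ([Nw M m, Nw X x], \<Phi> M X, [Nw X u, Nw M p]), Idn (Nw Y y)]]"]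
  by auto

lemma phi_ten_left:
  assumes o: "M \<in> ob C" "N \<in> ob C" "X \<in> ob C" and d: "distinct [m, n, x, y, p, q]" "distinct [m, n, x, z, y, p, q]"
  shows "rl [([Nw M m, Nw N n, Nw X x], \<Phi> (M \<boxtimes> N) X, [Nw X y, Nw M p, Nw N q])] [phi N X n x z q, phi M X m z y p]
    [Nw M m, Nw N n, Nw X x] [Nw X y, Nw M p, Nw N q]"
  using o d braid_ten_left[of M N X] rl_op[of "[phi N X n x z q, phi M X m z y p]" "([Nw M m, Nw N n, Nw X x], \<Phi> (M \<boxtimes> N) X, [Nw X y, Nw M p, Nw N q])"]
    den_diag[of "[[Gen ([Nw M m, Nw X z], \<Phi> M X, [Nw X y, Nw M p]), Idn (Nw N q)], [Idn (Nw M m), Gen ([Nw N n, Nw X x], \<Phi> N X, [Nw X z, Nw N q])]]"]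
  by auto

lemma half_br_den:
  assumes M: "left_comodule C A M l" and X: "left_module C A X \<chi>" and d: "distinct [m, n, x, y, p, z]"
  shows "den [coa M l m i n, phi M X n x y p, act X \<chi> i y z] ([Nw M m, Nw X x], half_br M l X \<chi>, [Nw X z, Nw M p])"
  using den_diag[of "[[Gen ([h i, Nw X y], \<chi>, [Nw X z]), Idn (Nw M p)], [Idn (h i), Gen ([Nw M n, Nw X x], \<Phi> M X, [Nw X y, Nw M p])],
      [Gen ([Nw M m], l, [h i, Nw M n]), Idn (Nw X x)]]"] d left_comoduleD(1,2,5)[OF M] left_moduleD(1,2,5)[OF X]
  by (auto simp: half_br_def)

lemma half_br_rl:
  assumes M: "left_comodule C A M l" and X: "left_module C A X \<chi>" and d: "distinct [m, n, x, y, p, z]"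
  shows "rl [hbr M l X \<chi> m x z p] [coa M l m i n, phi M X n x y p, act X \<chi> i y z] [Nw M m, Nw X x] [Nw X z, Nw M p]"
  using rl_op[OF half_br_den[OF assms]] by simp

lemma okop_hbr:
  assumes M: "left_comodule C A M l" and X: "left_module C A X \<chi>"
  shows "okop (hbr M l X \<chi> m x z p)"
proof -
  have "okop (hbr M l X \<chi> 1 3 6 5)" by (rule okop_den[OF half_br_den[OF M X, of 1 2 3 4]]) simp_all
  thus ?thesis by (auto simp: okop_def ok_def)
qed

lemma half_br_hom:
  assumes M: "left_comodule C A M l" and X: "left_module C A X \<chi>"
  shows "half_br M l X \<chi> \<in> hom C (M \<boxtimes> X) (X \<boxtimes> M)"
  using okop_hbr[OF M X, of 1 2 3 4] by (simp add: okop_def ok_def)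

text \<open>The sides are \<open>(h1 m)(-1) h2 x \<otimes> (h1 m)(0)\<close> and
  \<open>h1 m(-1) x \<otimes> h2 m(0)\<close>: linearity is the Yetter-Drinfel'd condition applied
  to \<open>x\<close>.\<close>

lemma half_br_linear:
  assumes M: "left_yd_module C A M \<mu> l" and X: "left_module C A X \<chi>"
  shows "half_br M l X \<chi> \<cdot> left_action_tensor C A M \<mu> X \<chi> = left_action_tensor C A X \<chi> M \<mu> \<cdot> (\<one> H \<otimes> half_br M l X \<chi>)"
proof -
  note Mm = left_ydD(1)[OF M] and Mc = left_ydD(2)[OF M]
  note [simp] = left_moduleD(1,2,5)[OF Mm] left_comoduleD(2,5)[OF Mc] left_moduleD(1,2,5)[OF X] okop_hbr[OF Mc X]
  note [simp] = okop_actT[OF Mm X] okop_actT[OF X Mm]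
  note 1 = den_diag[of "[[Gen (hbr M l X \<chi> 4 5 6 7)], [Gen (actT M \<mu> X \<chi> 1 2 3 4 5)]]", simplified]
  note 1 = den_rw[OF 1 actT_rl[OF Mm X, of 1 8 9 2 3 4 5], simplified]
  note 1 = den_rw[OF 1 half_br_rl[OF Mc X, of 4 10 5 11 7 6 12], simplified]
  note 1 = den_rw[OF 1 phi_act_right[OF left_moduleD(1)[OF Mm] X, of 3 5 11 10 7 13 9], simplified]
  note 1 = den_rw[OF 1 rl_sym[OF act_rl[OF X, of 12 9 5 13 6 11]], simplified]
  note 1 = den_rw[OF 1 yd_rl[OF M, of 1 8 9 12 5 2 4 10 11 14 15 16], simplified]
  note 2 = den_diag[of "[[Gen (actT X \<chi> M \<mu> 1 10 17 6 7)], [Idn (h 1), Gen (hbr M l X \<chi> 2 3 10 17)]]", simplified]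
  note 2 = den_rw[OF 2 actT_rl[OF X Mm, of 1 11 14 10 17 6 7], simplified]
  note 2 = den_rw[OF 2 half_br_rl[OF Mc X, of 2 16 3 13 17 10 15], simplified]
  note 2 = den_rw[OF 2 rl_sym[OF act_rl[OF X, of 11 15 5 13 6 10]], simplified]
  note 2 = den_rw[OF 2 rl_sym[OF phi_act_left[OF Mm left_moduleD(1)[OF X], of 16 10 3 13 7 17 14]], simplified]
  show ?thesis using den_eq[OF 1 2] by simp
qed

lemma half_br_natural:
  assumes Mc: "left_comodule C A M l" and X: "left_module C A X \<chi>" and Y: "left_module C A Y \<xi>"
    and g: "g \<in> hom C X Y" "g \<cdot> \<chi> = \<xi> \<cdot> (\<one> H \<otimes> g)"
  shows "half_br M l Y \<xi> \<cdot> (\<one> M \<otimes> g) = (g \<otimes> \<one> M) \<cdot> half_br M l X \<chi>"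
proof -
  note [simp] = left_comoduleD(1,2,5)[OF Mc] left_moduleD(1,2,5)[OF X] left_moduleD(1,2,5)[OF Y] okop_hbr[OF Mc X] okop_hbr[OF Mc Y] g(1)
  note 1 = den_diag[of "[[Gen (hbr M l Y \<xi> 1 3 4 5)], [Idn (Nw M 1), Gen (mor X Y g 2 3)]]", simplified]
  note 1 = den_rw[OF 1 half_br_rl[OF Mc Y, of 1 6 3 7 5 4 8], simplified]
  note 1 = den_rw[OF 1 phi_mor_right[OF left_comoduleD(1)[OF Mc] left_moduleD(1)[OF X] left_moduleD(1)[OF Y] g(1), of 6 2 3 7 5 9], simplified]
  note 2 = den_diag[of "[[Gen (mor X Y g 3 4), Idn (Nw M 5)], [Gen (hbr M l X \<chi> 1 2 3 5)]]", simplified]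
  note 2 = den_rw[OF 2 half_br_rl[OF Mc X, of 1 6 2 9 5 3 8], simplified]
  note 2 = den_rw[OF 2 hom_rl[OF X Y g, of 9 3 4 7 8], simplified]
  show ?thesis using den_eq[OF 1 2] by simp
qed

abbreviation "phiR M X Y m x y u v n \<equiv> ([Nw M m, Nw X x, Nw Y y], \<Phi> M (X \<boxtimes> Y), [Nw X u, Nw Y v, Nw M n])"
abbreviation "phiL M N X m n x y p q \<equiv> ([Nw M m, Nw N n, Nw X x], \<Phi> (M \<boxtimes> N) X, [Nw X y, Nw M p, Nw N q])"

lemma okop_phi3 [simp]: "M \<in> ob C \<Longrightarrow> X \<in> ob C \<Longrightarrow> Y \<in> ob C \<Longrightarrow> okop (phiR M X Y m x y u v n)"
  "M \<in> ob C \<Longrightarrow> N \<in> ob C \<Longrightarrow> X \<in> ob C \<Longrightarrow> okop (phiL M N X m n' x y p q)"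
  using braid_hom[of M "X \<boxtimes> Y"] braid_hom[of "M \<boxtimes> N" X] by (auto simp: okop_def ok_def ten_ob tenO_assoc)

text \<open>By coassociativity of the coaction, the two factors of the coproduct of
  \<open>m(-1)\<close> act on \<open>X\<close> and on \<open>Y\<close> one after the other.\<close>

lemma half_br_tensor_right:
  assumes Mc: "left_comodule C A M l" and X: "left_module C A X \<chi>" and Y: "left_module C A Y \<xi>"
  shows "half_br M l (X \<boxtimes> Y) (left_action_tensor C A X \<chi> Y \<xi>) = (\<one> X \<otimes> half_br M l Y \<xi>) \<cdot> (half_br M l X \<chi> \<otimes> \<one> Y)"
proof -
  note [simp] = left_comoduleD(1,2,5)[OF Mc] left_moduleD(1,2,5)[OF X] left_moduleD(1,2,5)[OF Y] okop_hbr[OF Mc X] okop_hbr[OF Mc Y] okop_actT[OF X Y]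
  note 1 = den_diag[of "[[Gen (actT X \<chi> Y \<xi> 2 6 7 8 9), Idn (Nw M 10)], [Idn (h 2), Gen (phiR M X Y 3 4 5 6 7 10)], [Gen (coa M l 1 2 3), Idl [Nw X 4, Nw Y 5]]]", simplified]
  note 1 = den_rw[OF 1 actT_rl[OF X Y, of 2 11 12 6 7 8 9], simplified]
  note 1 = den_rw[OF 1 phi_ten_right[OF left_comoduleD(1)[OF Mc] left_moduleD(1)[OF X] left_moduleD(1)[OF Y], of 3 4 5 6 7 10 13], simplified]
  note 1 = den_rw[OF 1 coa_rl[OF Mc, of 2 11 12 1 3 14], simplified]
  note 2 = den_diag[of "[[Idn (Nw X 8), Gen (hbr M l Y \<xi> 15 5 9 10)], [Gen (hbr M l X \<chi> 1 4 8 15), Idn (Nw Y 5)]]", simplified]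
  note 2 = den_rw[OF 2 half_br_rl[OF Mc X, of 1 14 4 6 15 8 11], simplified]
  note 2 = den_rw[OF 2 half_br_rl[OF Mc Y, of 15 13 5 7 10 9 12], simplified]
  note 2 = den_rw[OF 2 rl_sym[OF phi_coa_left[OF Mc left_moduleD(1)[OF X], of 14 3 4 6 13 15 12]], simplified]
  show ?thesis using den_eq[OF 1 2] by (simp add: half_br_def[of _ _ "_ \<boxtimes> _"])
qed

lemma twist_den:
  assumes Mc: "left_comodule C A M l" and X: "left_module C A X \<chi>" and d: "distinct [x, m, n, y]"
  shows "den [coa M l m i n, act X \<chi> i x y] ([Nw X x, Nw M m], twist M l X \<chi>, [Nw X y, Nw M n])"
  using den_diag[of "[[Gen ([h i, Nw X x], \<chi>, [Nw X y]), Idn (Nw M n)], [Brd [Nw X x] [h i], Idn (Nw M n)], [Idn (Nw X x), Gen ([Nw M m], l, [h i, Nw M n])]]"]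
    d left_comoduleD(1,2,5)[OF Mc] left_moduleD(1,2,5)[OF X] by (auto simp: twist_def)

lemma untwist_den:
  assumes Mc: "left_comodule C A M l" and X: "left_module C A X \<chi>" and d: "distinct [x, m, n, y]" "i \<noteq> j"
  shows "den [coa M l m i n, ani i j, act X \<chi> j x y] ([Nw X x, Nw M m], untwist M l X \<chi>, [Nw X y, Nw M n])"
  using den_diag[of "[[Gen ([h j, Nw X x], \<chi>, [Nw X y]), Idn (Nw M n)], [Brd [Nw X x] [h j], Idn (Nw M n)], [Idn (Nw X x), Gen (ani i j), Idn (Nw M n)],
      [Idn (Nw X x), Gen ([Nw M m], l, [h i, Nw M n])]]"]
    d left_comoduleD(1,2,5)[OF Mc] left_moduleD(1,2,5)[OF X] by (auto simp: untwist_def)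

abbreviation "tw M l X \<chi> x m y n \<equiv> ([Nw X x, Nw M m], twist M l X \<chi>, [Nw X y, Nw M n])"
abbreviation "untw M l X \<chi> x m y n \<equiv> ([Nw X x, Nw M m], untwist M l X \<chi>, [Nw X y, Nw M n])"

lemma okop_tw:
  assumes Mc: "left_comodule C A M l" and X: "left_module C A X \<chi>"
  shows "okop (tw M l X \<chi> x m y n)" "okop (untw M l X \<chi> x m y n)"
proof -
  have "okop (tw M l X \<chi> 1 2 4 3)" by (rule okop_den[OF twist_den[OF Mc X]]) simp_all
  thus "okop (tw M l X \<chi> x m y n)" by (auto simp: okop_def ok_def)
  have "okop (untw M l X \<chi> 1 2 4 3)" by (rule okop_den[OF untwist_den[OF Mc X, where i = 1 and j = 2]]) simp_all
  thus "okop (untw M l X \<chi> x m y n)" by (auto simp: okop_def ok_def)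
qed

text \<open>The composites multiply \<open>x\<close> by \<open>Si(m(-1)) m(-2)\<close> and by
  \<open>m(-1) Si(m(-2))\<close>, which are trivial by \<open>Si_right\<close> and
  \<open>Si_left\<close>.\<close>

lemma twist_inverse:
  assumes Mc: "left_comodule C A M l" and X: "left_module C A X \<chi>"
  shows "inverse_pair C (X \<boxtimes> M) (X \<boxtimes> M) (twist M l X \<chi>) (untwist M l X \<chi>)"
    "twist M l X \<chi> \<in> hom C (X \<boxtimes> M) (X \<boxtimes> M)"
proof -
  note [simp] = left_comoduleD(1,2,5)[OF Mc] left_moduleD(1,2,5)[OF X] okop_tw[OF Mc X]
  note 1 = den_diag[of "[[Gen (untw M l X \<chi> 3 4 5 6)], [Gen (tw M l X \<chi> 1 2 3 4)]]", simplified]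
  note 1 = den_rw[OF 1 rl_op[OF twist_den[OF Mc X, of 1 2 4 3 7], simplified], simplified]
  note 1 = den_rw[OF 1 rl_op[OF untwist_den[OF Mc X, of 3 4 6 5 8 9], simplified], simplified]
  note 1 = den_rw[OF 1 rl_sym[OF act_rl[OF X, of 9 7 10 1 5 3]], simplified]
  note 1 = den_rw[OF 1 rl_sym[OF coa_rl[OF Mc, of 3 7 8 2 6 4]], simplified]
  note 1 = den_rw[OF 1 Si_right_rl[of 3 7 8 9 10], simplified]
  note 1 = den_rw_id[OF 1 act_unit[OF X, of 1 5 10], simplified]
  note 1 = den_rw_id[OF 1 coa_unit[OF Mc, of 2 6 3], simplified]
  note 2 = den_diag[of "[[Idl [Nw X 1, Nw M 2]]]", simplified]
  have "untwist M l X \<chi> \<cdot> twist M l X \<chi> = \<one> (X \<boxtimes> M)"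
    using den_eq[OF 1 2] by simp
  moreover
  note 1 = den_diag[of "[[Gen (tw M l X \<chi> 3 4 5 6)], [Gen (untw M l X \<chi> 1 2 3 4)]]", simplified]
  note 1 = den_rw[OF 1 rl_op[OF twist_den[OF Mc X, of 3 4 6 5 7], simplified], simplified]
  note 1 = den_rw[OF 1 rl_op[OF untwist_den[OF Mc X, of 1 2 4 3 8 9], simplified], simplified]
  note 1 = den_rw[OF 1 rl_sym[OF act_rl[OF X, of 7 9 10 1 5 3]], simplified]
  note 1 = den_rw[OF 1 rl_sym[OF coa_rl[OF Mc, of 3 8 7 2 6 4]], simplified]
  note 1 = den_rw[OF 1 Si_left_rl[of 3 8 7 9 10], simplified]
  note 1 = den_rw_id[OF 1 act_unit[OF X, of 1 5 10], simplified]
  note 1 = den_rw_id[OF 1 coa_unit[OF Mc, of 2 6 3], simplified]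
  note 2 = den_diag[of "[[Idl [Nw X 1, Nw M 2]]]", simplified]
  have "twist M l X \<chi> \<cdot> untwist M l X \<chi> = \<one> (X \<boxtimes> M)"
    using den_eq[OF 1 2] by simp
  moreover show "twist M l X \<chi> \<in> hom C (X \<boxtimes> M) (X \<boxtimes> M)"
    using okop_tw(1)[OF Mc X, of 1 2 3 4] by (simp add: okop_def ok_def)
  ultimately show "inverse_pair C (X \<boxtimes> M) (X \<boxtimes> M) (twist M l X \<chi>) (untwist M l X \<chi>)"
    using okop_tw(2)[OF Mc X, of 1 2 3 4] by (simp add: okop_def ok_def inverse_pair_def)
qed

lemma half_br_twist:
  assumes Mc: "left_comodule C A M l" and X: "left_module C A X \<chi>"
  shows "half_br M l X \<chi> = twist M l X \<chi> \<cdot> \<Phi> M X"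
proof -
  note [simp] = left_comoduleD(1,2,5)[OF Mc] left_moduleD(1,2,5)[OF X] okop_hbr[OF Mc X] okop_tw[OF Mc X]
  note 1 = den_diag[of "[[Gen (hbr M l X \<chi> 1 2 3 4)]]", simplified]
  note 1 = den_rw[OF 1 half_br_rl[OF Mc X, of 1 5 2 6 4 3 7], simplified]
  note 1 = den_rw[OF 1 phi_coa_left[OF Mc left_moduleD(1)[OF X], of 1 5 2 6 4 8 7], simplified]
  note 2 = den_diag[of "[[Gen (tw M l X \<chi> 6 8 3 4)], [Gen (phi M X 1 2 6 8)]]", simplified]
  note 2 = den_rw[OF 2 rl_op[OF twist_den[OF Mc X, of 6 8 4 3 7], simplified], simplified]
  show ?thesis using den_eq[OF 1 2] by simp
qed

lemma half_br_iso:
  assumes Mc: "left_comodule C A M l" and X: "left_module C A X \<chi>"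
  shows "iso_mor C (M \<boxtimes> X) (X \<boxtimes> M) (half_br M l X \<chi>)"
proof -
  note o = left_comoduleD(1)[OF Mc] left_moduleD(1)[OF X]
  have "iso_mor C (X \<boxtimes> M) (X \<boxtimes> M) (twist M l X \<chi>)" using twist_inverse[OF Mc X] by (auto simp: iso_mor_def)
  from iso_cmp[OF _ _ _ braid_iso[OF o] this] show ?thesis using o by (simp add: half_br_twist[OF Mc X] ten_ob)
qed

lemma left_comodule_tensor:
  assumes Mc: "left_comodule C A M l" and Nc: "left_comodule C A N l'"
  shows "left_comodule C A (M \<boxtimes> N) (left_coaction_tensor C A M l N l')"
proof -
  note [simp] = left_comoduleD(1,2,5)[OF Mc] left_comoduleD(1,2,5)[OF Nc] okop_coaT[OF Mc Nc]
  note 1 = den_diag[of "[[Gen (com 3 4 5), Idl [Nw M 8, Nw N 9]], [Gen (coaT M l N l' 1 2 3 8 9)]]", simplified]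
  note 1 = den_rw[OF 1 coaT_rl[OF Mc Nc, of 6 7 3 1 2 8 9], simplified]
  note 1 = den_rw[OF 1 bialg_rl[of 6 7 3 4 5 10 11 12 13], simplified]
  note 1 = den_rw[OF 1 coa_rl[OF Mc, of 6 10 11 1 8 3], simplified]
  note 1 = den_rw[OF 1 coa_rl[OF Nc, of 7 12 13 2 9 6], simplified]
  note 2 = den_diag[of "[[Idn (h 4), Gen (coaT M l N l' 3 6 5 8 9)], [Gen (coaT M l N l' 1 2 4 3 6)]]", simplified]
  note 2 = den_rw[OF 2 coaT_rl[OF Mc Nc, of 10 12 4 1 2 3 6], simplified]
  note 2 = den_rw[OF 2 coaT_rl[OF Mc Nc, of 11 13 5 3 6 8 9], simplified]
  have "(De \<otimes> \<one> (M \<boxtimes> N)) \<cdot> left_coaction_tensor C A M l N l' = (\<one> H \<otimes> left_coaction_tensor C A M l N l') \<cdot> left_coaction_tensor C A M l N l'"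
    using den_eq[OF 1 2] by simp
  moreover
  note 1 = den_diag[of "[[Gen (cou 3), Idl [Nw M 8, Nw N 9]], [Gen (coaT M l N l' 1 2 3 8 9)]]", simplified]
  note 1 = den_rw[OF 1 coaT_rl[OF Mc Nc, of 4 5 3 1 2 8 9], simplified]
  note 1 = den_rw[OF 1 Mu_Ep_rl[of 4 5 3], simplified]
  note 1 = den_rw_id[OF 1 coa_unit[OF Mc, of 1 8 4], simplified]
  note 1 = den_rw_id[OF 1 coa_unit[OF Nc, of 2 9 5], simplified]
  note 2 = den_diag[of "[[Idl [Nw M 1, Nw N 2]]]", simplified]
  have "(Ep \<otimes> \<one> (M \<boxtimes> N)) \<cdot> left_coaction_tensor C A M l N l' = \<one> (M \<boxtimes> N)"
    using den_eq[OF 1 2] by simp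
  moreover have "left_coaction_tensor C A M l N l' \<in> hom C (M \<boxtimes> N) (H \<boxtimes> M \<boxtimes> N)"
    using okop_coaT[OF Mc Nc, of 1 2 3 4 5] by (simp add: okop_def ok_def)
  ultimately show ?thesis by (simp add: left_comodule_def ten_ob)
qed

text \<open>The condition is applied to \<open>N\<close> and then to \<open>M\<close>.
  Coassociativity supplies the middle factor of \<open>h\<close> that is handed from one to the
  other.\<close>

lemma left_yd_tensor:
  assumes M: "left_yd_module C A M \<mu> l" and N: "left_yd_module C A N \<nu> l'"
  shows "left_yd_module C A (M \<boxtimes> N) (left_action_tensor C A M \<mu> N \<nu>) (left_coaction_tensor C A M l N l')"
proof -
  note Mm = left_ydD(1)[OF M] and Mc = left_ydD(2)[OF M] and Nm = left_ydD(1)[OF N] and Nc = left_ydD(2)[OF N]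
  note [simp] = left_moduleD(1,2,5)[OF Mm] left_comoduleD(2,5)[OF Mc] left_moduleD(1,2,5)[OF Nm] left_comoduleD(2,5)[OF Nc]
    okop_actT[OF Mm Nm] okop_coaT[OF Mc Nc]
  note 1 = den_diag[of "[[Gen (mul 10 3 11), Idl [Nw M 8, Nw N 9]], [Idn (h 10), Brd [Nw M 8, Nw N 9] [h 3]], [Gen (coaT M l N l' 6 7 10 8 9), Idn (h 3)],
    [Gen (actT M \<mu> N \<nu> 2 4 5 6 7), Idn (h 3)], [Idn (h 2), Brd [h 3] [Nw M 4, Nw N 5]], [Gen (com 1 2 3), Idl [Nw M 4, Nw N 5]]]", simplified]
  note 1 = den_rw[OF 1 actT_rl[OF Mm Nm, of 2 12 13 4 5 6 7], simplified]
  note 1 = den_rw[OF 1 coaT_rl[OF Mc Nc, of 14 15 10 6 7 8 9], simplified]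
  note 1 = den_rw[OF 1 coassoc_rl[of 1 2 3 12 13 16], simplified]
  note 1 = den_rw[OF 1 assoc_rl[of 14 15 10 3 11 2], simplified]
  note 1 = den_rw[OF 1 yd_rl[OF N, of 16 13 3 15 2 5 7 9 10 17 18 19], simplified]
  note 1 = den_rw[OF 1 rl_sym[OF assoc_rl[of 14 10 3 18 11 2]], simplified]
  note 1 = den_rw[OF 1 rl_sym[OF coassoc_rl[of 1 2 17 12 10 16]], simplified]
  note 1 = den_rw[OF 1 yd_rl[OF M, of 2 12 10 14 3 4 6 8 7 13 15 16], simplified]
  note 2 = den_diag[of "[[Gen (mul 7 2 11), Gen (actT M \<mu> N \<nu> 20 16 19 8 9)], [Idn (h 7), Brd [h 20] [h 2], Idl [Nw M 16, Nw N 19]], [Gen (com 1 7 20),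
    Gen (coaT M l N l' 4 5 2 16 19)]]", simplified]
  note 2 = den_rw[OF 2 actT_rl[OF Mm Nm, of 20 13 17 16 19 8 9], simplified]
  note 2 = den_rw[OF 2 coaT_rl[OF Mc Nc, of 15 18 2 4 5 16 19], simplified]
  note 2 = den_rw[OF 2 rl_sym[OF assoc_rl[of 7 15 3 18 11 2]], simplified]
  note 2 = den_rw[OF 2 rl_sym[OF coassoc_rl[of 1 2 17 7 13 20]], simplified]
  have "(Mu \<otimes> \<one> (M \<boxtimes> N)) \<cdot> (\<one> H \<otimes> \<Phi> (M \<boxtimes> N) H) \<cdot> (left_coaction_tensor C A M l N l' \<otimes> \<one> H) \<cdot> (left_action_tensor C A M \<mu> N \<nu> \<otimes> \<one> H) \<cdot> (\<one> H \<otimes> \<Phi> H (M \<boxtimes> N)) \<cdot> (De \<otimes> \<one> (M \<boxtimes> N)) = (Mu \<otimes> left_action_tensor C A M \<mu> N \<nu>) \<cdot> (\<one> H \<otimes> \<Phi> H H \<otimes> \<one> (M \<boxtimes> N)) \<cdot> (De \<otimes> left_coaction_tensor C A M l N l')"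
    using den_eq[OF 1 2] by simp
  thus ?thesis using left_module_tensor[OF Mm Nm] left_comodule_tensor[OF Mc Nc] by (simp add: left_yd_module_def Let_def)
qed

text \<open>The coaction of \<open>M \<boxtimes> N\<close> multiplies \<open>m(-1)\<close> and
  \<open>n(-1)\<close>, so associativity of the action on \<open>X\<close> separates the two half
  braidings.\<close>

lemma half_br_tensor_left:
  assumes Mc: "left_comodule C A M l" and Nc: "left_comodule C A N l'" and X: "left_module C A X \<chi>"
  shows "half_br (M \<boxtimes> N) (left_coaction_tensor C A M l N l') X \<chi> = (half_br M l X \<chi> \<otimes> \<one> N) \<cdot> (\<one> M \<otimes> half_br N l' X \<chi>)"
proof -
  note [simp] = left_comoduleD(1,2,5)[OF Mc] left_comoduleD(1,2,5)[OF Nc] left_moduleD(1,2,5)[OF X] okop_hbr[OF Mc X] okop_hbr[OF Nc X] okop_coaT[OF Mc Nc]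
  note 1 = den_diag[of "[[Gen (act X \<chi> 4 7 10), Idl [Nw M 8, Nw N 9]], [Idn (h 4), Gen (phiL M N X 5 6 3 7 8 9)], [Gen (coaT M l N l' 1 2 4 5 6), Idn (Nw X 3)]]", simplified]
  note 1 = den_rw[OF 1 coaT_rl[OF Mc Nc, of 11 12 4 1 2 5 6], simplified]
  note 1 = den_rw[OF 1 phi_ten_left[OF left_comoduleD(1)[OF Mc] left_comoduleD(1)[OF Nc] left_moduleD(1)[OF X], of 5 6 3 7 8 9 13], simplified]
  note 1 = den_rw[OF 1 act_rl[OF X, of 11 12 4 7 10 14], simplified]
  note 2 = den_diag[of "[[Gen (hbr M l X \<chi> 1 15 10 8), Idn (Nw N 9)], [Idn (Nw M 1), Gen (hbr N l' X \<chi> 2 3 15 9)]]", simplified]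
  note 2 = den_rw[OF 2 half_br_rl[OF Mc X, of 1 5 15 14 8 10 11], simplified]
  note 2 = den_rw[OF 2 half_br_rl[OF Nc X, of 2 6 3 13 9 15 12], simplified]
  note 2 = den_rw[OF 2 phi_act_right[OF left_comoduleD(1)[OF Mc] X, of 13 15 14 5 8 7 12], simplified]
  show ?thesis using den_eq[OF 1 2] by (simp add: half_br_def[of "M \<boxtimes> N"])
qed

section \<open>The monoidal category of modules and the embedding into its center\<close>

lemma left_modules_sel [simp]:
  "ob (left_modules C A) = {(M, \<mu>). left_module C A M \<mu>}"
  "hom (left_modules C A) (M, \<mu>) (N, \<nu>) = {f \<in> hom C M N. f \<cdot> \<mu> = \<nu> \<cdot> (\<one> H \<otimes> f)}"
  "idm (left_modules C A) (M, \<mu>) = \<one> M" "cmp (left_modules C A) = cmp C" "unitO (left_modules C A) = (\<I>, Ep)"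
  "tenO (left_modules C A) (M, \<mu>) (N, \<nu>) = (M \<boxtimes> N, left_action_tensor C A M \<mu> N \<nu>)"
  "tenM (left_modules C A) = tenM C"
  by (simp_all add: left_modules_def)

lemma left_module_unit: "left_module C A \<I> Ep"
proof -

  note 1 = den_diag[of "[[Gen (cou 3)], [Gen (mul 1 2 3), Idl []]]", simplified]
  note 1 = den_rw[OF 1 Mu_Ep_rl[of 1 2 3], simplified]
  note 2 = den_diag[of "[[Gen (cou 1)], [Idn (h 1), Gen (cou 2)]]", simplified]
  have "Ep \<cdot> (Mu \<otimes> \<one> \<I>) = Ep \<cdot> (\<one> H \<otimes> Ep)"
    using den_eq[OF 1 2] by simp
  moreover
  note 1 = den_diag[of "[[Gen (cou 3)], [Gen (uni 3), Idl []]]", simplified]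
  note 1 = den_rw[OF 1 Et_Ep_rl[of 3], simplified]
  note 2 = den_diag[of "[[Idl []]]", simplified]
  have "Ep \<cdot> (Et \<otimes> \<one> \<I>) = \<one> \<I>"
    using den_eq[OF 1 2] by simp
  ultimately show ?thesis using hopf_unf by (simp add: left_module_def unit_ob tenO_unit_right)
qed

theorem left_modules_monoidal: "strict_monoidal_category (left_modules C A)"
proof -
  let ?D = "left_modules C A"
  note D = left_moduleD
  have oc: "fst P \<in> ob C" if "P \<in> ob ?D" for P using that by (auto dest: D(1))
  have hc: "f \<in> hom C (fst P) (fst Q)" if "f \<in> hom ?D P Q" for f P Q using that by (cases P; cases Q) simp
  show ?thesis
  proof
    fix P assume "P \<in> ob ?D"
    then obtain M \<mu> where P: "P = (M, \<mu>)" and M: "left_module C A M \<mu>" by (cases P) auto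
    show "idm ?D P \<in> hom ?D P P"
      using D[OF M] by (simp add: P id_hom ten_id id_left[OF _ _ D(2)[OF M]] id_right[OF _ _ D(2)[OF M]] ten_ob)
    show "tenO ?D (unitO ?D) P = P" "tenO ?D P (unitO ?D) = P"
      using D(1)[OF M] left_action_tensor_unit[OF M] by (simp_all add: P tenO_unit_left tenO_unit_right)
  next
    fix P Q R f g assume "P \<in> ob ?D" "Q \<in> ob ?D" "R \<in> ob ?D" and f: "f \<in> hom ?D P Q" and g: "g \<in> hom ?D Q R"
    then obtain M \<mu> N \<nu> U \<pi> where P: "P = (M, \<mu>)" and M: "left_module C A M \<mu>" and Q: "Q = (N, \<nu>)"
      and N: "left_module C A N \<nu>" and R: "R = (U, \<pi>)" and U: "left_module C A U \<pi>"
      by (cases P; cases Q; cases R) auto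
    note o = D(1)[OF M] D(1)[OF N] D(1)[OF U]
    have f': "f \<in> hom C M N" "f \<cdot> \<mu> = \<nu> \<cdot> (\<one> H \<otimes> f)" and g': "g \<in> hom C N U" "g \<cdot> \<nu> = \<pi> \<cdot> (\<one> H \<otimes> g)"
      using f g by (auto simp: P Q R)
    have h: "\<one> H \<otimes> f \<in> hom C (H \<boxtimes> M) (H \<boxtimes> N)" "\<one> H \<otimes> g \<in> hom C (H \<boxtimes> N) (H \<boxtimes> U)"
      using o f' g' by (simp_all add: homs)
    have oo: "H \<boxtimes> M \<in> ob C" "H \<boxtimes> N \<in> ob C" "H \<boxtimes> U \<in> ob C" using o by (simp_all add: ten_ob)
    have "(g \<cdot> f) \<cdot> \<mu> = (g \<cdot> \<nu>) \<cdot> (\<one> H \<otimes> f)"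
      using cmp_assoc[OF oo(1) o(1,2,3) D(2)[OF M] f'(1) g'(1)] cmp_assoc[OF oo(1,2) o(2,3) h(1) D(2)[OF N] g'(1)] f'(2) by simp
    also have "\<dots> = \<pi> \<cdot> (\<one> H \<otimes> (g \<cdot> f))"
      using cmp_assoc[OF oo(1,2,3) o(3) h D(2)[OF U]] g'(2) lwhisk[OF o H_ob f'(1) g'(1)] by simp
    finally show "cmp ?D g f \<in> hom ?D P R" using cmp_hom[OF o f'(1) g'(1)] by (simp add: P R)
  next
    fix P Q f assume "P \<in> ob ?D" "Q \<in> ob ?D" "f \<in> hom ?D P Q"
    then obtain M \<mu> N \<nu> where P: "P = (M, \<mu>)" "M \<in> ob C" and Q: "Q = (N, \<nu>)" "N \<in> ob C" and f: "f \<in> hom C M N"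
      by (cases P; cases Q) (auto dest: D(1))
    show "cmp ?D (idm ?D Q) f = f" "cmp ?D f (idm ?D P) = f"
      "tenM ?D (idm ?D (unitO ?D)) f = f" "tenM ?D f (idm ?D (unitO ?D)) = f"
      using id_left[OF P(2) Q(2) f] id_right[OF P(2) Q(2) f] tenM_unit_left[OF P(2) Q(2) f] tenM_unit_right[OF P(2) Q(2) f]
      by (simp_all add: P Q)
  next
    fix P Q R T f g k assume "P \<in> ob ?D" "Q \<in> ob ?D" "R \<in> ob ?D" "T \<in> ob ?D"
      "f \<in> hom ?D P Q" "g \<in> hom ?D Q R" "k \<in> hom ?D R T"
    thus "cmp ?D (cmp ?D k g) f = cmp ?D k (cmp ?D g f)"
      using cmp_assoc[of "fst P" "fst Q" "fst R" "fst T" f g k] by (simp add: oc hc)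
  next
    show "unitO ?D \<in> ob ?D" using left_module_unit by simp
  next
    fix P Q assume "P \<in> ob ?D" "Q \<in> ob ?D"
    then obtain M \<mu> N \<nu> where P: "P = (M, \<mu>)" "left_module C A M \<mu>" and Q: "Q = (N, \<nu>)" "left_module C A N \<nu>"
      by (cases P; cases Q) auto
    show "tenO ?D P Q \<in> ob ?D" "tenM ?D (idm ?D P) (idm ?D Q) = idm ?D (tenO ?D P Q)"
      using left_module_tensor[OF P(2) Q(2)] D(1)[OF P(2)] D(1)[OF Q(2)] by (simp_all add: P Q ten_id)
  next
    fix P Q P' Q' f g assume "P \<in> ob ?D" "Q \<in> ob ?D" "P' \<in> ob ?D" "Q' \<in> ob ?D" "f \<in> hom ?D P Q" "g \<in> hom ?D P' Q'"
    then obtain M \<mu> N \<nu> M' \<mu>' N' \<nu>' where P: "P = (M, \<mu>)" "left_module C A M \<mu>" and Q: "Q = (N, \<nu>)" "left_module C A N \<nu>"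
      and P': "P' = (M', \<mu>')" "left_module C A M' \<mu>'" and Q': "Q' = (N', \<nu>')" "left_module C A N' \<nu>'"
      and f: "f \<in> hom C M N" "f \<cdot> \<mu> = \<nu> \<cdot> (\<one> H \<otimes> f)" and g: "g \<in> hom C M' N'" "g \<cdot> \<mu>' = \<nu>' \<cdot> (\<one> H \<otimes> g)"
      by (cases P; cases Q; cases P'; cases Q') auto
    show "tenM ?D f g \<in> hom ?D (tenO ?D P P') (tenO ?D Q Q')"
      using left_module_hom_tensor[OF P(2) P'(2) Q(2) Q'(2) f g] ten_hom[OF D(1)[OF P(2)] D(1)[OF Q(2)] D(1)[OF P'(2)] D(1)[OF Q'(2)] f(1) g(1)]
      by (simp add: P Q P' Q')
  next
    fix P Q R P' Q' R' f g f' g'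
    assume "P \<in> ob ?D" "Q \<in> ob ?D" "R \<in> ob ?D" "P' \<in> ob ?D" "Q' \<in> ob ?D" "R' \<in> ob ?D"
      "f \<in> hom ?D P Q" "g \<in> hom ?D Q R" "f' \<in> hom ?D P' Q'" "g' \<in> hom ?D Q' R'"
    thus "tenM ?D (cmp ?D g f) (cmp ?D g' f') = cmp ?D (tenM ?D g g') (tenM ?D f f')"
      using interchange[of "fst P" "fst Q" "fst R" "fst P'" "fst Q'" "fst R'" f g f' g'] by (simp add: oc hc)
  next
    fix P Q R assume "P \<in> ob ?D" "Q \<in> ob ?D" "R \<in> ob ?D"
    thus "tenO ?D (tenO ?D P Q) R = tenO ?D P (tenO ?D Q R)"
      using left_action_tensor_assoc tenO_assoc[of "fst P" "fst Q" "fst R"]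
      by (cases P; cases Q; cases R) (auto dest: D(1))
  next
    fix P Q P' Q' P'' Q'' f g k assume "P \<in> ob ?D" "Q \<in> ob ?D" "P' \<in> ob ?D" "Q' \<in> ob ?D" "P'' \<in> ob ?D" "Q'' \<in> ob ?D"
      "f \<in> hom ?D P Q" "g \<in> hom ?D P' Q'" "k \<in> hom ?D P'' Q''"
    thus "tenM ?D (tenM ?D f g) k = tenM ?D f (tenM ?D g k)"
      using tenM_assoc[of "fst P" "fst Q" "fst P'" "fst Q'" "fst P''" "fst Q''" f g k] by (simp add: oc hc)
  qed
qed

text \<open>Makes the half braiding an isomorphism in the category of modules, whose hom-sets
  contain only linear maps.\<close>

lemma left_module_inverse:
  assumes M: "left_module C A M \<mu>" and N: "left_module C A N \<nu>" and f: "f \<in> hom C M N" "f \<cdot> \<mu> = \<nu> \<cdot> (\<one> H \<otimes> f)"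
    and g: "inverse_pair C M N f g"
  shows "g \<cdot> \<nu> = \<mu> \<cdot> (\<one> H \<otimes> g)"
proof -
  note o = left_moduleD(1)[OF M] left_moduleD(1)[OF N] and mu = left_moduleD(2)[OF M] and nu = left_moduleD(2)[OF N]
  have g': "g \<in> hom C N M" "g \<cdot> f = \<one> M" "f \<cdot> g = \<one> N" using g by (auto simp: inverse_pair_def)
  have oo: "H \<boxtimes> M \<in> ob C" "H \<boxtimes> N \<in> ob C" using o by (simp_all add: ten_ob)
  have h: "\<one> H \<otimes> f \<in> hom C (H \<boxtimes> M) (H \<boxtimes> N)" "\<one> H \<otimes> g \<in> hom C (H \<boxtimes> N) (H \<boxtimes> M)"
    using o f g' by (simp_all add: homs)
  have fg: "(\<one> H \<otimes> f) \<cdot> (\<one> H \<otimes> g) = \<one> (H \<boxtimes> N)" using lwhisk[OF o(2,1,2) H_ob g'(1) f(1)] g' o by (simp add: ten_id)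
  have "g \<cdot> \<nu> = (g \<cdot> \<nu>) \<cdot> ((\<one> H \<otimes> f) \<cdot> (\<one> H \<otimes> g))"
    using id_right[OF oo(2) o(1) cmp_hom[OF oo(2) o(2,1) nu g'(1)]] fg by simp
  also have "\<dots> = g \<cdot> ((f \<cdot> \<mu>) \<cdot> (\<one> H \<otimes> g))"
    using cmp4[OF oo(2,1,2) o(2,1) h(2,1) nu g'(1)] f(2) by simp
  also have "\<dots> = (g \<cdot> f) \<cdot> (\<mu> \<cdot> (\<one> H \<otimes> g))"
    using cmp4[OF oo(2,1) o(1,2,1) h(2) mu f(1) g'(1)] by simp
  finally show ?thesis using g' id_left[OF oo(2) o(1) cmp_hom[OF oo(2,1) o(1) h(2) mu]] by simp
qed

lemma half_br_unit:
  assumes X: "left_module C A X \<chi>"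
  shows "half_br \<I> Et X \<chi> = \<one> X"
proof -
  note [simp] = left_moduleD(1,2,5)[OF X]

  note 1 = den_diag[of "[[Gen (act X \<chi> 1 2 3), Idl []], [Idn (h 1), Brd [] [Nw X 2]], [Gen (uni 1), Idn (Nw X 2)]]", simplified]
  note 1 = den_rw_id[OF 1 act_unit[OF X, of 2 3 1], simplified]
  note 2 = den_diag[of "[[Idn (Nw X 2)]]", simplified]
  show ?thesis using den_eq[OF 1 2] by (simp add: half_br_def half_br_def)
qed

lemma left_yd_unit: "left_yd_module C A \<I> Ep Et"
proof -
  note 1 = den_diag[of "[[Gen (com 1 2 3), Idl []], [Gen (uni 1)]]", simplified]
  note 1 = den_rw[OF 1 unit_De_rl[of 1 2 3], simplified]
  note 2 = den_diag[of "[[Idn (h 2), Gen (uni 3)], [Gen (uni 2)]]", simplified]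
  have "(De \<otimes> \<one> \<I>) \<cdot> Et = (\<one> H \<otimes> Et) \<cdot> Et"
    using den_eq[OF 1 2] by simp
  note 1 = den_diag[of "[[Gen (cou 1), Idl []], [Gen (uni 1)]]", simplified]
  note 1 = den_rw[OF 1 Et_Ep_rl[of 1], simplified]
  note 2 = den_diag[of "[[Idl []]]", simplified]
  have "(Ep \<otimes> \<one> \<I>) \<cdot> Et = \<one> \<I>"
    using den_eq[OF 1 2] by simp
  note 1 = den_diag[of "[[Gen (mul 4 3 5), Idl []], [Idn (h 4), Brd [] [h 3]], [Gen (uni 4), Idn (h 3)], [Gen (cou 2), Idn (h 3)], [Idn (h 2), Brd [h 3] []], [Gen (com 1 2 3),
    Idl []]]", simplified]
  note 1 = den_rw_id[OF 1 counit_left[of 1 2 3], simplified]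
  note 1 = den_rw_id[OF 1 unit_left[of 1 4 5], simplified]
  note 2 = den_diag[of "[[Gen (mul 2 4 5), Gen (cou 3)], [Idn (h 2), Brd [h 3] [h 4], Idl []], [Gen (com 1 2 3), Gen (uni 4)]]", simplified]
  note 2 = den_rw_id[OF 2 counit_right[of 1 2 3], simplified]
  note 2 = den_rw_id[OF 2 unit_right[of 1 4 5], simplified]
  have "(Mu \<otimes> \<one> \<I>) \<cdot> (\<one> H \<otimes> \<Phi> \<I> H) \<cdot> (Et \<otimes> \<one> H) \<cdot> (Ep \<otimes> \<one> H) \<cdot> (\<one> H \<otimes> \<Phi> H \<I>) \<cdot> (De \<otimes> \<one> \<I>) = (Mu \<otimes> Ep) \<cdot> (\<one> H \<otimes> \<Phi> H H \<otimes> \<one> \<I>) \<cdot> (De \<otimes> Et)"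
    using den_eq[OF 1 2] by simp
  show ?thesis
    using left_module_unit hopf_unf \<open>(De \<otimes> \<one> \<I>) \<cdot> Et = _\<close> \<open>(Ep \<otimes> \<one> \<I>) \<cdot> Et = _\<close> \<open>(Mu \<otimes> \<one> \<I>) \<cdot> _ = _\<close>
    by (simp add: left_yd_module_def left_comodule_def Let_def unit_ob tenO_unit_right)
qed

lemma half_br_colinear:
  assumes Mc: "left_comodule C A M l" and Nc: "left_comodule C A N l'" and X: "left_module C A X \<chi>"
    and f: "f \<in> hom C M N" "l' \<cdot> f = (\<one> H \<otimes> f) \<cdot> l"
  shows "(\<one> X \<otimes> f) \<cdot> half_br M l X \<chi> = half_br N l' X \<chi> \<cdot> (f \<otimes> \<one> X)"
proof -
  note [simp] = left_comoduleD(1,2,5)[OF Mc] left_comoduleD(1,2,5)[OF Nc] left_moduleD(1,2,5)[OF X] okop_hbr[OF Mc X] okop_hbr[OF Nc X] f(1)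
  note 1 = den_diag[of "[[Idn (Nw X 3), Gen (mor M N f 4 5)], [Gen (hbr M l X \<chi> 1 2 3 4)]]", simplified]
  note 1 = den_rw[OF 1 half_br_rl[OF Mc X, of 1 6 2 7 4 3 8], simplified]
  note 2 = den_diag[of "[[Gen (hbr N l' X \<chi> 4 2 3 5)], [Gen (mor M N f 1 4), Idn (Nw X 2)]]", simplified]
  note 2 = den_rw[OF 2 half_br_rl[OF Nc X, of 4 10 2 7 5 3 8], simplified]
  note 2 = den_rw[OF 2 cohom_rl[OF Mc Nc f, of 1 4 10 6 8], simplified]
  note 2 = den_rw[OF 2 phi_mor_left[OF left_comoduleD(1)[OF Mc] left_comoduleD(1)[OF Nc] left_moduleD(1)[OF X] f(1), of 6 10 2 7 5 4], simplified]
  show ?thesis using den_eq[OF 1 2] by simp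
qed

lemma half_br_regular:
  assumes Mc: "left_comodule C A M l"
  shows "half_br M l H Mu \<cdot> (\<one> M \<otimes> Et) = l"
proof -
  note [simp] = left_comoduleD(1,2,5)[OF Mc]
  note o = left_comoduleD(1)[OF Mc]
  have t: "\<one> M \<otimes> Et \<in> hom C M (M \<boxtimes> H)" "l \<otimes> \<one> H \<in> hom C (M \<boxtimes> H) (H \<boxtimes> M \<boxtimes> H)"
    "\<one> H \<otimes> \<Phi> M H \<in> hom C (H \<boxtimes> M \<boxtimes> H) (H \<boxtimes> H \<boxtimes> M)" "Mu \<otimes> \<one> M \<in> hom C (H \<boxtimes> H \<boxtimes> M) (H \<boxtimes> M)"
    using ten_hom[of M M \<I> H "\<one> M" Et] ten_hom[of M "H \<boxtimes> M" H H l "\<one> H"] ten_hom[of H H "M \<boxtimes> H" "H \<boxtimes> M" "\<one> H" "\<Phi> M H"]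
      ten_hom[of "H \<boxtimes> H" H M M Mu "\<one> M"] hopf_unf by (simp_all add: id_hom unit_ob ten_ob tenO_assoc tenO_unit_right braid_hom)
  have oo: "M \<boxtimes> H \<in> ob C" "H \<boxtimes> M \<in> ob C" "H \<boxtimes> M \<boxtimes> H \<in> ob C" "H \<boxtimes> H \<boxtimes> M \<in> ob C" by (simp_all add: ten_ob)
  have "half_br M l H Mu \<cdot> (\<one> M \<otimes> Et) = (Mu \<otimes> \<one> M) \<cdot> (\<one> H \<otimes> \<Phi> M H) \<cdot> (l \<otimes> \<one> H) \<cdot> (\<one> M \<otimes> Et)"
    unfolding half_br_def
    using cmp_assoc[OF o oo(1,4,2) t(1) cmp_hom[OF oo(1,3,4) t(2,3)] t(4)] cmp_assoc[OF o oo(1,3,4) t(1,2,3)] by simp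
  also
  note 1 = den_diag[of "[[Gen (mul 2 4 5), Idn (Nw M 3)], [Idn (h 2), Brd [Nw M 3] [h 4]], [Gen (coa M l 1 2 3), Idn (h 4)], [Idn (Nw M 1), Gen (uni 4)]]", simplified]
  note 1 = den_rw_id[OF 1 unit_right[of 2 4 5], simplified]
  note 2 = den_diag[of "[[Gen (coa M l 1 2 3)]]", simplified]
  have "(Mu \<otimes> \<one> M) \<cdot> (\<one> H \<otimes> \<Phi> M H) \<cdot> (l \<otimes> \<one> H) \<cdot> (\<one> M \<otimes> Et) = l"
    using den_eq[OF 1 2] by simp
  finally show ?thesis .
qed

lemma left_module_regular: "left_module C A H Mu"
  using hopf_unf by (simp add: left_module_def)

text \<open>Fullness of the embedding into the center: compatibility with the half braiding at the
  regular module, evaluated on the unit, is colinearity.\<close>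

lemma half_br_colinear_conv:
  assumes Mc: "left_comodule C A M l" and Nc: "left_comodule C A N l'" and f: "f \<in> hom C M N"
    and e: "(\<one> H \<otimes> f) \<cdot> half_br M l H Mu = half_br N l' H Mu \<cdot> (f \<otimes> \<one> H)"
  shows "l' \<cdot> f = (\<one> H \<otimes> f) \<cdot> l"
proof -
  note o = left_comoduleD(1)[OF Mc] left_comoduleD(1)[OF Nc]
  note b = half_br_hom[OF Mc left_module_regular] half_br_hom[OF Nc left_module_regular]
  have t: "\<one> M \<otimes> Et \<in> hom C M (M \<boxtimes> H)" "\<one> N \<otimes> Et \<in> hom C N (N \<boxtimes> H)" "\<one> H \<otimes> f \<in> hom C (H \<boxtimes> M) (H \<boxtimes> N)"
    "f \<otimes> \<one> H \<in> hom C (M \<boxtimes> H) (N \<boxtimes> H)"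
    using ten_hom[of M M \<I> H "\<one> M" Et] ten_hom[of N N \<I> H "\<one> N" Et] o f hopf_unf
    by (simp_all add: homs tenO_unit_right)
  have oo: "M \<boxtimes> H \<in> ob C" "H \<boxtimes> M \<in> ob C" "N \<boxtimes> H \<in> ob C" "H \<boxtimes> N \<in> ob C" using o by (simp_all add: ten_ob)
  have "(\<one> H \<otimes> f) \<cdot> l = ((\<one> H \<otimes> f) \<cdot> half_br M l H Mu) \<cdot> (\<one> M \<otimes> Et)"
    using cmp_assoc[OF o(1) oo(1,2,4) t(1) b(1) t(3)] half_br_regular[OF Mc] by simp
  also have "\<dots> = half_br N l' H Mu \<cdot> ((f \<otimes> \<one> H) \<cdot> (\<one> M \<otimes> Et))"
    unfolding e by (rule cmp_assoc[OF o(1) oo(1,3,4) t(1,4) b(2)])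
  also have "(f \<otimes> \<one> H) \<cdot> (\<one> M \<otimes> Et) = (\<one> N \<otimes> Et) \<cdot> f"
    using slide1[OF o unit_ob H_ob f, of Et] slide2[OF o unit_ob H_ob f, of Et] tenM_unit_right[OF o f] hopf_unf by simp
  also have "half_br N l' H Mu \<cdot> ((\<one> N \<otimes> Et) \<cdot> f) = l' \<cdot> f"
    using cmp_assoc[OF o oo(3,4) f t(2) b(2)] half_br_regular[OF Nc] by simp
  finally show ?thesis by simp
qed

definition yd_center :: "'o \<times> 'm \<times> 'm \<Rightarrow> ('o \<times> 'm) \<times> ('o \<times> 'm \<Rightarrow> 'm)" where
  "yd_center = (\<lambda>(M, \<mu>, l). ((M, \<mu>), \<lambda>P\<in>ob (left_modules C A). half_br M l (fst P) (snd P)))"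

lemma left_yd_sel [simp]:
  "ob (left_yd C A) = {(M, \<mu>, l). left_yd_module C A M \<mu> l}"
  "hom (left_yd C A) (M, \<mu>, l) (N, \<nu>, l') = {f \<in> hom C M N. f \<cdot> \<mu> = \<nu> \<cdot> (\<one> H \<otimes> f) \<and> l' \<cdot> f = (\<one> H \<otimes> f) \<cdot> l}"
  "idm (left_yd C A) (M, \<mu>, l) = \<one> M" "cmp (left_yd C A) = cmp C" "unitO (left_yd C A) = (\<I>, Ep, Et)"
  "tenO (left_yd C A) (M, \<mu>, l) (N, \<nu>, l') = (M \<boxtimes> N, left_action_tensor C A M \<mu> N \<nu>, left_coaction_tensor C A M l N l')"
  "tenM (left_yd C A) = tenM C"
  "braid (left_yd C A) (M, \<mu>, l) (N, \<nu>, l') = half_br M l N \<nu>"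
  by (simp_all add: left_yd_def half_br_def)

text \<open>Injectivity on objects and fullness are both tested on the regular module. The braiding
  is preserved because in the center it is the half braiding evaluated at the second object.\<close>

theorem left_yd_center_embedding: "strict_embedding (left_yd C A) (left_center (left_modules C A)) yd_center"
proof -
  let ?D = "left_modules C A"
  interpret D: strict_monoidal_category ?D by (rule left_modules_monoidal)
  have hb: "left_half_braiding ?D (M, \<mu>) (\<lambda>P\<in>ob ?D. half_br M l (fst P) (snd P))" if M: "left_yd_module C A M \<mu> l" for M \<mu> l
  proof (rule D.left_half_braidingI)
    note Mm = left_ydD(1)[OF M] and Mc = left_ydD(2)[OF M]
    show "(M, \<mu>) \<in> ob ?D" using Mm by simp
    fix P assume "P \<in> ob ?D"
    then obtain X \<chi> where P: "P = (X, \<chi>)" and X: "left_module C A X \<chi>" by (cases P) auto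
    have lin: "half_br M l X \<chi> \<in> hom ?D (tenO ?D (M, \<mu>) P) (tenO ?D P (M, \<mu>))"
      using half_br_linear[OF M X] half_br_hom[OF Mc X] by (simp add: P)
    obtain g where g: "inverse_pair C (M \<boxtimes> X) (X \<boxtimes> M) (half_br M l X \<chi>) g"
      using half_br_iso[OF Mc X] by (auto simp: iso_mor_def)
    have "g \<cdot> left_action_tensor C A X \<chi> M \<mu> = left_action_tensor C A M \<mu> X \<chi> \<cdot> (\<one> H \<otimes> g)"
      by (rule left_module_inverse[OF left_module_tensor[OF Mm X] left_module_tensor[OF X Mm] half_br_hom[OF Mc X] half_br_linear[OF M X] g])
    hence "inverse_pair ?D (tenO ?D (M, \<mu>) P) (tenO ?D P (M, \<mu>)) (half_br M l X \<chi>) g"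
      using g by (simp add: inverse_pair_def P)
    thus "iso_mor ?D (tenO ?D (M, \<mu>) P) (tenO ?D P (M, \<mu>)) ((\<lambda>P\<in>ob ?D. half_br M l (fst P) (snd P)) P)"
      using lin X by (auto simp: iso_mor_def P)
    fix Q assume "Q \<in> ob ?D"
    then obtain Y \<xi> where Q: "Q = (Y, \<xi>)" and Y: "left_module C A Y \<xi>" by (cases Q) auto
    show "(\<lambda>P\<in>ob ?D. half_br M l (fst P) (snd P)) (tenO ?D P Q) =
        cmp ?D (tenM ?D (idm ?D P) ((\<lambda>P\<in>ob ?D. half_br M l (fst P) (snd P)) Q))
          (tenM ?D ((\<lambda>P\<in>ob ?D. half_br M l (fst P) (snd P)) P) (idm ?D Q))"
      using half_br_tensor_right[OF Mc X Y] left_module_tensor[OF X Y] X Y by (simp add: P Q)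
    fix g assume "g \<in> hom ?D P Q"
    thus "cmp ?D ((\<lambda>P\<in>ob ?D. half_br M l (fst P) (snd P)) Q) (tenM ?D (idm ?D (M, \<mu>)) g) =
        cmp ?D (tenM ?D g (idm ?D (M, \<mu>))) ((\<lambda>P\<in>ob ?D. half_br M l (fst P) (snd P)) P)"
      using half_br_natural[OF Mc X Y] X Y by (simp add: P Q)
  qed simp
  have reg: "(H, Mu) \<in> ob ?D" using left_module_regular by simp
  show ?thesis
    unfolding strict_embedding_def
  proof (intro conjI ballI)
    show "inj_on yd_center (ob (left_yd C A))"
    proof (rule inj_onI)
      fix P Q assume "P \<in> ob (left_yd C A)" "Q \<in> ob (left_yd C A)" and e: "yd_center P = yd_center Q"
      then obtain M \<mu> l N \<nu> l' where P: "P = (M, \<mu>, l)" "left_yd_module C A M \<mu> l" and Q: "Q = (N, \<nu>, l')" "left_yd_module C A N \<nu> l'"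
        by (cases P; cases Q) simp
      have MN: "N = M" "\<nu> = \<mu>" using e by (simp_all add: P Q yd_center_def)
      have "(\<lambda>P\<in>ob ?D. half_br M l (fst P) (snd P)) = (\<lambda>P\<in>ob ?D. half_br M l' (fst P) (snd P))"
        using e by (simp add: P Q MN yd_center_def)
      from fun_cong[OF this, of "(H, Mu)"] have "half_br M l H Mu = half_br M l' H Mu" using reg by simp
      hence "l = l'" using half_br_regular[OF left_ydD(2)[OF P(2)]] half_br_regular[OF left_ydD(2)[OF Q(2)]] by (simp add: MN)
      thus "P = Q" by (simp add: P Q MN)
    qed
    show "cmp (left_yd C A) = cmp (left_center ?D)" "tenM (left_yd C A) = tenM (left_center ?D)" by simp_all
    show "unitO (left_yd C A) \<in> ob (left_yd C A)" using left_yd_unit by simp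
    show "yd_center (unitO (left_yd C A)) = unitO (left_center ?D)"
    proof -
      have "(\<lambda>P\<in>ob ?D. half_br \<I> Et (fst P) (snd P)) = (\<lambda>P\<in>ob ?D. idm ?D P)"
        by (rule restrict_ext) (auto simp: half_br_unit)
      thus ?thesis by (simp add: yd_center_def)
    qed
    fix P assume "P \<in> ob (left_yd C A)"
    then obtain M \<mu> l where P: "P = (M, \<mu>, l)" and M: "left_yd_module C A M \<mu> l" by (cases P) auto
    note Mm = left_ydD(1)[OF M] and Mc = left_ydD(2)[OF M]
    show "yd_center P \<in> ob (left_center ?D)" "idm (left_yd C A) P = idm (left_center ?D) (yd_center P)"
      using hb[OF M] by (simp_all add: P yd_center_def)
    fix Q assume "Q \<in> ob (left_yd C A)"
    then obtain N \<nu> l' where Q: "Q = (N, \<nu>, l')" and N: "left_yd_module C A N \<nu> l'" by (cases Q) auto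
    note Nm = left_ydD(1)[OF N] and Nc = left_ydD(2)[OF N]
    show "hom (left_yd C A) P Q = hom (left_center ?D) (yd_center P) (yd_center Q)"
    proof (intro equalityI subsetI)
      fix f assume "f \<in> hom (left_yd C A) P Q"
      thus "f \<in> hom (left_center ?D) (yd_center P) (yd_center Q)"
        using half_br_colinear[OF Mc Nc] by (auto simp: P Q yd_center_def)
    next
      fix f assume f: "f \<in> hom (left_center ?D) (yd_center P) (yd_center Q)"
      hence "f \<in> hom C M N" "(\<one> H \<otimes> f) \<cdot> half_br M l H Mu = half_br N l' H Mu \<cdot> (f \<otimes> \<one> H)"
        using left_module_regular by (auto simp: P Q yd_center_def)
      from half_br_colinear_conv[OF Mc Nc this] show "f \<in> hom (left_yd C A) P Q"
        using f by (auto simp: P Q yd_center_def)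
    qed
    show "tenO (left_yd C A) P Q \<in> ob (left_yd C A)" using left_yd_tensor[OF M N] by (simp add: P Q)
    have "(\<lambda>P\<in>ob ?D. half_br (M \<boxtimes> N) (left_coaction_tensor C A M l N l') (fst P) (snd P)) =
        (\<lambda>P\<in>ob ?D. (half_br M l (fst P) (snd P) \<otimes> \<one> N) \<cdot> (\<one> M \<otimes> half_br N l' (fst P) (snd P)))"
      by (rule restrict_ext) (auto simp: half_br_tensor_left[OF Mc Nc])
    thus "yd_center (tenO (left_yd C A) P Q) = tenO (left_center ?D) (yd_center P) (yd_center Q)"
      by (simp add: P Q yd_center_def cong: restrict_cong)
    show "braid (left_yd C A) P Q = braid (left_center ?D) (yd_center P) (yd_center Q)"
      using Nm by (simp add: P Q yd_center_def)
  qed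
qed

end

section \<open>The right-handed case by reversal\<close>

context transparent_hopf begin

lemma rev_left_action_tensor:
  assumes "M \<in> ob C" "N \<in> ob C"
  shows "left_action_tensor (rev_cat C) A M \<mu> N \<nu> = right_action_tensor C A N \<nu> M \<mu>"
  using assms tenM_assoc[of N N "M \<boxtimes> H" "H \<boxtimes> M" H H "\<one> N" "\<Phi> M H" "\<one> H"] tenM_assoc[of N N M M H "H \<boxtimes> H" "\<one> N" "\<one> M" De]
    hopf_unf by (simp add: left_action_tensor_def right_action_tensor_def homs braid_hom)

lemma rev_left_coaction_tensor:
  assumes "M \<in> ob C" "N \<in> ob C"
  shows "left_coaction_tensor (rev_cat C) A M l N l' = right_coaction_tensor C A N l' M l"
  using assms tenM_assoc[of N N "H \<boxtimes> M" "M \<boxtimes> H" H H "\<one> N" "\<Phi> H M" "\<one> H"] tenM_assoc[of N N M M "H \<boxtimes> H" H "\<one> N" "\<one> M" Mu]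
    hopf_unf by (simp add: left_coaction_tensor_def right_coaction_tensor_def homs braid_hom)

lemma rev_left_module: "left_module (rev_cat C) A M \<nu> \<longleftrightarrow> right_module C A M \<nu>"
  by (simp add: left_module_def right_module_def)

lemma rev_left_comodule: "left_comodule (rev_cat C) A M r \<longleftrightarrow> right_comodule C A M r"
  by (simp add: left_comodule_def right_comodule_def)

lemma rev_left_yd_module: "left_yd_module (rev_cat C) A M \<nu> r \<longleftrightarrow> right_yd_module C A M \<nu> r"
proof (cases "M \<in> ob C")
  case True
  thus ?thesis
    using tenM_assoc[of M M "H \<boxtimes> H" "H \<boxtimes> H" H H "\<one> M" "\<Phi> H H" "\<one> H"]
    by (simp add: left_yd_module_def right_yd_module_def Let_def rev_left_module rev_left_comodule homs braid_hom)
next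
  case False
  thus ?thesis
    by (auto simp: left_yd_module_def right_yd_module_def Let_def left_module_def right_module_def)
qed

lemma rev_transparent: "transparent C X \<Longrightarrow> transparent (rev_cat C) X"
  using transparent_braid(2) by (auto simp: transparent_def)

text \<open>The same structure morphisms serve in the reversed category; the left and right versions
  of the unit, counit and antipode axioms change places.\<close>

lemma rev_hopf: "transparent_hopf (rev_cat C) A"
proof -
  have "hopf_algebra_in (rev_cat C) A"
    using hopf tenM_assoc[of H H "H \<boxtimes> H" "H \<boxtimes> H" H H "\<one> H" "\<Phi> H H" "\<one> H"]
    by (simp add: hopf_algebra_in_def bialgebra_in_def algebra_in_def coalgebra_in_def Let_def id_hom ten_ob braid_hom)
  moreover have "bijective_antipode (rev_cat C) A"
    using bij by (simp add: bijective_antipode_def iso_mor_def inverse_pair_def)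
  ultimately show ?thesis
    using rev_braided[OF braided_category_axioms] rev_transparent[OF trH]
    by (simp add: transparent_hopf_def transparent_hopf_axioms_def)
qed

lemma tenM_rev: "tenM (rev_cat B) = (\<lambda>f g. tenM B g f)"
  by (simp add: fun_eq_iff)

text \<open>Left modules in the reversed category are right modules, but their tensor products come
  out in the opposite order. The outer reversal corrects this.\<close>

lemma right_yd_rev: "strict_embedding (right_yd C A) (rev_cat (left_yd (rev_cat C) A)) id"
proof -
  have o: "M \<in> ob C" if "right_yd_module C A M \<mu> r" for M \<mu> r
    using that by (simp add: right_yd_module_def right_module_def Let_def)
  interpret R: transparent_hopf "rev_cat C" A by (rule rev_hopf)
  have t: "right_yd_module C A (M \<boxtimes> N) (right_action_tensor C A M \<mu> N \<nu>) (right_coaction_tensor C A M r N r')"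
    if "right_yd_module C A M \<mu> r" "right_yd_module C A N \<nu> r'" for M \<mu> r N \<nu> r'
    using R.left_yd_tensor[of N \<nu> r' M \<mu> r] that
    by (simp add: rev_left_yd_module rev_left_action_tensor rev_left_coaction_tensor o)
  show ?thesis
    unfolding strict_embedding_def
    using R.left_yd_unit[unfolded rev_left_yd_module]
    by (auto simp del: R.left_yd_sel simp: right_yd_def left_yd_def rev_left_yd_module rev_left_action_tensor rev_left_coaction_tensor o t
        tenM_rev fun_eq_iff)
qed

lemma rev_left_modules:
  "ob (left_modules (rev_cat C) A) = ob (right_modules C A)" "hom (left_modules (rev_cat C) A) = hom (right_modules C A)"
  "idm (left_modules (rev_cat C) A) = idm (right_modules C A)" "cmp (left_modules (rev_cat C) A) = cmp (right_modules C A)"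
  "unitO (left_modules (rev_cat C) A) = unitO (right_modules C A)"
  "tenM (left_modules (rev_cat C) A) = (\<lambda>f g. tenM (right_modules C A) g f)"
  by (auto simp: left_modules_def right_modules_def rev_left_module tenM_rev fun_eq_iff)

lemma rev_left_modules_ten:
  "P \<in> ob (right_modules C A) \<Longrightarrow> Q \<in> ob (right_modules C A) \<Longrightarrow>
    tenO (left_modules (rev_cat C) A) P Q = tenO (right_modules C A) Q P"
  by (auto simp: left_modules_def right_modules_def right_module_def rev_left_action_tensor)

lemma rev_half_braiding:
  "left_half_braiding (left_modules (rev_cat C) A) P c \<longleftrightarrow> right_half_braiding (right_modules C A) P c"
proof (cases "P \<in> ob (right_modules C A)")
  case True
  thus ?thesis
    by (simp add: left_half_braiding_def right_half_braiding_def rev_left_modules rev_left_modules_ten iso_mor_def inverse_pair_def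
        cong: ball_cong) (rule iffI; elim conjE; intro conjI; (assumption | blast))
next
  case False
  thus ?thesis by (simp add: left_half_braiding_def right_half_braiding_def rev_left_modules)
qed

lemma rev_center_ten:
  assumes "P \<in> ob (right_center (right_modules C A))" "Q \<in> ob (right_center (right_modules C A))"
  shows "tenO (left_center (left_modules (rev_cat C) A)) Q P = tenO (right_center (right_modules C A)) P Q"
proof -
  obtain V c W d where P: "P = (V, c)" "V \<in> ob (right_modules C A)" and Q: "Q = (W, d)" "W \<in> ob (right_modules C A)"
    using assms by (cases P; cases Q) (auto simp: right_center_def right_half_braiding_def)
  show ?thesis
    using rev_left_modules_ten[OF Q(2) P(2)] by (simp add: P Q left_center_def right_center_def rev_left_modules)
qed

text \<open>An embedding by the identity instead of an equality of records, since
  \<open>rev_left_modules_ten\<close> identifies the tensor products only on objects.\<close>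

lemma right_center_rev:
  "strict_embedding (rev_cat (left_center (left_modules (rev_cat C) A))) (right_center (right_modules C A)) id"
  "ob (left_center (left_modules (rev_cat C) A)) = ob (right_center (right_modules C A))"
proof -
  let ?D = "left_modules (rev_cat C) A" and ?E = "right_modules C A"
  interpret R: transparent_hopf "rev_cat C" A by (rule rev_hopf)
  interpret D: strict_monoidal_category ?D by (rule R.left_modules_monoidal)
  have hb: "P \<in> ob ?E" if "right_half_braiding ?E P c" for P c using that by (simp add: right_half_braiding_def)
  show ob: "ob (left_center ?D) = ob (right_center ?E)"
    by (simp del: R.left_modules_sel add: right_center_def rev_half_braiding)
  note ten = rev_center_ten
  have cl: "tenO (left_center ?D) P Q \<in> ob (left_center ?D)" if "P \<in> ob (left_center ?D)" "Q \<in> ob (left_center ?D)" for P Q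
    using that D.half_braiding_tensor by (cases P; cases Q) auto
  have hm: "hom (left_center ?D) P Q = hom (right_center ?E) P Q" for P Q
    by (cases P; cases Q) (simp del: R.left_modules_sel add: right_center_def rev_left_modules)
  have idc: "idm (left_center ?D) P = idm (right_center ?E) P" for P
    by (cases P) (simp del: R.left_modules_sel add: right_center_def rev_left_modules)
  have brc: "braid (left_center ?D) Q P = braid (right_center ?E) P Q" for P Q
    by (cases P; cases Q) (simp add: right_center_def)
  show "strict_embedding (rev_cat (left_center ?D)) (right_center ?E) id"
    unfolding strict_embedding_def
  proof (intro conjI ballI)
    show "cmp (rev_cat (left_center ?D)) = cmp (right_center ?E)" "tenM (rev_cat (left_center ?D)) = tenM (right_center ?E)"
      by (simp_all del: R.left_modules_sel add: right_center_def rev_left_modules tenM_rev)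
    show "unitO (rev_cat (left_center ?D)) \<in> ob (rev_cat (left_center ?D))" using D.half_braiding_unit by simp
    show "id (unitO (rev_cat (left_center ?D))) = unitO (right_center ?E)"
      by (simp del: R.left_modules_sel add: right_center_def rev_left_modules)
    show "inj_on id (ob (rev_cat (left_center ?D)))" by simp
    fix P assume "P \<in> ob (rev_cat (left_center ?D))"
    hence P: "P \<in> ob (left_center ?D)" "P \<in> ob (right_center ?E)" by (simp_all only: rev_cat_sel ob)
    show "id P \<in> ob (right_center ?E)" "idm (rev_cat (left_center ?D)) P = idm (right_center ?E) (id P)"
      using P idc by (simp_all only: rev_cat_sel id_apply)
    fix Q assume "Q \<in> ob (rev_cat (left_center ?D))"
    hence Q: "Q \<in> ob (left_center ?D)" "Q \<in> ob (right_center ?E)" by (simp_all only: rev_cat_sel ob)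
    show "tenO (rev_cat (left_center ?D)) P Q \<in> ob (rev_cat (left_center ?D))"
      using cl[OF Q(1) P(1)] by (simp only: rev_cat_sel)
    show "hom (rev_cat (left_center ?D)) P Q = hom (right_center ?E) (id P) (id Q)"
      "id (tenO (rev_cat (left_center ?D)) P Q) = tenO (right_center ?E) (id P) (id Q)"
      "braid (rev_cat (left_center ?D)) P Q = braid (right_center ?E) (id P) (id Q)"
      using P Q hm ten brc by (simp_all only: rev_cat_sel id_apply)
  qed
qed

theorem braided_right_center: "braided_category (right_center (right_modules C A))"
proof -
  interpret R: transparent_hopf "rev_cat C" A by (rule rev_hopf)
  have "braided_category (rev_cat (left_center (left_modules (rev_cat C) A)))"
    by (intro rev_braided strict_monoidal_category.braided_left_center R.left_modules_monoidal)
  from strict_embedding_braided[OF this strict_embedding_inverse[OF right_center_rev(1)]]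
  show ?thesis using right_center_rev(2) by simp
qed

theorem right_yd_center_embedding:
  "\<exists>F. strict_embedding (right_yd C A) (right_center (right_modules C A)) F"
proof -
  interpret R: transparent_hopf "rev_cat C" A by (rule rev_hopf)
  from strict_embedding_comp[OF strict_embedding_comp[OF right_yd_rev strict_embedding_rev[OF R.left_yd_center_embedding]]
      right_center_rev(1)]
  show ?thesis by blast
qed

end

section \<open>The dual of a finite transparent Hopf algebra\<close>

locale finite_hopf = transparent_hopf C A for C :: "('o, 'm) bcat" (structure) and A :: "('o, 'm) hopf" +
  fixes Hs E :: 'o and ev e :: 'm
  assumes fin: "finite_object C (car A) Hs ev E e"
begin

abbreviation "coev \<equiv> dual_basis C H Hs ev E e"

lemma inner: "inner_hom C H \<I> Hs ev" "inner_hom C H H E e"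
  using fin by (simp_all add: finite_object_def)

lemma Hs_ob [simp]: "Hs \<in> ob C" "E \<in> ob C" and ev_hom: "ev \<in> hom C (Hs \<boxtimes> H) \<I>" and e_hom: "e \<in> hom C (E \<boxtimes> H) H"
  using inner by (simp_all add: inner_hom_def)

lemma ev_ex1: "T \<in> ob C \<Longrightarrow> f \<in> hom C (T \<boxtimes> H) \<I> \<Longrightarrow> \<exists>!g. g \<in> hom C T Hs \<and> ev \<cdot> (g \<otimes> \<one> H) = f"
  using inner(1) by (simp add: inner_hom_def)

text \<open>Let b be the canonical morphism and j the name of the identity, so that
  \<open>coev\<close> is the inverse of b applied to j. Evaluating j gives the identity and
  evaluating b gives \<open>\<one> H \<otimes> ev\<close>, whence the first triangle
  identity.\<close>

lemma coev: "coev \<in> hom C \<I> (H \<boxtimes> Hs)" "(\<one> H \<otimes> ev) \<cdot> (coev \<otimes> \<one> H) = \<one> H"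
proof -
  let ?b = "canonical_mor C H Hs ev E e" and ?j = "THE j. j \<in> hom C \<I> E \<and> e \<cdot> (j \<otimes> \<one> H) = \<one> H"
  have ex: "\<exists>!g. g \<in> hom C T E \<and> e \<cdot> (g \<otimes> \<one> H) = f" if "T \<in> ob C" "f \<in> hom C (T \<boxtimes> H) H" for T f
    using inner(2) that by (simp add: inner_hom_def)
  have o: "H \<boxtimes> Hs \<in> ob C" by (simp add: obs)
  have "\<one> H \<otimes> ev \<in> hom C ((H \<boxtimes> Hs) \<boxtimes> H) H"
    using ten_hom[of H H "Hs \<boxtimes> H" \<I> "\<one> H" ev] ev_hom by (simp add: homs tenO_assoc tenO_unit_right)
  from theI'[OF ex[OF o this]] have b: "?b \<in> hom C (H \<boxtimes> Hs) E" "e \<cdot> (?b \<otimes> \<one> H) = \<one> H \<otimes> ev"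
    unfolding canonical_mor_def by auto
  have "\<one> H \<in> hom C (\<I> \<boxtimes> H) H" by (simp add: homs tenO_unit_left)
  from theI'[OF ex[OF unit_ob this]] have j: "?j \<in> hom C \<I> E" "e \<cdot> (?j \<otimes> \<one> H) = \<one> H" by auto
  have "iso_mor C (H \<boxtimes> Hs) E ?b" using fin by (simp add: finite_object_def)
  from iso_inv[OF o _ this] have g: "inv_mor C (H \<boxtimes> Hs) E ?b \<in> hom C E (H \<boxtimes> Hs)" "?b \<cdot> inv_mor C (H \<boxtimes> Hs) E ?b = \<one> E"
    by (simp_all add: inverse_pair_def)
  show d: "coev \<in> hom C \<I> (H \<boxtimes> Hs)" unfolding dual_basis_def using cmp_hom[OF unit_ob _ o j(1) g(1)] by simp
  have "?b \<cdot> coev = ?j"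
    unfolding dual_basis_def using cmp_assoc[OF unit_ob _ o _ j(1) g(1) b(1)] g(2) id_left[OF unit_ob _ j(1)] by simp
  hence "(?b \<otimes> \<one> H) \<cdot> (coev \<otimes> \<one> H) = ?j \<otimes> \<one> H" using rwhisk[OF unit_ob o _ H_ob d b(1)] by simp
  moreover have "?b \<otimes> \<one> H \<in> hom C (H \<boxtimes> Hs \<boxtimes> H) (E \<boxtimes> H)" "coev \<otimes> \<one> H \<in> hom C H (H \<boxtimes> Hs \<boxtimes> H)"
    using ten_hom[of "H \<boxtimes> Hs" E H H ?b "\<one> H"] ten_hom[of \<I> "H \<boxtimes> Hs" H H coev "\<one> H"] b d
    by (simp_all add: homs tenO_assoc tenO_unit_left)
  ultimately show "(\<one> H \<otimes> ev) \<cdot> (coev \<otimes> \<one> H) = \<one> H"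
    using cmp_assoc[of H "H \<boxtimes> Hs \<boxtimes> H" "E \<boxtimes> H" H "coev \<otimes> \<one> H" "?b \<otimes> \<one> H" e] b(2) j(2) e_hom by (simp add: obs)
qed

text \<open>Morphisms into \<open>Hs\<close> are determined by their pairing with \<open>H\<close>,
  and by the first triangle identity the composite in question has the same pairing as the
  identity.\<close>

lemma ev_coev: "(ev \<otimes> \<one> Hs) \<cdot> (\<one> Hs \<otimes> coev) = \<one> Hs"
proof -
  let ?k = "(ev \<otimes> \<one> Hs) \<cdot> (\<one> Hs \<otimes> coev)"
  have a: "ev \<otimes> \<one> Hs \<in> hom C (Hs \<boxtimes> H \<boxtimes> Hs) Hs" "\<one> Hs \<otimes> coev \<in> hom C Hs (Hs \<boxtimes> H \<boxtimes> Hs)"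
    using ten_hom[of "Hs \<boxtimes> H" \<I> Hs Hs ev "\<one> Hs"] ten_hom[of Hs Hs \<I> "H \<boxtimes> Hs" "\<one> Hs" coev] coev(1) ev_hom
    by (simp_all add: id_hom obs tenO_assoc tenO_unit_left tenO_unit_right)
  have o: "Hs \<boxtimes> H \<boxtimes> Hs \<in> ob C" "Hs \<boxtimes> H \<boxtimes> Hs \<boxtimes> H \<in> ob C" "H \<boxtimes> Hs \<in> ob C" "Hs \<boxtimes> H \<in> ob C" "H \<boxtimes> Hs \<boxtimes> H \<in> ob C" by (simp_all add: obs)
  have k: "?k \<in> hom C Hs Hs" by (rule cmp_hom[OF _ o(1) _ a(2,1)]) simp_all
  have b: "coev \<otimes> \<one> H \<in> hom C H (H \<boxtimes> Hs \<boxtimes> H)" "\<one> H \<otimes> ev \<in> hom C (H \<boxtimes> Hs \<boxtimes> H) H"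
    "ev \<otimes> \<one> (Hs \<boxtimes> H) \<in> hom C (Hs \<boxtimes> H \<boxtimes> Hs \<boxtimes> H) (Hs \<boxtimes> H)"
    "\<one> (Hs \<boxtimes> H) \<otimes> ev \<in> hom C (Hs \<boxtimes> H \<boxtimes> Hs \<boxtimes> H) (Hs \<boxtimes> H)"
    "\<one> Hs \<otimes> coev \<otimes> \<one> H \<in> hom C (Hs \<boxtimes> H) (Hs \<boxtimes> H \<boxtimes> Hs \<boxtimes> H)"
    using ten_hom[of \<I> "H \<boxtimes> Hs" H H coev "\<one> H"] ten_hom[of H H "Hs \<boxtimes> H" \<I> "\<one> H" ev] coev ev_hom
      ten_hom[of "Hs \<boxtimes> H" \<I> "Hs \<boxtimes> H" "Hs \<boxtimes> H" ev "\<one> (Hs \<boxtimes> H)"] ten_hom[of "Hs \<boxtimes> H" "Hs \<boxtimes> H" "Hs \<boxtimes> H" \<I> "\<one> (Hs \<boxtimes> H)" ev]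
      ten_hom[of Hs Hs H "H \<boxtimes> Hs \<boxtimes> H" "\<one> Hs" "coev \<otimes> \<one> H"]
    by (simp_all add: id_hom obs tenO_assoc tenO_unit_left tenO_unit_right)
  have s: "ev \<cdot> (ev \<otimes> \<one> (Hs \<boxtimes> H)) = ev \<cdot> (\<one> (Hs \<boxtimes> H) \<otimes> ev)"
    using slide1[OF o(4) unit_ob o(4) unit_ob ev_hom ev_hom] slide2[OF o(4) unit_ob o(4) unit_ob ev_hom ev_hom]
      tenM_unit_left[OF _ unit_ob ev_hom] tenM_unit_right[OF _ unit_ob ev_hom] o by simp
  have t: "(ev \<otimes> \<one> Hs) \<otimes> \<one> H = ev \<otimes> \<one> (Hs \<boxtimes> H)" "(\<one> Hs \<otimes> coev) \<otimes> \<one> H = \<one> Hs \<otimes> coev \<otimes> \<one> H"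
    "\<one> Hs \<otimes> \<one> H \<otimes> ev = \<one> (Hs \<boxtimes> H) \<otimes> ev"
    using tenM_assoc[OF o(4) unit_ob Hs_ob(1) Hs_ob(1) H_ob H_ob ev_hom id_hom id_hom] tenM_assoc[OF Hs_ob(1) Hs_ob(1) unit_ob o(3) H_ob H_ob id_hom coev(1) id_hom]
      tenM_assoc[OF Hs_ob(1) Hs_ob(1) H_ob H_ob o(4) unit_ob id_hom id_hom ev_hom] by (simp_all add: ten_id)
  have "ev \<cdot> (?k \<otimes> \<one> H) = ev \<cdot> ((ev \<otimes> \<one> (Hs \<boxtimes> H)) \<cdot> (\<one> Hs \<otimes> coev \<otimes> \<one> H))"
    using rwhisk[OF Hs_ob(1) o(1) Hs_ob(1) H_ob a(2,1)] t by (simp only:)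
  also have "\<dots> = ev \<cdot> ((\<one> (Hs \<boxtimes> H) \<otimes> ev) \<cdot> (\<one> Hs \<otimes> coev \<otimes> \<one> H))"
    using cmp_assoc[OF o(4,2,4) unit_ob b(5,3) ev_hom] cmp_assoc[OF o(4,2,4) unit_ob b(5,4) ev_hom] s by simp
  also have "(\<one> (Hs \<boxtimes> H) \<otimes> ev) \<cdot> (\<one> Hs \<otimes> coev \<otimes> \<one> H) = \<one> (Hs \<boxtimes> H)"
    using lwhisk[OF H_ob o(5) H_ob Hs_ob(1) b(1,2)] t(3) coev(2) ten_id[OF Hs_ob(1) H_ob] by simp
  also have "ev \<cdot> \<one> (Hs \<boxtimes> H) = ev \<cdot> (\<one> Hs \<otimes> \<one> H)" by (simp add: ten_id)
  finally have eq: "ev \<cdot> (?k \<otimes> \<one> H) = ev \<cdot> (\<one> Hs \<otimes> \<one> H)" .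
  have "\<one> Hs \<otimes> \<one> H \<in> hom C (Hs \<boxtimes> H) (Hs \<boxtimes> H)" using id_hom[OF o(4)] by (simp add: ten_id)
  from ev_ex1[OF Hs_ob(1) cmp_hom[OF o(4,4) unit_ob this ev_hom]] eq k id_hom[OF Hs_ob(1)] show ?thesis by blast
qed

text \<open>The second triangle identity recovers \<open>k\<close> from its effect on the
  \<open>Hs\<close>-leg of the dual basis.\<close>

lemma coev_cancel:
  assumes X: "X \<in> ob C" and k: "k \<in> hom C (Hs \<boxtimes> X) (Hs \<boxtimes> X)" and e: "(\<one> H \<otimes> k) \<cdot> (coev \<otimes> \<one> X) = coev \<otimes> \<one> X"
  shows "k = \<one> (Hs \<boxtimes> X)"
proof -
  have o: "Hs \<boxtimes> X \<in> ob C" "H \<boxtimes> Hs \<boxtimes> X \<in> ob C" "Hs \<boxtimes> H \<boxtimes> Hs \<boxtimes> X \<in> ob C" "Hs \<boxtimes> H \<in> ob C" "Hs \<boxtimes> H \<boxtimes> Hs \<in> ob C" "H \<boxtimes> Hs \<in> ob C" using X by (simp_all add: obs)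
  have h: "coev \<otimes> \<one> X \<in> hom C X (H \<boxtimes> Hs \<boxtimes> X)" "\<one> H \<otimes> k \<in> hom C (H \<boxtimes> Hs \<boxtimes> X) (H \<boxtimes> Hs \<boxtimes> X)"
    "ev \<otimes> \<one> (Hs \<boxtimes> X) \<in> hom C (Hs \<boxtimes> H \<boxtimes> Hs \<boxtimes> X) (Hs \<boxtimes> X)"
    "\<one> Hs \<otimes> coev \<otimes> \<one> X \<in> hom C (Hs \<boxtimes> X) (Hs \<boxtimes> H \<boxtimes> Hs \<boxtimes> X)"
    "\<one> (Hs \<boxtimes> H) \<otimes> k \<in> hom C (Hs \<boxtimes> H \<boxtimes> Hs \<boxtimes> X) (Hs \<boxtimes> H \<boxtimes> Hs \<boxtimes> X)"
    "ev \<otimes> \<one> Hs \<in> hom C (Hs \<boxtimes> H \<boxtimes> Hs) Hs" "\<one> Hs \<otimes> coev \<in> hom C Hs (Hs \<boxtimes> H \<boxtimes> Hs)"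
    using ten_hom[OF unit_ob o(6) X X coev(1) id_hom[OF X]] ten_hom[OF H_ob H_ob o(1,1) id_hom[OF H_ob] k]
      ten_hom[OF o(4) unit_ob o(1,1) ev_hom id_hom[OF o(1)]] ten_hom[OF o(4,4,1,1) id_hom[OF o(4)] k]
      ten_hom[OF o(4) unit_ob Hs_ob(1) Hs_ob(1) ev_hom id_hom] ten_hom[OF Hs_ob(1) Hs_ob(1) unit_ob o(6) id_hom coev(1)]
      ten_hom[OF Hs_ob(1) Hs_ob(1) X o(2) id_hom[OF Hs_ob(1)] ten_hom[OF unit_ob o(6) X X coev(1) id_hom[OF X], unfolded tenO_assoc[OF H_ob Hs_ob(1) X] tenO_unit_left[OF X]]]
    using X by (simp_all add: obs tenO_assoc tenO_unit_left tenO_unit_right)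
  have z: "(ev \<otimes> \<one> (Hs \<boxtimes> X)) \<cdot> (\<one> Hs \<otimes> coev \<otimes> \<one> X) = \<one> (Hs \<boxtimes> X)"
    using rwhisk[OF Hs_ob(1) o(5) Hs_ob(1) X h(7,6)] ev_coev ten_id[OF Hs_ob(1) X]
      tenM_assoc[OF o(4) unit_ob Hs_ob(1) Hs_ob(1) X X ev_hom id_hom id_hom] tenM_assoc[OF Hs_ob(1) Hs_ob(1) unit_ob o(6) X X id_hom coev(1) id_hom]
    by (simp add: X)
  have "k = k \<cdot> ((ev \<otimes> \<one> (Hs \<boxtimes> X)) \<cdot> (\<one> Hs \<otimes> coev \<otimes> \<one> X))" using z id_right[OF o(1,1) k] by simp
  also have "\<dots> = (k \<cdot> (ev \<otimes> \<one> (Hs \<boxtimes> X))) \<cdot> (\<one> Hs \<otimes> coev \<otimes> \<one> X)" by (rule cmp_assoc[OF o(1,3,1,1) h(4,3) k, symmetric])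
  also have "k \<cdot> (ev \<otimes> \<one> (Hs \<boxtimes> X)) = (ev \<otimes> \<one> (Hs \<boxtimes> X)) \<cdot> (\<one> (Hs \<boxtimes> H) \<otimes> k)"
    using slide1[OF o(4) unit_ob o(1,1) ev_hom k] slide2[OF o(4) unit_ob o(1,1) ev_hom k] tenM_unit_left[OF o(1,1) k] by simp
  also have "\<dots> \<cdot> (\<one> Hs \<otimes> coev \<otimes> \<one> X) = (ev \<otimes> \<one> (Hs \<boxtimes> X)) \<cdot> ((\<one> (Hs \<boxtimes> H) \<otimes> k) \<cdot> (\<one> Hs \<otimes> coev \<otimes> \<one> X))"
    by (rule cmp_assoc[OF o(1,3,3,1) h(4,5,3)])
  also have "(\<one> (Hs \<boxtimes> H) \<otimes> k) \<cdot> (\<one> Hs \<otimes> coev \<otimes> \<one> X) = \<one> Hs \<otimes> coev \<otimes> \<one> X"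
    using lwhisk[OF X o(2,2) Hs_ob(1) h(1,2)] e tenM_assoc[OF Hs_ob(1) Hs_ob(1) H_ob H_ob o(1,1) id_hom id_hom k] ten_id[OF Hs_ob(1) H_ob]
    by simp
  finally show ?thesis using z by simp
qed

text \<open>Crossing the pair \<open>H \<boxtimes> Hs\<close> behind \<open>coev\<close> is trivial
  by naturality. As the crossing with \<open>H\<close> can be undone, so can the one with
  \<open>Hs\<close>, first on the dual basis and then by \<open>coev_cancel\<close> in
  general.\<close>

lemma transparent_dual: "transparent C Hs"
  unfolding transparent_def
proof (intro conjI ballI)
  fix X assume X: "X \<in> ob C"
  let ?u = "\<Phi> X Hs \<cdot> \<Phi> Hs X"
  have o: "Hs \<boxtimes> X \<in> ob C" "X \<boxtimes> Hs \<in> ob C" "H \<boxtimes> Hs \<in> ob C" "H \<boxtimes> Hs \<boxtimes> X \<in> ob C" "H \<boxtimes> X \<boxtimes> Hs \<in> ob C" "X \<boxtimes> H \<boxtimes> Hs \<in> ob C"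
    "X \<boxtimes> H \<in> ob C" "H \<boxtimes> X \<in> ob C" using X by (simp_all add: obs)
  have u: "?u \<in> hom C (Hs \<boxtimes> X) (Hs \<boxtimes> X)" using X by (simp add: cmp_hom[OF o(1,2,1)] braid_hom)
  have h: "\<one> H \<otimes> \<Phi> Hs X \<in> hom C (H \<boxtimes> Hs \<boxtimes> X) (H \<boxtimes> X \<boxtimes> Hs)" "\<one> H \<otimes> \<Phi> X Hs \<in> hom C (H \<boxtimes> X \<boxtimes> Hs) (H \<boxtimes> Hs \<boxtimes> X)"
    "\<Phi> H X \<otimes> \<one> Hs \<in> hom C (H \<boxtimes> X \<boxtimes> Hs) (X \<boxtimes> H \<boxtimes> Hs)" "\<Phi> X H \<otimes> \<one> Hs \<in> hom C (X \<boxtimes> H \<boxtimes> Hs) (H \<boxtimes> X \<boxtimes> Hs)"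
    "coev \<otimes> \<one> X \<in> hom C X (H \<boxtimes> Hs \<boxtimes> X)" "\<one> X \<otimes> coev \<in> hom C X (X \<boxtimes> H \<boxtimes> Hs)"
    using ten_hom[of H H "Hs \<boxtimes> X" "X \<boxtimes> Hs" "\<one> H" "\<Phi> Hs X"] ten_hom[of H H "X \<boxtimes> Hs" "Hs \<boxtimes> X" "\<one> H" "\<Phi> X Hs"]
      ten_hom[of "H \<boxtimes> X" "X \<boxtimes> H" Hs Hs "\<Phi> H X" "\<one> Hs"] ten_hom[of "X \<boxtimes> H" "H \<boxtimes> X" Hs Hs "\<Phi> X H" "\<one> Hs"]
      ten_hom[of \<I> "H \<boxtimes> Hs" X X coev "\<one> X"] ten_hom[of X X \<I> "H \<boxtimes> Hs" "\<one> X" coev] X coev(1)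
    by (simp_all add: id_hom obs braid_hom tenO_assoc tenO_unit_left tenO_unit_right)
  \<comment> \<open>Naturality at \<open>coev\<close> together with a hexagon; the crossings with
    \<open>H\<close> then cancel by transparency.\<close>
  have "(\<Phi> X H \<otimes> \<one> Hs) \<cdot> (\<one> X \<otimes> coev) = (\<Phi> X H \<otimes> \<one> Hs) \<cdot> ((\<Phi> H X \<otimes> \<one> Hs) \<cdot> (\<one> H \<otimes> \<Phi> Hs X)) \<cdot> (coev \<otimes> \<one> X)"
    using braid_natural[OF unit_ob o(3) X X coev(1), of "\<one> X"] braid_ten_left[OF H_ob _ X, of Hs] X
      braid_unit[OF X] id_right[OF X _ h(6)] o by (simp add: homs)
  also have "\<dots> = ((\<Phi> X H \<otimes> \<one> Hs) \<cdot> (\<Phi> H X \<otimes> \<one> Hs) \<cdot> (\<one> H \<otimes> \<Phi> Hs X)) \<cdot> (coev \<otimes> \<one> X)"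
    by (rule cmp_assoc[OF X o(4,6,5) h(5) cmp_hom[OF o(4,5,6) h(1,3)] h(4), symmetric])
  also have "(\<Phi> X H \<otimes> \<one> Hs) \<cdot> (\<Phi> H X \<otimes> \<one> Hs) \<cdot> (\<one> H \<otimes> \<Phi> Hs X) = \<one> H \<otimes> \<Phi> Hs X"
    using cmp_assoc[OF o(4,5,6,5) h(1,3,4)] rwhisk[of "H \<boxtimes> X" "X \<boxtimes> H" "H \<boxtimes> X" Hs "\<Phi> H X" "\<Phi> X H"] X o
      transparent_braid(1)[OF trH X] ten_id[of "H \<boxtimes> X" Hs] id_left[OF o(4,5) h(1)] by (simp add: braid_hom tenO_assoc)
  finally have 1: "(\<Phi> X H \<otimes> \<one> Hs) \<cdot> (\<one> X \<otimes> coev) = (\<one> H \<otimes> \<Phi> Hs X) \<cdot> (coev \<otimes> \<one> X)" .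
  have "(\<one> H \<otimes> ?u) \<cdot> (coev \<otimes> \<one> X) = (\<one> H \<otimes> \<Phi> X Hs) \<cdot> ((\<one> H \<otimes> \<Phi> Hs X) \<cdot> (coev \<otimes> \<one> X))"
    using lwhisk[OF o(1,2,1) H_ob, of "\<Phi> Hs X" "\<Phi> X Hs"] cmp_assoc[OF X o(4,5,4) h(5,1,2)] X by (simp add: braid_hom)
  also have "\<dots> = ((\<one> H \<otimes> \<Phi> X Hs) \<cdot> (\<Phi> X H \<otimes> \<one> Hs)) \<cdot> (\<one> X \<otimes> coev)"
    unfolding 1[symmetric] by (rule cmp_assoc[OF X o(6,5,4) h(6,4,2), symmetric])
  also have "\<dots> = coev \<otimes> \<one> X"
    using braid_natural[OF X X unit_ob o(3), of "\<one> X" coev] coev(1) braid_ten_right[OF X H_ob, of Hs] X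
      braid_unit[OF X] id_right[OF X _ h(5)] o by (simp add: homs)
  finally show "?u = \<one> (Hs \<boxtimes> X)" by (rule coev_cancel[OF X u])
qed simp

end

section \<open>The Drinfel'd double\<close>

context transparent_hopf begin

text \<open>Two evaluations of \<open>S(h1)(1) h2 S(h5) \<otimes> S(h1)(2) h3 S(h4)\<close>, where
  (1) and (2) number the factors of the coproduct of \<open>S(h1)\<close>. Cancelling from the right
  leaves the coproduct of \<open>S(h)\<close>; cancelling from the left leaves
  \<open>S(h2) \<otimes> S(h1)\<close>.\<close>

lemma S_De: "De \<cdot> S = \<Phi> H H \<cdot> (S \<otimes> S) \<cdot> De"
proof -
  note 0 = den_diag[of "[[Gen (mul 15 13 16), Gen (mul 17 14 18)], [Idn (h 15), Brd [h 17, h 14] [h 13]], [Gen (mul 11 4 15), Gen (mul 12 6 17), Gen (ant 8 14),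
    Gen (ant 9 13)], [Idn (h 11), Brd [h 12] [h 4], Idl [h 6, h 8, h 9]], [Gen (com 10 11 12), Idn (h 4), Idn (h 6), Gen (com 7 8 9)], [Gen (ant 2 10),
    Idn (h 4), Gen (com 5 6 7)], [Idn (h 2), Gen (com 3 4 5)], [Gen (com 1 2 3)]]", simplified]
  note 1 = den_rw[OF 0 rl_sym[OF coassoc_rl[of 5 19 9 6 8 7]], simplified]
  note 1 = den_rw[OF 1 assoc_rl[of 12 6 17 14 18 7], simplified]
  note 1 = den_rw[OF 1 antipode_right_rl[of 19 6 8 14 7], simplified]
  note 1 = den_rw_id[OF 1 unit_right[of 12 7 18], simplified]
  note 1 = den_rw_id[OF 1 counit_left[of 5 19 9], simplified]
  note 1 = den_rw[OF 1 assoc_rl[of 11 4 15 13 16 6], simplified]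
  note 1 = den_rw[OF 1 antipode_right_rl[of 3 4 5 13 6], simplified]
  note 1 = den_rw_id[OF 1 unit_right[of 11 6 16], simplified]
  note 1 = den_rw_id[OF 1 counit_right[of 1 2 3], simplified]
  note 1 = den_eq[OF 1 den_diag[of "[[Gen (com 10 11 12)], [Gen (ant 1 10)]]", simplified], simplified]
  note 2 = den_rw[OF 0 rl_sym[OF coassoc_rl[of 3 19 7 4 6 5]], simplified]
  note 2 = den_rw[OF 2 rl_sym[OF coassoc_rl[of 1 5 7 2 19 3]], simplified]
  note 2 = den_rw[OF 2 rl_sym[OF bialg_rl[of 10 19 3 15 17 11 12 4 6]], simplified]
  note 2 = den_rw[OF 2 antipode_left_rl[of 5 2 19 10 3], simplified]
  note 2 = den_rw[OF 2 unit_De_rl[of 3 15 17], simplified]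
  note 2 = den_rw_id[OF 2 unit_left[of 13 15 16], simplified]
  note 2 = den_rw_id[OF 2 unit_left[of 14 17 18], simplified]
  note 2 = den_rw_id[OF 2 counit_left[of 1 5 7], simplified]
  note 2 = den_eq[OF 2 den_diag[of "[[Brd [h 14] [h 13]], [Gen (ant 8 14), Gen (ant 9 13)], [Gen (com 1 8 9)]]", simplified], simplified]
  show ?thesis using trans[OF 1[symmetric] 2] by simp
qed

lemma S_De_rl:
  assumes "distinct [i, j, k, l]" and "distinct [i, a, b, l, k]"
  shows "diag_rl [[Gen (com j k l)], [Gen (ant i j)]]
    [[Brd [h l] [h k]], [Gen (ant a l), Gen (ant b k)], [Gen (com i a b)]]"
  by (rule diag_rlI) (use assms S_De in auto)

text \<open>Derived from \<open>S_De\<close> by surrounding it with inverse antipodes.\<close>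

lemma Si_De: "De \<cdot> Si = \<Phi> H H \<cdot> (Si \<otimes> Si) \<cdot> De"
proof -
  note 0 = den_diag[of "[[Gen (ani 4 7), Gen (ani 5 6)], [Gen (ant 11 4), Gen (ant 12 5)], [Gen (com 2 11 12)], [Gen (ani 1 2)]]", simplified]
  note 1 = den_rw_id[OF 0 Si_S[of 11 4 7], simplified]
  note 1 = den_rw_id[OF 1 Si_S[of 12 5 6], simplified]
  note 1 = den_eq[OF 1 den_diag[of "[[Gen (com 2 11 12)], [Gen (ani 1 2)]]", simplified], simplified]
  note 2 = den_rw[OF 0 rl_sym[OF S_De_rl[of 2 3 5 4 11 12]], simplified]
  note 2 = den_rw_id[OF 2 S_Si[of 1 2 3], simplified]
  note 2 = den_eq[OF 2 den_diag[of "[[Brd [h 6] [h 7]], [Gen (ani 5 6), Gen (ani 4 7)], [Gen (com 1 5 4)]]", simplified], simplified]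
  show ?thesis using trans[OF 1[symmetric] 2] by simp
qed

lemma Si_De_rl:
  assumes "distinct [i, j, k, l]" and "distinct [i, a, b, l, k]"
  shows "diag_rl [[Gen (com j k l)], [Gen (ani i j)]]
    [[Brd [h l] [h k]], [Gen (ani a l), Gen (ani b k)], [Gen (com i a b)]]"
  by (rule diag_rlI) (use assms Si_De in auto)

end

context finite_hopf begin

lemmas transparent_dual [simp]

abbreviation b :: "nat \<Rightarrow> 'o wire" where "b \<equiv> Uw Hs"
abbreviation "evl i j \<equiv> ([b i, h j], ev, [])"
abbreviation "dul i j \<equiv> ([], coev, [h i, b j])"

lemma okop_dual [simp]: "okop (evl i j)" "okop (dul i j)"
  using ev_hom coev(1) by (auto simp: okop_def ok_def)

lemma zig: "distinct [k, i] \<Longrightarrow> den [dul i j, evl j k] ([h k], \<one> (wo (h k)), [h i])"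
  using den_diag[of "[[Idn (h i), Gen (evl j k)], [Gen (dul i j), Idn (h k)]]"] coev(2) by auto

lemma zag: "distinct [k, j] \<Longrightarrow> den [dul i j, evl k i] ([b k], \<one> (wo (b k)), [b j])"
  using den_diag[of "[[Gen (evl k i), Idn (b j)], [Idn (b k), Gen (dul i j)]]"] ev_coev by auto

section \<open>Algebra and coalgebra structure of the dual\<close>

abbreviation "B \<equiv> op_dual C A Hs ev"
abbreviation "Bm \<equiv> mlt B"
abbreviation "Bu \<equiv> unt B"
abbreviation "Bc \<equiv> cmlt B"
abbreviation "Be \<equiv> cunt B"
abbreviation "bml i j k \<equiv> ([b i, b j], Bm, [b k])"
abbreviation "bun i \<equiv> ([], Bu, [b i])"
abbreviation "bco i j k \<equiv> ([b i], Bc, [b j, b k])"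
abbreviation "bou i \<equiv> ([b i], Be, [])"

lemma Bm: "Bm \<in> hom C (Hs \<boxtimes> Hs) Hs"
  "ev \<cdot> (Bm \<otimes> \<one> H) = (ev \<otimes> ev) \<cdot> (\<one> Hs \<otimes> \<Phi> Hs H \<otimes> \<one> H) \<cdot> (\<one> Hs \<otimes> \<one> Hs \<otimes> De)"
proof -
  have "(ev \<otimes> ev) \<cdot> (\<one> Hs \<otimes> \<Phi> Hs H \<otimes> \<one> H) \<cdot> (\<one> Hs \<otimes> \<one> Hs \<otimes> De) \<in> hom C ((Hs \<boxtimes> Hs) \<boxtimes> H) \<I>"
    using den_hom[OF den_diag[of "[[Gen ([b 1, h 4], ev, []), Gen ([b 2, h 5], ev, [])], [Idn (b 1), Brd [b 2] [h 4], Idn (h 5)],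
      [Idn (b 1), Idn (b 2), Gen (com 3 4 5)]]", unfolded diag.simps layer.simps item.simps arr arrow_sel]]
    by (simp add: tenO_assoc arr)
  from theI'[OF ev_ex1[OF _ this]] show "Bm \<in> hom C (Hs \<boxtimes> Hs) Hs"
    "ev \<cdot> (Bm \<otimes> \<one> H) = (ev \<otimes> ev) \<cdot> (\<one> Hs \<otimes> \<Phi> Hs H \<otimes> \<one> H) \<cdot> (\<one> Hs \<otimes> \<one> Hs \<otimes> De)"
    by (simp_all add: op_dual_def Let_def obs)
qed

lemma Bu: "Bu \<in> hom C \<I> Hs" "ev \<cdot> (Bu \<otimes> \<one> H) = Ep"
proof -
  have "Ep \<in> hom C (\<I> \<boxtimes> H) \<I>" using hopf_unf by (simp add: tenO_unit_left)
  from theI'[OF ev_ex1[OF unit_ob this]] show "Bu \<in> hom C \<I> Hs" "ev \<cdot> (Bu \<otimes> \<one> H) = Ep"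
    by (simp_all add: op_dual_def Let_def)
qed

lemma Be: "Be = ev \<cdot> (\<one> Hs \<otimes> Et)"
  by (simp add: op_dual_def Let_def)

lemma okop_B [simp]: "okop (bml i j k)" "okop (bun i)" "okop (bou i)"
proof -
  have "okop (bou i)"
    by (rule okop_den[OF den_diagI[of "[[Gen ([b i, h 1], ev, [])], [Idn (b i), Gen (uni 1)]]" _ _ _ "[uni 1, evl i 1]"]]) (simp_all add: arr Be)
  thus "okop (bml i j k)" "okop (bun i)" "okop (bou i)" using Bm(1) Bu(1) by (auto simp: okop_def ok_def)
qed

lemma Bm_rl:
  assumes "distinct [i, j, k]" and "distinct [i, j]" and "distinct [x, y, z]"
  shows "diag_rl [[Gen (evl k x)], [Gen (bml i j k), Idn (h x)]]
    [[Gen (evl i y), Gen (evl j z)], [Idn (b i), Brd [b j] [h y], Idn (h z)], [Idn (b i), Idn (b j), Gen (com x y z)]]"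
  by (rule diag_rlI) (use assms Bm(2) in auto)

lemma Bu_rl:
  shows "diag_rl [[Gen (evl i x)], [Gen (bun i), Idn (h x)]]
    [[Gen (cou x)]]"
  by (rule diag_rlI) (use  Bu(2) in auto)

lemma Be_rl:
  shows "diag_rl [[Gen (bou i)]]
    [[Gen (evl i x)], [Idn (b i), Gen (uni x)]]"
  by (rule diag_rlI) (simp_all, simp_all add: Be)

abbreviation "evb i j \<equiv> ([h i, b j], ev_bar C A Hs ev, [])"
abbreviation "muo i j k \<equiv> ([h i, h j], Mu \<cdot> \<Phi> H H, [h k])"

lemma okop_evb_rl [simp]: "okop (evb i j)"
proof -
  let ?i = "[h 1, b 2]" and ?o = "[]"
  have "ev_bar C A Hs ev \<in> hom C (obj ?i) (obj ?o)"
    by (rule den_hom[OF den_diagI[of "[[Gen (evl 2 1)], [Brd [h 1] [b 2]]]" ?i _ ?o "[evl 2 1]"]]) (simp_all add: arr ev_bar_def)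
  thus ?thesis by (auto simp: okop_def ok_def)
qed

lemma evb_rl:
  shows "diag_rl [[Gen (evb i j)]]
    [[Gen (evl j i)], [Brd [h i] [b j]]]"
  by (rule diag_rlI) (simp_all, simp_all add: ev_bar_def)

lemma okop_Mu_op [simp]: "okop (muo i j k)"
proof -
  let ?i = "[h 1, h 2]" and ?o = "[h 3]"
  have "Mu \<cdot> \<Phi> H H \<in> hom C (obj ?i) (obj ?o)"
    by (rule den_hom[OF den_diagI[of "[[Gen (mul 2 1 3)], [Brd [h 1] [h 2]]]" ?i _ ?o "[mul 2 1 3]"]]) (simp_all add: arr )
  thus ?thesis by (auto simp: okop_def ok_def)
qed

lemma Mu_op_rl:
  assumes "distinct [i, j, k]"
  shows "diag_rl [[Gen (muo i j k)]]
    [[Gen (mul j i k)], [Brd [h i] [h j]]]"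
  by (rule diag_rlI) (insert assms, auto)

text \<open>The coproduct is specified by a pairing with \<open>H \<boxtimes> H\<close>, whereas the
  universal property of \<open>ev\<close> concerns pairings with \<open>H\<close>. Existence and
  uniqueness are therefore derived from the dual basis.\<close>

lemma Bc: "Bc \<in> hom C Hs (Hs \<boxtimes> Hs)" "(ev \<otimes> ev) \<cdot> (\<one> Hs \<otimes> \<Phi> Hs H \<otimes> \<one> H) \<cdot> (Bc \<otimes> \<one> H \<otimes> \<one> H) = ev \<cdot> (\<one> Hs \<otimes> Mu) \<cdot> (\<one> Hs \<otimes> \<Phi> H H)"
proof -
  \<comment> \<open>The candidate \<open>b \<mapsto> \<Sum> <b, f e> e* \<otimes> f*\<close>, with
    e, e* and f, f* two copies of the dual basis.\<close>
  define c where "c = mo (diag [[Gen (evl 1 4), Idn (b 6), Idn (b 7)], [Idn (b 1), Gen (mul 3 2 4), Idn (b 6), Idn (b 7)], [Idn (b 1), Brd [h 2, b 6] [h 3], Idn (b 7)], [Idn (b 1),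
    Gen (dul 2 6), Gen (dul 3 7)]])"
  have d: "den [dul 2 6, dul 3 7, mul 3 2 4, evl 1 4] ([b 1], c, [b 6, b 7])"
    unfolding c_def by (rule den_diagI[of "[[Gen (evl 1 4), Idn (b 6), Idn (b 7)], [Idn (b 1), Gen (mul 3 2 4), Idn (b 6), Idn (b 7)], [Idn (b 1), Brd [h 2, b 6] [h 3], Idn (b 7)], [Idn (b 1),
    Gen (dul 2 6), Gen (dul 3 7)]]"]) simp_all
  have c: "c \<in> hom C Hs (Hs \<boxtimes> Hs)" using den_hom[OF d] by simp
  hence [simp]: "okop ([b i], c, [b j, b k])" for i j k by (simp add: okop_def ok_def)
  have c0: "rl [([b 1], c, [b 6, b 7])] [dul 2 6, dul 3 7, mul 3 2 4, evl 1 4] [b 1] [b 6, b 7]" using rl_op[OF d] by simp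
  note 1 = den_diag[of "[[Gen (evl 6 8), Gen (evl 7 9)], [Idn (b 6), Brd [b 7] [h 8], Idn (h 9)], [Gen ([b 1], c, [b 6, b 7]), Idn (h 8), Idn (h 9)]]", simplified]
  note 1 = den_rw[OF 1 c0, simplified]
  note 1 = den_rw_id[OF 1 zig[of 8 2 6], simplified]
  note 1 = den_rw_id[OF 1 zig[of 9 3 7], simplified]
  note 2 = den_diag[of "[[Gen (evl 1 4)], [Idn (b 1), Gen (mul 9 8 4)], [Idn (b 1), Brd [h 8] [h 9]]]", simplified]
  have "(ev \<otimes> ev) \<cdot> (\<one> Hs \<otimes> \<Phi> Hs H \<otimes> \<one> H) \<cdot> (c \<otimes> \<one> H \<otimes> \<one> H) = ev \<cdot> (\<one> Hs \<otimes> Mu) \<cdot> (\<one> Hs \<otimes> \<Phi> H H)"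
    using den_eq[OF 1 2] by simp
  note eq = this
  \<comment> \<open>In \<open>g\<close> both \<open>H\<close>-inputs of the specification are closed
    off by dual bases. Straightening the wires gives \<open>f\<close>; applying the specification
    first gives \<open>c\<close>.\<close>
  have un: "f = c" if f: "f \<in> hom C Hs (Hs \<boxtimes> Hs)" and e: "(ev \<otimes> ev) \<cdot> (\<one> Hs \<otimes> \<Phi> Hs H \<otimes> \<one> H) \<cdot> (f \<otimes> \<one> H \<otimes> \<one> H) = ev \<cdot> (\<one> Hs \<otimes> Mu) \<cdot> (\<one> Hs \<otimes> \<Phi> H H)" for f
  proof -
    have [simp]: "okop ([b i], f, [b j, b k])" for i j k using f by (simp add: okop_def ok_def)
    have f0: "diag_rl [[Gen (evl 6 8), Gen (evl 7 9)], [Idn (b 6), Brd [b 7] [h 8], Idn (h 9)], [Gen ([b 1], f, [b 6, b 7]), Idn (h 8), Idn (h 9)]]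
    [[Gen (evl 1 4)], [Idn (b 1), Gen (mul 9 8 4)], [Idn (b 1), Brd [h 8] [h 9]]]"
  by (rule diag_rlI) (use e in auto)
    define g where "g = mo (diag [[Gen (evl 6 8), Gen (evl 7 9), Idl [b 10, b 11]], [Idn (b 6), Brd [b 7] [h 8], Idn (h 9), Idl [b 10, b 11]], [Gen ([b 1], f, [b 6, b 7]), Idl [h 8,
    h 9, b 10, b 11]], [Idn (b 1), Idn (h 8), Brd [b 10] [h 9], Idn (b 11)], [Idn (b 1), Gen (dul 8 10), Gen (dul 9 11)]])"
  note 1 = den_diag[of "[[Gen (evl 6 8), Gen (evl 7 9), Idl [b 10, b 11]], [Idn (b 6), Brd [b 7] [h 8], Idn (h 9), Idl [b 10, b 11]], [Gen ([b 1], f, [b 6, b 7]), Idl [h 8,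
    h 9, b 10, b 11]], [Idn (b 1), Idn (h 8), Brd [b 10] [h 9], Idn (b 11)], [Idn (b 1), Gen (dul 8 10), Gen (dul 9 11)]]", simplified]
  note 1 = den_rw_id[OF 1 zag[of 6 10 8], simplified]
  note 1 = den_rw_id[OF 1 zag[of 7 11 9], simplified]
  note 2 = den_diag[of "[[Gen ([b 1], f, [b 6, b 7])]]", simplified]
  have "g = f"
    using den_eq[OF 1 2] by (simp add: g_def)
  note 1 = den_diag[of "[[Gen (evl 6 8), Gen (evl 7 9), Idl [b 10, b 11]], [Idn (b 6), Brd [b 7] [h 8], Idn (h 9), Idl [b 10, b 11]], [Gen ([b 1], f, [b 6, b 7]), Idl [h 8,
    h 9, b 10, b 11]], [Idn (b 1), Idn (h 8), Brd [b 10] [h 9], Idn (b 11)], [Idn (b 1), Gen (dul 8 10), Gen (dul 9 11)]]", simplified]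
  note 1 = den_rw[OF 1 f0, simplified]
  note 2 = den_diag[of "[[Gen (evl 1 4), Idn (b 10), Idn (b 11)], [Idn (b 1), Gen (mul 9 8 4), Idn (b 10), Idn (b 11)], [Idn (b 1), Brd [h 8, b 10] [h 9], Idn (b 11)],
    [Idn (b 1), Gen (dul 8 10), Gen (dul 9 11)]]", simplified]
  have "g = c"
    using den_eq[OF 1 2] by (simp add: g_def c_def)
    show ?thesis using \<open>g = f\<close> \<open>g = c\<close> by simp
  qed
  have mm: "\<one> Hs \<otimes> (Mu \<cdot> \<Phi> H H) = (\<one> Hs \<otimes> Mu) \<cdot> (\<one> Hs \<otimes> \<Phi> H H)"
    using lwhisk[of "H \<boxtimes> H" "H \<boxtimes> H" H Hs "\<Phi> H H" Mu] hopf_unf by (simp add: braid_hom obs)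
  have "Bc = c"
    unfolding op_dual_def Let_def bialg.simps mm using c eq by (intro the_equality conjI) (blast intro: un)+
  thus "Bc \<in> hom C Hs (Hs \<boxtimes> Hs)" "(ev \<otimes> ev) \<cdot> (\<one> Hs \<otimes> \<Phi> Hs H \<otimes> \<one> H) \<cdot> (Bc \<otimes> \<one> H \<otimes> \<one> H) = ev \<cdot> (\<one> Hs \<otimes> Mu) \<cdot> (\<one> Hs \<otimes> \<Phi> H H)" using c eq by simp_all
qed

lemma okop_Bc [simp]: "okop (bco i j k)"
  using Bc(1) by (auto simp: okop_def ok_def)

lemma Bc_rl:
  assumes "distinct [i, j, k]" and "distinct [x, y]" and "distinct [x, y, v]"
  shows "diag_rl [[Gen (evl j x), Gen (evl k y)], [Idn (b j), Brd [b k] [h x], Idn (h y)], [Gen (bco i j k), Idn (h x), Idn (h y)]]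
    [[Gen (evl i v)], [Idn (b i), Gen (mul y x v)], [Idn (b i), Brd [h x] [h y]]]"
  by (rule diag_rlI) (use assms Bc(2) in auto)

section \<open>The two actions in the double and their cross term\<close>

lemma okop_twisted_conj [simp]: "okop (([h x, h k], Mu \<cdot> \<Phi> H H \<cdot> (Mu \<otimes> Si) \<cdot> (\<one> H \<otimes> De), [h z]))"
proof -
  let ?i = "[h 1, h 2]" and ?o = "[h 7]"
  have "Mu \<cdot> \<Phi> H H \<cdot> (Mu \<otimes> Si) \<cdot> (\<one> H \<otimes> De) \<in> hom C (obj ?i) (obj ?o)"
    by (rule den_hom[OF den_diagI[of "[[Gen (mul 6 5 7)], [Brd [h 5] [h 6]], [Gen (mul 1 3 5), Gen (ani 4 6)], [Idn (h 1), Gen (com 2 3 4)]]" ?i _ ?o "[com 2 3 4, mul 1 3 5, ani 4 6, mul 6 5 7]"]]) (simp_all add: arr )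
  thus ?thesis by (auto simp: okop_def ok_def)
qed

text \<open>The morphism is \<open>x \<otimes> h \<mapsto> Si(h2) x h1\<close>, a twisted
  conjugation. Its transpose is the left action in the double.\<close>

lemma twisted_conj_rl:
  assumes "distinct [x, k, p, q, y, s, z]"
  shows "diag_rl [[Gen (([h x, h k], Mu \<cdot> \<Phi> H H \<cdot> (Mu \<otimes> Si) \<cdot> (\<one> H \<otimes> De), [h z]))]]
    [[Gen (mul s y z)], [Brd [h y] [h s]], [Gen (mul x p y), Gen (ani q s)], [Idn (h x), Gen (com k p q)]]"
  by (rule diag_rlI) (insert assms, auto)

abbreviation "La \<equiv> dd_left_act C A Hs ev"
abbreviation "Ra \<equiv> dd_right_act C A Hs ev"
abbreviation "lac i j k \<equiv> ([h i, b j], La, [b k])"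
abbreviation "rac i j k \<equiv> ([h i, b j], Ra, [h k])"

text \<open>The candidate is \<open>h \<otimes> b \<mapsto> \<Sum> <b, Si(h2) e h1> e*\<close>. As
  for the coproduct of the dual, closing off the remaining input by a dual basis shows
  uniqueness.\<close>

lemma La: "La \<in> hom C (H \<boxtimes> Hs) Hs" "ev_bar C A Hs ev \<cdot> (\<one> H \<otimes> La) = ev_bar C A Hs ev \<cdot> ((Mu \<cdot> \<Phi> H H \<cdot> (Mu \<otimes> Si) \<cdot> (\<one> H \<otimes> De)) \<otimes> \<one> Hs)"
proof -
  define c where "c = mo (diag [[Gen (evl 2 7), Idn (b 9)], [Brd [h 7, b 9] [b 2]], [Gen (mul 8 6 7), Idn (b 9), Idn (b 2)], [Brd [h 6, b 9] [h 8], Idn (b 2)], [Gen (mul 3 4 6),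
    Idn (b 9), Gen (ani 5 8), Idn (b 2)], [Idn (h 3), Brd [b 9] [h 4], Idn (h 5), Idn (b 2)], [Gen (dul 3 9), Gen (com 1 4 5), Idn (b 2)]])"
  have d: "den [dul 3 9, com 1 4 5, mul 3 4 6, ani 5 8, mul 8 6 7, evl 2 7] ([h 1, b 2], c, [b 9])"
    unfolding c_def by (rule den_diagI[of "[[Gen (evl 2 7), Idn (b 9)], [Brd [h 7, b 9] [b 2]], [Gen (mul 8 6 7), Idn (b 9), Idn (b 2)], [Brd [h 6, b 9] [h 8], Idn (b 2)], [Gen (mul 3 4 6),
    Idn (b 9), Gen (ani 5 8), Idn (b 2)], [Idn (h 3), Brd [b 9] [h 4], Idn (h 5), Idn (b 2)], [Gen (dul 3 9), Gen (com 1 4 5), Idn (b 2)]]"]) simp_all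
  have c: "c \<in> hom C (H \<boxtimes> Hs) Hs" using den_hom[OF d] by simp
  hence [simp]: "okop ([h i, b j], c, [b k])" for i j k by (simp add: okop_def ok_def)
  have c0: "rl [([h 1, b 2], c, [b 9])] [dul 3 9, com 1 4 5, mul 3 4 6, ani 5 8, mul 8 6 7, evl 2 7] [h 1, b 2] [b 9]" using rl_op[OF d] by simp
  note 1 = den_diag[of "[[Gen (evb 10 9)], [Idn (h 10), Gen ([h 1, b 2], c, [b 9])]]", simplified]
  note 1 = den_rw[OF 1 c0, simplified]
  note 1 = den_rw[OF 1 evb_rl[of 10 9], simplified]
  note 1 = den_rw_id[OF 1 zig[of 10 3 9], simplified]
  note 2 = den_diag[of "[[Gen (evb 7 2)], [Gen ([h 10, h 1], Mu \<cdot> \<Phi> H H \<cdot> (Mu \<otimes> Si) \<cdot> (\<one> H \<otimes> De), [h 7]), Idn (b 2)]]", simplified]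
  note 2 = den_rw[OF 2 twisted_conj_rl[of 10 1 4 5 6 8 7], simplified]
  note 2 = den_rw[OF 2 evb_rl[of 7 2], simplified]
  have "ev_bar C A Hs ev \<cdot> (\<one> H \<otimes> c) = ev_bar C A Hs ev \<cdot> ((Mu \<cdot> \<Phi> H H \<cdot> (Mu \<otimes> Si) \<cdot> (\<one> H \<otimes> De)) \<otimes> \<one> Hs)"
    using den_eq[OF 1 2] by simp
  note eq = this
  have un: "f = c" if f: "f \<in> hom C (H \<boxtimes> Hs) Hs" and e: "ev_bar C A Hs ev \<cdot> (\<one> H \<otimes> f) = ev_bar C A Hs ev \<cdot> ((Mu \<cdot> \<Phi> H H \<cdot> (Mu \<otimes> Si) \<cdot> (\<one> H \<otimes> De)) \<otimes> \<one> Hs)" for f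
  proof -
    have [simp]: "okop ([h i, b j], f, [b k])" for i j k using f by (simp add: okop_def ok_def)
    have f0: "diag_rl [[Gen (evb 10 9)], [Idn (h 10), Gen ([h 1, b 2], f, [b 9])]]
    [[Gen (evb 7 2)], [Gen ([h 10, h 1], Mu \<cdot> \<Phi> H H \<cdot> (Mu \<otimes> Si) \<cdot> (\<one> H \<otimes> De), [h 7]), Idn (b 2)]]"
  by (rule diag_rlI) (use e in auto)
    define g where "g = mo (diag [[Gen (evb 10 9), Idn (b 11)], [Idn (h 10), Brd [b 11] [b 9]], [Idn (h 10), Idn (b 11), Gen ([h 1, b 2], f, [b 9])], [Gen (dul 10 11), Idn (h 1),
    Idn (b 2)]])"
  note 1 = den_diag[of "[[Gen (evb 10 9), Idn (b 11)], [Idn (h 10), Brd [b 11] [b 9]], [Idn (h 10), Idn (b 11), Gen ([h 1, b 2], f, [b 9])], [Gen (dul 10 11), Idn (h 1),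
    Idn (b 2)]]", simplified]
  note 1 = den_rw[OF 1 evb_rl[of 10 9], simplified]
  note 1 = den_rw_id[OF 1 zag[of 9 11 10], simplified]
  note 2 = den_diag[of "[[Gen ([h 1, b 2], f, [b 9])]]", simplified]
  have "g = f"
    using den_eq[OF 1 2] by (simp add: g_def)
  note 1 = den_diag[of "[[Gen (evb 10 9), Idn (b 11)], [Idn (h 10), Brd [b 11] [b 9]], [Idn (h 10), Idn (b 11), Gen ([h 1, b 2], f, [b 9])], [Gen (dul 10 11), Idn (h 1),
    Idn (b 2)]]", simplified]
  note 1 = den_rw[OF 1 f0, simplified]
  note 1 = den_rw[OF 1 twisted_conj_rl[of 10 1 3 4 5 6 7], simplified]
  note 1 = den_rw[OF 1 evb_rl[of 7 2], simplified]
  note 2 = den_diag[of "[[Gen (evl 2 7), Idn (b 11)], [Brd [h 7, b 11] [b 2]], [Gen (mul 6 5 7), Idn (b 11), Idn (b 2)], [Brd [h 5, b 11] [h 6], Idn (b 2)], [Gen (mul 10 3 5),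
    Idn (b 11), Gen (ani 4 6), Idn (b 2)], [Idn (h 10), Brd [b 11] [h 3], Idn (h 4), Idn (b 2)], [Gen (dul 10 11), Gen (com 1 3 4), Idn (b 2)]]", simplified]
  have "g = c"
    using den_eq[OF 1 2] by (simp add: g_def c_def)
    show ?thesis using \<open>g = f\<close> \<open>g = c\<close> by simp
  qed
  have "La = c"
    unfolding dd_left_act_def Let_def using c eq by (intro the_equality conjI) (blast intro: un)+
  thus "La \<in> hom C (H \<boxtimes> Hs) Hs" "ev_bar C A Hs ev \<cdot> (\<one> H \<otimes> La) = ev_bar C A Hs ev \<cdot> ((Mu \<cdot> \<Phi> H H \<cdot> (Mu \<otimes> Si) \<cdot> (\<one> H \<otimes> De)) \<otimes> \<one> Hs)" using c eq by simp_all
qed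

lemma okop_La [simp]: "okop (lac i j k)"
  using La(1) by (auto simp: okop_def ok_def)

lemma La_bar:
  assumes "distinct [i, c]" and "distinct [x, k]" and "distinct [x, k, z]"
  shows "diag_rl [[Gen (evb x c)], [Idn (h x), Gen (lac k i c)]]
    [[Gen (evb z i)], [Gen ([h x, h k], Mu \<cdot> \<Phi> H H \<cdot> (Mu \<otimes> Si) \<cdot> (\<one> H \<otimes> De), [h z]), Idn (b i)]]"
  by (rule diag_rlI) (use assms La(2) in auto)

text \<open>\<open><h \<triangleright> b, x> = <b, Si(h2) x h1>\<close>: the specification with
  \<open>ev_bar\<close> and the opposite product resolved into elementary boxes.\<close>

lemma La_rl:
  assumes "distinct [j, m]" and "distinct [i, k]" and "distinct [i, k, n, p, q, r, s]"
  shows "diag_rl [[Gen (evl m k)], [Gen (lac i j m), Idn (h k)]]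
    [[Gen (evl j s)], [Idn (b j), Gen (mul r q s)], [Idn (b j), Brd [h q] [h r]], [Idn (b j), Gen (mul k n q), Gen (ani p r)], [Idn (b j), Idn (h k),
    Gen (com i n p)], [Brd [h i] [b j, h k]]]"
proof -
  note 1 = den_diag[of "[[Gen (evl 9 10)], [Gen (lac 1 2 9), Idn (h 10)]]", simplified]
  note 1 = den_rw[OF 1 rl_sym[OF evb_rl[of 10 9]], simplified]
  note 1 = den_rw[OF 1 La_bar[of 2 9 10 1 3], simplified]
  note 1 = den_rw[OF 1 twisted_conj_rl[of 10 1 4 5 6 7 3], simplified]
  note 1 = den_rw[OF 1 evb_rl[of 3 2], simplified]
  note 2 = den_diag[of "[[Gen (evl 2 3)], [Idn (b 2), Gen (mul 7 6 3)], [Idn (b 2), Brd [h 6] [h 7]], [Idn (b 2), Gen (mul 10 4 6), Gen (ani 5 7)], [Idn (b 2), Idn (h 10),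
    Gen (com 1 4 5)], [Brd [h 1] [b 2, h 10]]]", simplified]
  note e = den_eq[OF 1 2, simplified]
  show ?thesis by (rule diag_rlI) (use assms e in auto)
qed

text \<open>Transparency turns the inverse braiding in the definition of the right action into an
  ordinary crossing, which diagrams need not record.\<close>

lemma inv_braid_HH: "inv_mor C (H \<boxtimes> H) (H \<boxtimes> H) (\<Phi> H H) = \<Phi> H H"
  by (rule inv_mor_eq) (simp_all add: obs braid_hom inverse_pair_def transparent_braid[OF trH])

lemma okop_De_twice [simp]: "okop (([h i], (De \<otimes> \<one> H) \<cdot> De, [h j, h k, h l]))"
proof -
  let ?i = "[h 1]" and ?o = "[h 4, h 5, h 3]"
  have "(De \<otimes> \<one> H) \<cdot> De \<in> hom C (obj ?i) (obj ?o)"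
    by (rule den_hom[OF den_diagI[of "[[Gen (com 2 4 5), Idn (h 3)], [Gen (com 1 2 3)]]" ?i _ ?o "[com 1 2 3, com 2 4 5]"]]) (simp_all add: arr )
  thus ?thesis by (auto simp: okop_def ok_def)
qed

lemma De_twice_rl:
  assumes "distinct [i, m, l, j, k]"
  shows "diag_rl [[Gen (([h i], (De \<otimes> \<one> H) \<cdot> De, [h j, h k, h l]))]]
    [[Gen (com m j k), Idn (h l)], [Gen (com i m l)]]"
  by (rule diag_rlI) (insert assms, auto)

lemma okop_Ra_exp [simp]: "okop (rac i j k)"
proof -
  let ?i = "[h 1, b 2]" and ?o = "[h 4]"
  have "Ra \<in> hom C (obj ?i) (obj ?o)"
    by (rule den_hom[OF den_diagI[of "[[Idn (h 4), Gen (evb 7 2)], [Idn (h 4), Gen (muo 3 6 7), Idn (b 2)], [Brd [h 3] [h 4], Gen (ani 5 6), Idn (b 2)], [Gen ([h 1],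
    (De \<otimes> \<one> H) \<cdot> De, [h 3, h 4, h 5]), Idn (b 2)]]" ?i _ ?o "[([h 1], (De \<otimes> \<one> H) \<cdot> De, [h 3, h 4, h 5]), ani 5 6, muo 3 6 7, evb 7 2]"]]) (simp_all add: arr dd_right_act_def Let_def inv_braid_HH)
  thus ?thesis by (auto simp: okop_def ok_def)
qed

lemma Ra_exp:
  assumes "distinct [i, p, k, q, s, w]"
  shows "diag_rl [[Gen (rac i j k)]]
    [[Idn (h k), Gen (evb w j)], [Idn (h k), Gen (muo p s w), Idn (b j)], [Brd [h p] [h k], Gen (ani q s), Idn (b j)], [Gen ([h i],
    (De \<otimes> \<one> H) \<cdot> De, [h p, h k, h q]), Idn (b j)]]"
  by (rule diag_rlI) (insert assms, auto, auto simp: dd_right_act_def Let_def inv_braid_HH)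

text \<open>In elements, \<open>h \<triangleleft> b = <b, Si(h3) h1> h2\<close>.\<close>

lemma Ra_rl:
  assumes "distinct [i, k]" and "distinct [i, m, n, p, k, q, r]"
  shows "diag_rl [[Gen (rac i j k)]]
    [[Idn (h k), Gen (evl j r)], [Idn (h k), Brd [h r] [b j]], [Idn (h k), Gen (mul q p r), Idn (b j)], [Idn (h k), Brd [h p] [h q], Idn (b j)],
    [Brd [h p] [h k], Gen (ani n q), Idn (b j)], [Gen (com m p k), Idn (h n), Idn (b j)], [Gen (com i m n), Idn (b j)]]"
proof -
  note 1 = den_diag[of "[[Gen (rac 1 2 3)]]", simplified]
  note 1 = den_rw[OF 1 Ra_exp[of 1 4 3 5 6 7 2], simplified]
  note 1 = den_rw[OF 1 De_twice_rl[of 1 8 5 4 3], simplified]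
  note 1 = den_rw[OF 1 Mu_op_rl[of 4 6 7], simplified]
  note 1 = den_rw[OF 1 evb_rl[of 7 2], simplified]
  note 2 = den_diag[of "[[Idn (h 3), Gen (evl 2 7)], [Idn (h 3), Brd [h 7] [b 2]], [Idn (h 3), Gen (mul 6 4 7), Idn (b 2)], [Idn (h 3), Brd [h 4] [h 6], Idn (b 2)],
    [Brd [h 4] [h 3], Gen (ani 5 6), Idn (b 2)], [Gen (com 8 4 3), Idn (h 5), Idn (b 2)], [Gen (com 1 8 5), Idn (b 2)]]", simplified]
  note e = den_eq[OF 1 2, simplified]
  show ?thesis by (rule diag_rlI) (use assms e[symmetric] in auto)
qed

text \<open>
  The cross term \<open>(h\<^sub>1 \<triangleright> b\<^sub>1) \<otimes> (h\<^sub>2 \<triangleleft> b\<^sub>2)\<close> of the multiplication of \<open>D(H)\<close>, paired with \<open>x\<close>, is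
  \<open>\<langle>b, S\<^sup>-\<^sup>1(h\<^sub>3) x h\<^sub>1\<rangle> h\<^sub>2\<close>: of \<open>\<langle>b, S\<^sup>-\<^sup>1(h\<^sub>5) h\<^sub>3 S\<^sup>-\<^sup>1(h\<^sub>2) x h\<^sub>1\<rangle> h\<^sub>4\<close> the two inner factors cancel.
\<close>

lemma cross_eval:
  assumes "distinct [j, p, q, r]" and "distinct [i, k, m, n, s]" and "distinct [i, k, t, u, s, v, x, y, z]"
  shows "diag_rl [[Gen (evl r k), Idn (h s)], [Idn (b r), Brd [h s] [h k]], [Gen (lac m p r), Gen (rac n q s), Idn (h k)], [Idn (h m), Brd [h n] [b p], Idn (b q),
    Idn (h k)], [Gen (com i m n), Gen (bco j p q), Idn (h k)]]
    [[Gen (evl j z), Idn (h s)], [Idn (b j), Gen (mul x y z), Idn (h s)], [Idn (b j), Gen (ani v x), Gen (mul k t y), Idn (h s)], [Idn (b j), Brd [h k,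
    h t, h s] [h v]], [Brd [h t, h s, h v] [b j, h k]], [Idn (h t), Gen (com u s v), Idl [b j, h k]], [Gen (com i t u), Idl [b j, h k]]]"
proof -
  note 1 = den_diag[of "[[Gen (evl 8 3), Idn (h 9)], [Idn (b 8), Brd [h 9] [h 3]], [Gen (lac 4 6 8), Gen (rac 5 7 9), Idn (h 3)], [Idn (h 4), Brd [h 5] [b 6], Idn (b 7),
    Idn (h 3)], [Gen (com 1 4 5), Gen (bco 2 6 7), Idn (h 3)]]", simplified]
  note 1 = den_rw[OF 1 La_rl[of 6 8 4 3 10 11 12 13 14], simplified]
  note 1 = den_rw[OF 1 Ra_rl[of 5 9 8 15 16 17 18 7], simplified]
  note 1 = den_rw[OF 1 Bc_rl[of 2 6 7 14 18 19], simplified]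
  note 1 = den_rw[OF 1 assoc_rl[of 17 16 18 14 19 6], simplified]
  note 1 = den_rw[OF 1 rl_sym[OF assoc_rl[of 16 13 7 12 6 14]], simplified]
  note 1 = den_rw[OF 1 coassoc_rl[of 1 4 5 10 11 14], simplified]
  note 1 = den_rw[OF 1 coassoc_rl[of 5 8 15 16 9 4], simplified]
  note 1 = den_rw[OF 1 rl_sym[OF coassoc_rl[of 14 8 4 11 16 5]], simplified]
  note 1 = den_rw[OF 1 Si_left_rl[of 8 11 16 13 7], simplified]
  note 1 = den_rw_id[OF 1 unit_left[of 12 7 6], simplified]
  note 1 = den_rw_id[OF 1 counit_left[of 14 8 4], simplified]
  note 2 = den_diag[of "[[Gen (evl 2 19), Idn (h 9)], [Idn (b 2), Gen (mul 17 12 19), Idn (h 9)], [Idn (b 2), Gen (ani 15 17), Gen (mul 3 10 12), Idn (h 9)], [Idn (b 2),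
    Brd [h 3, h 10, h 9] [h 15]], [Brd [h 10, h 9, h 15] [b 2, h 3]], [Idn (h 10), Gen (com 14 9 15), Idl [b 2, h 3]], [Gen (com 1 10 14), Idl [b 2, h 3]]]", simplified]
  note e = den_eq[OF 1 2, simplified]
  show ?thesis by (rule diag_rlI) (use assms e in auto)
qed

text \<open>The dual basis transposes the counit of \<open>H\<close> into the unit of the dual.
  Pairing that unit with the dual basis is evaluated once by its specification and once by a
  triangle identity.\<close>

lemma coev_Ep:
  shows "diag_rl [[Gen (cou i), Idn (b j)], [Gen (dul i j)]]
    [[Gen (bun j)]]"
proof -
  note 0 = den_diag[of "[[Gen (evl 5 1), Idn (b 2)], [Gen (bun 5), Gen (dul 1 2)]]", simplified]
  note 1 = den_rw[OF 0 Bu_rl[of 5 1], simplified]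
  note 1 = den_eq[OF 1 den_diag[of "[[Gen (cou 1), Idn (b 2)], [Gen (dul 1 2)]]", simplified], simplified]
  note 2 = den_rw_id[OF 0 zag[of 5 2 1], simplified]
  note 2 = den_eq[OF 2 den_diag[of "[[Gen (bun 5)]]", simplified], simplified]
  note e = trans[OF 1[symmetric] 2]
  show ?thesis by (rule diag_rlI) (use e in auto)
qed

text \<open>The coproduct of \<open>H\<close> transposes to the product of the dual: \<open>\<Sum>
  e1 \<otimes> e2 \<otimes> e* = \<Sum> e \<otimes> f \<otimes> e* f*\<close>. Later it makes
  actions of the dual into coassociative coactions.\<close>

lemma coev_De:
  assumes "distinct [i, k, m]" and "distinct [n, p, j]" and "distinct [k, m]"
  shows "diag_rl [[Gen (com i k m), Idn (b j)], [Gen (dul i j)]]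
    [[Idl [h k, h m], Gen (bml n p j)], [Idn (h k), Brd [b n] [h m], Idn (b p)], [Gen (dul k n), Gen (dul m p)]]"
proof -
  note 0 = den_diag[of "[[Idl [h 1, h 2], Gen (evl 7 3), Idn (b 8)], [Idl [h 1, h 2], Gen (bml 5 6 7), Gen (dul 3 8)], [Idn (h 1), Brd [b 5] [h 2], Idn (b 6)], [Gen (dul 1 5),
    Gen (dul 2 6)]]", simplified]
  note 1 = den_rw[OF 0 Bm_rl[of 5 6 7 3 4 9], simplified]
  note 1 = den_rw_id[OF 1 zig[of 4 1 5], simplified]
  note 1 = den_rw_id[OF 1 zig[of 9 2 6], simplified]
  note 1 = den_eq[OF 1 den_diag[of "[[Gen (com 3 4 9), Idn (b 8)], [Gen (dul 3 8)]]", simplified], simplified]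
  note 2 = den_rw_id[OF 0 zag[of 7 8 3], simplified]
  note 2 = den_eq[OF 2 den_diag[of "[[Idl [h 1, h 2], Gen (bml 5 6 7)], [Idn (h 1), Brd [b 5] [h 2], Idn (b 6)], [Gen (dul 1 5), Gen (dul 2 6)]]", simplified], simplified]
  note e = trans[OF 1[symmetric] 2]
  show ?thesis by (rule diag_rlI) (use assms e in auto)
qed

text \<open>Equations between morphisms into \<open>Hs\<close> are verified through their pairing
  with \<open>H\<close>. In a diagram this means inserting a zigzag, which one evaluation
  straightens and the other uses for the pairing rules.\<close>

lemma Bm_unit_left_eq: "Bm \<cdot> (Bu \<otimes> \<one> Hs) = \<one> Hs"
proof -
  note 0 = den_diag[of "[[Gen (evl 3 5), Idn (b 6)], [Gen (bml 1 2 3), Idn (h 5), Idn (b 6)], [Gen (bun 1), Idn (b 2), Gen (dul 5 6)]]", simplified]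
  note 1 = den_rw_id[OF 0 zag[of 3 6 5], simplified]
  note 1 = den_eq[OF 1 den_diag[of "[[Gen (bml 1 2 3)], [Gen (bun 1), Idn (b 2)]]", simplified], simplified]
  note 2 = den_rw[OF 0 Bm_rl[of 1 2 3 5 4 7], simplified]
  note 2 = den_rw[OF 2 Bu_rl[of 1 4], simplified]
  note 2 = den_rw_id[OF 2 counit_left[of 5 4 7], simplified]
  note 2 = den_rw_id[OF 2 zag[of 2 6 5], simplified]
  note 2 = den_eq[OF 2 den_diag[of "[[Idn (b 2)]]", simplified], simplified]
  show ?thesis using trans[OF 1[symmetric] 2] by simp
qed

lemma Bm_unit_left: "distinct [j, i, k] \<Longrightarrow> den [bun i, bml i j k] ([b j], \<one> (wo (b j)), [b k])"
  using den_diag[of "[[Gen (bml i j k)], [Gen (bun i), Idn (b j)]]"] Bm_unit_left_eq by auto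

lemma Bm_unit_right_eq: "Bm \<cdot> (\<one> Hs \<otimes> Bu) = \<one> Hs"
proof -
  note 0 = den_diag[of "[[Gen (evl 3 5), Idn (b 6)], [Gen (bml 2 1 3), Idn (h 5), Idn (b 6)], [Idn (b 2), Gen (bun 1), Gen (dul 5 6)]]", simplified]
  note 1 = den_rw_id[OF 0 zag[of 3 6 5], simplified]
  note 1 = den_eq[OF 1 den_diag[of "[[Gen (bml 2 1 3)], [Idn (b 2), Gen (bun 1)]]", simplified], simplified]
  note 2 = den_rw[OF 0 Bm_rl[of 2 1 3 5 4 7], simplified]
  note 2 = den_rw[OF 2 Bu_rl[of 1 7], simplified]
  note 2 = den_rw_id[OF 2 counit_right[of 5 4 7], simplified]
  note 2 = den_rw_id[OF 2 zag[of 2 6 5], simplified]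
  note 2 = den_eq[OF 2 den_diag[of "[[Idn (b 2)]]", simplified], simplified]
  show ?thesis using trans[OF 1[symmetric] 2] by simp
qed

lemma Bm_unit_right: "distinct [j, i, k] \<Longrightarrow> den [bun i, bml j i k] ([b j], \<one> (wo (b j)), [b k])"
  using den_diag[of "[[Gen (bml j i k)], [Idn (b j), Gen (bun i)]]"] Bm_unit_right_eq by auto

text \<open>\<open>cross_eval\<close> with the paired element replaced by a dual basis: the cross
  term becomes \<open>\<Sum> <b, Si(h3) e h1> e* \<otimes> h2\<close>. In this form it can be
  substituted where no pairing is present.\<close>

lemma cross_expand:
  assumes "distinct [j, n, p, q]" and "distinct [i, k, m, r]" and "distinct [j, q]" and "distinct [i, s, t, u, r, v, x, y, z]"
  shows "diag_rl [[Gen (lac k n q), Gen (rac m p r)], [Idn (h k), Brd [h m] [b n], Idn (b p)], [Gen (com i k m), Gen (bco j n p)]]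
    [[Idl [b q, h r], Gen (evl j z)], [Idn (b q), Brd [b j, h z] [h r]], [Idn (b q), Idn (b j), Gen (mul x y z), Idn (h r)], [Idn (b q), Idn (b j),
    Gen (ani v x), Gen (mul u s y), Idn (h r)], [Idn (b q), Idn (b j), Brd [h u, h s, h r] [h v]], [Idn (b q), Brd [h s, h r, h v] [b j, h u]], [Brd [h s,
    h r, h v, b j, h u] [b q]], [Idn (h s), Gen (com t r v), Idn (b j), Idl [h u, b q]], [Gen (com i s t), Idn (b j), Gen (dul u q)]]"
proof -
  note 0 = den_diag[of "[[Gen (evl 18 3), Idl [b 8, h 9]], [Idn (b 18), Brd [h 9] [h 3, b 8]], [Gen (lac 4 6 18), Gen (rac 5 7 9), Idl [h 3, b 8]], [Idn (h 4),
    Brd [h 5] [b 6], Idn (b 7), Idl [h 3, b 8]], [Gen (com 1 4 5), Gen (bco 2 6 7), Gen (dul 3 8)]]", simplified]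
  note 1 = den_rw_id[OF 0 zag[of 18 8 3], simplified]
  note 1 = den_eq[OF 1 den_diag[of "[[Gen (lac 4 6 18), Gen (rac 5 7 9)], [Idn (h 4), Brd [h 5] [b 6], Idn (b 7)], [Gen (com 1 4 5), Gen (bco 2 6 7)]]", simplified], simplified]
  note 2 = den_rw[OF 0 cross_eval[of 2 6 7 18 1 3 4 5 9 10 11 12 13 14 15], simplified]
  note 2 = den_eq[OF 2 den_diag[of "[[Idl [b 8, h 9], Gen (evl 2 15)], [Idn (b 8), Brd [b 2, h 15] [h 9]], [Idn (b 8), Idn (b 2), Gen (mul 13 14 15), Idn (h 9)], [Idn (b 8), Idn (b 2),
    Gen (ani 12 13), Gen (mul 3 10 14), Idn (h 9)], [Idn (b 8), Idn (b 2), Brd [h 3, h 10, h 9] [h 12]], [Idn (b 8), Brd [h 10, h 9, h 12] [b 2, h 3]],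
    [Brd [h 10, h 9, h 12, b 2, h 3] [b 8]], [Idn (h 10), Gen (com 11 9 12), Idn (b 2), Idl [h 3, b 8]], [Gen (com 1 10 11), Idn (b 2), Gen (dul 3 8)]]", simplified], simplified]
  note e = trans[OF 1[symmetric] 2]
  show ?thesis by (rule diag_rlI) (use assms e in auto)
qed

text \<open>The cross term of \<open>1\<close> and b is \<open>b \<otimes> 1\<close>. The
  multiplication behind it is part of the rule because a rule of type \<open>rl\<close> cannot end
  in a bare wire with a new label; \<open>cross_unit_right\<close> includes a multiplication for the
  same reason.\<close>

lemma cross_unit_left:
  assumes "distinct [i, j, p, q, r, t]" and "distinct [k, m, n, s]" and "distinct [i, j, t]"
  shows "diag_rl [[Gen (bml i r t), Idn (h s)], [Idn (b i), Gen (lac m p r), Gen (rac n q s)], [Idn (b i), Idn (h m), Brd [h n] [b p], Idn (b q)], [Idn (b i),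
    Gen (com k m n), Gen (bco j p q)], [Idn (b i), Gen (uni k), Idn (b j)]]
    [[Gen (bml i j t), Gen (uni s)]]"
proof -
  note 0 = den_diag[of "[[Gen (bml 20 8 21), Idn (h 9)], [Idn (b 20), Gen (evl 18 10), Idn (b 8), Idn (h 9)], [Idn (b 20), Idn (b 18), Brd [h 9] [h 10, b 8]], [Idn (b 20),
    Gen (lac 4 6 18), Gen (rac 5 7 9), Idl [h 10, b 8]], [Idn (b 20), Idn (h 4), Brd [h 5] [b 6], Idn (b 7), Idl [h 10, b 8]], [Idn (b 20),
    Gen (com 1 4 5), Gen (bco 2 6 7), Gen (dul 10 8)], [Idn (b 20), Gen (uni 1), Idn (b 2)]]", simplified]
  note 1 = den_rw_id[OF 0 zag[of 18 8 10], simplified]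
  note 1 = den_eq[OF 1 den_diag[of "[[Gen (bml 20 18 21), Idn (h 9)], [Idn (b 20), Gen (lac 4 6 18), Gen (rac 5 7 9)], [Idn (b 20), Idn (h 4), Brd [h 5] [b 6], Idn (b 7)], [Idn (b 20),
    Gen (com 1 4 5), Gen (bco 2 6 7)], [Idn (b 20), Gen (uni 1), Idn (b 2)]]", simplified], simplified]
  note 2 = den_rw[OF 0 cross_eval[of 2 6 7 18 1 10 4 5 9 3 11 12 13 14 15], simplified]
  note 2 = den_rw[OF 2 unit_De_rl[of 1 3 11], simplified]
  note 2 = den_rw[OF 2 unit_De_rl[of 11 9 12], simplified]
  note 2 = den_rw[OF 2 Si_Et_rl[of 12 13], simplified]
  note 2 = den_rw_id[OF 2 unit_right[of 10 3 14], simplified]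
  note 2 = den_rw_id[OF 2 unit_left[of 10 13 15], simplified]
  note 2 = den_rw_id[OF 2 zag[of 2 8 10], simplified]
  note 2 = den_eq[OF 2 den_diag[of "[[Gen (bml 20 2 21), Gen (uni 9)]]", simplified], simplified]
  note e = trans[OF 1[symmetric] 2]
  show ?thesis by (rule diag_rlI) (use assms e in auto)
qed

lemma cross_unit_right:
  assumes "distinct [k, p, q, r]" and "distinct [i, j, m, n, s, t]" and "distinct [i, j, t]"
  shows "diag_rl [[Idn (b r), Gen (mul s j t)], [Gen (lac m p r), Gen (rac n q s), Idn (h j)], [Idn (h m), Brd [h n] [b p], Idn (b q), Idn (h j)], [Gen (com i m n),
    Gen (bco k p q), Idn (h j)], [Idn (h i), Gen (bun k), Idn (h j)]]
    [[Gen (bun r), Gen (mul i j t)]]"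
proof -
  note 0 = den_diag[of "[[Idn (b 8), Gen (mul 9 20 21)], [Gen (evl 18 10), Idl [b 8, h 9], Idn (h 20)], [Idn (b 18), Brd [h 9] [h 10, b 8], Idn (h 20)], [Gen (lac 4 6 18),
    Gen (rac 5 7 9), Idl [h 10, b 8], Idn (h 20)], [Idn (h 4), Brd [h 5] [b 6], Idn (b 7), Idl [h 10, b 8], Idn (h 20)], [Gen (com 1 4 5), Gen (bco 2 6 7),
    Gen (dul 10 8), Idn (h 20)], [Idn (h 1), Gen (bun 2), Idn (h 20)]]", simplified]
  note 1 = den_rw_id[OF 0 zag[of 18 8 10], simplified]
  note 1 = den_eq[OF 1 den_diag[of "[[Idn (b 18), Gen (mul 9 20 21)], [Gen (lac 4 6 18), Gen (rac 5 7 9), Idn (h 20)], [Idn (h 4), Brd [h 5] [b 6], Idn (b 7), Idn (h 20)],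
    [Gen (com 1 4 5), Gen (bco 2 6 7), Idn (h 20)], [Idn (h 1), Gen (bun 2), Idn (h 20)]]", simplified], simplified]
  note 2 = den_rw[OF 0 cross_eval[of 2 6 7 18 1 10 4 5 9 3 11 12 13 14 15], simplified]
  note 2 = den_rw[OF 2 Bu_rl[of 2 15], simplified]
  note 2 = den_rw[OF 2 Mu_Ep_rl[of 13 14 15], simplified]
  note 2 = den_rw[OF 2 Mu_Ep_rl[of 10 3 14], simplified]
  note 2 = den_rw[OF 2 Si_Ep_rl[of 12 13], simplified]
  note 2 = den_rw_id[OF 2 counit_right[of 11 9 12], simplified]
  note 2 = den_rw_id[OF 2 counit_left[of 1 3 11], simplified]
  note 2 = den_rw[OF 2 coev_Ep[of 10 8], simplified]
  note 2 = den_eq[OF 2 den_diag[of "[[Gen (bun 8), Gen (mul 1 20 21)]]", simplified], simplified]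
  note e = trans[OF 1[symmetric] 2]
  show ?thesis by (rule diag_rlI) (use assms e in auto)
qed

abbreviation "D \<equiv> drinfeld_double C A Hs ev"
text \<open>The carrier of the double is run on two wires, one for each factor, so that its
  operations can be resolved into those of \<open>H\<close> and of the dual.\<close>

abbreviation "dmu i j k l m n \<equiv> ([b i, h j, b k, h l], mlt D, [b m, h n])"
abbreviation "dun i j \<equiv> ([], unt D, [b i, h j])"
abbreviation "dco i j k l m n \<equiv> ([b i, h j], cmlt D, [b k, h l, b m, h n])"
abbreviation "dou i j \<equiv> ([b i, h j], cunt D, [])"

lemma car_D [simp]: "car D = Hs \<boxtimes> H"
  by (simp add: drinfeld_double_def Let_def)

lemma okop_dmu_rl [simp]: "okop (dmu i j k l m n)"
proof -
  let ?i = "[b 1, h 2, b 3, h 4]" and ?o = "[b 11, h 12]"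
  have "mlt D \<in> hom C (obj ?i) (obj ?o)"
    by (rule den_hom[OF den_diagI[of "[[Gen (bml 1 9 11), Gen (mul 10 4 12)], [Idn (b 1), Gen (lac 5 7 9), Gen (rac 6 8 10), Idn (h 4)], [Idn (b 1), Idn (h 5), Brd [h 6] [b 7], Idn (b 8),
    Idn (h 4)], [Idn (b 1), Gen (com 2 5 6), Gen (bco 3 7 8), Idn (h 4)]]" ?i _ ?o "[com 2 5 6, bco 3 7 8, lac 5 7 9, rac 6 8 10, bml 1 9 11, mul 10 4 12]"]]) (simp_all add: arr drinfeld_double_def Let_def)
  thus ?thesis by (auto simp: okop_def ok_def)
qed

lemma dmu_rl:
  assumes "distinct [i, k, x, y, p, m]" and "distinct [j, l, u, v, q, n]"
  shows "diag_rl [[Gen (dmu i j k l m n)]]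
    [[Gen (bml i p m), Gen (mul q l n)], [Idn (b i), Gen (lac u x p), Gen (rac v y q), Idn (h l)], [Idn (b i), Idn (h u), Brd [h v] [b x], Idn (b y),
    Idn (h l)], [Idn (b i), Gen (com j u v), Gen (bco k x y), Idn (h l)]]"
  by (rule diag_rlI) (insert assms, auto, auto simp: drinfeld_double_def Let_def)

lemma okop_dun_rl [simp]: "okop (dun i j)"
proof -
  let ?i = "[]" and ?o = "[b 1, h 2]"
  have "unt D \<in> hom C (obj ?i) (obj ?o)"
    by (rule den_hom[OF den_diagI[of "[[Gen (bun 1), Gen (uni 2)]]" ?i _ ?o "[bun 1, uni 2]"]]) (simp_all add: arr drinfeld_double_def Let_def)
  thus ?thesis by (auto simp: okop_def ok_def)
qed

lemma dun_rl:
  shows "diag_rl [[Gen (dun i j)]]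
    [[Gen (bun i), Gen (uni j)]]"
  by (rule diag_rlI) (simp_all, simp_all add: drinfeld_double_def Let_def)

lemma okop_dco_rl [simp]: "okop (dco i j k l m n)"
proof -
  let ?i = "[b 1, h 2]" and ?o = "[b 3, h 5, b 4, h 6]"
  have "cmlt D \<in> hom C (obj ?i) (obj ?o)"
    by (rule den_hom[OF den_diagI[of "[[Idn (b 3), Brd [b 4] [h 5], Idn (h 6)], [Gen (bco 1 3 4), Gen (com 2 5 6)]]" ?i _ ?o "[bco 1 3 4, com 2 5 6]"]]) (simp_all add: arr drinfeld_double_def Let_def)
  thus ?thesis by (auto simp: okop_def ok_def)
qed

lemma dco_rl:
  assumes "distinct [i, k, m]" and "distinct [j, l, n]"
  shows "diag_rl [[Gen (dco i j k l m n)]]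
    [[Idn (b k), Brd [b m] [h l], Idn (h n)], [Gen (bco i k m), Gen (com j l n)]]"
  by (rule diag_rlI) (insert assms, auto, auto simp: drinfeld_double_def Let_def)

lemma okop_dou_rl [simp]: "okop (dou i j)"
proof -
  let ?i = "[b 1, h 2]" and ?o = "[]"
  have "cunt D \<in> hom C (obj ?i) (obj ?o)"
    by (rule den_hom[OF den_diagI[of "[[Gen (bou 1), Gen (cou 2)]]" ?i _ ?o "[bou 1, cou 2]"]]) (simp_all add: arr drinfeld_double_def Let_def)
  thus ?thesis by (auto simp: okop_def ok_def)
qed

lemma dou_rl:
  shows "diag_rl [[Gen (dou i j)]]
    [[Gen (bou i), Gen (cou j)]]"
  by (rule diag_rlI) (simp_all, simp_all add: drinfeld_double_def Let_def)

end

section \<open>Left modules over the double\<close>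

context finite_hopf begin

abbreviation "dac M w i j m n \<equiv> ([b i, h j, Nw M m], w, [Nw M n])"
abbreviation "bac M s i m n \<equiv> ([b i, Nw M m], s, [Nw M n])"

text \<open>
  \<open>(b \<otimes> h) m = \<langle>b, S\<^sup>-\<^sup>1((h m)\<^sub>-\<^sub>1)\<rangle> (h m)\<^sub>0\<close>
\<close>

definition double_act :: "'o \<Rightarrow> 'm \<Rightarrow> 'm \<Rightarrow> 'm" where
  "double_act M \<mu> l = (ev \<otimes> \<one> M) \<cdot> (\<one> Hs \<otimes> Si \<otimes> \<one> M) \<cdot> (\<one> Hs \<otimes> l) \<cdot> (\<one> Hs \<otimes> \<mu>)"

lemma okop_double_act_rl:
  assumes Mm: "left_module C A M \<mu>" and Mc: "left_comodule C A M l"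
  shows "okop (dac M (double_act M \<mu> l) i j k p)"
proof -
  have 0: "okop (dac M (double_act M \<mu> l) 1 2 3 4)"
    by (rule okop_den[of "[act M \<mu> 2 3 5, coa M l 5 6 4, ani 6 7, evl 1 7]"]) (use left_moduleD(1,2,5)[OF Mm] left_comoduleD(1,2,5)[OF Mc] den_diag[of "[[Gen (evl 1 7), Idn (Nw M 4)], [Idn (b 1), Gen (ani 6 7), Idn (Nw M 4)], [Idn (b 1), Gen (coa M l 5 6 4)], [Idn (b 1), Gen (act M \<mu> 2 3 5)]]"] in \<open>auto simp: double_act_def\<close>)
  thus ?thesis by (auto simp: okop_def ok_def)
qed

lemma double_act_rl:
  assumes Mm: "left_module C A M \<mu>" and Mc: "left_comodule C A M l" and "distinct [j, n, q]" and "distinct [k, m, p]"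
  shows "diag_rl [[Gen (dac M (double_act M \<mu> l) i j k p)]]
    [[Gen (evl i q), Idn (Nw M p)], [Idn (b i), Gen (ani n q), Idn (Nw M p)], [Idn (b i), Gen (coa M l m n p)], [Idn (b i), Gen (act M \<mu> j k m)]]"
  by (rule diag_rlI) (use assms okop_double_act_rl[OF Mm Mc] left_moduleD(1,2,5)[OF Mm] left_comoduleD(1,2,5)[OF Mc] in \<open>auto, auto simp: double_act_def\<close>)

text \<open>
  \<open>S\<^sup>-\<^sup>1(m\<^sub>-\<^sub>1) \<otimes> h m\<^sub>0 = S\<^sup>-\<^sup>1(h\<^sub>3) S\<^sup>-\<^sup>1((h\<^sub>2 m)\<^sub>-\<^sub>1) h\<^sub>1 \<otimes> (h\<^sub>2 m)\<^sub>0\<close>, obtained by inserting \<open>S(h\<^sub>1) h\<^sub>2\<close>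
\<close>

lemma left_yd_cross:
  assumes M: "left_yd_module C A M \<mu> l" and "distinct [i, k, n]" and "distinct [j, m, p]" and "distinct [i, k, q, r, s, u, v, x, y, n]" and "distinct [j, t, p]"
  shows "diag_rl [[Idn (h n), Gen (act M \<mu> i m p)], [Brd [h i] [h n], Idn (Nw M m)], [Idn (h i), Gen (ani k n), Idn (Nw M m)], [Idn (h i), Gen (coa M l j k m)]]
    [[Gen (mul x y n), Idn (Nw M p)], [Gen (ani s x), Gen (mul v k y), Idn (Nw M p)], [Idn (h s), Brd [h k] [h v], Idn (Nw M p)], [Brd [h k] [h s],
    Gen (ani u v), Idn (Nw M p)], [Idn (h k), Idn (h s), Gen (coa M l t u p)], [Idn (h k), Idn (h s), Gen (act M \<mu> r j t)], [Idn (h k),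
    Brd [h r] [h s], Idn (Nw M j)], [Idn (h k), Gen (com q r s), Idn (Nw M j)], [Gen (com i k q), Idn (Nw M j)]]"
proof -
  note Mm = left_ydD(1)[OF M] and Mc = left_ydD(2)[OF M]
  note [simp] = left_moduleD(1,2,5)[OF Mm] left_comoduleD(1,2,5)[OF Mc] okop_double_act_rl[OF Mm Mc]
  \<comment> \<open>\<open>Si(S(h1) (h2 m)(-1) h3) \<otimes> (h2 m)(0)\<close>. The Yetter-Drinfel'd
    condition produces \<open>S(h1) h2\<close>, which cancels; distributing \<open>Si\<close> over
    the product gives the other side.\<close>
  note 0 = den_diag[of "[[Gen (ani 9 10), Idn (Nw M 11)], [Gen (mul 8 5 9), Idn (Nw M 11)], [Gen (mul 6 7 8), Idn (h 5), Idn (Nw M 11)], [Idn (h 6), Brd [h 5] [h 7],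
    Idn (Nw M 11)], [Gen (ant 2 6), Idn (h 5), Gen (coa M l 14 7 11)], [Idn (h 2), Idn (h 5), Gen (act M \<mu> 4 13 14)], [Idn (h 2), Brd [h 4] [h 5],
    Idn (Nw M 13)], [Idn (h 2), Gen (com 3 4 5), Idn (Nw M 13)], [Gen (com 1 2 3), Idn (Nw M 13)]]", simplified]
  note 1 = den_rw[OF 0 assoc_rl[of 6 7 8 5 9 12], simplified]
  note 1 = den_rw[OF 1 yd_rl[OF M, of 3 4 5 7 12 13 14 11 8 15 16 17], simplified]
  note 1 = den_rw[OF 1 rl_sym[OF assoc_rl[of 6 8 4 16 9 12]], simplified]
  note 1 = den_rw[OF 1 rl_sym[OF coassoc_rl[of 1 5 15 2 8 3]], simplified]
  note 1 = den_rw[OF 1 antipode_left_rl[of 5 2 8 6 4], simplified]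
  note 1 = den_rw_id[OF 1 unit_left[of 16 4 9], simplified]
  note 1 = den_rw_id[OF 1 counit_left[of 1 5 15], simplified]
  note 1 = den_eq[OF 1 den_diag[of "[[Idn (h 10), Gen (act M \<mu> 1 17 11)], [Brd [h 1] [h 10], Idn (Nw M 17)], [Idn (h 1), Gen (ani 16 10), Idn (Nw M 17)], [Idn (h 1),
    Gen (coa M l 13 16 17)]]", simplified], simplified]
  note 2 = den_rw[OF 0 Si_Mu_rl[of 8 5 9 10 12 15], simplified]
  note 2 = den_rw[OF 2 Si_Mu_rl[of 6 7 8 12 9 16], simplified]
  note 2 = den_rw_id[OF 2 Si_S[of 2 6 9], simplified]
  note 2 = den_eq[OF 2 den_diag[of "[[Gen (mul 15 12 10), Idn (Nw M 11)], [Gen (ani 5 15), Gen (mul 16 2 12), Idn (Nw M 11)], [Idn (h 5), Brd [h 2] [h 16], Idn (Nw M 11)],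
    [Brd [h 2] [h 5], Gen (ani 7 16), Idn (Nw M 11)], [Idn (h 2), Idn (h 5), Gen (coa M l 14 7 11)], [Idn (h 2), Idn (h 5), Gen (act M \<mu> 4 13 14)],
    [Idn (h 2), Brd [h 4] [h 5], Idn (Nw M 13)], [Idn (h 2), Gen (com 3 4 5), Idn (Nw M 13)], [Gen (com 1 2 3), Idn (Nw M 13)]]", simplified], simplified]
  note e = trans[OF 1[symmetric] 2]
  show ?thesis by (rule diag_rlI) (use assms e in auto)
qed

text \<open>A product in the double acts through its cross term, which is expanded by means of the
  dual basis. What remains is the rule for moving an action of \<open>H\<close> past an action of
  the dual.\<close>

theorem left_double_module:
  assumes M: "left_yd_module C A M \<mu> l"
  shows "left_module C D M (double_act M \<mu> l)"
proof -
  note Mm = left_ydD(1)[OF M] and Mc = left_ydD(2)[OF M]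
  note [simp] = left_moduleD(1,2,5)[OF Mm] left_comoduleD(1,2,5)[OF Mc] okop_double_act_rl[OF Mm Mc]
  note 1 = den_diag[of "[[Gen (dac M (double_act M \<mu> l) 5 6 7 8)], [Gen (dmu 1 2 3 4 5 6), Idn (Nw M 7)]]", simplified]
  note 1 = den_rw[OF 1 dmu_rl[of 1 3 9 10 11 5 2 4 12 13 14 6], simplified]
  note 1 = den_rw[OF 1 double_act_rl[OF Mm Mc, of 6 15 16 7 17 8 5], simplified]
  note 1 = den_rw[OF 1 Bm_rl[of 1 11 5 16 18 19], simplified]
  note 1 = den_rw[OF 1 Si_De_rl[of 15 16 18 19 5 20], simplified]
  note 1 = den_rw[OF 1 coa_rl[OF Mc, of 15 5 20 17 8 16], simplified]
  \<comment> \<open>This introduces a dual basis, which the next step contracts with the pairing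
    already present.\<close>
  note 1 = den_rw[OF 1 cross_expand[of 3 9 10 11 2 12 13 14 15 21 22 23 24 25 26], simplified]
  note 1 = den_rw_id[OF 1 zig[of 19 22 11], simplified]
  note 1 = den_rw[OF 1 act_rl[OF Mm, of 14 4 6 7 17 9], simplified]
  note 2 = den_diag[of "[[Gen (dac M (double_act M \<mu> l) 1 2 22 8)], [Idl [b 1, h 2], Gen (dac M (double_act M \<mu> l) 3 4 7 22)]]", simplified]
  note 2 = den_rw[OF 2 double_act_rl[OF Mm Mc, of 4 15 26 7 9 22 3], simplified]
  note 2 = den_rw[OF 2 double_act_rl[OF Mm Mc, of 2 20 18 22 16 8 1], simplified]
  \<comment> \<open>The Yetter-Drinfel'd condition enters here, as the commutation rule of
    \<open>H\<close> and its dual.\<close>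
  note 2 = den_rw[OF 2 left_yd_cross[OF M, of 2 15 26 9 22 16 21 14 23 5 19 24 25 17], simplified]
  have "double_act M \<mu> l \<cdot> (mlt D \<otimes> \<one> M) = double_act M \<mu> l \<cdot> (\<one> (Hs \<boxtimes> H) \<otimes> double_act M \<mu> l)"
    using den_eq[OF 1 2] by simp
  moreover
  note 1 = den_diag[of "[[Gen (dac M (double_act M \<mu> l) 5 6 7 8)], [Gen (dun 5 6), Idn (Nw M 7)]]", simplified]
  note 1 = den_rw[OF 1 dun_rl[of 5 6], simplified]
  note 1 = den_rw[OF 1 double_act_rl[OF Mm Mc, of 6 1 2 7 3 8 5], simplified]
  note 1 = den_rw[OF 1 Bu_rl[of 5 2], simplified]
  note 1 = den_rw[OF 1 Si_Ep_rl[of 1 2], simplified]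
  note 1 = den_rw_id[OF 1 coa_unit[OF Mc, of 3 8 1], simplified]
  note 1 = den_rw_id[OF 1 act_unit[OF Mm, of 7 3 6], simplified]
  note 2 = den_diag[of "[[Idn (Nw M 7)]]", simplified]
  have "double_act M \<mu> l \<cdot> (unt D \<otimes> \<one> M) = \<one> M"
    using den_eq[OF 1 2] by simp
  moreover have "double_act M \<mu> l \<in> hom C ((Hs \<boxtimes> H) \<boxtimes> M) M"
    using okop_double_act_rl[OF Mm Mc, of 1 1 1 2] by (simp add: okop_def ok_def tenO_assoc)
  ultimately show ?thesis by (simp add: left_module_def)
qed

section \<open>From modules over the double back to Yetter-Drinfel'd modules\<close>

abbreviation "lact M w \<equiv> left_act_H C A Hs ev M w"
abbreviation "sact M w \<equiv> left_act_Hs C A Hs M w"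

text \<open>\<open>m \<mapsto> \<Sum> S(e) \<otimes> e* m\<close>. The antipode compensates the
  inverse antipode by which \<open>double_act\<close> turns coactions into actions.\<close>

definition double_coact :: "'o \<Rightarrow> 'm \<Rightarrow> 'm" where
  "double_coact M w = (S \<otimes> \<one> M) \<cdot> (\<one> H \<otimes> sact M w) \<cdot> (coev \<otimes> \<one> M)"

lemma double_moduleD:
  assumes "left_module C D M w"
  shows "M \<in> ob C" "w \<in> hom C (Hs \<boxtimes> H \<boxtimes> M) M" "w \<cdot> (mlt D \<otimes> \<one> M) = w \<cdot> (\<one> (Hs \<boxtimes> H) \<otimes> w)" "w \<cdot> (unt D \<otimes> \<one> M) = \<one> M"
    "okop (dac M w i j m n)"
  using assms by (auto simp: left_module_def tenO_assoc okop_def ok_def)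

lemma double_rl:
  assumes W: "left_module C D M w" and "distinct [i, k, p]" and "distinct [j, m, q]" and "distinct [n, r]" and "distinct [i, k]" and "distinct [j, m]" and "distinct [n, s, r]"
  shows "diag_rl [[Gen (dac M w p q n r)], [Gen (dmu i j k m p q), Idn (Nw M n)]]
    [[Gen (dac M w i j s r)], [Idl [b i, h j], Gen (dac M w k m n s)]]"
  by (rule diag_rlI) (use assms double_moduleD(1,2,5)[OF W] double_moduleD(3)[OF W] in auto)

lemma double_unit:
  assumes W: "left_module C D M w" and "distinct [i, m]"
  shows "den [dun j k, dac M w j k i m] ([Nw M i], \<one> (wo (Nw M i)), [Nw M m])"
  using double_moduleD(1,2,5)[OF W] double_moduleD(4)[OF W] assms(2-) den_diag[of "[[Gen (dac M w j k i m)], [Gen (dun j k), Idn (Nw M i)]]"] by auto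

lemma okop_lact_rl:
  assumes W: "left_module C D M w"
  shows "okop (act M (lact M w) i j m)"
proof -
  have 0: "okop (act M (lact M w) 1 7 8)"
    by (rule okop_den[of "[bun 2, dac M w 2 1 7 8]"]) (use double_moduleD(1,2,5)[OF W] den_diag[of "[[Gen (dac M w 2 1 7 8)], [Gen (bun 2), Idn (h 1), Idn (Nw M 7)]]"] in \<open>auto simp: left_act_H_def\<close>)
  thus ?thesis by (auto simp: okop_def ok_def)
qed

lemma lact_rl:
  assumes W: "left_module C D M w" and "distinct [j, m]"
  shows "diag_rl [[Gen (act M (lact M w) i j m)]]
    [[Gen (dac M w k i j m)], [Gen (bun k), Idn (h i), Idn (Nw M j)]]"
  by (rule diag_rlI) (use assms okop_lact_rl[OF W] double_moduleD(1,2,5)[OF W] in \<open>auto, auto simp: left_act_H_def\<close>)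

lemma okop_sact_rl:
  assumes W: "left_module C D M w"
  shows "okop (bac M (sact M w) i j m)"
proof -
  have 0: "okop (bac M (sact M w) 1 7 8)"
    by (rule okop_den[of "[uni 2, dac M w 1 2 7 8]"]) (use double_moduleD(1,2,5)[OF W] den_diag[of "[[Gen (dac M w 1 2 7 8)], [Idn (b 1), Gen (uni 2), Idn (Nw M 7)]]"] in \<open>auto simp: left_act_Hs_def\<close>)
  thus ?thesis by (auto simp: okop_def ok_def)
qed

lemma sact_rl:
  assumes W: "left_module C D M w" and "distinct [j, m]"
  shows "diag_rl [[Gen (bac M (sact M w) i j m)]]
    [[Gen (dac M w i k j m)], [Idn (b i), Gen (uni k), Idn (Nw M j)]]"
  by (rule diag_rlI) (use assms okop_sact_rl[OF W] double_moduleD(1,2,5)[OF W] in \<open>auto, auto simp: left_act_Hs_def\<close>)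

lemma okop_double_coact_rl:
  assumes W: "left_module C D M w"
  shows "okop (coa M (double_coact M w) i n m)"
proof -
  have 0: "okop (coa M (double_coact M w) 7 3 8)"
    by (rule okop_den[of "[dul 1 2, bac M (sact M w) 2 7 8, ant 1 3]"]) (use double_moduleD(1,2,5)[OF W] okop_sact_rl[OF W] den_diag[of "[[Gen (ant 1 3), Idn (Nw M 8)], [Idn (h 1), Gen (bac M (sact M w) 2 7 8)], [Gen (dul 1 2), Idn (Nw M 7)]]"] in \<open>auto simp: double_coact_def\<close>)
  thus ?thesis by (auto simp: okop_def ok_def)
qed

lemma double_coact_rl:
  assumes W: "left_module C D M w" and "distinct [j, n]" and "distinct [i, m]"
  shows "diag_rl [[Gen (coa M (double_coact M w) i n m)]]
    [[Gen (ant j n), Idn (Nw M m)], [Idn (h j), Gen (bac M (sact M w) k i m)], [Gen (dul j k), Idn (Nw M i)]]"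
  by (rule diag_rlI) (use assms okop_double_coact_rl[OF W] double_moduleD(1,2,5)[OF W] okop_sact_rl[OF W] in \<open>auto, auto simp: double_coact_def\<close>)

lemmas double_ops = double_moduleD(1,2,5) okop_lact_rl okop_sact_rl okop_double_coact_rl

text \<open>In the double \<open>(b \<otimes> 1)(1 \<otimes> h) = b \<otimes> h\<close>, since the
  cross term of two units is trivial. A module over the double is thus determined by its two
  restrictions.\<close>

lemma double_split:
  assumes W: "left_module C D M w" and "distinct [k, m]" and "distinct [k, n, m]"
  shows "diag_rl [[Gen (dac M w i j k m)]]
    [[Gen (bac M (sact M w) i n m)], [Idn (b i), Gen (act M (lact M w) j k n)]]"
proof -
  note [simp] = double_ops[OF W]
  note 1 = den_diag[of "[[Gen (dac M w 1 2 7 8)]]", simplified]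
  note 2 = den_diag[of "[[Gen (bac M (sact M w) 1 9 8)], [Idn (b 1), Gen (act M (lact M w) 2 7 9)]]", simplified]
  note 2 = den_rw[OF 2 sact_rl[OF W, of 9 8 1 3], simplified]
  note 2 = den_rw[OF 2 lact_rl[OF W, of 7 9 2 4], simplified]
  note 2 = den_rw[OF 2 rl_sym[OF double_rl[OF W, of 1 4 5 3 2 6 7 8 9]], simplified]
  note 2 = den_rw[OF 2 dmu_rl[of 1 4 9 10 11 5 3 2 12 13 14 6], simplified]
  note 2 = den_rw[OF 2 cross_unit_right[of 4 9 10 11 3 2 12 13 14 6], simplified]
  note 2 = den_rw_id[OF 2 Bm_unit_right[of 1 11 5], simplified]
  note 2 = den_rw_id[OF 2 unit_left[of 2 3 6], simplified]
  note e = den_eq[OF 1 2, simplified]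
  show ?thesis by (rule diag_rlI) (use assms e[symmetric] in auto)
qed

lemma lact_mul_eq:
  assumes W: "left_module C D M w"
  shows "(lact M w) \<cdot> (Mu \<otimes> \<one> M) =
    (lact M w) \<cdot> (\<one> H \<otimes> (lact M w))"
proof -
  note [simp] = double_ops[OF W]
  note 1 = den_diag[of "[[Gen (act M (lact M w) 3 7 8)], [Gen (mul 1 2 3), Idn (Nw M 7)]]", simplified]
  note 1 = den_rw[OF 1 lact_rl[OF W, of 7 8 3 4], simplified]
  note 2 = den_diag[of "[[Gen (act M (lact M w) 1 9 8)], [Idn (h 1), Gen (act M (lact M w) 2 7 9)]]", simplified]
  note 2 = den_rw[OF 2 lact_rl[OF W, of 7 9 2 15], simplified]
  note 2 = den_rw[OF 2 lact_rl[OF W, of 9 8 1 16], simplified]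
  note 2 = den_rw[OF 2 rl_sym[OF double_rl[OF W, of 16 15 5 1 2 3 7 8 9]], simplified]
  note 2 = den_rw[OF 2 dmu_rl[of 16 15 9 10 4 5 1 2 12 13 14 3], simplified]
  note 2 = den_rw[OF 2 cross_unit_right[of 15 9 10 4 1 2 12 13 14 3], simplified]
  note 2 = den_rw_id[OF 2 Bm_unit_left[of 4 16 5], simplified]
  show ?thesis using den_eq[OF 1 2] by simp
qed

lemma lact_unit:
  assumes W: "left_module C D M w"
  shows "(lact M w) \<cdot> (Et \<otimes> \<one> M) =
    \<one> M"
proof -
  note [simp] = double_ops[OF W]
  note 1 = den_diag[of "[[Gen (act M (lact M w) 1 7 8)], [Gen (uni 1), Idn (Nw M 7)]]", simplified]
  note 1 = den_rw[OF 1 lact_rl[OF W, of 7 8 1 2], simplified]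
  note 1 = den_rw[OF 1 rl_sym[OF dun_rl[of 2 1]], simplified]
  note 1 = den_rw_id[OF 1 double_unit[OF W, of 7 8 2 1], simplified]
  note 2 = den_diag[of "[[Idn (Nw M 7)]]", simplified]
  show ?thesis using den_eq[OF 1 2] by simp
qed

lemma sact_mul:
  assumes W: "left_module C D M w" and "distinct [i, j, m]" and "distinct [k, n]" and "distinct [i, j]" and "distinct [k, p, n]"
  shows "diag_rl [[Gen (bac M (sact M w) m k n)], [Gen (bml i j m), Idn (Nw M k)]]
    [[Gen (bac M (sact M w) i p n)], [Idn (b i), Gen (bac M (sact M w) j k p)]]"
proof -
  note [simp] = double_ops[OF W]
  note 1 = den_diag[of "[[Gen (bac M (sact M w) 3 7 8)], [Gen (bml 1 2 3), Idn (Nw M 7)]]", simplified]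
  note 1 = den_rw[OF 1 sact_rl[OF W, of 7 8 3 4], simplified]
  note 2 = den_diag[of "[[Gen (bac M (sact M w) 1 9 8)], [Idn (b 1), Gen (bac M (sact M w) 2 7 9)]]", simplified]
  note 2 = den_rw[OF 2 sact_rl[OF W, of 7 9 2 4], simplified]
  note 2 = den_rw[OF 2 sact_rl[OF W, of 9 8 1 15], simplified]
  note 2 = den_rw[OF 2 rl_sym[OF double_rl[OF W, of 1 2 3 15 4 6 7 8 9]], simplified]
  note 2 = den_rw[OF 2 dmu_rl[of 1 2 9 10 11 3 15 4 12 13 14 6], simplified]
  note 2 = den_rw[OF 2 cross_unit_left[of 1 2 9 10 11 3 15 12 13 14], simplified]
  note 2 = den_rw_id[OF 2 unit_left[of 4 14 6], simplified]
  note e = den_eq[OF 1 2, simplified]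
  show ?thesis by (rule diag_rlI) (use assms e in auto)
qed

lemma sact_unit_eq:
  assumes W: "left_module C D M w"
  shows "(sact M w) \<cdot> (Bu \<otimes> \<one> M) =
    \<one> M"
proof -
  note [simp] = double_ops[OF W]
  note 1 = den_diag[of "[[Gen (bac M (sact M w) 1 7 8)], [Gen (bun 1), Idn (Nw M 7)]]", simplified]
  note 1 = den_rw[OF 1 sact_rl[OF W, of 7 8 1 2], simplified]
  note 1 = den_rw[OF 1 rl_sym[OF dun_rl[of 1 2]], simplified]
  note 1 = den_rw_id[OF 1 double_unit[OF W, of 7 8 1 2], simplified]
  note 2 = den_diag[of "[[Idn (Nw M 7)]]", simplified]
  show ?thesis using den_eq[OF 1 2] by simp
qed

lemma sact_unit:
  assumes W: "left_module C D M w" and "distinct [i, k]"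
  shows "den [bun j, bac M (sact M w) j i k] ([Nw M i], \<one> (wo (Nw M i)), [Nw M k])"
  using double_ops[OF W] sact_unit_eq[OF W] assms(2-) den_diag[of "[[Gen (bac M (sact M w) j i k)], [Gen (bun j), Idn (Nw M i)]]"] by auto

text \<open>The product \<open>(1 \<otimes> h)(b \<otimes> 1)\<close> in the double is exactly the
  cross term, so this is the commutation rule of the two restricted actions.\<close>

lemma sact_lact:
  assumes W: "left_module C D M w" and "distinct [k, m, n]" and "distinct [j, r, s, t]" and "distinct [i, p, q, u]"
  shows "diag_rl [[Gen (act M (lact M w) i m n)], [Idn (h i), Gen (bac M (sact M w) j k m)]]
    [[Gen (bac M (sact M w) t m n)], [Idn (b t), Gen (act M (lact M w) u k m)], [Gen (lac p r t), Gen (rac q s u), Idn (Nw M k)], [Idn (h p),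
    Brd [h q] [b r], Idn (b s), Idn (Nw M k)], [Gen (com i p q), Gen (bco j r s), Idn (Nw M k)]]"
proof -
  note [simp] = double_ops[OF W]
  note 1 = den_diag[of "[[Gen (act M (lact M w) 2 9 8)], [Idn (h 2), Gen (bac M (sact M w) 1 7 9)]]", simplified]
  note 1 = den_rw[OF 1 lact_rl[OF W, of 9 8 2 3], simplified]
  note 1 = den_rw[OF 1 sact_rl[OF W, of 7 9 1 4], simplified]
  note 1 = den_rw[OF 1 rl_sym[OF double_rl[OF W, of 3 1 5 2 4 6 7 8 9]], simplified]
  note 1 = den_rw[OF 1 dmu_rl[of 3 1 9 10 11 5 2 4 12 13 14 6], simplified]
  note 1 = den_rw_id[OF 1 Bm_unit_left[of 11 3 5], simplified]
  note 1 = den_rw_id[OF 1 unit_right[of 14 4 6], simplified]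
  note 1 = den_rw[OF 1 double_split[OF W, of 7 8 3 11 14], simplified]
  note 2 = den_diag[of "[[Gen (bac M (sact M w) 11 3 8)], [Idn (b 11), Gen (act M (lact M w) 14 7 3)], [Gen (lac 12 9 11), Gen (rac 13 10 14), Idn (Nw M 7)], [Idn (h 12),
    Brd [h 13] [b 9], Idn (b 10), Idn (Nw M 7)], [Gen (com 2 12 13), Gen (bco 1 9 10), Idn (Nw M 7)]]", simplified]
  note e = den_eq[OF 1 2, simplified]
  show ?thesis by (rule diag_rlI) (use assms e in auto)
qed

text \<open>Every action of the dual arises from the coaction by the recipe of
  \<open>double_act\<close>: the antipodes cancel and the dual basis is contracted.\<close>

lemma sact_coact:
  assumes W: "left_module C D M w" and "distinct [j, k]" and "distinct [m, n]"
  shows "diag_rl [[Gen (bac M (sact M w) i j k)]]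
    [[Gen (evl i n), Idn (Nw M k)], [Idn (b i), Gen (ani m n), Idn (Nw M k)], [Idn (b i), Gen (coa M (double_coact M w) j m k)]]"
proof -
  note [simp] = double_ops[OF W]
  note 1 = den_diag[of "[[Gen (bac M (sact M w) 1 7 8)]]", simplified]
  note 2 = den_diag[of "[[Gen (evl 1 4), Idn (Nw M 8)], [Idn (b 1), Gen (ani 3 4), Idn (Nw M 8)], [Idn (b 1), Gen (coa M (double_coact M w) 7 3 8)]]", simplified]
  note 2 = den_rw[OF 2 double_coact_rl[OF W, of 2 3 7 8 5], simplified]
  note 2 = den_rw_id[OF 2 Si_S[of 2 3 4], simplified]
  note 2 = den_rw_id[OF 2 zag[of 1 5 2], simplified]
  note e = den_eq[OF 1 2, simplified]
  show ?thesis by (rule diag_rlI) (use assms e[symmetric] in auto)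
qed

text \<open>The antipode reverses the coproduct, which transposes to a product in the dual. The
  resulting \<open>S(f) \<otimes> S(e) \<otimes> e* (f* m)\<close> is two successive coactions,
  \<open>f*\<close> acting first.\<close>

lemma double_coact_coassoc:
  assumes W: "left_module C D M w"
  shows "(De \<otimes> \<one> M) \<cdot> double_coact M w =
    (\<one> H \<otimes> double_coact M w) \<cdot> double_coact M w"
proof -
  note [simp] = double_ops[OF W]
  note 1 = den_diag[of "[[Gen (com 1 2 3), Idn (Nw M 8)], [Gen (coa M (double_coact M w) 7 1 8)]]", simplified]
  note 1 = den_rw[OF 1 double_coact_rl[OF W, of 4 1 7 8 5], simplified]
  note 1 = den_rw[OF 1 S_De_rl[of 4 1 2 3 6 9], simplified]
  note 1 = den_rw[OF 1 coev_De[of 4 6 9 1 10 5], simplified]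
  note 1 = den_rw[OF 1 sact_mul[OF W, of 1 10 5 7 8 4], simplified]
  note 2 = den_diag[of "[[Idn (h 2), Gen (coa M (double_coact M w) 4 3 8)], [Gen (coa M (double_coact M w) 7 2 4)]]", simplified]
  note 2 = den_rw[OF 2 double_coact_rl[OF W, of 9 2 7 4 10], simplified]
  note 2 = den_rw[OF 2 double_coact_rl[OF W, of 6 3 4 8 1], simplified]
  show ?thesis using den_eq[OF 1 2] by simp
qed

lemma double_coact_counit:
  assumes W: "left_module C D M w"
  shows "(Ep \<otimes> \<one> M) \<cdot> double_coact M w =
    \<one> M"
proof -
  note [simp] = double_ops[OF W]
  note 1 = den_diag[of "[[Gen (cou 1), Idn (Nw M 8)], [Gen (coa M (double_coact M w) 7 1 8)]]", simplified]
  note 1 = den_rw[OF 1 double_coact_rl[OF W, of 2 1 7 8 3], simplified]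
  note 1 = den_rw[OF 1 S_Ep_rl[of 2 1], simplified]
  note 1 = den_rw[OF 1 coev_Ep[of 2 3], simplified]
  note 1 = den_rw_id[OF 1 sact_unit[OF W, of 7 8 3], simplified]
  note 2 = den_diag[of "[[Idn (Nw M 7)]]", simplified]
  show ?thesis using den_eq[OF 1 2] by simp
qed

text \<open>The right-hand side is \<open>h1 S(e) \<otimes> h2 (e* m)\<close>. Moving
  \<open>h2\<close> past \<open>e*\<close> by the commutation rule and expanding the cross term
  brings it to the form of the left-hand side, up to a factor that cancels.\<close>

lemma double_yd:
  assumes W: "left_module C D M w"
  shows "(Mu \<otimes> \<one> M) \<cdot> (\<one> H \<otimes> \<Phi> M H) \<cdot> ((double_coact M w) \<otimes> \<one> H) \<cdot> ((lact M w) \<otimes> \<one> H) \<cdot> (\<one> H \<otimes> \<Phi> H M) \<cdot> (De \<otimes> \<one> M) =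
    (Mu \<otimes> (lact M w)) \<cdot> (\<one> H \<otimes> \<Phi> H H \<otimes> \<one> M) \<cdot> (De \<otimes> (double_coact M w))"
proof -
  note [simp] = double_ops[OF W]
  note 1 = den_diag[of "[[Gen (mul 4 3 5), Idn (Nw M 17)], [Idn (h 4), Brd [Nw M 17] [h 3]], [Gen (coa M (double_coact M w) 16 4 17), Idn (h 3)],
    [Gen (act M (lact M w) 2 7 16), Idn (h 3)], [Idn (h 2), Brd [h 3] [Nw M 7]], [Gen (com 1 2 3), Idn (Nw M 7)]]", simplified]
  note 2 = den_diag[of "[[Gen (mul 26 6 5), Gen (act M (lact M w) 27 16 17)], [Idn (h 26), Brd [h 27] [h 6], Idn (Nw M 16)], [Gen (com 1 26 27),
    Gen (coa M (double_coact M w) 7 6 16)]]", simplified]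
  note 2 = den_rw[OF 2 double_coact_rl[OF W, of 28 6 7 16 8], simplified]
  note 2 = den_rw[OF 2 sact_lact[OF W, of 7 16 17 8 9 10 11 27 12 13 2], simplified]
  note 2 = den_rw[OF 2 sact_coact[OF W, of 16 17 4 18 11], simplified]
  note 2 = den_rw[OF 2 cross_expand[of 8 9 10 11 27 12 13 2 19 20 21 3 23 24 25], simplified]
  note 2 = den_rw_id[OF 2 zig[of 25 28 8], simplified]
  note 2 = den_rw_id[OF 2 zig[of 18 21 11], simplified]
  \<comment> \<open>From here \<open>S\<close> is distributed over the product and meets the inverse
    antipodes, leaving \<open>h1 S(h2) (h3 m)(-1) h4 \<otimes> (h3 m)(0)\<close>, where the first
    two factors cancel.\<close>
  note 2 = den_rw[OF 2 S_Mu_rl[of 23 24 25 6 28 8], simplified]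
  note 2 = den_rw_id[OF 2 S_Si[of 3 23 28], simplified]
  note 2 = den_rw[OF 2 S_Mu_rl[of 18 19 24 8 28 9], simplified]
  note 2 = den_rw_id[OF 2 S_Si[of 4 18 28], simplified]
  note 2 = den_rw[OF 2 rl_sym[OF assoc_rl[of 26 8 28 3 5 6]], simplified]
  note 2 = den_rw[OF 2 rl_sym[OF assoc_rl[of 26 9 6 4 28 8]], simplified]
  note 2 = den_rw[OF 2 rl_sym[OF coassoc_rl[of 1 8 20 26 19 27]], simplified]
  note 2 = den_rw[OF 2 antipode_right_rl[of 8 26 19 9 6], simplified]
  note 2 = den_rw_id[OF 2 unit_left[of 4 6 28], simplified]
  note 2 = den_rw_id[OF 2 counit_left[of 1 8 20], simplified]
  show ?thesis using den_eq[OF 1 2] by simp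
qed

theorem left_yd_of_double:
  assumes W: "left_module C D M w"
  shows "left_yd_module C A M (lact M w) (double_coact M w)"
proof -
  have "lact M w \<in> hom C (H \<boxtimes> M) M" "double_coact M w \<in> hom C M (H \<boxtimes> M)"
    using okop_lact_rl[OF W, of 1 1 2] okop_double_coact_rl[OF W, of 1 1 2] by (simp_all add: okop_def ok_def)
  thus ?thesis
    using double_moduleD(1)[OF W] lact_mul_eq[OF W] lact_unit[OF W] double_coact_coassoc[OF W] double_coact_counit[OF W] double_yd[OF W]
    by (simp add: left_yd_module_def left_module_def left_comodule_def Let_def)
qed

section \<open>The two constructions are mutually inverse and compatible with morphisms, tensor
  products and braidings\<close>

lemma double_act_of_double:
  assumes W: "left_module C D M w"
  shows "double_act M (lact M w) (double_coact M w) =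
    w"
proof -
  note [simp] = double_ops[OF W]
  note 1 = den_diag[of "[[Gen (evl 1 4), Idn (Nw M 8)], [Idn (b 1), Gen (ani 3 4), Idn (Nw M 8)], [Idn (b 1), Gen (coa M (double_coact M w) 9 3 8)], [Idn (b 1),
    Gen (act M (lact M w) 2 7 9)]]", simplified]
  note 1 = den_rw[OF 1 rl_sym[OF sact_coact[OF W, of 9 8 3 4 1]], simplified]
  note 1 = den_rw[OF 1 rl_sym[OF double_split[OF W, of 7 8 9 1 2]], simplified]
  note 2 = den_diag[of "[[Gen (dac M w 1 2 7 8)]]", simplified]
  show ?thesis using den_eq[OF 1 2] by (simp add: double_act_def double_act_def)
qed

lemma double_hom_rl:
  assumes W: "left_module C D M w" and V: "left_module C D N w'" and f: "f \<in> hom C M N" and e: "f \<cdot> w = w' \<cdot> (\<one> (Hs \<boxtimes> H) \<otimes> f)" and "distinct [k, m, n]" and "distinct [k, p, n]"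
  shows "diag_rl [[Gen (mor M N f m n)], [Gen (dac M w i j k m)]]
    [[Gen (dac N w' i j p n)], [Idl [b i, h j], Gen (mor M N f k p)]]"
  by (rule diag_rlI) (use assms double_moduleD(1,2,5)[OF W] double_moduleD(1,2,5)[OF V] f e in auto)

lemma lact_hom:
  assumes W: "left_module C D M w" and V: "left_module C D N w'"
    and f: "f \<in> hom C M N" and e: "f \<cdot> w = w' \<cdot> (\<one> (Hs \<boxtimes> H) \<otimes> f)"
  shows "f \<cdot> (lact M w) =
    lact N w' \<cdot> (\<one> H \<otimes> f)"
proof -
  note [simp] = double_ops[OF W] double_ops[OF V] f
  note 1 = den_diag[of "[[Gen (mor M N f 8 9)], [Gen (act M (lact M w) 1 7 8)]]", simplified]
  note 1 = den_rw[OF 1 lact_rl[OF W, of 7 8 1 2], simplified]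
  note 1 = den_rw[OF 1 double_hom_rl[OF W V f e, of 7 8 9 3 2 1], simplified]
  note 2 = den_diag[of "[[Gen (act N (lact N w') 1 3 9)], [Idn (h 1), Gen (mor M N f 7 3)]]", simplified]
  note 2 = den_rw[OF 2 lact_rl[OF V, of 3 9 1 2], simplified]
  show ?thesis using den_eq[OF 1 2] by simp
qed

text \<open>The coaction is built from the action of the dual and the constant \<open>coev\<close>,
  so linear maps over the double are automatically colinear.\<close>

lemma double_coact_hom:
  assumes W: "left_module C D M w" and V: "left_module C D N w'"
    and f: "f \<in> hom C M N" and e: "f \<cdot> w = w' \<cdot> (\<one> (Hs \<boxtimes> H) \<otimes> f)"
  shows "double_coact N w' \<cdot> f =
    (\<one> H \<otimes> f) \<cdot> double_coact M w"
proof -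
  note [simp] = double_ops[OF W] double_ops[OF V] f
  note 1 = den_diag[of "[[Gen (coa N (double_coact N w') 8 3 9)], [Gen (mor M N f 7 8)]]", simplified]
  note 1 = den_rw[OF 1 double_coact_rl[OF V, of 1 3 8 9 2], simplified]
  note 1 = den_rw[OF 1 sact_rl[OF V, of 8 9 2 4], simplified]
  note 1 = den_rw[OF 1 rl_sym[OF double_hom_rl[OF W V f e, of 7 5 9 8 2 4]], simplified]
  note 2 = den_diag[of "[[Idn (h 3), Gen (mor M N f 5 9)], [Gen (coa M (double_coact M w) 7 3 5)]]", simplified]
  note 2 = den_rw[OF 2 double_coact_rl[OF W, of 1 3 7 5 2], simplified]
  note 2 = den_rw[OF 2 sact_rl[OF W, of 7 5 2 4], simplified]
  show ?thesis using den_eq[OF 1 2] by simp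
qed

lemma lact_double_act:
  assumes M: "left_yd_module C A M \<mu> l"
  shows "lact M (double_act M \<mu> l) =
    \<mu>"
proof -
  note Mm = left_ydD(1)[OF M] and Mc = left_ydD(2)[OF M]
  note [simp] = left_moduleD(1,2,5)[OF Mm] left_comoduleD(1,2,5)[OF Mc] okop_double_act_rl[OF Mm Mc]
  note 1 = den_diag[of "[[Gen (dac M (double_act M \<mu> l) 5 6 7 8)], [Gen (bun 5), Idn (h 6), Idn (Nw M 7)]]", simplified]
  note 1 = den_rw[OF 1 double_act_rl[OF Mm Mc, of 6 1 2 7 3 8 5], simplified]
  note 1 = den_rw[OF 1 Bu_rl[of 5 2], simplified]
  note 1 = den_rw[OF 1 Si_Ep_rl[of 1 2], simplified]
  note 1 = den_rw_id[OF 1 coa_unit[OF Mc, of 3 8 1], simplified]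
  note 2 = den_diag[of "[[Gen (act M \<mu> 6 7 3)]]", simplified]
  show ?thesis using den_eq[OF 1 2] by (simp add: left_act_H_def left_act_H_def)
qed

lemma sact_double_act_eq:
  assumes M: "left_yd_module C A M \<mu> l"
  shows "sact M (double_act M \<mu> l) =
    (ev \<otimes> \<one> M) \<cdot> (\<one> Hs \<otimes> Si \<otimes> \<one> M) \<cdot> (\<one> Hs \<otimes> l)"
proof -
  note Mm = left_ydD(1)[OF M] and Mc = left_ydD(2)[OF M]
  note [simp] = left_moduleD(1,2,5)[OF Mm] left_comoduleD(1,2,5)[OF Mc] okop_double_act_rl[OF Mm Mc]
  note 1 = den_diag[of "[[Gen (dac M (double_act M \<mu> l) 1 2 7 8)], [Idn (b 1), Gen (uni 2), Idn (Nw M 7)]]", simplified]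
  note 1 = den_rw[OF 1 double_act_rl[OF Mm Mc, of 2 3 4 7 5 8 1], simplified]
  note 1 = den_rw_id[OF 1 act_unit[OF Mm, of 7 5 2], simplified]
  note 2 = den_diag[of "[[Gen (evl 1 4), Idn (Nw M 8)], [Idn (b 1), Gen (ani 3 4), Idn (Nw M 8)], [Idn (b 1), Gen (coa M l 7 3 8)]]", simplified]
  show ?thesis using den_eq[OF 1 2] by (simp add: left_act_Hs_def left_act_Hs_def)
qed

lemma sact_double_act:
  assumes M: "left_yd_module C A M \<mu> l" and "distinct [j, k]" and "distinct [m, n]"
  shows "diag_rl [[Gen (bac M (sact M (double_act M \<mu> l)) i j k)]]
    [[Gen (evl i n), Idn (Nw M k)], [Idn (b i), Gen (ani m n), Idn (Nw M k)], [Idn (b i), Gen (coa M l j m k)]]"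
  by (rule diag_rlI) (use assms sact_double_act_eq[OF M, symmetric] okop_sact_rl[OF left_double_module[OF M]] left_moduleD(1,2,5)[OF left_ydD(1)[OF M]] left_comoduleD(1,2,5)[OF left_ydD(2)[OF M]] in auto)

lemma double_coact_double_act:
  assumes M: "left_yd_module C A M \<mu> l"
  shows "double_coact M (double_act M \<mu> l) =
    l"
proof -
  note Mm = left_ydD(1)[OF M] and Mc = left_ydD(2)[OF M]
  note [simp] = left_moduleD(1,2,5)[OF Mm] left_comoduleD(1,2,5)[OF Mc] okop_double_act_rl[OF Mm Mc]
  note [simp] = okop_sact_rl[OF left_double_module[OF M]]
  note 1 = den_diag[of "[[Gen (ant 1 3), Idn (Nw M 8)], [Idn (h 1), Gen (bac M (sact M (double_act M \<mu> l)) 2 7 8)], [Gen (dul 1 2), Idn (Nw M 7)]]", simplified]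
  note 1 = den_rw[OF 1 sact_double_act[OF M, of 7 8 4 5 2], simplified]
  note 1 = den_rw_id[OF 1 zig[of 5 1 2], simplified]
  note 1 = den_rw_id[OF 1 S_Si[of 4 5 3], simplified]
  note 2 = den_diag[of "[[Gen (coa M l 7 4 8)]]", simplified]
  show ?thesis using den_eq[OF 1 2] by (simp add: double_coact_def double_coact_def)
qed

text \<open>Two reversals cancel: the coproduct of the dual gives
  \<open><b, Si(n(-1)) Si(m(-1))>\<close>, which is \<open><b, Si(m(-1) n(-1))>\<close>. This is why
  the dual of the opposite algebra is used.\<close>

lemma double_act_tensor:
  assumes M: "left_yd_module C A M \<mu> l" and N: "left_yd_module C A N \<nu> l'"
  shows "left_action_tensor C D M (double_act M \<mu> l) N (double_act N \<nu> l') =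
    double_act (M \<boxtimes> N) (left_action_tensor C A M \<mu> N \<nu>) (left_coaction_tensor C A M l N l')"
proof -
  note Mm = left_ydD(1)[OF M] and Mc = left_ydD(2)[OF M]
  note [simp] = left_moduleD(1,2,5)[OF Mm] left_comoduleD(1,2,5)[OF Mc] okop_double_act_rl[OF Mm Mc]
  note [simp] = okop_sact_rl[OF left_double_module[OF M]]
  note Nm = left_ydD(1)[OF N] and Nc = left_ydD(2)[OF N]
  note [simp] = left_moduleD(1,2,5)[OF Nm] left_comoduleD(1,2,5)[OF Nc] okop_double_act_rl[OF Nm Nc]
  note [simp] = okop_actT[OF Mm Nm] okop_coaT[OF Mc Nc]
  note 1 = den_diag[of "[[Gen (dac M (double_act M \<mu> l) 3 4 7 9), Gen (dac N (double_act N \<nu> l') 5 6 8 10)], [Idl [b 3, h 4], Brd [b 5, h 6] [Nw M 7], Idn (Nw N 8)],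
    [Gen (dco 1 2 3 4 5 6), Idn (Nw M 7), Idn (Nw N 8)]]", simplified]
  note 1 = den_rw[OF 1 dco_rl[of 1 3 5 2 4 6], simplified]
  note 1 = den_rw[OF 1 double_act_rl[OF Mm Mc, of 4 11 12 7 13 9 3], simplified]
  note 1 = den_rw[OF 1 double_act_rl[OF Nm Nc, of 6 14 15 8 16 10 5], simplified]
  note 1 = den_rw[OF 1 Bc_rl[of 1 3 5 12 15 17], simplified]
  note 1 = den_rw[OF 1 rl_sym[OF Si_Mu_rl[of 11 14 3 17 12 15]], simplified]
  note 2 = den_diag[of "[[Gen (evl 1 17), Idl [Nw M 9, Nw N 10]], [Idn (b 1), Gen (ani 3 17), Idl [Nw M 9, Nw N 10]], [Idn (b 1), Gen (coaT M l N l' 13 16 3 9 10)],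
    [Idn (b 1), Gen (actT M \<mu> N \<nu> 2 7 8 13 16)]]", simplified]
  note 2 = den_rw[OF 2 coaT_rl[OF Mc Nc, of 11 14 3 13 16 9 10], simplified]
  note 2 = den_rw[OF 2 actT_rl[OF Mm Nm, of 2 4 6 7 8 13 16], simplified]
  show ?thesis using den_eq[OF 1 2] by (simp add: left_action_tensor_def[of C D] double_act_def[of "_ \<boxtimes> _"] left_action_tensor_def[of C D] double_act_def[of "_ \<boxtimes> _"])
qed

lemma double_act_unit:
  shows "double_act \<I> Ep Et =
    cunt D"
proof -
  note 1 = den_diag[of "[[Gen (evl 1 4), Idl []], [Idn (b 1), Gen (ani 3 4), Idl []], [Idn (b 1), Gen (uni 3)], [Idn (b 1), Gen (cou 2)]]", simplified]
  note 1 = den_rw[OF 1 Si_Et_rl[of 3 4], simplified]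
  note 1 = den_rw[OF 1 rl_sym[OF Be_rl[of 1 4]], simplified]
  note 2 = den_diag[of "[[Gen (dou 1 2)]]", simplified]
  note 2 = den_rw[OF 2 dou_rl[of 1 2], simplified]
  show ?thesis using den_eq[OF 1 2] by (simp add: double_act_def double_act_def)
qed

lemma double_act_hom:
  assumes M: "left_yd_module C A M \<mu> l" and N: "left_yd_module C A N \<nu> l'"
    and f: "f \<in> hom C M N" "f \<cdot> \<mu> = \<nu> \<cdot> (\<one> H \<otimes> f)" "l' \<cdot> f = (\<one> H \<otimes> f) \<cdot> l"
  shows "f \<cdot> double_act M \<mu> l =
    double_act N \<nu> l' \<cdot> (\<one> (Hs \<boxtimes> H) \<otimes> f)"
proof -
  note Mm = left_ydD(1)[OF M] and Mc = left_ydD(2)[OF M]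
  note [simp] = left_moduleD(1,2,5)[OF Mm] left_comoduleD(1,2,5)[OF Mc] okop_double_act_rl[OF Mm Mc]
  note [simp] = okop_sact_rl[OF left_double_module[OF M]]
  note Nm = left_ydD(1)[OF N] and Nc = left_ydD(2)[OF N]
  note [simp] = left_moduleD(1,2,5)[OF Nm] left_comoduleD(1,2,5)[OF Nc] okop_double_act_rl[OF Nm Nc]
  note [simp] = okop_actT[OF Mm Nm] okop_coaT[OF Mc Nc]
  note [simp] = f(1)
  note 1 = den_diag[of "[[Gen (mor M N f 8 9)], [Gen (dac M (double_act M \<mu> l) 1 2 7 8)]]", simplified]
  note 1 = den_rw[OF 1 double_act_rl[OF Mm Mc, of 2 3 4 7 5 8 1], simplified]
  note 1 = den_rw[OF 1 rl_sym[OF cohom_rl[OF Mc Nc f(1,3), of 5 6 9 8 3]], simplified]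
  note 1 = den_rw[OF 1 hom_rl[OF Mm Nm f(1,2), of 7 5 6 8 2], simplified]
  note 2 = den_diag[of "[[Gen (dac N (double_act N \<nu> l') 1 2 8 9)], [Idl [b 1, h 2], Gen (mor M N f 7 8)]]", simplified]
  note 2 = den_rw[OF 2 double_act_rl[OF Nm Nc, of 2 3 4 8 6 9 1], simplified]
  show ?thesis using den_eq[OF 1 2] by simp
qed

text \<open>Contracting the dual basis in \<open>\<Sum> e n \<otimes> e* m\<close> leaves
  \<open>Si(m(-1)) n \<otimes> m(0)\<close>.\<close>

lemma left_R_untwist:
  assumes M: "left_yd_module C A M \<mu> l" and N: "left_yd_module C A N \<nu> l'"
  shows "left_R C A Hs ev coev N (double_act N \<nu> l') M (double_act M \<mu> l) =
    untwist M l N \<nu>"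
proof -
  note Mm = left_ydD(1)[OF M] and Mc = left_ydD(2)[OF M]
  note [simp] = left_moduleD(1,2,5)[OF Mm] left_comoduleD(1,2,5)[OF Mc] okop_double_act_rl[OF Mm Mc]
  note [simp] = okop_sact_rl[OF left_double_module[OF M]]
  note Nm = left_ydD(1)[OF N] and Nc = left_ydD(2)[OF N]
  note [simp] = left_moduleD(1,2,5)[OF Nm] left_comoduleD(1,2,5)[OF Nc] okop_double_act_rl[OF Nm Nc]
  note [simp] = okop_actT[OF Mm Nm] okop_coaT[OF Mc Nc]
  note 1 = den_diag[of "[[Gen (act N \<nu> 1 8 9), Gen (bac M (sact M (double_act M \<mu> l)) 2 7 10)], [Idn (h 1), Brd [b 2] [Nw N 8], Idn (Nw M 7)], [Gen (dul 1 2),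
    Idn (Nw N 8), Idn (Nw M 7)]]", simplified]
  note 1 = den_rw[OF 1 sact_double_act[OF M, of 7 10 3 4 2], simplified]
  note 1 = den_rw_id[OF 1 zig[of 4 1 2], simplified]
  note 2 = den_diag[of "[[Gen (act N \<nu> 4 8 9), Idn (Nw M 10)], [Brd [Nw N 8] [h 4], Idn (Nw M 10)], [Idn (Nw N 8), Gen (ani 3 4), Idn (Nw M 10)], [Idn (Nw N 8),
    Gen (coa M l 7 3 10)]]", simplified]
  show ?thesis using den_eq[OF 1 2] by (simp add: left_R_def untwist_def lact_double_act[OF N] left_R_def untwist_def lact_double_act[OF N])
qed

lemma left_double_modules_sel [simp]:
  "ob (left_double_modules C A Hs ev d) = {(M, w). left_module C D M w}"
  "hom (left_double_modules C A Hs ev d) (M, w) (N, w') = {f \<in> hom C M N. f \<cdot> w = w' \<cdot> (\<one> (Hs \<boxtimes> H) \<otimes> f)}"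
  "idm (left_double_modules C A Hs ev d) (M, w) = \<one> M" "cmp (left_double_modules C A Hs ev d) = cmp C"
  "unitO (left_double_modules C A Hs ev d) = (\<I>, cunt D)"
  "tenO (left_double_modules C A Hs ev d) (M, w) (N, w') = (M \<boxtimes> N, left_action_tensor C D M w N w')"
  "tenM (left_double_modules C A Hs ev d) = tenM C"
  "braid (left_double_modules C A Hs ev d) (M, w) (N, w') =
    inv_mor C (N \<boxtimes> M) (N \<boxtimes> M) (left_R C A Hs ev d N w' M w) \<cdot> \<Phi> M N"
  by (simp_all add: left_double_modules_def with_braiding_def left_modules_def)

theorem left_yd_double:
  "strict_embedding (left_yd C A) (left_double_modules C A Hs ev coev) (\<lambda>(M, \<mu>, l). (M, double_act M \<mu> l))"
  "(\<lambda>(M, \<mu>, l). (M, double_act M \<mu> l)) ` ob (left_yd C A) = ob (left_double_modules C A Hs ev coev)"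
proof -
  let ?F = "\<lambda>(M, \<mu>, l). (M, double_act M \<mu> l)" and ?D = "left_double_modules C A Hs ev coev"
  show "?F ` ob (left_yd C A) = ob ?D"
  proof (intro equalityI subsetI)
    fix P assume "P \<in> ob ?D"
    then obtain M w where P: "P = (M, w)" "left_module C D M w" by (cases P) auto
    hence "P = ?F (M, lact M w, double_coact M w)" by (simp add: double_act_of_double)
    moreover have "(M, lact M w, double_coact M w) \<in> ob (left_yd C A)" using left_yd_of_double[OF P(2)] by simp
    ultimately show "P \<in> ?F ` ob (left_yd C A)" by (rule image_eqI)
  qed (auto simp: left_double_module)
  show "strict_embedding (left_yd C A) ?D ?F"
    unfolding strict_embedding_def
  proof (intro conjI ballI)
    show "inj_on ?F (ob (left_yd C A))"
    proof (rule inj_onI)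
      fix P Q assume "P \<in> ob (left_yd C A)" "Q \<in> ob (left_yd C A)" and e: "?F P = ?F Q"
      then obtain M \<mu> l N \<nu> l' where P: "P = (M, \<mu>, l)" "left_yd_module C A M \<mu> l" and Q: "Q = (N, \<nu>, l')" "left_yd_module C A N \<nu> l'"
        by (cases P; cases Q) simp
      have "N = M" "double_act M \<nu> l' = double_act M \<mu> l" using e by (auto simp: P Q)
      thus "P = Q"
        using lact_double_act[OF P(2)] lact_double_act[OF Q(2)] double_coact_double_act[OF P(2)] double_coact_double_act[OF Q(2)]
        by (simp add: P Q)
    qed
    show "cmp (left_yd C A) = cmp ?D" "tenM (left_yd C A) = tenM ?D" by simp_all
    show "unitO (left_yd C A) \<in> ob (left_yd C A)" using left_yd_unit by simp
    show "?F (unitO (left_yd C A)) = unitO ?D" by (simp add: double_act_unit)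
    fix P assume "P \<in> ob (left_yd C A)"
    then obtain M \<mu> l where P: "P = (M, \<mu>, l)" and M: "left_yd_module C A M \<mu> l" by (cases P) auto
    show "?F P \<in> ob ?D" "idm (left_yd C A) P = idm ?D (?F P)" using left_double_module[OF M] by (simp_all add: P)
    fix Q assume "Q \<in> ob (left_yd C A)"
    then obtain N \<nu> l' where Q: "Q = (N, \<nu>, l')" and N: "left_yd_module C A N \<nu> l'" by (cases Q) auto
    show "hom (left_yd C A) P Q = hom ?D (?F P) (?F Q)"
    proof (intro equalityI subsetI)
      fix f assume "f \<in> hom (left_yd C A) P Q"
      thus "f \<in> hom ?D (?F P) (?F Q)" using double_act_hom[OF M N] by (simp add: P Q)
    next
      fix f assume "f \<in> hom ?D (?F P) (?F Q)"
      hence f: "f \<in> hom C M N" "f \<cdot> double_act M \<mu> l = double_act N \<nu> l' \<cdot> (\<one> (Hs \<boxtimes> H) \<otimes> f)" by (simp_all add: P Q)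
      show "f \<in> hom (left_yd C A) P Q"
        using lact_hom[OF left_double_module[OF M] left_double_module[OF N] f] f(1)
          double_coact_hom[OF left_double_module[OF M] left_double_module[OF N] f]
        by (simp add: P Q lact_double_act[OF M] lact_double_act[OF N] double_coact_double_act[OF M] double_coact_double_act[OF N])
    qed
    show "tenO (left_yd C A) P Q \<in> ob (left_yd C A)" using left_yd_tensor[OF M N] by (simp add: P Q)
    show "?F (tenO (left_yd C A) P Q) = tenO ?D (?F P) (?F Q)" by (simp add: P Q double_act_tensor[OF M N])
    note tw = twist_inverse[OF left_ydD(2)[OF M] left_ydD(1)[OF N]]
    have NM: "N \<boxtimes> M \<in> ob C" using left_moduleD(1)[OF left_ydD(1)[OF M]] left_moduleD(1)[OF left_ydD(1)[OF N]] by (simp add: ten_ob)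
    \<comment> \<open>Inverting the R-matrix thus gives \<open>twist\<close>, and
      \<open>twist\<close> after the crossing of \<open>M\<close> and \<open>N\<close> is the half
      braiding.\<close>
    have "inv_mor C (N \<boxtimes> M) (N \<boxtimes> M) (untwist M l N \<nu>) = twist M l N \<nu>"
      by (rule inv_mor_eq[OF NM NM]) (use tw in \<open>auto simp: inverse_pair_def\<close>)
    thus "braid (left_yd C A) P Q = braid ?D (?F P) (?F Q)"
      using half_br_twist[OF left_ydD(2)[OF M] left_ydD(1)[OF N]] by (simp add: P Q left_R_untwist[OF M N])
  qed
qed

end

section \<open>Right modules over the double\<close>

context transparent_hopf begin

abbreviation "ract M \<nu> m i n \<equiv> ([Nw M m, h i], \<nu>, [Nw M n])"
abbreviation "rcoa M r m n i \<equiv> ([Nw M m], r, [Nw M n, h i])"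

lemma right_moduleD:
  assumes "right_module C A M \<nu>"
  shows "M \<in> ob C" "\<nu> \<in> hom C (M \<boxtimes> H) M" "\<nu> \<cdot> (\<one> M \<otimes> Mu) = \<nu> \<cdot> (\<nu> \<otimes> \<one> H)" "\<nu> \<cdot> (\<one> M \<otimes> Et) = \<one> M"
    "okop (ract M \<nu> m i n)"
  using assms by (auto simp: right_module_def okop_def ok_def)

lemma right_comoduleD:
  assumes "right_comodule C A M r"
  shows "M \<in> ob C" "r \<in> hom C M (M \<boxtimes> H)" "(\<one> M \<otimes> De) \<cdot> r = (r \<otimes> \<one> H) \<cdot> r" "(\<one> M \<otimes> Ep) \<cdot> r = \<one> M"
    "okop (rcoa M r m n i)"
  using assms by (auto simp: right_comodule_def okop_def ok_def)

lemma ract_rl: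
  assumes Mm: "right_module C A M \<nu>" and "distinct [j, k, m]" and "distinct [i, n]" and "distinct [j, k]" and "distinct [i, p, n]"
  shows "diag_rl [[Gen (ract M \<nu> i m n)], [Idn (Nw M i), Gen (mul j k m)]]
    [[Gen (ract M \<nu> p k n)], [Gen (ract M \<nu> i j p), Idn (h k)]]"
  by (rule diag_rlI) (use assms right_moduleD(1,2,5)[OF Mm] right_moduleD(3)[OF Mm] in auto)

lemma ract_unit:
  assumes Mm: "right_module C A M \<nu>" and "distinct [i, k]"
  shows "den [uni j, ract M \<nu> i j k] ([Nw M i], \<one> (wo (Nw M i)), [Nw M k])"
  using right_moduleD(1,2,5)[OF Mm] right_moduleD(4)[OF Mm] assms(2-) den_diag[of "[[Gen (ract M \<nu> i j k)], [Idn (Nw M i), Gen (uni j)]]"] by auto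

lemma rcoa_rl:
  assumes Mc: "right_comodule C A M r" and "distinct [k, m, n]" and "distinct [i, j]" and "distinct [n, m]" and "distinct [i, p, j]"
  shows "diag_rl [[Idn (Nw M j), Gen (com k m n)], [Gen (rcoa M r i j k)]]
    [[Gen (rcoa M r p j m), Idn (h n)], [Gen (rcoa M r i p n)]]"
  by (rule diag_rlI) (use assms right_comoduleD(1,2,5)[OF Mc] right_comoduleD(3)[OF Mc] in auto)

lemma rcoa_unit:
  assumes Mc: "right_comodule C A M r" and "distinct [i, j]"
  shows "den [rcoa M r i j k, cou k] ([Nw M i], \<one> (wo (Nw M i)), [Nw M j])"
  using right_comoduleD(1,2,5)[OF Mc] right_comoduleD(4)[OF Mc] assms(2-) den_diag[of "[[Idn (Nw M j), Gen (cou k)], [Gen (rcoa M r i j k)]]"] by auto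

lemma right_ydD:
  assumes "right_yd_module C A M \<nu> r"
  shows "right_module C A M \<nu>" "right_comodule C A M r"
  using assms by (auto simp: right_yd_module_def Let_def)

lemma right_yd_rl:
  assumes M: "right_yd_module C A M \<nu> r" and "distinct [j, k, m, q, s]" and "distinct [i, n, p]" and "distinct [j, q, k, m, s]"
  shows "diag_rl [[Idn (Nw M p), Gen (mul k q s)], [Brd [h k] [Nw M p], Idn (h q)], [Idn (h k), Gen (rcoa M r n p q)], [Idn (h k), Gen (ract M \<nu> i m n)],
    [Brd [Nw M i] [h k], Idn (h m)], [Idn (Nw M i), Gen (com j k m)]]
    [[Gen (ract M \<nu> n k p), Gen (mul q m s)], [Idn (Nw M n), Brd [h q] [h k], Idn (h m)], [Gen (rcoa M r i n q), Gen (com j k m)]]"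
  by (rule diag_rlI) (use assms right_moduleD(1,2,5)[OF right_ydD(1)[OF M]] right_comoduleD(1,2,5)[OF right_ydD(2)[OF M]] M[unfolded right_yd_module_def Let_def] in auto)

text \<open>In elements, \<open>(m h)(0) \<otimes> Si((m h)(1)) = m(0) h2 \<otimes> Si(h3) Si(m(1))
  h1\<close>: the right-hand counterpart of \<open>left_yd_cross\<close>, with the action before the
  coaction on the other side.\<close>

lemma right_yd_cross:
  assumes M: "right_yd_module C A M \<nu> r" and "distinct [j, n, p]" and "distinct [i, k, m]" and "distinct [j, s, t, n, k, u, v, x, y, p]" and "distinct [i, q, m]"
  shows "diag_rl [[Idn (Nw M m), Gen (ani n p)], [Gen (rcoa M r k m n)], [Gen (ract M \<nu> i j k)]]
    [[Idn (Nw M m), Gen (mul x y p)], [Gen (ract M \<nu> q k m), Idn (h x), Idn (h y)], [Idn (Nw M q), Brd [h x, h y] [h k]], [Idn (Nw M q), Gen (ani u x),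
    Gen (mul v t y), Idn (h k)], [Idn (Nw M q), Brd [h v, h t, h k] [h u]], [Idn (Nw M q), Gen (ani s v), Idl [h t, h k, h u]], [Idn (Nw M q), Idn (h s),
    Idn (h t), Gen (com n k u)], [Gen (rcoa M r i q s), Gen (com j t n)]]"
proof -
  note Mm = right_ydD(1)[OF M] and Mc = right_ydD(2)[OF M]
  note [simp] = right_moduleD(1,2,5)[OF Mm] right_comoduleD(1,2,5)[OF Mc]
  \<comment> \<open>\<open>m(0) h2 \<otimes> Si(S(h1) m(1) h3)\<close>, evaluated by the
    Yetter-Drinfel'd condition and by distributing \<open>Si\<close>.\<close>
  note 0 = den_diag[of "[[Idn (Nw M 11), Gen (ani 9 10)], [Idn (Nw M 11), Gen (mul 8 14 9)], [Idn (Nw M 11), Gen (mul 6 5 8), Idn (h 14)], [Gen (ract M \<nu> 12 4 11),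
    Idn (h 6), Idn (h 5), Idn (h 14)], [Idn (Nw M 12), Idn (h 4), Brd [h 5] [h 6], Idn (h 14)], [Idn (Nw M 12), Brd [h 5, h 6] [h 4], Idn (h 14)],
    [Idn (Nw M 12), Idn (h 5), Gen (ant 2 6), Gen (com 3 4 14)], [Gen (rcoa M r 7 12 5), Gen (com 1 2 3)]]", simplified]
  note 1 = den_rw[OF 0 assoc_rl[of 6 5 8 14 9 13], simplified]
  note 1 = den_rw[OF 1 rl_sym[OF right_yd_rl[OF M, of 3 4 14 5 13 7 12 11]], simplified]
  note 1 = den_rw[OF 1 rl_sym[OF assoc_rl[of 6 4 8 5 9 13]], simplified]
  note 1 = den_rw[OF 1 rl_sym[OF coassoc_rl[of 1 13 14 2 4 3]], simplified]
  note 1 = den_rw[OF 1 antipode_left_rl[of 13 2 4 6 8], simplified]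
  note 1 = den_rw_id[OF 1 unit_left[of 5 8 9], simplified]
  note 1 = den_rw_id[OF 1 counit_left[of 1 13 14], simplified]
  note 1 = den_eq[OF 1 den_diag[of "[[Idn (Nw M 11), Gen (ani 5 10)], [Gen (rcoa M r 12 11 5)], [Gen (ract M \<nu> 7 1 12)]]", simplified], simplified]
  note 2 = den_rw[OF 0 Si_Mu_rl[of 8 14 9 10 13 15], simplified]
  note 2 = den_rw[OF 2 Si_Mu_rl[of 6 5 8 13 9 16], simplified]
  note 2 = den_rw_id[OF 2 Si_S[of 2 6 9], simplified]
  note 2 = den_eq[OF 2 den_diag[of "[[Idn (Nw M 11), Gen (mul 15 13 10)], [Gen (ract M \<nu> 12 4 11), Idn (h 15), Idn (h 13)], [Idn (Nw M 12), Brd [h 15, h 13] [h 4]], [Idn (Nw M 12),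
    Gen (ani 14 15), Gen (mul 16 2 13), Idn (h 4)], [Idn (Nw M 12), Brd [h 16, h 2, h 4] [h 14]], [Idn (Nw M 12), Gen (ani 5 16), Idl [h 2, h 4, h 14]],
    [Idn (Nw M 12), Idn (h 5), Idn (h 2), Gen (com 3 4 14)], [Gen (rcoa M r 7 12 5), Gen (com 1 2 3)]]", simplified], simplified]
  note e = trans[OF 1[symmetric] 2]
  show ?thesis by (rule diag_rlI) (use assms e in auto)
qed

end

context finite_hopf begin

abbreviation "rdac M w m i j n \<equiv> ([Nw M m, b i, h j], w, [Nw M n])"
abbreviation "rbac M s m i n \<equiv> ([Nw M m, b i], s, [Nw M n])"

text \<open>
  \<open>m (b \<otimes> h) = \<langle>b, S\<^sup>-\<^sup>1(m\<^sub>1)\<rangle> m\<^sub>0 h\<close>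
\<close>

definition right_double_act :: "'o \<Rightarrow> 'm \<Rightarrow> 'm \<Rightarrow> 'm" where
  "right_double_act M \<nu> r = \<nu> \<cdot> (\<one> M \<otimes> ev \<otimes> \<one> H) \<cdot> (\<one> M \<otimes> \<one> Hs \<otimes> Si \<otimes> \<one> H) \<cdot> (\<one> M \<otimes> \<Phi> H Hs \<otimes> \<one> H) \<cdot> (r \<otimes> \<one> Hs \<otimes> \<one> H)"

lemma okop_right_double_act_rl:
  assumes Mm: "right_module C A M \<nu>" and Mc: "right_comodule C A M r"
  shows "okop (rdac M (right_double_act M \<nu> r) i j k q)"
proof -
  have 0: "okop (rdac M (right_double_act M \<nu> r) 7 1 2 8)"
    by (rule okop_den[of "[rcoa M r 7 9 3, ani 3 4, evl 1 4, ract M \<nu> 9 2 8]"]) (use right_moduleD(1,2,5)[OF Mm] right_comoduleD(1,2,5)[OF Mc] den_diag[of "[[Gen (ract M \<nu> 9 2 8)], [Idn (Nw M 9), Gen (evl 1 4), Idn (h 2)], [Idn (Nw M 9), Idn (b 1), Gen (ani 3 4), Idn (h 2)], [Idn (Nw M 9),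
    Brd [h 3] [b 1], Idn (h 2)], [Gen (rcoa M r 7 9 3), Idn (b 1), Idn (h 2)]]"] in \<open>auto simp: right_double_act_def\<close>)
  thus ?thesis by (auto simp: okop_def ok_def)
qed

lemma right_double_act_rl:
  assumes Mm: "right_module C A M \<nu>" and Mc: "right_comodule C A M r" and "distinct [k, n, p]" and "distinct [i, m, q]"
  shows "diag_rl [[Gen (rdac M (right_double_act M \<nu> r) i j k q)]]
    [[Gen (ract M \<nu> m k q)], [Idn (Nw M m), Gen (evl j p), Idn (h k)], [Idn (Nw M m), Idn (b j), Gen (ani n p), Idn (h k)], [Idn (Nw M m),
    Brd [h n] [b j], Idn (h k)], [Gen (rcoa M r i m n), Idn (b j), Idn (h k)]]"
  by (rule diag_rlI) (use assms okop_right_double_act_rl[OF Mm Mc] right_moduleD(1,2,5)[OF Mm] right_comoduleD(1,2,5)[OF Mc] in \<open>auto, auto simp: right_double_act_def\<close>)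

text \<open>The double is the same as on the left, so the expansion of the cross term is reused; the
  Yetter-Drinfel'd condition again enters through the commutation rule alone.\<close>

theorem right_double_module:
  assumes M: "right_yd_module C A M \<nu> r"
  shows "right_module C D M (right_double_act M \<nu> r)"
proof -
  note Mm = right_ydD(1)[OF M] and Mc = right_ydD(2)[OF M]
  note [simp] = right_moduleD(1,2,5)[OF Mm] right_comoduleD(1,2,5)[OF Mc]
  note [simp] = okop_right_double_act_rl[OF Mm Mc]
  note 1 = den_diag[of "[[Gen (rdac M (right_double_act M \<nu> r) 7 5 6 8)], [Idn (Nw M 7), Gen (dmu 1 2 3 4 5 6)]]", simplified]
  note 1 = den_rw[OF 1 dmu_rl[of 1 3 9 10 11 5 2 4 12 13 14 6], simplified]
  note 1 = den_rw[OF 1 right_double_act_rl[OF Mm Mc, of 6 15 16 7 17 8 5], simplified]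
  note 1 = den_rw[OF 1 Bm_rl[of 1 11 5 16 18 19], simplified]
  note 1 = den_rw[OF 1 Si_De_rl[of 15 16 18 19 5 20], simplified]
  note 1 = den_rw[OF 1 rcoa_rl[OF Mc, of 15 5 20 7 17 16], simplified]
  note 1 = den_rw[OF 1 cross_expand[of 3 9 10 11 2 12 13 14 15 21 22 23 24 25 26], simplified]
  note 1 = den_rw_id[OF 1 zig[of 19 22 11], simplified]
  note 1 = den_rw[OF 1 ract_rl[OF Mm, of 14 4 6 17 8 9], simplified]
  note 2 = den_diag[of "[[Gen (rdac M (right_double_act M \<nu> r) 14 3 4 8)], [Gen (rdac M (right_double_act M \<nu> r) 7 1 2 14), Idl [b 3, h 4]]]", simplified]
  note 2 = den_rw[OF 2 right_double_act_rl[OF Mm Mc, of 2 20 18 7 16 14 1], simplified]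
  note 2 = den_rw[OF 2 right_double_act_rl[OF Mm Mc, of 4 21 26 14 9 8 3], simplified]
  note 2 = den_rw[OF 2 right_yd_cross[OF M, of 2 21 26 16 14 9 5 15 23 19 24 25 17], simplified]
  have "right_double_act M \<nu> r \<cdot> (\<one> M \<otimes> mlt D) = right_double_act M \<nu> r \<cdot> (right_double_act M \<nu> r \<otimes> \<one> (Hs \<boxtimes> H))"
    using den_eq[OF 1 2] by simp
  moreover
  note 1 = den_diag[of "[[Gen (rdac M (right_double_act M \<nu> r) 7 5 6 8)], [Idn (Nw M 7), Gen (dun 5 6)]]", simplified]
  note 1 = den_rw[OF 1 dun_rl[of 5 6], simplified]
  note 1 = den_rw[OF 1 right_double_act_rl[OF Mm Mc, of 6 1 2 7 3 8 5], simplified]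
  note 1 = den_rw[OF 1 Bu_rl[of 5 2], simplified]
  note 1 = den_rw[OF 1 Si_Ep_rl[of 1 2], simplified]
  note 1 = den_rw_id[OF 1 rcoa_unit[OF Mc, of 7 3 1], simplified]
  note 1 = den_rw_id[OF 1 ract_unit[OF Mm, of 7 8 6], simplified]
  note 2 = den_diag[of "[[Idn (Nw M 7)]]", simplified]
  have "right_double_act M \<nu> r \<cdot> (\<one> M \<otimes> unt D) = \<one> M"
    using den_eq[OF 1 2] by simp
  moreover have "right_double_act M \<nu> r \<in> hom C (M \<boxtimes> Hs \<boxtimes> H) M"
    using okop_right_double_act_rl[OF Mm Mc, of 1 1 1 2] by (simp add: okop_def ok_def tenO_assoc)
  ultimately show ?thesis by (simp add: right_module_def)
qed

abbreviation "rlact M w \<equiv> right_act_H C A Hs ev M w"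
abbreviation "rsact M w \<equiv> right_act_Hs C A Hs M w"

text \<open>\<open>m \<mapsto> \<Sum> m e* \<otimes> S(e)\<close>. The crossing puts the legs of the
  dual basis into the order in which they are consumed.\<close>

definition right_double_coact :: "'o \<Rightarrow> 'm \<Rightarrow> 'm" where
  "right_double_coact M w = (rsact M w \<otimes> S) \<cdot> (\<one> M \<otimes> \<Phi> H Hs) \<cdot> (\<one> M \<otimes> coev)"

lemma right_double_moduleD:
  assumes "right_module C D M w"
  shows "M \<in> ob C" "w \<in> hom C (M \<boxtimes> Hs \<boxtimes> H) M" "w \<cdot> (\<one> M \<otimes> mlt D) = w \<cdot> (w \<otimes> \<one> (Hs \<boxtimes> H))" "w \<cdot> (\<one> M \<otimes> unt D) = \<one> M"
    "okop (rdac M w m i j n)"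
  using assms by (auto simp: right_module_def okop_def ok_def)

lemma right_double_rl:
  assumes W: "right_module C D M w" and "distinct [j, m, p]" and "distinct [k, n, q]" and "distinct [i, s]" and "distinct [j, m]" and "distinct [k, n]" and "distinct [i, t, s]"
  shows "diag_rl [[Gen (rdac M w i p q s)], [Idn (Nw M i), Gen (dmu j k m n p q)]]
    [[Gen (rdac M w t m n s)], [Gen (rdac M w i j k t), Idl [b m, h n]]]"
  by (rule diag_rlI) (use assms right_double_moduleD(1,2,5)[OF W] right_double_moduleD(3)[OF W] in auto)

lemma right_double_unit:
  assumes W: "right_module C D M w" and "distinct [i, m]"
  shows "den [dun j k, rdac M w i j k m] ([Nw M i], \<one> (wo (Nw M i)), [Nw M m])"
  using right_double_moduleD(1,2,5)[OF W] right_double_moduleD(4)[OF W] assms(2-) den_diag[of "[[Gen (rdac M w i j k m)], [Idn (Nw M i), Gen (dun j k)]]"] by auto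

lemma okop_rlact_rl:
  assumes W: "right_module C D M w"
  shows "okop (ract M (rlact M w) i j m)"
proof -
  have 0: "okop (ract M (rlact M w) 7 1 8)"
    by (rule okop_den[of "[bun 2, rdac M w 7 2 1 8]"]) (use right_double_moduleD(1,2,5)[OF W] den_diag[of "[[Gen (rdac M w 7 2 1 8)], [Idn (Nw M 7), Gen (bun 2), Idn (h 1)]]"] in \<open>auto simp: right_act_H_def\<close>)
  thus ?thesis by (auto simp: okop_def ok_def)
qed

lemma rlact_rl:
  assumes W: "right_module C D M w" and "distinct [i, m]"
  shows "diag_rl [[Gen (ract M (rlact M w) i j m)]]
    [[Gen (rdac M w i k j m)], [Idn (Nw M i), Gen (bun k), Idn (h j)]]"
  by (rule diag_rlI) (use assms okop_rlact_rl[OF W] right_double_moduleD(1,2,5)[OF W] in \<open>auto, auto simp: right_act_H_def\<close>)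

lemma okop_rsact_rl:
  assumes W: "right_module C D M w"
  shows "okop (rbac M (rsact M w) i j m)"
proof -
  have 0: "okop (rbac M (rsact M w) 7 1 8)"
    by (rule okop_den[of "[uni 2, rdac M w 7 1 2 8]"]) (use right_double_moduleD(1,2,5)[OF W] den_diag[of "[[Gen (rdac M w 7 1 2 8)], [Idn (Nw M 7), Idn (b 1), Gen (uni 2)]]"] in \<open>auto simp: right_act_Hs_def\<close>)
  thus ?thesis by (auto simp: okop_def ok_def)
qed

lemma rsact_rl:
  assumes W: "right_module C D M w" and "distinct [i, m]"
  shows "diag_rl [[Gen (rbac M (rsact M w) i j m)]]
    [[Gen (rdac M w i j k m)], [Idn (Nw M i), Idn (b j), Gen (uni k)]]"
  by (rule diag_rlI) (use assms okop_rsact_rl[OF W] right_double_moduleD(1,2,5)[OF W] in \<open>auto, auto simp: right_act_Hs_def\<close>)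

lemma okop_right_double_coact_rl:
  assumes W: "right_module C D M w"
  shows "okop (rcoa M (right_double_coact M w) i m n)"
proof -
  have 0: "okop (rcoa M (right_double_coact M w) 7 8 3)"
    by (rule okop_den[of "[dul 1 2, rbac M (rsact M w) 7 2 8, ant 1 3]"]) (use right_double_moduleD(1,2,5)[OF W] okop_rsact_rl[OF W] den_diag[of "[[Gen (rbac M (rsact M w) 7 2 8), Gen (ant 1 3)], [Idn (Nw M 7), Brd [h 1] [b 2]], [Idn (Nw M 7), Gen (dul 1 2)]]"] in \<open>auto simp: right_double_coact_def\<close>)
  thus ?thesis by (auto simp: okop_def ok_def)
qed

lemma right_double_coact_rl:
  assumes W: "right_module C D M w" and "distinct [j, n]" and "distinct [i, m]"
  shows "diag_rl [[Gen (rcoa M (right_double_coact M w) i m n)]]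
    [[Gen (rbac M (rsact M w) i k m), Gen (ant j n)], [Idn (Nw M i), Brd [h j] [b k]], [Idn (Nw M i), Gen (dul j k)]]"
  by (rule diag_rlI) (use assms okop_right_double_coact_rl[OF W] right_double_moduleD(1,2,5)[OF W] okop_rsact_rl[OF W] in \<open>auto, auto simp: right_double_coact_def\<close>)

lemmas right_double_ops = right_double_moduleD(1,2,5) okop_rlact_rl okop_rsact_rl okop_right_double_coact_rl

text \<open>The factorization \<open>b \<otimes> h = (b \<otimes> 1)(1 \<otimes> h)\<close> in the
  double; for right modules the dual acts first.\<close>

lemma right_double_split:
  assumes W: "right_module C D M w" and "distinct [i, m]" and "distinct [i, n, m]"
  shows "diag_rl [[Gen (rdac M w i j k m)]]
    [[Gen (ract M (rlact M w) n k m)], [Gen (rbac M (rsact M w) i j n), Idn (h k)]]"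
proof -
  note [simp] = right_double_ops[OF W]
  note 1 = den_diag[of "[[Gen (rdac M w 7 1 2 8)]]", simplified]
  note 2 = den_diag[of "[[Gen (ract M (rlact M w) 9 2 8)], [Gen (rbac M (rsact M w) 7 1 9), Idn (h 2)]]", simplified]
  note 2 = den_rw[OF 2 rsact_rl[OF W, of 7 9 1 3], simplified]
  note 2 = den_rw[OF 2 rlact_rl[OF W, of 9 8 2 4], simplified]
  note 2 = den_rw[OF 2 rl_sym[OF right_double_rl[OF W, of 1 4 5 3 2 6 7 8 9]], simplified]
  note 2 = den_rw[OF 2 dmu_rl[of 1 4 9 10 11 5 3 2 12 13 14 6], simplified]
  note 2 = den_rw[OF 2 cross_unit_right[of 4 9 10 11 3 2 12 13 14 6], simplified]
  note 2 = den_rw_id[OF 2 Bm_unit_right[of 1 11 5], simplified]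
  note 2 = den_rw_id[OF 2 unit_left[of 2 3 6], simplified]
  note e = den_eq[OF 1 2, simplified]
  show ?thesis by (rule diag_rlI) (use assms e[symmetric] in auto)
qed

lemma rlact_mul_eq:
  assumes W: "right_module C D M w"
  shows "(rlact M w) \<cdot> (\<one> M \<otimes> Mu) =
    (rlact M w) \<cdot> ((rlact M w) \<otimes> \<one> H)"
proof -
  note [simp] = right_double_ops[OF W]
  note 1 = den_diag[of "[[Gen (ract M (rlact M w) 7 3 8)], [Idn (Nw M 7), Gen (mul 1 2 3)]]", simplified]
  note 1 = den_rw[OF 1 rlact_rl[OF W, of 7 8 3 4], simplified]
  note 2 = den_diag[of "[[Gen (ract M (rlact M w) 9 2 8)], [Gen (ract M (rlact M w) 7 1 9), Idn (h 2)]]", simplified]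
  note 2 = den_rw[OF 2 rlact_rl[OF W, of 7 9 1 15], simplified]
  note 2 = den_rw[OF 2 rlact_rl[OF W, of 9 8 2 16], simplified]
  note 2 = den_rw[OF 2 rl_sym[OF right_double_rl[OF W, of 15 16 5 1 2 3 7 8 9]], simplified]
  note 2 = den_rw[OF 2 dmu_rl[of 15 16 9 10 4 5 1 2 12 13 14 3], simplified]
  note 2 = den_rw[OF 2 cross_unit_right[of 16 9 10 4 1 2 12 13 14 3], simplified]
  note 2 = den_rw_id[OF 2 Bm_unit_left[of 4 15 5], simplified]
  show ?thesis using den_eq[OF 1 2] by simp
qed

lemma rlact_unit:
  assumes W: "right_module C D M w"
  shows "(rlact M w) \<cdot> (\<one> M \<otimes> Et) =
    \<one> M"
proof -
  note [simp] = right_double_ops[OF W]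
  note 1 = den_diag[of "[[Gen (ract M (rlact M w) 7 1 8)], [Idn (Nw M 7), Gen (uni 1)]]", simplified]
  note 1 = den_rw[OF 1 rlact_rl[OF W, of 7 8 1 2], simplified]
  note 1 = den_rw[OF 1 rl_sym[OF dun_rl[of 2 1]], simplified]
  note 1 = den_rw_id[OF 1 right_double_unit[OF W, of 7 8 2 1], simplified]
  note 2 = den_diag[of "[[Idn (Nw M 7)]]", simplified]
  show ?thesis using den_eq[OF 1 2] by simp
qed

lemma rsact_mul:
  assumes W: "right_module C D M w" and "distinct [j, k, m]" and "distinct [i, n]" and "distinct [j, k]" and "distinct [i, p, n]"
  shows "diag_rl [[Gen (rbac M (rsact M w) i m n)], [Idn (Nw M i), Gen (bml j k m)]]
    [[Gen (rbac M (rsact M w) p k n)], [Gen (rbac M (rsact M w) i j p), Idn (b k)]]"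
proof -
  note [simp] = right_double_ops[OF W]
  note 1 = den_diag[of "[[Gen (rbac M (rsact M w) 7 3 8)], [Idn (Nw M 7), Gen (bml 1 2 3)]]", simplified]
  note 1 = den_rw[OF 1 rsact_rl[OF W, of 7 8 3 4], simplified]
  note 2 = den_diag[of "[[Gen (rbac M (rsact M w) 9 2 8)], [Gen (rbac M (rsact M w) 7 1 9), Idn (b 2)]]", simplified]
  note 2 = den_rw[OF 2 rsact_rl[OF W, of 7 9 1 15], simplified]
  note 2 = den_rw[OF 2 rsact_rl[OF W, of 9 8 2 4], simplified]
  note 2 = den_rw[OF 2 rl_sym[OF right_double_rl[OF W, of 1 2 3 15 4 6 7 8 9]], simplified]
  note 2 = den_rw[OF 2 dmu_rl[of 1 2 9 10 11 3 15 4 12 13 14 6], simplified]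
  note 2 = den_rw[OF 2 cross_unit_left[of 1 2 9 10 11 3 15 12 13 14], simplified]
  note 2 = den_rw_id[OF 2 unit_left[of 4 14 6], simplified]
  note e = den_eq[OF 1 2, simplified]
  show ?thesis by (rule diag_rlI) (use assms e in auto)
qed

lemma rsact_unit_eq:
  assumes W: "right_module C D M w"
  shows "(rsact M w) \<cdot> (\<one> M \<otimes> Bu) =
    \<one> M"
proof -
  note [simp] = right_double_ops[OF W]
  note 1 = den_diag[of "[[Gen (rbac M (rsact M w) 7 1 8)], [Idn (Nw M 7), Gen (bun 1)]]", simplified]
  note 1 = den_rw[OF 1 rsact_rl[OF W, of 7 8 1 2], simplified]
  note 1 = den_rw[OF 1 rl_sym[OF dun_rl[of 1 2]], simplified]
  note 1 = den_rw_id[OF 1 right_double_unit[OF W, of 7 8 1 2], simplified]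
  note 2 = den_diag[of "[[Idn (Nw M 7)]]", simplified]
  show ?thesis using den_eq[OF 1 2] by simp
qed

lemma rsact_unit:
  assumes W: "right_module C D M w" and "distinct [i, k]"
  shows "den [bun j, rbac M (rsact M w) i j k] ([Nw M i], \<one> (wo (Nw M i)), [Nw M k])"
  using right_double_ops[OF W] rsact_unit_eq[OF W] assms(2-) den_diag[of "[[Gen (rbac M (rsact M w) i j k)], [Idn (Nw M i), Gen (bun j)]]"] by auto

text \<open>For right modules, acting by \<open>h\<close> and then by b means multiplying
  \<open>1 \<otimes> h\<close> and \<open>b \<otimes> 1\<close> in this order, which yields the
  cross term.\<close>

lemma rlact_rsact:
  assumes W: "right_module C D M w" and "distinct [i, m, n]" and "distinct [k, s, t, u]" and "distinct [j, p, q, v]"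
  shows "diag_rl [[Gen (rbac M (rsact M w) m k n)], [Gen (ract M (rlact M w) i j m), Idn (b k)]]
    [[Gen (ract M (rlact M w) m v n)], [Gen (rbac M (rsact M w) i u m), Idn (h v)], [Idn (Nw M i), Gen (lac p s u), Gen (rac q t v)], [Idn (Nw M i),
    Idn (h p), Brd [h q] [b s], Idn (b t)], [Idn (Nw M i), Gen (com j p q), Gen (bco k s t)]]"
proof -
  note [simp] = right_double_ops[OF W]
  note 1 = den_diag[of "[[Gen (rbac M (rsact M w) 9 1 8)], [Gen (ract M (rlact M w) 7 2 9), Idn (b 1)]]", simplified]
  note 1 = den_rw[OF 1 rlact_rl[OF W, of 7 9 2 3], simplified]
  note 1 = den_rw[OF 1 rsact_rl[OF W, of 9 8 1 4], simplified]
  note 1 = den_rw[OF 1 rl_sym[OF right_double_rl[OF W, of 3 1 5 2 4 6 7 8 9]], simplified]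
  note 1 = den_rw[OF 1 dmu_rl[of 3 1 9 10 11 5 2 4 12 13 14 6], simplified]
  note 1 = den_rw_id[OF 1 Bm_unit_left[of 11 3 5], simplified]
  note 1 = den_rw_id[OF 1 unit_right[of 14 4 6], simplified]
  note 1 = den_rw[OF 1 right_double_split[OF W, of 7 8 3 11 14], simplified]
  note 2 = den_diag[of "[[Gen (ract M (rlact M w) 3 14 8)], [Gen (rbac M (rsact M w) 7 11 3), Idn (h 14)], [Idn (Nw M 7), Gen (lac 12 9 11), Gen (rac 13 10 14)],
    [Idn (Nw M 7), Idn (h 12), Brd [h 13] [b 9], Idn (b 10)], [Idn (Nw M 7), Gen (com 2 12 13), Gen (bco 1 9 10)]]", simplified]
  note e = den_eq[OF 1 2, simplified]
  show ?thesis by (rule diag_rlI) (use assms e in auto)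
qed

lemma rsact_coact:
  assumes W: "right_module C D M w" and "distinct [i, k]" and "distinct [m, n]"
  shows "diag_rl [[Gen (rbac M (rsact M w) i j k)]]
    [[Idn (Nw M k), Gen (evl j n)], [Idn (Nw M k), Idn (b j), Gen (ani m n)], [Idn (Nw M k), Brd [h m] [b j]],
    [Gen (rcoa M (right_double_coact M w) i k m), Idn (b j)]]"
proof -
  note [simp] = right_double_ops[OF W]
  note 1 = den_diag[of "[[Gen (rbac M (rsact M w) 7 1 8)]]", simplified]
  note 2 = den_diag[of "[[Idn (Nw M 8), Gen (evl 1 4)], [Idn (Nw M 8), Idn (b 1), Gen (ani 3 4)], [Idn (Nw M 8), Brd [h 3] [b 1]],
    [Gen (rcoa M (right_double_coact M w) 7 8 3), Idn (b 1)]]", simplified]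
  note 2 = den_rw[OF 2 right_double_coact_rl[OF W, of 2 3 7 8 5], simplified]
  note 2 = den_rw_id[OF 2 Si_S[of 2 3 4], simplified]
  note 2 = den_rw_id[OF 2 zag[of 1 5 2], simplified]
  note e = den_eq[OF 1 2, simplified]
  show ?thesis by (rule diag_rlI) (use assms e[symmetric] in auto)
qed

lemma right_double_coact_coassoc:
  assumes W: "right_module C D M w"
  shows "(\<one> M \<otimes> De) \<cdot> right_double_coact M w =
    (right_double_coact M w \<otimes> \<one> H) \<cdot> right_double_coact M w"
proof -
  note [simp] = right_double_ops[OF W]
  note 1 = den_diag[of "[[Idn (Nw M 8), Gen (com 1 2 3)], [Gen (rcoa M (right_double_coact M w) 7 8 1)]]", simplified]
  note 1 = den_rw[OF 1 right_double_coact_rl[OF W, of 4 1 7 8 5], simplified]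
  note 1 = den_rw[OF 1 S_De_rl[of 4 1 2 3 6 9], simplified]
  note 1 = den_rw[OF 1 coev_De[of 4 6 9 1 10 5], simplified]
  note 1 = den_rw[OF 1 rsact_mul[OF W, of 1 10 5 7 8 4], simplified]
  note 2 = den_diag[of "[[Gen (rcoa M (right_double_coact M w) 4 8 2), Idn (h 3)], [Gen (rcoa M (right_double_coact M w) 7 4 3)]]", simplified]
  note 2 = den_rw[OF 2 right_double_coact_rl[OF W, of 6 3 7 4 1], simplified]
  note 2 = den_rw[OF 2 right_double_coact_rl[OF W, of 9 2 4 8 10], simplified]
  show ?thesis using den_eq[OF 1 2] by simp
qed

lemma right_double_coact_counit:
  assumes W: "right_module C D M w"
  shows "(\<one> M \<otimes> Ep) \<cdot> right_double_coact M w =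
    \<one> M"
proof -
  note [simp] = right_double_ops[OF W]
  note 1 = den_diag[of "[[Idn (Nw M 8), Gen (cou 1)], [Gen (rcoa M (right_double_coact M w) 7 8 1)]]", simplified]
  note 1 = den_rw[OF 1 right_double_coact_rl[OF W, of 2 1 7 8 3], simplified]
  note 1 = den_rw[OF 1 S_Ep_rl[of 2 1], simplified]
  note 1 = den_rw[OF 1 coev_Ep[of 2 3], simplified]
  note 1 = den_rw_id[OF 1 rsact_unit[OF W, of 7 8 3], simplified]
  note 2 = den_diag[of "[[Idn (Nw M 7)]]", simplified]
  show ?thesis using den_eq[OF 1 2] by simp
qed

text \<open>On this side it is the left-hand side that contains an action of \<open>H\<close>
  followed by one of the dual. Expanding it gives \<open>m(0) h3 \<otimes> h1 S(h2) m(1) h4\<close>,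
  where \<open>h1 S(h2)\<close> cancels.\<close>

lemma right_double_yd:
  assumes W: "right_module C D M w"
  shows "(\<one> M \<otimes> Mu) \<cdot> (\<Phi> H M \<otimes> \<one> H) \<cdot> (\<one> H \<otimes> (right_double_coact M w)) \<cdot> (\<one> H \<otimes> (rlact M w)) \<cdot> (\<Phi> M H \<otimes> \<one> H) \<cdot> (\<one> M \<otimes> De) =
    ((rlact M w) \<otimes> Mu) \<cdot> (\<one> M \<otimes> \<Phi> H H \<otimes> \<one> H) \<cdot> ((right_double_coact M w) \<otimes> De)"
proof -
  note [simp] = right_double_ops[OF W]
  note 1 = den_diag[of "[[Idn (Nw M 17), Gen (mul 2 4 5)], [Brd [h 2] [Nw M 17], Idn (h 4)], [Idn (h 2), Gen (rcoa M (right_double_coact M w) 16 17 4)], [Idn (h 2),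
    Gen (ract M (rlact M w) 7 3 16)], [Brd [Nw M 7] [h 2], Idn (h 3)], [Idn (Nw M 7), Gen (com 1 2 3)]]", simplified]
  note 1 = den_rw[OF 1 right_double_coact_rl[OF W, of 6 4 16 17 8], simplified]
  note 1 = den_rw[OF 1 rlact_rsact[OF W, of 7 16 17 8 9 10 11 3 12 13 14], simplified]
  note 1 = den_rw[OF 1 rsact_coact[OF W, of 7 16 15 18 11], simplified]
  note 1 = den_rw[OF 1 cross_expand[of 8 9 10 11 3 12 13 14 19 20 21 22 23 24 25], simplified]
  note 1 = den_rw_id[OF 1 zig[of 25 6 8], simplified]
  note 1 = den_rw_id[OF 1 zig[of 18 21 11], simplified]
  note 1 = den_rw[OF 1 S_Mu_rl[of 23 24 25 4 6 8], simplified]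
  note 1 = den_rw_id[OF 1 S_Si[of 22 23 6], simplified]
  note 1 = den_rw[OF 1 S_Mu_rl[of 18 19 24 8 6 9], simplified]
  note 1 = den_rw_id[OF 1 S_Si[of 15 18 6], simplified]
  note 1 = den_rw[OF 1 rl_sym[OF assoc_rl[of 2 8 6 22 5 4]], simplified]
  note 1 = den_rw[OF 1 rl_sym[OF assoc_rl[of 2 9 4 15 6 8]], simplified]
  note 1 = den_rw[OF 1 rl_sym[OF coassoc_rl[of 1 8 20 2 19 3]], simplified]
  note 1 = den_rw[OF 1 antipode_right_rl[of 8 2 19 9 4], simplified]
  note 1 = den_rw_id[OF 1 unit_left[of 15 4 6], simplified]
  note 1 = den_rw_id[OF 1 counit_left[of 1 8 20], simplified]
  note 2 = den_diag[of "[[Gen (ract M (rlact M w) 16 14 17), Gen (mul 15 22 5)], [Idn (Nw M 16), Brd [h 15] [h 14], Idn (h 22)],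
    [Gen (rcoa M (right_double_coact M w) 7 16 15), Gen (com 1 14 22)]]", simplified]
  show ?thesis using den_eq[OF 1 2] by simp
qed

theorem right_yd_of_double:
  assumes W: "right_module C D M w"
  shows "right_yd_module C A M (rlact M w) (right_double_coact M w)"
proof -
  have "rlact M w \<in> hom C (M \<boxtimes> H) M" "right_double_coact M w \<in> hom C M (M \<boxtimes> H)"
    using okop_rlact_rl[OF W, of 1 1 2] okop_right_double_coact_rl[OF W, of 1 1 2] by (simp_all add: okop_def ok_def)
  thus ?thesis
    using right_double_moduleD(1)[OF W] rlact_mul_eq[OF W] rlact_unit[OF W] right_double_coact_coassoc[OF W] right_double_coact_counit[OF W]
      right_double_yd[OF W]
    by (simp add: right_yd_module_def right_module_def right_comodule_def Let_def)
qed

lemma right_double_act_of_double: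
  assumes W: "right_module C D M w"
  shows "right_double_act M (rlact M w) (right_double_coact M w) =
    w"
proof -
  note [simp] = right_double_ops[OF W]
  note 1 = den_diag[of "[[Gen (ract M (rlact M w) 9 2 8)], [Idn (Nw M 9), Gen (evl 1 4), Idn (h 2)], [Idn (Nw M 9), Idn (b 1), Gen (ani 3 4), Idn (h 2)], [Idn (Nw M 9),
    Brd [h 3] [b 1], Idn (h 2)], [Gen (rcoa M (right_double_coact M w) 7 9 3), Idn (b 1), Idn (h 2)]]", simplified]
  note 1 = den_rw[OF 1 rl_sym[OF rsact_coact[OF W, of 7 9 3 4 1]], simplified]
  note 1 = den_rw[OF 1 rl_sym[OF right_double_split[OF W, of 7 8 9 1 2]], simplified]
  note 2 = den_diag[of "[[Gen (rdac M w 7 1 2 8)]]", simplified]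
  show ?thesis using den_eq[OF 1 2] by (simp add: right_double_act_def right_double_act_def)
qed

lemma right_double_hom_rl:
  assumes W: "right_module C D M w" and V: "right_module C D N w'" and f: "f \<in> hom C M N" and e: "f \<cdot> w = w' \<cdot> (f \<otimes> \<one> (Hs \<boxtimes> H))" and "distinct [i, m, n]" and "distinct [i, p, n]"
  shows "diag_rl [[Gen (mor M N f m n)], [Gen (rdac M w i j k m)]]
    [[Gen (rdac N w' p j k n)], [Gen (mor M N f i p), Idl [b j, h k]]]"
  by (rule diag_rlI) (use assms right_double_moduleD(1,2,5)[OF W] right_double_moduleD(1,2,5)[OF V] f e in auto)

lemma rlact_hom:
  assumes W: "right_module C D M w" and V: "right_module C D N w'"
    and f: "f \<in> hom C M N" and e: "f \<cdot> w = w' \<cdot> (f \<otimes> \<one> (Hs \<boxtimes> H))"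
  shows "f \<cdot> (rlact M w) =
    rlact N w' \<cdot> (f \<otimes> \<one> H)"
proof -
  note [simp] = right_double_ops[OF W] right_double_ops[OF V] f
  note 1 = den_diag[of "[[Gen (mor M N f 8 9)], [Gen (ract M (rlact M w) 7 1 8)]]", simplified]
  note 1 = den_rw[OF 1 rlact_rl[OF W, of 7 8 1 2], simplified]
  note 1 = den_rw[OF 1 right_double_hom_rl[OF W V f e, of 7 8 9 3 2 1], simplified]
  note 2 = den_diag[of "[[Gen (ract N (rlact N w') 3 1 9)], [Gen (mor M N f 7 3), Idn (h 1)]]", simplified]
  note 2 = den_rw[OF 2 rlact_rl[OF V, of 3 9 1 2], simplified]
  show ?thesis using den_eq[OF 1 2] by simp
qed

lemma right_double_coact_hom:
  assumes W: "right_module C D M w" and V: "right_module C D N w'"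
    and f: "f \<in> hom C M N" and e: "f \<cdot> w = w' \<cdot> (f \<otimes> \<one> (Hs \<boxtimes> H))"
  shows "right_double_coact N w' \<cdot> f =
    (f \<otimes> \<one> H) \<cdot> right_double_coact M w"
proof -
  note [simp] = right_double_ops[OF W] right_double_ops[OF V] f
  note 1 = den_diag[of "[[Gen (rcoa N (right_double_coact N w') 8 9 3)], [Gen (mor M N f 7 8)]]", simplified]
  note 1 = den_rw[OF 1 right_double_coact_rl[OF V, of 1 3 8 9 2], simplified]
  note 1 = den_rw[OF 1 rsact_rl[OF V, of 8 9 2 4], simplified]
  note 1 = den_rw[OF 1 rl_sym[OF right_double_hom_rl[OF W V f e, of 7 5 9 8 2 4]], simplified]
  note 2 = den_diag[of "[[Gen (mor M N f 5 9), Idn (h 3)], [Gen (rcoa M (right_double_coact M w) 7 5 3)]]", simplified]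
  note 2 = den_rw[OF 2 right_double_coact_rl[OF W, of 1 3 7 5 2], simplified]
  note 2 = den_rw[OF 2 rsact_rl[OF W, of 7 5 2 4], simplified]
  show ?thesis using den_eq[OF 1 2] by simp
qed

end

context transparent_hopf begin

text \<open>The statements on \<open>twist\<close>, \<open>untwist\<close> and
  \<open>half_br\<close> read in the reversed category. The map is
  \<open>n \<otimes> m \<mapsto> n(0) \<otimes> m n(1)\<close>, and the inverse antipode is
  unaffected by reversal since only composition enters its definition.\<close>

lemma right_twist:
  assumes N: "right_comodule C A N r'" and M: "right_module C A M \<nu>"
  shows "inverse_pair C (N \<boxtimes> M) (N \<boxtimes> M) ((\<one> N \<otimes> \<nu>) \<cdot> (\<one> N \<otimes> \<Phi> H M) \<cdot> (r' \<otimes> \<one> M))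
      ((\<one> N \<otimes> \<nu>) \<cdot> (\<one> N \<otimes> \<Phi> H M) \<cdot> (\<one> N \<otimes> Si \<otimes> \<one> M) \<cdot> (r' \<otimes> \<one> M))"
    "(\<one> N \<otimes> \<nu>) \<cdot> (\<one> N \<otimes> \<Phi> H M) \<cdot> (r' \<otimes> \<one> M) \<in> hom C (N \<boxtimes> M) (N \<boxtimes> M)"
    "(\<one> N \<otimes> \<nu>) \<cdot> (\<Phi> M N \<otimes> \<one> H) \<cdot> (\<one> M \<otimes> r') = ((\<one> N \<otimes> \<nu>) \<cdot> (\<one> N \<otimes> \<Phi> H M) \<cdot> (r' \<otimes> \<one> M)) \<cdot> \<Phi> M N"
proof -
  interpret R: transparent_hopf "rev_cat C" A by (rule rev_hopf)
  have N': "left_comodule (rev_cat C) A N r'" and M': "left_module (rev_cat C) A M \<nu>"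
    using N M by (simp_all add: rev_left_comodule rev_left_module)
  have [simp]: "inv_antipode (rev_cat C) A = Si"
    by (simp add: inv_antipode_def inv_mor_def inverse_pair_def)
  have [simp]: "(\<one> N \<otimes> Si) \<otimes> \<one> M = \<one> N \<otimes> Si \<otimes> \<one> M"
    using right_comoduleD(1)[OF N] right_moduleD(1)[OF M] inv_antipode(1) by (intro tenM_assoc[of N N H H M M]) (simp_all add: id_hom)
  note t = R.twist_def[of N r' M \<nu>, simplified] and u = R.untwist_def[of N r' M \<nu>, simplified]
  show "inverse_pair C (N \<boxtimes> M) (N \<boxtimes> M) ((\<one> N \<otimes> \<nu>) \<cdot> (\<one> N \<otimes> \<Phi> H M) \<cdot> (r' \<otimes> \<one> M))
      ((\<one> N \<otimes> \<nu>) \<cdot> (\<one> N \<otimes> \<Phi> H M) \<cdot> (\<one> N \<otimes> Si \<otimes> \<one> M) \<cdot> (r' \<otimes> \<one> M))"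
    "(\<one> N \<otimes> \<nu>) \<cdot> (\<one> N \<otimes> \<Phi> H M) \<cdot> (r' \<otimes> \<one> M) \<in> hom C (N \<boxtimes> M) (N \<boxtimes> M)"
    using R.twist_inverse[OF N' M'] by (simp_all add: t u inverse_pair_def)
  show "(\<one> N \<otimes> \<nu>) \<cdot> (\<Phi> M N \<otimes> \<one> H) \<cdot> (\<one> M \<otimes> r') = ((\<one> N \<otimes> \<nu>) \<cdot> (\<one> N \<otimes> \<Phi> H M) \<cdot> (r' \<otimes> \<one> M)) \<cdot> \<Phi> M N"
    using R.half_br_twist[OF N' M'] by (simp add: t R.half_br_def)
qed

lemma right_yd_sel [simp]:
  "ob (right_yd C A) = {(M, \<nu>, r). right_yd_module C A M \<nu> r}"
  "hom (right_yd C A) (M, \<nu>, r) (N, \<pi>, r') = {f \<in> hom C M N. f \<cdot> \<nu> = \<pi> \<cdot> (f \<otimes> \<one> H) \<and> r' \<cdot> f = (f \<otimes> \<one> H) \<cdot> r}"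
  "idm (right_yd C A) (M, \<nu>, r) = \<one> M" "cmp (right_yd C A) = cmp C" "unitO (right_yd C A) = (\<I>, Ep, Et)"
  "tenO (right_yd C A) (M, \<nu>, r) (N, \<pi>, r') = (M \<boxtimes> N, right_action_tensor C A M \<nu> N \<pi>, right_coaction_tensor C A M r N r')"
  "tenM (right_yd C A) = tenM C"
  "braid (right_yd C A) (M, \<nu>, r) (N, \<pi>, r') = (\<one> N \<otimes> \<nu>) \<cdot> (\<Phi> M N \<otimes> \<one> H) \<cdot> (\<one> M \<otimes> r')"
  by (simp_all add: right_yd_def)

end

context finite_hopf begin

section \<open>Comparison of the two constructions on the right\<close>

lemma rlact_double_act:
  assumes M: "right_yd_module C A M \<nu> r"
  shows "rlact M (right_double_act M \<nu> r) =
    \<nu>"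
proof -
  note Mm = right_ydD(1)[OF M] and Mc = right_ydD(2)[OF M]
  note [simp] = right_moduleD(1,2,5)[OF Mm] right_comoduleD(1,2,5)[OF Mc]
  note [simp] = okop_right_double_act_rl[OF Mm Mc]
  note 1 = den_diag[of "[[Gen (rdac M (right_double_act M \<nu> r) 7 5 6 8)], [Idn (Nw M 7), Gen (bun 5), Idn (h 6)]]", simplified]
  note 1 = den_rw[OF 1 right_double_act_rl[OF Mm Mc, of 6 1 2 7 3 8 5], simplified]
  note 1 = den_rw[OF 1 Bu_rl[of 5 2], simplified]
  note 1 = den_rw[OF 1 Si_Ep_rl[of 1 2], simplified]
  note 1 = den_rw_id[OF 1 rcoa_unit[OF Mc, of 7 3 1], simplified]
  note 2 = den_diag[of "[[Gen (ract M \<nu> 7 6 8)]]", simplified]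
  show ?thesis using den_eq[OF 1 2] by (simp add: right_act_H_def right_act_H_def)
qed

lemma rsact_double_act_eq:
  assumes M: "right_yd_module C A M \<nu> r"
  shows "rsact M (right_double_act M \<nu> r) =
    (\<one> M \<otimes> ev) \<cdot> (\<one> M \<otimes> \<one> Hs \<otimes> Si) \<cdot> (\<one> M \<otimes> \<Phi> H Hs) \<cdot> (r \<otimes> \<one> Hs)"
proof -
  note Mm = right_ydD(1)[OF M] and Mc = right_ydD(2)[OF M]
  note [simp] = right_moduleD(1,2,5)[OF Mm] right_comoduleD(1,2,5)[OF Mc]
  note [simp] = okop_right_double_act_rl[OF Mm Mc]
  note 1 = den_diag[of "[[Gen (rdac M (right_double_act M \<nu> r) 7 1 2 8)], [Idn (Nw M 7), Idn (b 1), Gen (uni 2)]]", simplified]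
  note 1 = den_rw[OF 1 right_double_act_rl[OF Mm Mc, of 2 3 4 7 5 8 1], simplified]
  note 1 = den_rw_id[OF 1 ract_unit[OF Mm, of 5 8 2], simplified]
  note 2 = den_diag[of "[[Idn (Nw M 5), Gen (evl 1 4)], [Idn (Nw M 5), Idn (b 1), Gen (ani 3 4)], [Idn (Nw M 5), Brd [h 3] [b 1]], [Gen (rcoa M r 7 5 3), Idn (b 1)]]", simplified]
  show ?thesis using den_eq[OF 1 2] by (simp add: right_act_Hs_def right_act_Hs_def)
qed

lemma rsact_double_act:
  assumes M: "right_yd_module C A M \<nu> r" and "distinct [i, k]" and "distinct [m, n]"
  shows "diag_rl [[Gen (rbac M (rsact M (right_double_act M \<nu> r)) i j k)]]
    [[Idn (Nw M k), Gen (evl j n)], [Idn (Nw M k), Idn (b j), Gen (ani m n)], [Idn (Nw M k), Brd [h m] [b j]], [Gen (rcoa M r i k m), Idn (b j)]]"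
  by (rule diag_rlI) (use assms rsact_double_act_eq[OF M, symmetric] okop_rsact_rl[OF right_double_module[OF M]] right_moduleD(1,2,5)[OF right_ydD(1)[OF M]] right_comoduleD(1,2,5)[OF right_ydD(2)[OF M]] in auto)

lemma right_double_coact_double_act:
  assumes M: "right_yd_module C A M \<nu> r"
  shows "right_double_coact M (right_double_act M \<nu> r) =
    r"
proof -
  note Mm = right_ydD(1)[OF M] and Mc = right_ydD(2)[OF M]
  note [simp] = right_moduleD(1,2,5)[OF Mm] right_comoduleD(1,2,5)[OF Mc]
  note [simp] = okop_right_double_act_rl[OF Mm Mc]
  note [simp] = okop_rsact_rl[OF right_double_module[OF M]]
  note 1 = den_diag[of "[[Gen (rbac M (rsact M (right_double_act M \<nu> r)) 7 2 8), Gen (ant 1 3)], [Idn (Nw M 7), Brd [h 1] [b 2]], [Idn (Nw M 7), Gen (dul 1 2)]]", simplified]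
  note 1 = den_rw[OF 1 rsact_double_act[OF M, of 7 8 4 5 2], simplified]
  note 1 = den_rw_id[OF 1 zig[of 5 1 2], simplified]
  note 1 = den_rw_id[OF 1 S_Si[of 4 5 3], simplified]
  note 2 = den_diag[of "[[Gen (rcoa M r 7 8 4)]]", simplified]
  show ?thesis using den_eq[OF 1 2] by (simp add: right_double_coact_def right_double_coact_def)
qed

lemma okop_right_action_tensor_rl:
  assumes Mm: "right_module C A M \<nu>" and Nm: "right_module C A N \<pi>"
  shows "okop (([Nw M i, Nw N j, h k], right_action_tensor C A M \<nu> N \<pi>, [Nw M p, Nw N q]))"
proof -
  have 0: "okop (([Nw M 7, Nw N 8, h 1], right_action_tensor C A M \<nu> N \<pi>, [Nw M 9, Nw N 10]))"
    by (rule okop_den[of "[com 1 2 3, ract M \<nu> 7 2 9, ract N \<pi> 8 3 10]"]) (use right_moduleD(1,2,5)[OF Mm] right_moduleD(1,2,5)[OF Nm] den_diag[of "[[Gen (ract M \<nu> 7 2 9), Gen (ract N \<pi> 8 3 10)], [Idn (Nw M 7), Brd [Nw N 8] [h 2], Idn (h 3)], [Idn (Nw M 7), Idn (Nw N 8), Gen (com 1 2 3)]]"] in \<open>auto simp: right_action_tensor_def\<close>)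
  thus ?thesis by (auto simp: okop_def ok_def)
qed

lemma right_action_tensor_rl:
  assumes Mm: "right_module C A M \<nu>" and Nm: "right_module C A N \<pi>" and "distinct [k, m, n]" and "distinct [i, j, p, q]"
  shows "diag_rl [[Gen (([Nw M i, Nw N j, h k], right_action_tensor C A M \<nu> N \<pi>, [Nw M p, Nw N q]))]]
    [[Gen (ract M \<nu> i m p), Gen (ract N \<pi> j n q)], [Idn (Nw M i), Brd [Nw N j] [h m], Idn (h n)], [Idn (Nw M i), Idn (Nw N j), Gen (com k m n)]]"
  by (rule diag_rlI) (use assms okop_right_action_tensor_rl[OF Mm Nm] right_moduleD(1,2,5)[OF Mm] right_moduleD(1,2,5)[OF Nm] in \<open>auto, auto simp: right_action_tensor_def\<close>)

lemma okop_right_coaction_tensor_rl: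
  assumes Mc: "right_comodule C A M r" and Nc: "right_comodule C A N r'"
  shows "okop (([Nw M i, Nw N j], right_coaction_tensor C A M r N r', [Nw M k, Nw N n, h q]))"
proof -
  have 0: "okop (([Nw M 7, Nw N 8], right_coaction_tensor C A M r N r', [Nw M 9, Nw N 10, h 3]))"
    by (rule okop_den[of "[rcoa M r 7 9 1, rcoa N r' 8 10 2, mul 1 2 3]"]) (use right_comoduleD(1,2,5)[OF Mc] right_comoduleD(1,2,5)[OF Nc] den_diag[of "[[Idn (Nw M 9), Idn (Nw N 10), Gen (mul 1 2 3)], [Idn (Nw M 9), Brd [h 1] [Nw N 10], Idn (h 2)], [Gen (rcoa M r 7 9 1), Gen (rcoa N r' 8 10 2)]]"] in \<open>auto simp: right_coaction_tensor_def\<close>)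
  thus ?thesis by (auto simp: okop_def ok_def)
qed

lemma right_coaction_tensor_rl:
  assumes Mc: "right_comodule C A M r" and Nc: "right_comodule C A N r'" and "distinct [m, p, q]" and "distinct [i, j, k, n]"
  shows "diag_rl [[Gen (([Nw M i, Nw N j], right_coaction_tensor C A M r N r', [Nw M k, Nw N n, h q]))]]
    [[Idn (Nw M k), Idn (Nw N n), Gen (mul m p q)], [Idn (Nw M k), Brd [h m] [Nw N n], Idn (h p)], [Gen (rcoa M r i k m), Gen (rcoa N r' j n p)]]"
  by (rule diag_rlI) (use assms okop_right_coaction_tensor_rl[OF Mc Nc] right_comoduleD(1,2,5)[OF Mc] right_comoduleD(1,2,5)[OF Nc] in \<open>auto, auto simp: right_coaction_tensor_def\<close>)

text \<open>As on the left, the opposite product behind the coproduct of the dual is undone by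
  \<open>Si\<close>: \<open><b, Si(n(1)) Si(m(1))> = <b, Si(m(1) n(1))>\<close>.\<close>

lemma right_double_act_tensor:
  assumes M: "right_yd_module C A M \<nu> r" and N: "right_yd_module C A N \<pi> r'"
  shows "right_action_tensor C D M (right_double_act M \<nu> r) N (right_double_act N \<pi> r') =
    right_double_act (M \<boxtimes> N) (right_action_tensor C A M \<nu> N \<pi>) (right_coaction_tensor C A M r N r')"
proof -
  note Mm = right_ydD(1)[OF M] and Mc = right_ydD(2)[OF M]
  note [simp] = right_moduleD(1,2,5)[OF Mm] right_comoduleD(1,2,5)[OF Mc]
  note [simp] = okop_right_double_act_rl[OF Mm Mc]
  note [simp] = okop_rsact_rl[OF right_double_module[OF M]]
  note Nm = right_ydD(1)[OF N] and Nc = right_ydD(2)[OF N]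
  note [simp] = right_moduleD(1,2,5)[OF Nm] right_comoduleD(1,2,5)[OF Nc]
  note [simp] = okop_right_double_act_rl[OF Nm Nc]
  note [simp] = okop_rsact_rl[OF right_double_module[OF N]]
  note [simp] = okop_right_action_tensor_rl[OF Mm Nm] okop_right_coaction_tensor_rl[OF Mc Nc]
  note 1 = den_diag[of "[[Gen (rdac M (right_double_act M \<nu> r) 7 3 4 9), Gen (rdac N (right_double_act N \<pi> r') 8 5 6 10)], [Idn (Nw M 7), Brd [Nw N 8] [b 3, h 4],
    Idl [b 5, h 6]], [Idn (Nw M 7), Idn (Nw N 8), Gen (dco 1 2 3 4 5 6)]]", simplified]
  note 1 = den_rw[OF 1 dco_rl[of 1 3 5 2 4 6], simplified]
  note 1 = den_rw[OF 1 right_double_act_rl[OF Mm Mc, of 4 11 12 7 13 9 3], simplified]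
  note 1 = den_rw[OF 1 right_double_act_rl[OF Nm Nc, of 6 14 15 8 16 10 5], simplified]
  note 1 = den_rw[OF 1 Bc_rl[of 1 3 5 12 15 17], simplified]
  note 1 = den_rw[OF 1 rl_sym[OF Si_Mu_rl[of 11 14 3 17 12 15]], simplified]
  note 2 = den_diag[of "[[Gen ([Nw M 13, Nw N 16, h 2], right_action_tensor C A M \<nu> N \<pi>, [Nw M 9, Nw N 10])], [Idl [Nw M 13, Nw N 16], Gen (evl 1 17), Idn (h 2)],
    [Idl [Nw M 13, Nw N 16], Idn (b 1), Gen (ani 3 17), Idn (h 2)], [Idl [Nw M 13, Nw N 16], Brd [h 3] [b 1], Idn (h 2)], [Gen ([Nw M 7, Nw N 8],
    right_coaction_tensor C A M r N r', [Nw M 13, Nw N 16, h 3]), Idn (b 1), Idn (h 2)]]", simplified]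
  note 2 = den_rw[OF 2 right_coaction_tensor_rl[OF Mc Nc, of 11 14 3 7 8 13 16], simplified]
  note 2 = den_rw[OF 2 right_action_tensor_rl[OF Mm Nm, of 2 4 6 13 16 9 10], simplified]
  show ?thesis using den_eq[OF 1 2] by (simp add: right_action_tensor_def[of C D] right_double_act_def[of "_ \<boxtimes> _"] right_action_tensor_def[of C D] right_double_act_def[of "_ \<boxtimes> _"])
qed

lemma right_double_act_unit:
  shows "right_double_act \<I> Ep Et =
    cunt D"
proof -
  note 1 = den_diag[of "[[Gen (cou 2)], [Idl [], Gen (evl 1 4), Idn (h 2)], [Idl [], Idn (b 1), Gen (ani 3 4), Idn (h 2)], [Idl [], Brd [h 3] [b 1], Idn (h 2)], [Gen (uni 3),
    Idn (b 1), Idn (h 2)]]", simplified]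
  note 1 = den_rw[OF 1 Si_Et_rl[of 3 4], simplified]
  note 1 = den_rw[OF 1 rl_sym[OF Be_rl[of 1 4]], simplified]
  note 2 = den_diag[of "[[Gen (dou 1 2)]]", simplified]
  note 2 = den_rw[OF 2 dou_rl[of 1 2], simplified]
  show ?thesis using den_eq[OF 1 2] by (simp add: right_double_act_def right_double_act_def)
qed

lemma right_hom_rl:
  assumes Mm: "right_module C A M \<nu>" and Nm: "right_module C A N \<pi>" and f: "f \<in> hom C M N" "f \<cdot> \<nu> = \<pi> \<cdot> (f \<otimes> \<one> H)" and "distinct [i, k, m]" and "distinct [i, n, m]"
  shows "diag_rl [[Gen (mor M N f k m)], [Gen (ract M \<nu> i j k)]]
    [[Gen (ract N \<pi> n j m)], [Gen (mor M N f i n), Idn (h j)]]"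
  by (rule diag_rlI) (use assms right_moduleD(1,2,5)[OF Mm] right_moduleD(1,2,5)[OF Nm] f in auto)

lemma right_cohom_rl:
  assumes Mc: "right_comodule C A M r" and Nc: "right_comodule C A N r'" and f: "f \<in> hom C M N" "r' \<cdot> f = (f \<otimes> \<one> H) \<cdot> r" and "distinct [i, j, k]" and "distinct [i, n, k]"
  shows "diag_rl [[Gen (rcoa N r' j k m)], [Gen (mor M N f i j)]]
    [[Gen (mor M N f n k), Idn (h m)], [Gen (rcoa M r i n m)]]"
  by (rule diag_rlI) (use assms right_comoduleD(1,2,5)[OF Mc] right_comoduleD(1,2,5)[OF Nc] f in auto)

lemma right_double_act_hom:
  assumes M: "right_yd_module C A M \<nu> r" and N: "right_yd_module C A N \<pi> r'"
    and f: "f \<in> hom C M N" "f \<cdot> \<nu> = \<pi> \<cdot> (f \<otimes> \<one> H)" "r' \<cdot> f = (f \<otimes> \<one> H) \<cdot> r"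
  shows "f \<cdot> right_double_act M \<nu> r =
    right_double_act N \<pi> r' \<cdot> (f \<otimes> \<one> (Hs \<boxtimes> H))"
proof -
  note Mm = right_ydD(1)[OF M] and Mc = right_ydD(2)[OF M]
  note [simp] = right_moduleD(1,2,5)[OF Mm] right_comoduleD(1,2,5)[OF Mc]
  note [simp] = okop_right_double_act_rl[OF Mm Mc]
  note [simp] = okop_rsact_rl[OF right_double_module[OF M]]
  note Nm = right_ydD(1)[OF N] and Nc = right_ydD(2)[OF N]
  note [simp] = right_moduleD(1,2,5)[OF Nm] right_comoduleD(1,2,5)[OF Nc]
  note [simp] = okop_right_double_act_rl[OF Nm Nc]
  note [simp] = okop_rsact_rl[OF right_double_module[OF N]]
  note [simp] = okop_right_action_tensor_rl[OF Mm Nm] okop_right_coaction_tensor_rl[OF Mc Nc]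
  note [simp] = f(1)
  note 1 = den_diag[of "[[Gen (mor M N f 8 9)], [Gen (rdac M (right_double_act M \<nu> r) 7 1 2 8)]]", simplified]
  note 1 = den_rw[OF 1 right_double_act_rl[OF Mm Mc, of 2 3 4 7 5 8 1], simplified]
  note 1 = den_rw[OF 1 right_hom_rl[OF Mm Nm f(1,2), of 5 8 9 6 2], simplified]
  note 2 = den_diag[of "[[Gen (rdac N (right_double_act N \<pi> r') 10 1 2 9)], [Gen (mor M N f 7 10), Idl [b 1, h 2]]]", simplified]
  note 2 = den_rw[OF 2 right_double_act_rl[OF Nm Nc, of 2 3 4 10 6 9 1], simplified]
  note 2 = den_rw[OF 2 right_cohom_rl[OF Mc Nc f(1,3), of 7 10 6 5 3], simplified]
  show ?thesis using den_eq[OF 1 2] by simp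
qed

abbreviation "dulf i j \<equiv> ([], \<Phi> H Hs \<cdot> coev, [b i, h j])"

lemma okop_dulf_rl [simp]: "okop (dulf i j)"
proof -
  let ?i = "[]" and ?o = "[b 2, h 1]"
  have "\<Phi> H Hs \<cdot> coev \<in> hom C (obj ?i) (obj ?o)"
    by (rule den_hom[OF den_diagI[of "[[Brd [h 1] [b 2]], [Gen (dul 1 2)]]" ?i _ ?o "[dul 1 2]"]]) (simp_all add: arr )
  thus ?thesis by (auto simp: okop_def ok_def)
qed

lemma dulf_rl:
  shows "diag_rl [[Gen (dulf i j)]]
    [[Brd [h j] [b i]], [Gen (dul j i)]]"
  by (rule diag_rlI) (simp_all)

text \<open>\<open>\<Sum> n e* \<otimes> m e\<close> contracts to
  \<open>n(0) \<otimes> m Si(n(1))\<close>, the inverse of the map in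
  \<open>right_twist\<close>.\<close>

lemma right_R_untwist:
  assumes M: "right_yd_module C A M \<nu> r" and N: "right_yd_module C A N \<pi> r'"
  shows "right_R C A Hs ev coev N (right_double_act N \<pi> r') M (right_double_act M \<nu> r) =
    (\<one> N \<otimes> \<nu>) \<cdot> (\<one> N \<otimes> \<Phi> H M) \<cdot> (\<one> N \<otimes> Si \<otimes> \<one> M) \<cdot> (r' \<otimes> \<one> M)"
proof -
  note Mm = right_ydD(1)[OF M] and Mc = right_ydD(2)[OF M]
  note [simp] = right_moduleD(1,2,5)[OF Mm] right_comoduleD(1,2,5)[OF Mc]
  note [simp] = okop_right_double_act_rl[OF Mm Mc]
  note [simp] = okop_rsact_rl[OF right_double_module[OF M]]
  note Nm = right_ydD(1)[OF N] and Nc = right_ydD(2)[OF N]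
  note [simp] = right_moduleD(1,2,5)[OF Nm] right_comoduleD(1,2,5)[OF Nc]
  note [simp] = okop_right_double_act_rl[OF Nm Nc]
  note [simp] = okop_rsact_rl[OF right_double_module[OF N]]
  note [simp] = okop_right_action_tensor_rl[OF Mm Nm] okop_right_coaction_tensor_rl[OF Mc Nc]
  note 1 = den_diag[of "[[Gen (rbac N (rsact N (right_double_act N \<pi> r')) 11 2 12), Gen (ract M \<nu> 7 1 8)], [Idn (Nw N 11), Brd [Nw M 7] [b 2], Idn (h 1)],
    [Idn (Nw N 11), Idn (Nw M 7), Gen (dulf 2 1)]]", simplified]
  note 1 = den_rw[OF 1 dulf_rl[of 2 1], simplified]
  note 1 = den_rw[OF 1 rsact_double_act[OF N, of 11 12 3 4 2], simplified]
  note 1 = den_rw_id[OF 1 zig[of 4 1 2], simplified]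
  note 2 = den_diag[of "[[Idn (Nw N 12), Gen (ract M \<nu> 7 4 8)], [Idn (Nw N 12), Brd [h 4] [Nw M 7]], [Idn (Nw N 12), Gen (ani 3 4), Idn (Nw M 7)],
    [Gen (rcoa N r' 11 12 3), Idn (Nw M 7)]]", simplified]
  show ?thesis using den_eq[OF 1 2] by (simp add: right_R_def rlact_double_act[OF M] right_R_def rlact_double_act[OF M])
qed

lemma right_double_modules_sel [simp]:
  "ob (right_double_modules C A Hs ev d) = {(M, w). right_module C D M w}"
  "hom (right_double_modules C A Hs ev d) (M, w) (N, w') = {f \<in> hom C M N. f \<cdot> w = w' \<cdot> (f \<otimes> \<one> (Hs \<boxtimes> H))}"
  "idm (right_double_modules C A Hs ev d) (M, w) = \<one> M" "cmp (right_double_modules C A Hs ev d) = cmp C"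
  "unitO (right_double_modules C A Hs ev d) = (\<I>, cunt D)"
  "tenO (right_double_modules C A Hs ev d) (M, w) (N, w') = (M \<boxtimes> N, right_action_tensor C D M w N w')"
  "tenM (right_double_modules C A Hs ev d) = tenM C"
  "braid (right_double_modules C A Hs ev d) (M, w) (N, w') =
    inv_mor C (N \<boxtimes> M) (N \<boxtimes> M) (right_R C A Hs ev d N w' M w) \<cdot> \<Phi> M N"
  by (simp_all add: right_double_modules_def with_braiding_def right_modules_def)

theorem right_yd_double:
  "strict_embedding (right_yd C A) (right_double_modules C A Hs ev coev) (\<lambda>(M, \<nu>, r). (M, right_double_act M \<nu> r))"
  "(\<lambda>(M, \<nu>, r). (M, right_double_act M \<nu> r)) ` ob (right_yd C A) = ob (right_double_modules C A Hs ev coev)"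
proof -
  let ?F = "\<lambda>(M, \<nu>, r). (M, right_double_act M \<nu> r)" and ?D = "right_double_modules C A Hs ev coev"
  show "?F ` ob (right_yd C A) = ob ?D"
  proof (intro equalityI subsetI)
    fix P assume "P \<in> ob ?D"
    then obtain M w where P: "P = (M, w)" "right_module C D M w" by (cases P) auto
    hence "P = ?F (M, rlact M w, right_double_coact M w)" by (simp add: right_double_act_of_double)
    moreover have "(M, rlact M w, right_double_coact M w) \<in> ob (right_yd C A)" using right_yd_of_double[OF P(2)] by simp
    ultimately show "P \<in> ?F ` ob (right_yd C A)" by (rule image_eqI)
  qed (auto simp: right_double_module)
  show "strict_embedding (right_yd C A) ?D ?F"
    unfolding strict_embedding_def
  proof (intro conjI ballI)
    show "inj_on ?F (ob (right_yd C A))"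
    proof (rule inj_onI)
      fix P Q assume "P \<in> ob (right_yd C A)" "Q \<in> ob (right_yd C A)" and e: "?F P = ?F Q"
      then obtain M \<nu> r N \<pi> r' where P: "P = (M, \<nu>, r)" "right_yd_module C A M \<nu> r" and Q: "Q = (N, \<pi>, r')" "right_yd_module C A N \<pi> r'"
        by (cases P; cases Q) simp
      have "N = M" "right_double_act M \<pi> r' = right_double_act M \<nu> r" using e by (auto simp: P Q)
      thus "P = Q"
        using rlact_double_act[OF P(2)] rlact_double_act[OF Q(2)] right_double_coact_double_act[OF P(2)] right_double_coact_double_act[OF Q(2)]
        by (simp add: P Q)
    qed
    show "cmp (right_yd C A) = cmp ?D" "tenM (right_yd C A) = tenM ?D" by simp_all
    \<comment> \<open>Closure under the unit, and below under tensor products, is read off from the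
      embedding obtained by reversal.\<close>
    show "unitO (right_yd C A) \<in> ob (right_yd C A)" by (rule strict_embeddingD(10)[OF right_yd_rev])
    show "?F (unitO (right_yd C A)) = unitO ?D" by (simp add: right_double_act_unit)
    fix P assume "P \<in> ob (right_yd C A)"
    then obtain M \<nu> r where P: "P = (M, \<nu>, r)" and M: "right_yd_module C A M \<nu> r" by (cases P) auto
    show "?F P \<in> ob ?D" "idm (right_yd C A) P = idm ?D (?F P)" using right_double_module[OF M] by (simp_all add: P)
    fix Q assume "Q \<in> ob (right_yd C A)"
    then obtain N \<pi> r' where Q: "Q = (N, \<pi>, r')" and N: "right_yd_module C A N \<pi> r'" by (cases Q) auto
    show "hom (right_yd C A) P Q = hom ?D (?F P) (?F Q)"
    proof (intro equalityI subsetI)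
      fix f assume "f \<in> hom (right_yd C A) P Q"
      thus "f \<in> hom ?D (?F P) (?F Q)" using right_double_act_hom[OF M N] by (simp add: P Q)
    next
      fix f assume "f \<in> hom ?D (?F P) (?F Q)"
      hence f: "f \<in> hom C M N" "f \<cdot> right_double_act M \<nu> r = right_double_act N \<pi> r' \<cdot> (f \<otimes> \<one> (Hs \<boxtimes> H))" by (simp_all add: P Q)
      show "f \<in> hom (right_yd C A) P Q"
        using rlact_hom[OF right_double_module[OF M] right_double_module[OF N] f] f(1)
          right_double_coact_hom[OF right_double_module[OF M] right_double_module[OF N] f]
        by (simp add: P Q rlact_double_act[OF M] rlact_double_act[OF N] right_double_coact_double_act[OF M] right_double_coact_double_act[OF N])
    qed
    show "tenO (right_yd C A) P Q \<in> ob (right_yd C A)" using strict_embeddingD(5)[OF right_yd_rev, of P Q] M N by (simp add: P Q)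
    show "?F (tenO (right_yd C A) P Q) = tenO ?D (?F P) (?F Q)" by (simp add: P Q right_double_act_tensor[OF M N])
    have NM: "N \<boxtimes> M \<in> ob C" using right_moduleD(1)[OF right_ydD(1)[OF M]] right_moduleD(1)[OF right_ydD(1)[OF N]] by (simp add: ten_ob)
    note tw = right_twist[OF right_ydD(2)[OF N] right_ydD(1)[OF M]]
    have "inv_mor C (N \<boxtimes> M) (N \<boxtimes> M) ((\<one> N \<otimes> \<nu>) \<cdot> (\<one> N \<otimes> \<Phi> H M) \<cdot> (\<one> N \<otimes> Si \<otimes> \<one> M) \<cdot> (r' \<otimes> \<one> M)) = (\<one> N \<otimes> \<nu>) \<cdot> (\<one> N \<otimes> \<Phi> H M) \<cdot> (r' \<otimes> \<one> M)"
      by (rule inv_mor_eq[OF NM NM]) (use tw(1,2) in \<open>auto simp: inverse_pair_def\<close>)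
    thus "braid (right_yd C A) P Q = braid ?D (?F P) (?F Q)" using tw(3) by (simp add: P Q right_R_untwist[OF M N])
  qed
qed

end

theorem proposition7p3:
  fixes C :: "('o, 'm) bcat" and A :: "('o, 'm) hopf" and Hs E :: 'o and ev e :: 'm
  assumes "braided_category C"
    and "hopf_algebra_in C A"
    and "bijective_antipode C A"
    and "finite_object C (car A) Hs ev E e"
    and "transparent C (car A)"
  shows "let d = dual_basis C (car A) Hs ev E e in
           braided_isomorphic (left_yd C A) (left_double_modules C A Hs ev d)
         \<and> braided_embedding (left_double_modules C A Hs ev d) (left_center (left_modules C A))
         \<and> braided_isomorphic (right_yd C A) (right_double_modules C A Hs ev d)
         \<and> braided_embedding (right_double_modules C A Hs ev d) (right_center (right_modules C A))"
proof -
  interpret finite_hopf C A Hs E ev e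
    using assms by (intro finite_hopf.intro transparent_hopf.intro finite_hopf_axioms.intro transparent_hopf_axioms.intro)
  have bl: "braided_category (left_center (left_modules C A))"
    by (rule strict_monoidal_category.braided_left_center[OF left_modules_monoidal])
  obtain F where F: "strict_embedding (right_yd C A) (right_center (right_modules C A)) F"
    using right_yd_center_embedding by blast
  \<comment> \<open>The inverse comparison functors serve twice: they transport the braided axioms
    to the modules over the double, and composed with the embeddings of Yetter-Drinfel'd modules
    they give the embeddings into the centers.\<close>
  note l = strict_embedding_inverse[OF left_yd_double] and r = strict_embedding_inverse[OF right_yd_double]
  have "braided_category (left_double_modules C A Hs ev coev)" "braided_category (right_double_modules C A Hs ev coev)"
    using strict_embedding_braided[OF strict_embedding_braided[OF bl left_yd_center_embedding] l]
      strict_embedding_braided[OF strict_embedding_braided[OF braided_right_center F] r] by simp_all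
  thus ?thesis
    unfolding Let_def
    using strict_embedding_iso[OF _ left_yd_double] strict_embedding_iso[OF _ right_yd_double]
      strict_embedding_embeds[OF bl strict_embedding_comp[OF l left_yd_center_embedding]]
      strict_embedding_embeds[OF braided_right_center strict_embedding_comp[OF r F]] by blast
qed

end
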